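(* Let $w$ be a weight on $\mathbb{R}^n$. If $p>0$ and $w\in SC_p$, then for every Calderón–Zygmund operator $T$ with Dini-continuous kernel, $$\|T^{\star}f\|_{L^{p,\infty}(w)}\le C\|Mf\|_{L^p(w)},\qquad ( * )$$ with a constant $C>0$ independent of $f$. Conversely, if $p>1$ and $( * )$ holds for each of the maximal truncated Riesz transforms $R_j^{\star}$, $j=1,\dots,n$ (that is, with $T^{\star}$ replaced by $R_j^{\star}$), then $w\in SC_p$.
   Context: A weight is a non-negative locally integrable function $w$ on $\mathbb{R}^n$; $w(E)=\int_E w$, $\|f\|_{L^p(w)}=\left(\int_{\mathbb{R}^n}|f|^pw\right)^{1/p}$ and $\|f\|_{L^{p,\infty}(w)}=\sup_{\alpha>0}\alpha\, w(\{x:|f(x)|>\alpha\})^{1/p}$. For locally integrable $f$, the Hardy–Littlewood maximal function is $Mf(x)=\sup_{Q\ni x}\frac{1}{|Q|}\int_Q|f|$, the supremum being over all cubes $Q\subset\mathbb{R}^n$ containing $x$. Definition ($SC_p$). Let $p>0$. A weight $w$ satisfies the $SC_p$ condition ($w\in SC_p$) if there exist $C>0$ and $r>1$ such that for every family of pairwise disjoint cubes $\{Q_j\}$, $$\sum_j\left(\frac{1}{|Q_j|}\int_{Q_j}w^r\right)^{1/r}|Q_j|\le C\int_{\mathbb{R}^n}(M\chi_{\cup_jQ_j})^pw.$$ $T$ is a Calderón–Zygmund operator with Dini-continuous kernel if $T$ is a linear operator of weak type $(1,1)$ such that $Tf(x)=\int_{\mathbb{R}^n}K(x,y)f(y)\,dy$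 for all $x\notin\operatorname{supp} f$, with kernel $K$ satisfying the smoothness condition $$|K(x,y)-K(x',y)|\le \omega\left(\frac{|x-x'|}{|x-y|}\right)\frac{1}{|x-y|^n}\quad\text{for } |x-x'|<|x-y|/2,$$ where $\int_0^1\omega(t)\frac{dt}{t}<\infty$. The maximal truncation of $T$ is $T^{\star}f(x)=\sup_{\varepsilon>0}|T(f\chi_{\{y:|y-x|>\varepsilon\}})(x)|$. The Riesz transforms are $R_jf(x)=\lim_{\varepsilon\to0}c_n\int_{|y|>\varepsilon}f(x-y)\frac{y_j}{|y|^{n+1}}\,dy$, $j=1,\dots,n$, where $c_n$ is the standard dimensional constant; $R_j^{\star}$ is the maximal truncation of $R_j$. *)

theory Defs
  imports "HOL-Analysis.Analysis"
begin

text \<open>Norms, averages and maximal functions take values in \<open>[0,\<infinity>]\<close>, i.e. in \<^typ>\<open>ennreal\<close>, with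
  \<open>0 * \<infinity> = 0\<close>.  The power below is only used with a positive exponent.\<close>

definition epow :: "ennreal \<Rightarrow> real \<Rightarrow> ennreal" where
  "epow x a = (if x = \<infinity> then \<infinity> else ennreal (enn2real x powr a))"

definition locally_integrable :: "(real^'n \<Rightarrow> 'a::{banach, second_countable_topology}) \<Rightarrow> bool" where
  "locally_integrable f \<longleftrightarrow> (\<forall>S. compact S \<longrightarrow> set_integrable lebesgue S f)"

definition weight :: "(real^'n \<Rightarrow> real) \<Rightarrow> bool" where
  "weight w \<longleftrightarrow> (\<forall>x. 0 \<le> w x) \<and> locally_integrable w"

definition weight_of :: "(real^'n \<Rightarrow> real) \<Rightarrow> (real^'n) set \<Rightarrow> ennreal" where
  "weight_of w E = (\<integral>\<^sup>+x\<in>E. ennreal (w x) \<partial>lebesgue)"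

definition Lp_norm :: "real \<Rightarrow> (real^'n \<Rightarrow> real) \<Rightarrow> (real^'n \<Rightarrow> ennreal) \<Rightarrow> ennreal" where
  "Lp_norm p w g = epow (\<integral>\<^sup>+x. epow (g x) p * ennreal (w x) \<partial>lebesgue) (1 / p)"

definition weak_Lp_norm :: "real \<Rightarrow> (real^'n \<Rightarrow> real) \<Rightarrow> (real^'n \<Rightarrow> ennreal) \<Rightarrow> ennreal" where
  "weak_Lp_norm p w g =
     (SUP \<alpha>\<in>{0::real<..}. ennreal \<alpha> * epow (weight_of w {x. g x > ennreal \<alpha>}) (1 / p))"

text \<open>Cubes have sides parallel to the axes and are taken half-open, so that a disjoint family may
  consist of adjacent cubes.  With open or closed cubes the maximal function and the class \<open>SC p\<close>
  below would be the same.\<close>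

definition cube :: "(real^'n) set \<Rightarrow> bool" where
  "cube Q \<longleftrightarrow> (\<exists>a s. 0 < s \<and> Q = {x. \<forall>i. a $ i \<le> x $ i \<and> x $ i < a $ i + s})"

definition cube_avg :: "(real^'n) set \<Rightarrow> (real^'n \<Rightarrow> ennreal) \<Rightarrow> ennreal" where
  "cube_avg Q g = (\<integral>\<^sup>+x\<in>Q. g x \<partial>lebesgue) / emeasure lebesgue Q"

definition hl_maximal :: "(real^'n \<Rightarrow> 'a::real_normed_vector) \<Rightarrow> real^'n \<Rightarrow> ennreal" where
  "hl_maximal f x = (SUP Q\<in>{Q. cube Q \<and> x \<in> Q}. cube_avg Q (\<lambda>y. ennreal (norm (f y))))"

text \<open>Cubes are nonempty, so a pairwise disjoint family of cubes is the same as a disjoint set of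
  cubes (and it is countable).\<close>

definition SC :: "real \<Rightarrow> (real^'n \<Rightarrow> real) set" where
  "SC p = {w. weight w \<and>
     (\<exists>C>0. \<exists>r>1. \<forall>\<Q>. (\<forall>Q\<in>\<Q>. cube Q) \<and> disjoint \<Q> \<longrightarrow>
        (\<Sum>\<^sub>\<infinity>Q\<in>\<Q>. epow (cube_avg Q (\<lambda>x. ennreal (w x powr r))) (1 / r) * emeasure lebesgue Q)
          \<le> ennreal C *
            (\<integral>\<^sup>+x. epow (hl_maximal (indicator (\<Union>\<Q>) :: real^'n \<Rightarrow> real) x) p * ennreal (w x)
              \<partial>lebesgue))}"

text \<open>An operator of weak type \<open>(1,1)\<close> acts on \<open>L\<^sup>1\<close>.  Functions are complex-valued.  Both linearity and
  the values \<open>T f\<close> are understood up to null sets, as usual for an operator from \<open>L\<^sup>1\<close> to weak \<open>L\<^sup>1\<close>;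
  only off the support of \<open>f\<close> is \<open>T f\<close> prescribed pointwise, by the kernel.\<close>

definition linear_on_L1 :: "((real^'n \<Rightarrow> complex) \<Rightarrow> real^'n \<Rightarrow> complex) \<Rightarrow> bool" where
  "linear_on_L1 T \<longleftrightarrow>
     (\<forall>f g a b. integrable lebesgue f \<longrightarrow> integrable lebesgue g \<longrightarrow>
        (AE x in lebesgue. T (\<lambda>y. a * f y + b * g y) x = a * T f x + b * T g x))"

definition weak_type_1_1 :: "((real^'n \<Rightarrow> complex) \<Rightarrow> real^'n \<Rightarrow> complex) \<Rightarrow> bool" where
  "weak_type_1_1 T \<longleftrightarrow>
     (\<forall>f. integrable lebesgue f \<longrightarrow> T f \<in> borel_measurable lebesgue) \<and>
     (\<exists>C>0. \<forall>f. integrable lebesgue f \<longrightarrow>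
        weak_Lp_norm 1 (\<lambda>_. 1) (\<lambda>x. ennreal (norm (T f x)))
          \<le> ennreal C * Lp_norm 1 (\<lambda>_. 1) (\<lambda>x. ennreal (norm (f x))))"

text \<open>No monotonicity or subadditivity of the modulus \<open>\<omega>\<close> is assumed.\<close>

definition dini :: "(real \<Rightarrow> real) \<Rightarrow> bool" where
  "dini \<omega> \<longleftrightarrow> (\<forall>t. 0 \<le> \<omega> t) \<and> set_integrable lebesgue {0<..<1} (\<lambda>t. \<omega> t / t)"

definition dini_smooth_kernel :: "(real^'n \<Rightarrow> real^'n \<Rightarrow> complex) \<Rightarrow> bool" where
  "dini_smooth_kernel K \<longleftrightarrow>
     (\<exists>\<omega>. dini \<omega> \<and>
        (\<forall>x x' y. norm (x - x') < norm (x - y) / 2 \<longrightarrow>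
           norm (K x y - K x' y)
             \<le> \<omega> (norm (x - x') / norm (x - y)) * (1 / norm (x - y) ^ CARD('n))))"

text \<open>\<^const>\<open>has_bochner_integral\<close> also asserts that the integral converges absolutely.\<close>

definition has_kernel ::
  "((real^'n \<Rightarrow> complex) \<Rightarrow> real^'n \<Rightarrow> complex) \<Rightarrow> (real^'n \<Rightarrow> real^'n \<Rightarrow> complex) \<Rightarrow> bool" where
  "has_kernel T K \<longleftrightarrow>
     (\<forall>f x. integrable lebesgue f \<longrightarrow> x \<notin> closure {y. f y \<noteq> 0} \<longrightarrow>
        has_bochner_integral lebesgue (\<lambda>y. K x y * f y) (T f x))"

definition dini_CZ_operator :: "((real^'n \<Rightarrow> complex) \<Rightarrow> real^'n \<Rightarrow> complex) \<Rightarrow> bool" where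
  "dini_CZ_operator T \<longleftrightarrow>
     linear_on_L1 T \<and> weak_type_1_1 T \<and> (\<exists>K. dini_smooth_kernel K \<and> has_kernel T K)"

definition maximal_truncation ::
  "((real^'n \<Rightarrow> complex) \<Rightarrow> real^'n \<Rightarrow> complex) \<Rightarrow> (real^'n \<Rightarrow> complex) \<Rightarrow> real^'n \<Rightarrow> ennreal" where
  "maximal_truncation T f x =
     (SUP \<epsilon>\<in>{0::real<..}. ennreal (norm (T (\<lambda>y. f y * indicator {y. norm (y - x) > \<epsilon>} y) x)))"

definition riesz_const :: "nat \<Rightarrow> real" where
  "riesz_const n = Gamma ((real n + 1) / 2) / pi powr ((real n + 1) / 2)"

definition riesz :: "'n \<Rightarrow> (real^'n \<Rightarrow> complex) \<Rightarrow> real^'n \<Rightarrow> complex" where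
  "riesz j f x =
     Lim (at_right (0::real)) (\<lambda>\<epsilon>. of_real (riesz_const CARD('n)) *
       (LINT y:{y. norm y > \<epsilon>}|lebesgue.
          f (x - y) * of_real (y $ j / norm y ^ (CARD('n) + 1))))"

end

theory Submission
  imports Defs
begin

text \<open>
  Sufficiency is a good-\<open>\<lambda>\<close> argument. Cut \<open>{T\<^sup>*f > c}\<close> into maximal dyadic cubes. On a cube that meets
  \<open>{Mf \<le> \<gamma> c}\<close>, a localisation and the weak type \<open>(1,1)\<close> of \<open>T\<^sup>*\<close> show that \<open>{T\<^sup>*f > 2 c}\<close> has relative
  measure \<open>O(\<gamma>)\<close>; by Hoelder and \<open>SC\<^sub>p\<close> the total weight of these parts is at most \<open>O(\<gamma>\<^bsup>1-1/r\<^esup>)\<close> times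
  \<open>\<integral> (M \<chi>\<^bsub>{T\<^sup>*f > c}\<^esub>)\<^sup>p w\<close>. Since \<open>M \<chi>\<^bsub>{T\<^sup>*f > c}\<^esub> \<le> C Mf / c\<close> wherever \<open>T\<^sup>*f \<le> c/4\<close>, this integral is bounded
  by \<open>w {T\<^sup>*f > c/4} + C c\<^bsup>-p\<^esup> \<integral> (Mf)\<^sup>p w\<close>, and the first term is absorbed by iterating over \<open>c\<close>; the
  iteration starts at small \<open>c\<close>, where \<open>{T\<^sup>*f > c}\<close> is controlled by \<open>Mf\<close> directly if \<open>f\<close> has bounded support.

  For the converse a single Riesz transform \<open>R\<^sub>j\<close> suffices. Suppose that \<open>G\<^sub>0 \<subseteq> \<dots> \<subseteq> G\<^sub>L \<subseteq> U\<close> are open and that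
  \<open>G\<^sub>k\<close> is sparse near the complement of \<open>G\<^bsub>k+1\<^esub>\<close>. One finds disjoint sets \<open>Y\<close> in \<open>U\<close> such that every
  \<open>x\<close> in \<open>G\<^sub>0\<close> sees \<open>|R\<^sub>j \<chi>\<^sub>Y(x)|\<close> bounded below for at least \<open>L\<close> of them. By Khinchine's inequality
  \<open>f = \<Sum> \<plusminus> \<chi>\<^sub>Y\<close> with random signs has \<open>|R\<^sub>j f|\<close> of average size \<open>\<surd>L\<close> on \<open>G\<^sub>0\<close>, whereas \<open>|f| \<le> \<chi>\<^sub>U\<close>. As \<open>p > 1\<close>, the
  hypothesis yields \<open>w(G\<^sub>0) \<le> C L\<^bsup>-1/2\<^esup> \<integral> (M \<chi>\<^sub>U)\<^sup>p w\<close>. Level sets of \<open>M \<chi>\<^sub>E\<close> form such chains, so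
  \<open>\<integral> (M \<chi>\<^sub>E)\<^sup>p w \<le> \<epsilon> \<integral> (M \<chi>\<^sub>U)\<^sup>p w\<close> as soon as \<open>{M \<chi>\<^sub>E > \<eta>} \<subseteq> U\<close>. Applied to the level sets of \<open>Mv\<close> for
  \<open>v = \<Sum> w \<chi>\<^sub>Q / w\<^sub>Q\<close>, where \<open>w\<^sub>Q\<close> is the average of \<open>w\<close> over \<open>Q\<close>, this gives geometric decay of
  \<open>w {v > a\<^sup>k}\<close>, hence a bound for \<open>\<integral> v\<^sup>\<delta> w\<close>, which is the \<open>SC\<^sub>p\<close> inequality with \<open>r = 1 + \<delta>\<close>.
\<close>

section \<open>Maximal functions over balls and over cubes\<close>

text \<open>The weight of \<open>{T\<^sup>*f > c}\<close> may be infinite a priori, so its share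
  cannot be subtracted from both sides; hence the induction over levels and the detour through f of
  bounded support. \<open>T f\<close> is fixed only up to null sets, and K is smooth in its first
  variable alone. But each truncation is evaluated at the centre of the removed ball, where the
  kernel formula holds pointwise. This makes \<open>T\<^sup>*\<close> subadditive at every point and
  lower semicontinuous; the size bound away from the support follows from smoothness and weak type.

  In the converse the random sums must be dominated by \<open>\<chi>\<^sub>U\<close> pointwise, so
  the sets Y have to be disjoint across generations. It also keeps every Y away from
  \<open>G\<^sub>0\<close>, so that no principal value occurs there. Khinchine's inequality gives a
  lower bound in the mean, and p > 1 turns the weak \<open>L\<^sup>p\<close> hypothesis into an
  \<open>L\<^sup>1\<close> bound on \<open>G\<^sub>0\<close>.\<close>

declare emeasure_completion [simp del]

lemma borel_imp_sets_lebesgue: "S \<in> sets borel \<Longrightarrow> S \<in> sets lebesgue"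
  by (simp add: sets_completionI_sets)

lemma ennreal_mult_left_assoc: "0 \<le> a \<Longrightarrow> ennreal a * (ennreal b * x) = ennreal (a * b) * x"
  by (simp add: ennreal_mult' mult.assoc)

lemma emeasure_ball_scale:
  fixes a b :: "real^'n"
  assumes "0 \<le> c" "0 \<le> r"
  shows "emeasure lebesgue (ball a (c * r)) = ennreal (c ^ CARD('n)) * emeasure lebesgue (ball b r)"
proof -
  have *: "emeasure lebesgue (ball d s) = ennreal (s ^ CARD('n)) * emeasure lebesgue (ball (0::real^'n) 1)"
    if "0 \<le> s" for d :: "real^'n" and s
    using emeasure_lebesgue_ball_conv_unit_ball[of s d] that by simp
  show ?thesis
    using assms by (simp add: *[of "c * r" a] *[of r b] power_mult_distrib ennreal_mult' mult.assoc)
qed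

lemma emeasure_ball_pos:
  fixes a :: "real^'n"
  assumes "0 < r" shows "0 < emeasure lebesgue (ball a r)"
  using assms emeasure_ball[of r a] by (simp add: emeasure_completion)

lemma emeasure_ball_finite [simp]:
  fixes a :: "real^'n"
  shows "emeasure lebesgue (ball a r) < \<infinity>" "emeasure lebesgue (ball a r) \<noteq> \<infinity>"
  using emeasure_lborel_ball_finite[of a r] by (auto simp: emeasure_completion)

lemma emeasure_UN_le_count_space:
  assumes "countable I" "\<And>i. i \<in> I \<Longrightarrow> A i \<in> sets M"
  shows "emeasure M (\<Union>i\<in>I. A i) \<le> (\<integral>\<^sup>+i. emeasure M (A i) \<partial>count_space I)"
proof -
  have m: "(\<Union>i\<in>I. A i) \<in> sets M" using assms by (intro sets.countable_UN'') auto
  have "emeasure M (\<Union>i\<in>I. A i) = (\<integral>\<^sup>+x. indicator (\<Union>i\<in>I. A i) x \<partial>M)"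
    using m by simp
  also have "\<dots> \<le> (\<integral>\<^sup>+x. \<integral>\<^sup>+i. indicator (A i) x \<partial>count_space I \<partial>M)"
  proof (intro nn_integral_mono)
    fix x assume "x \<in> space M"
    show "indicator (\<Union>i\<in>I. A i) x \<le> (\<integral>\<^sup>+i. indicator (A i) x \<partial>count_space I)"
    proof (cases "x \<in> (\<Union>i\<in>I. A i)")
      case True
      then obtain j where j: "j \<in> I" "x \<in> A j" by auto
      have "indicator (\<Union>i\<in>I. A i) x = (\<integral>\<^sup>+i. indicator {j} i \<partial>count_space I)"
        using True j by simp
      also have "\<dots> \<le> (\<integral>\<^sup>+i. indicator (A i) x \<partial>count_space I)"
        using j by (intro nn_integral_mono) (auto split: split_indicator)
      finally show ?thesis .
    qed auto
  qed
  also have "\<dots> = (\<integral>\<^sup>+i. emeasure M (A i) \<partial>count_space I)"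
    using assms by (subst nn_integral_count_space_nn_integral) (auto intro!: nn_integral_cong)
  finally show ?thesis .
qed

text \<open>Vitali's selection as a transfer of measure: S inside a five-fold ball is paid for by N
  on the ball itself, and the N-masses of the selected balls add up because these are disjoint. N is
  \<open>density lebesgue v\<close> for the weak type of the maximal function, and Lebesgue measure
  elsewhere.\<close>

lemma Vitali_measure_le:
  fixes K :: "((real^'n) \<times> real) set" and S :: "(real^'n) set"
  assumes K: "\<And>a r. (a, r) \<in> K \<Longrightarrow> 0 < r \<and> r \<le> B"
    and cov: "S \<subseteq> (\<Union>(a, r)\<in>K. ball a r)"
    and S: "S \<in> sets lebesgue" and N: "sets N = sets lebesgue"
    and bd: "\<And>a r. (a, r) \<in> K \<Longrightarrow>
      emeasure lebesgue (S \<inter> ball a (5 * r)) \<le> c * emeasure N (ball a r)"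
  shows "emeasure lebesgue S \<le> c * emeasure N (\<Union>(a, r)\<in>K. ball a r)"
proof -
  obtain C where C: "countable C" "C \<subseteq> K"
     "pairwise (\<lambda>i j. disjnt (cball (fst i) (snd i)) (cball (fst j) (snd j))) C"
     "\<And>i. i \<in> K \<Longrightarrow> \<exists>j. j \<in> C \<and> \<not> disjnt (cball (fst i) (snd i)) (cball (fst j) (snd j)) \<and>
                        cball (fst i) (snd i) \<subseteq> ball (fst j) (5 * snd j)"
    by (rule Vitali_covering_lemma_cballs_balls[of K snd B fst]) (use K in auto)
  have sub: "S \<subseteq> (\<Union>i\<in>C. S \<inter> ball (fst i) (5 * snd i))"
  proof
    fix x assume x: "x \<in> S"
    then obtain a r where ar: "(a, r) \<in> K" "x \<in> ball a r" using cov by blast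
    then obtain j where "j \<in> C" "cball a r \<subseteq> ball (fst j) (5 * snd j)"
      using C(4)[of "(a, r)"] by auto
    with x ar show "x \<in> (\<Union>i\<in>C. S \<inter> ball (fst i) (5 * snd i))"
      by (meson IntI UN_I ball_subset_cball subsetD)
  qed
  have opn: "\<And>a r. ball a r \<in> sets lebesgue" for a :: "real^'n"
    by simp
  have dj: "disjoint_family_on (\<lambda>i. ball (fst i) (snd i)) C"
    using C(3) unfolding disjoint_family_on_def pairwise_def disjnt_def
    by (metis ball_subset_cball inf_mono subset_empty)
  have "emeasure lebesgue S \<le> emeasure lebesgue (\<Union>i\<in>C. S \<inter> ball (fst i) (5 * snd i))"
    using C(1) S by (intro emeasure_mono sub sets.countable_UN'') auto
  also have "\<dots> \<le> (\<integral>\<^sup>+i. emeasure lebesgue (S \<inter> ball (fst i) (5 * snd i)) \<partial>count_space C)"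
    using C(1) S by (intro emeasure_UN_le_count_space) auto
  also have "\<dots> \<le> (\<integral>\<^sup>+i. c * emeasure N (ball (fst i) (snd i)) \<partial>count_space C)"
    using C(2) bd by (intro nn_integral_mono) auto
  also have "\<dots> = c * (\<integral>\<^sup>+i. emeasure N (ball (fst i) (snd i)) \<partial>count_space C)"
    by (rule nn_integral_cmult) auto
  also have "(\<integral>\<^sup>+i. emeasure N (ball (fst i) (snd i)) \<partial>count_space C)
      = emeasure N (\<Union>i\<in>C. ball (fst i) (snd i))"
    using C(1) N dj by (intro emeasure_UN_countable[symmetric]) auto
  also have "\<dots> \<le> emeasure N (\<Union>(a, r)\<in>K. ball a r)"
  proof (intro emeasure_mono)
    show "(\<Union>i\<in>C. ball (fst i) (snd i)) \<subseteq> (\<Union>(a, r)\<in>K. ball a r)" using C(2) by auto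
    have "open (\<Union>(a, r)\<in>K. ball a r)" by auto
    then show "(\<Union>(a, r)\<in>K. ball a r) \<in> sets N" using N by simp
  qed
  finally show ?thesis by (simp add: mult_left_mono)
qed

text \<open>The level set above \<open>t\<close> of the uncentred maximal function over balls. It is easier to handle
  than that of \<^const>\<open>hl_maximal\<close>, with which it is comparable (\<open>mx_lev_equiv\<close> below).\<close>

definition lev :: "(real^'n \<Rightarrow> ennreal) \<Rightarrow> real \<Rightarrow> (real^'n) set" where
  "lev v t = (\<Union>(a, r)\<in>{(a, r). 0 < r \<and>
     ennreal t * emeasure lebesgue (ball a r) < (\<integral>\<^sup>+x\<in>ball a r. v x \<partial>lebesgue)}. ball a r)"

lemma open_lev: "open (lev v t)"
  unfolding lev_def by auto

lemma lev_measurable [measurable, simp]: "lev v t \<in> sets lebesgue"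
  using open_lev[of v t] by simp

lemma levI:
  "x \<in> ball a r \<Longrightarrow> ennreal t * emeasure lebesgue (ball a r) < (\<integral>\<^sup>+x\<in>ball a r. v x \<partial>lebesgue)
    \<Longrightarrow> x \<in> lev v t"
  unfolding lev_def by (rule UN_I[of "(a, r)"]) (use zero_le_dist[of a x] in \<open>auto simp del: zero_le_dist\<close>)

lemma levE:
  assumes "x \<in> lev v t"
  obtains a r where "0 < r" "x \<in> ball a r"
    "ennreal t * emeasure lebesgue (ball a r) < (\<integral>\<^sup>+x\<in>ball a r. v x \<partial>lebesgue)"
  using assms unfolding lev_def by auto

lemma not_levD:
  "x \<notin> lev v t \<Longrightarrow> x \<in> ball a r \<Longrightarrow>
    (\<integral>\<^sup>+x\<in>ball a r. v x \<partial>lebesgue) \<le> ennreal t * emeasure lebesgue (ball a r)"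
  using levI not_le by blast

lemma lev_antimono: "s \<le> t \<Longrightarrow> lev v t \<subseteq> lev v s"
  by (auto elim!: levE intro!: levI dest: le_less_trans[OF mult_right_mono[OF ennreal_leI]] simp del: mem_ball)

lemma emeasure_lev_le:
  fixes v :: "real^'n \<Rightarrow> ennreal"
  assumes v: "v \<in> borel_measurable lebesgue" and t: "0 < t"
  shows "emeasure lebesgue (lev v t) \<le> ennreal (5 ^ CARD('n) / t) * (\<integral>\<^sup>+x. v x \<partial>lebesgue)"
proof (cases "(\<integral>\<^sup>+x. v x \<partial>lebesgue) = \<infinity>")
  case True
  then show ?thesis using t by (simp add: ennreal_mult_top)
next
  case False
  then obtain I where I: "0 \<le> I" "(\<integral>\<^sup>+x. v x \<partial>lebesgue) = ennreal I"
    by (cases "\<integral>\<^sup>+x. v x \<partial>lebesgue") auto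
  define K where "K = {(a::real^'n, r). 0 < r \<and>
     ennreal t * emeasure lebesgue (ball a r) < (\<integral>\<^sup>+x\<in>ball a r. v x \<partial>lebesgue)}"
  define m where "m = measure lebesgue (ball (0::real^'n) 1)"
  have m: "0 < m" unfolding m_def by simp
  have em: "emeasure lebesgue (ball (0::real^'n) 1) = ennreal m"
    unfolding m_def using emeasure_lborel_ball_finite[of "0::real^'n" 1] 
    by (subst emeasure_eq_ennreal_measure) (auto simp: emeasure_completion)
  \<comment> \<open>Vitali needs bounded radii. For r > 1 the ball condition gives
    \<open>r ^ n * (t * m) < I\<close>, and \<open>r \<le> r ^ n\<close>.\<close>
  have B: "r \<le> max 1 (I / (t * m))" and r0: "0 < r" if "(a, r) \<in> K" for a r
  proof -
    show "0 < r" using that by (auto simp: K_def)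
    show "r \<le> max 1 (I / (t * m))"
    proof (cases "r \<le> 1")
      case False
      have "ennreal (t * (r ^ CARD('n) * m)) = ennreal t * emeasure lebesgue (ball a (r * 1))"
        using False t m by (subst emeasure_ball_scale[of _ _ _ 0]) (auto simp: em ennreal_mult)
      also have "\<dots> < (\<integral>\<^sup>+x\<in>ball a r. v x \<partial>lebesgue)" using that by (simp add: K_def)
      also have "\<dots> \<le> (\<integral>\<^sup>+x. v x \<partial>lebesgue)"
        by (intro nn_integral_mono) (auto split: split_indicator)
      finally have "t * (r ^ CARD('n) * m) < I"
        using I t m False by (simp add: ennreal_less_iff)
      moreover have "r \<le> r ^ CARD('n)" using False
        by (intro self_le_power) (auto simp: card_gt_0_iff)
      then have "r * (t * m) \<le> r ^ CARD('n) * (t * m)"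
        using t m by (intro mult_right_mono) auto
      ultimately have "r * (t * m) \<le> I"
        by (simp add: mult_ac)
      then show ?thesis using t m by (simp add: pos_le_divide_eq less_imp_le le_max_iff_disj)
    qed auto
  qed
  have L: "lev v t = (\<Union>(a, r)\<in>K. ball a r)" unfolding lev_def K_def ..
  have "emeasure lebesgue (lev v t) \<le> ennreal (5 ^ CARD('n) / t) * emeasure (density lebesgue v) (\<Union>(a, r)\<in>K. ball a r)"
  proof (rule Vitali_measure_le)
    show "0 < r \<and> r \<le> max 1 (I / (t * m))" if "(a, r) \<in> K" for a r using B r0 that by blast
    show "lev v t \<subseteq> (\<Union>(a, r)\<in>K. ball a r)" by (simp add: L)
    show "lev v t \<in> sets lebesgue" by simp
    fix a r assume ar: "(a, r) \<in> K"
    have "emeasure lebesgue (lev v t \<inter> ball a (5 * r)) \<le> emeasure lebesgue (ball a (5 * r))"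
      by (intro emeasure_mono) auto
    also have "\<dots> = ennreal (5 ^ CARD('n)) * emeasure lebesgue (ball a r)"
      using r0[OF ar] by (intro emeasure_ball_scale) auto
    also have "\<dots> = ennreal (5 ^ CARD('n) / t) * (ennreal t * emeasure lebesgue (ball a r))"
      using t by (simp add: mult.assoc[symmetric] ennreal_mult[symmetric])
    also have "\<dots> \<le> ennreal (5 ^ CARD('n) / t) * emeasure (density lebesgue v) (ball a r)"
      using ar v by (intro mult_left_mono) (auto simp: K_def emeasure_density)
    finally show "emeasure lebesgue (lev v t \<inter> ball a (5 * r))
       \<le> ennreal (5 ^ CARD('n) / t) * emeasure (density lebesgue v) (ball a r)" .
  qed auto
  also have "\<dots> \<le> ennreal (5 ^ CARD('n) / t) * (\<integral>\<^sup>+x. v x \<partial>lebesgue)"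
    unfolding L[symmetric] using v
    by (intro mult_left_mono) (auto simp: emeasure_density intro!: nn_integral_mono split: split_indicator)
  finally show ?thesis .
qed

text \<open>A level set of the maximal function is sparse in balls that reach outside a much lower
  level set. A ball through y with average above t must be smaller than the ball about a, since
  otherwise its triple would contain z and have average above s. So only v on the tripled ball
  matters, and the weak type gives the factor 15 = 5 * 3. This is the source of all sparse
  chains.\<close>

lemma emeasure_lev_Int_ball_le:
  fixes v :: "real^'n \<Rightarrow> ennreal"
  assumes v: "v \<in> borel_measurable lebesgue" and s: "0 \<le> s" and t: "0 < t" and st: "3 ^ CARD('n) * s \<le> t"
    and z: "z \<notin> lev v s" "z \<in> ball a \<rho>"
  shows "emeasure lebesgue (lev v t \<inter> ball a \<rho>) \<le> ennreal (15 ^ CARD('n) * (s / t)) * emeasure lebesgue (ball a \<rho>)"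
proof -
  have \<rho>: "0 < \<rho>" using z(2) by (meson le_less_trans mem_ball zero_le_dist)
  let ?u = "\<lambda>x. v x * indicator (ball a (3 * \<rho>)) x"
  have sub: "lev v t \<inter> ball a \<rho> \<subseteq> lev ?u t"
  proof
    fix y assume y: "y \<in> lev v t \<inter> ball a \<rho>"
    then obtain b r where b: "0 < r" "y \<in> ball b r"
      "ennreal t * emeasure lebesgue (ball b r) < (\<integral>\<^sup>+x\<in>ball b r. v x \<partial>lebesgue)"
      by (auto elim: levE)
    have "r < \<rho>"
    proof (rule ccontr)
      assume "\<not> r < \<rho>"
      moreover have "dist b z \<le> dist b y + dist a y + dist a z"
        using dist_triangle[of b z y] dist_triangle[of y z a] by (simp add: dist_commute)
      ultimately have "z \<in> ball b (3 * r)" using b(2) y z(2) by auto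
      with z(1) have "(\<integral>\<^sup>+x\<in>ball b (3*r). v x \<partial>lebesgue) \<le> ennreal s * emeasure lebesgue (ball b (3*r))"
        by (rule not_levD)
      also have "\<dots> = ennreal (3 ^ CARD('n) * s) * emeasure lebesgue (ball b r)"
        using b(1) s by (subst emeasure_ball_scale[of _ _ _ b]) (auto simp: ennreal_mult mult_ac)
      also have "\<dots> \<le> ennreal t * emeasure lebesgue (ball b r)"
        using st by (intro mult_right_mono ennreal_leI) auto
      finally have "(\<integral>\<^sup>+x\<in>ball b (3*r). v x \<partial>lebesgue) \<le> ennreal t * emeasure lebesgue (ball b r)" .
      moreover have "(\<integral>\<^sup>+x\<in>ball b r. v x \<partial>lebesgue) \<le> (\<integral>\<^sup>+x\<in>ball b (3*r). v x \<partial>lebesgue)"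
        using b(1) by (intro nn_integral_mono) (auto split: split_indicator)
      ultimately show False using b(3) by auto
    qed
    have "x \<in> ball a (3 * \<rho>)" if "x \<in> ball b r" for x
    proof -
      have "dist a x \<le> dist a y + dist b y + dist b x"
        using dist_triangle[of a x y] dist_triangle[of y x b] by (simp add: dist_commute)
      then show ?thesis using that b(2) y \<open>r < \<rho>\<close> by auto
    qed
    then have "(\<integral>\<^sup>+x\<in>ball b r. v x \<partial>lebesgue) = (\<integral>\<^sup>+x\<in>ball b r. ?u x \<partial>lebesgue)"
      by (intro nn_integral_cong) (auto split: split_indicator)
    with b(3) have "ennreal t * emeasure lebesgue (ball b r) < (\<integral>\<^sup>+x\<in>ball b r. ?u x \<partial>lebesgue)"
      by (simp only:)
    with b(2) show "y \<in> lev ?u t" by (rule levI)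
  qed
  have u: "?u \<in> borel_measurable lebesgue"
    using v by (intro borel_measurable_times_ennreal borel_measurable_indicator) auto
  have 15: "(15::real) ^ CARD('n) = 5 ^ CARD('n) * 3 ^ CARD('n)"
    by (simp flip: power_mult_distrib)
  have "(\<integral>\<^sup>+x. ?u x \<partial>lebesgue) \<le> ennreal s * emeasure lebesgue (ball a (3 * \<rho>))"
    using z \<rho> by (intro not_levD[of z]) auto
  also have "\<dots> = ennreal (s * 3 ^ CARD('n)) * emeasure lebesgue (ball a \<rho>)"
    using \<rho> s by (subst emeasure_ball_scale[of _ _ _ a]) (auto simp: ennreal_mult mult_ac)
  finally have I: "(\<integral>\<^sup>+x. ?u x \<partial>lebesgue) \<le> ennreal (s * 3 ^ CARD('n)) * emeasure lebesgue (ball a \<rho>)" .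
  have "emeasure lebesgue (lev v t \<inter> ball a \<rho>) \<le> emeasure lebesgue (lev ?u t)"
    by (intro emeasure_mono sub) auto
  also have "\<dots> \<le> ennreal (5 ^ CARD('n) / t) * (\<integral>\<^sup>+x. ?u x \<partial>lebesgue)"
    using u t by (rule emeasure_lev_le)
  also have "\<dots> \<le> ennreal (5 ^ CARD('n) / t) * (ennreal (s * 3 ^ CARD('n)) * emeasure lebesgue (ball a \<rho>))"
    using I by (rule mult_left_mono) simp
  also have "\<dots> = ennreal (15 ^ CARD('n) * (s / t)) * emeasure lebesgue (ball a \<rho>)"
  proof -
    have "15 ^ CARD('n) * (s / t) = 5 ^ CARD('n) / t * (s * 3 ^ CARD('n))"
      using t by (simp add: 15 field_simps)
    moreover have "0 \<le> 5 ^ CARD('n) / t" using t by simp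
    ultimately show ?thesis by (simp only: ennreal_mult_left_assoc)
  qed
  finally show ?thesis .
qed

section \<open>Powers of extended non-negative numbers and weighted norms\<close>

lemma epow_ennreal: "0 \<le> c \<Longrightarrow> epow (ennreal c) a = ennreal (c powr a)"
  by (simp add: epow_def)

lemma epow_top [simp]: "epow \<infinity> a = \<infinity>" "epow top a = top"
  by (simp_all add: epow_def)

lemma epow_0 [simp]: "epow 0 a = 0"
  by (simp add: epow_def)

lemma epow_1 [simp]: "epow 1 a = 1"
  by (simp add: epow_def)

lemma epow_mono:
  assumes "x \<le> y" "0 \<le> a" shows "epow x a \<le> epow y a"
proof (cases "y = \<infinity>")
  case False
  then obtain v where v: "0 \<le> v" "y = ennreal v" by (cases y) auto
  with assms obtain u where u: "0 \<le> u" "x = ennreal u" by (cases x) (auto simp: top_unique)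
  show ?thesis using assms u v by (simp add: epow_ennreal powr_mono2)
qed (simp add: epow_def)

lemma epow_mult:
  assumes "0 \<le> c" "0 < a"
  shows "epow (ennreal c * x) a = ennreal (c powr a) * epow x a"
proof (cases x)
  case (real u)
  then show ?thesis using assms by (simp add: epow_ennreal powr_mult flip: ennreal_mult)
next
  case top
  then show ?thesis using assms by (cases "c = 0") (auto simp: ennreal_mult_top)
qed

lemma epow_inverse_epow: "a \<noteq> 0 \<Longrightarrow> epow (epow x (1 / a)) a = x"
  by (cases x) (auto simp: epow_ennreal powr_powr)

lemma epow_measurable [measurable]:
  "f \<in> borel_measurable M \<Longrightarrow> (\<lambda>x. epow (f x) a) \<in> borel_measurable M"
  unfolding epow_def by measurable simp_all

lemma mult_epow_le_iff:
  assumes "0 \<le> c" "0 \<le> d" "0 < p"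
  shows "ennreal c * epow x (1 / p) \<le> ennreal d * epow y (1 / p)
    \<longleftrightarrow> ennreal (c powr p) * x \<le> ennreal (d powr p) * y"
proof
  assume "ennreal c * epow x (1 / p) \<le> ennreal d * epow y (1 / p)"
  then have "epow (ennreal c * epow x (1 / p)) p \<le> epow (ennreal d * epow y (1 / p)) p"
    using assms by (intro epow_mono) auto
  then show "ennreal (c powr p) * x \<le> ennreal (d powr p) * y"
    using assms by (simp add: epow_mult epow_inverse_epow)
next
  assume "ennreal (c powr p) * x \<le> ennreal (d powr p) * y"
  then have "epow (ennreal (c powr p) * x) (1/p) \<le> epow (ennreal (d powr p) * y) (1/p)"
    using assms by (intro epow_mono) auto
  then show "ennreal c * epow x (1 / p) \<le> ennreal d * epow y (1 / p)"
    using assms by (simp add: epow_mult powr_powr)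
qed

text \<open>Raising to the power p leaves a family of level set inequalities without roots. In this
  form the good-lambda inequality is linear in the weights and can be iterated.\<close>

lemma weak_Lp_norm_le_iff:
  assumes "0 < C" "0 < p"
  shows "weak_Lp_norm p w g \<le> ennreal C * Lp_norm p w h \<longleftrightarrow>
    (\<forall>\<alpha>>0. ennreal (\<alpha> powr p) * weight_of w {x. g x > ennreal \<alpha>}
      \<le> ennreal (C powr p) * (\<integral>\<^sup>+x. epow (h x) p * ennreal (w x) \<partial>lebesgue))"
  unfolding weak_Lp_norm_def Lp_norm_def SUP_le_iff
  using assms by (auto simp: mult_epow_le_iff)

lemma weight_measurable: 
  fixes w :: "real^'n \<Rightarrow> real"
  assumes "weight w" shows "w \<in> borel_measurable lebesgue"
proof -
  have *: "(\<lambda>x. indicator (cball 0 (real k)) x *\<^sub>R w x) \<in> borel_measurable lebesgue" for k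
    using assms unfolding weight_def locally_integrable_def set_integrable_def
    by (auto intro: borel_measurable_integrable)
  show ?thesis
  proof (rule borel_measurable_LIMSEQ_real[OF _ *])
    fix x :: "real^'n"
    obtain k0 :: nat where k0: "norm x \<le> real k0" using real_arch_simple by blast
    show "(\<lambda>k. indicator (cball 0 (real k)) x *\<^sub>R w x) \<longlonglongrightarrow> w x"
      by (rule tendsto_eventually, rule eventually_sequentiallyI[of k0]) (use k0 in auto)
  qed
qed

lemma weight_nonneg: "weight w \<Longrightarrow> 0 \<le> w x"
  by (simp add: weight_def)

lemma weight_of_mono: "A \<subseteq> B \<Longrightarrow> weight_of w A \<le> weight_of w B"
  unfolding weight_of_def by (intro nn_integral_mono) (auto split: split_indicator)

lemma weight_of_eq_emeasure:
  "weight w \<Longrightarrow> A \<in> sets lebesgue \<Longrightarrow> weight_of w A = emeasure (density lebesgue (\<lambda>x. ennreal (w x))) A"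
  unfolding weight_of_def using weight_measurable[of w] by (simp add: emeasure_density)

section \<open>Half-open cubes and the maximal function over them\<close>

definition hbox :: "real^'n \<Rightarrow> real \<Rightarrow> (real^'n) set" where
  "hbox a s = {x. \<forall>i. a $ i \<le> x $ i \<and> x $ i < a $ i + s}"

lemma cube_iff: "cube Q \<longleftrightarrow> (\<exists>a s. 0 < s \<and> Q = hbox a s)"
  by (simp add: cube_def hbox_def)

lemma sets_hbox [measurable, simp]: "hbox a s \<in> sets lebesgue"
proof -
  have "hbox a s = (\<Inter>i. {x. x $ i \<ge> a $ i}) \<inter> (\<Inter>i. {x. x $ i < a $ i + s})"
    by (auto simp: hbox_def)
  also have "\<dots> \<in> sets borel"
    by (intro sets.Int borel_closed borel_open closed_INT open_INT ballI)
       (auto intro: closed_halfspace_component_ge_cart open_halfspace_component_lt_cart)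
  finally show ?thesis by (rule borel_imp_sets_lebesgue)
qed

lemma emeasure_lebesgue_eq_lborel: "S \<in> sets borel \<Longrightarrow> emeasure lebesgue S = emeasure lborel S"
  by (simp add: emeasure_completion)

lemma emeasure_hbox:
  fixes a :: "real^'n"
  assumes "0 \<le> s" shows "emeasure lebesgue (hbox a s) = ennreal (s ^ CARD('n))"
proof -
  let ?b = "a + (\<chi> i. s)"
  have 1: "(\<Prod>b\<in>Basis. (?b - a) \<bullet> b) = s ^ CARD('n)"
  proof -
    have "(\<Prod>b\<in>Basis. (?b - a) \<bullet> b) = (\<Prod>b\<in>(Basis::(real^'n) set). s)"
      by (intro prod.cong refl) (auto simp: Basis_vec_def inner_axis)
    then show ?thesis by simp
  qed
  have le: "a \<bullet> b \<le> ?b \<bullet> b" if "b \<in> Basis" for b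
    using that assms by (auto simp: Basis_vec_def inner_axis)
  have c: "emeasure lebesgue (cbox a ?b) = ennreal (s ^ CARD('n))"
  proof -
    have e: "emeasure lborel (cbox a ?b) = ennreal (s ^ CARD('n))"
      unfolding 1[symmetric] by (rule emeasure_lborel_cbox) (rule le)
    show ?thesis by (subst emeasure_lebesgue_eq_lborel) (simp, rule e)
  qed
  have d: "emeasure lebesgue (box a ?b) = ennreal (s ^ CARD('n))"
  proof -
    have e: "emeasure lborel (box a ?b) = ennreal (s ^ CARD('n))"
      unfolding 1[symmetric] by (rule emeasure_lborel_box) (rule le)
    show ?thesis by (subst emeasure_lebesgue_eq_lborel) (simp, rule e)
  qed
  have "box a ?b \<subseteq> hbox a s" "hbox a s \<subseteq> cbox a ?b"
    by (auto simp: hbox_def mem_box_cart less_imp_le)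
  then have "emeasure lebesgue (box a ?b) \<le> emeasure lebesgue (hbox a s)"
    "emeasure lebesgue (hbox a s) \<le> emeasure lebesgue (cbox a ?b)"
    by (auto intro!: emeasure_mono)
  with c d show ?thesis by simp
qed

lemma ball_subset_hbox: "ball a r \<subseteq> hbox (a - (\<chi> i. r)) (2 * r)"
proof
  fix x assume "x \<in> ball a r"
  then have "\<bar>x $ i - a $ i\<bar> < r" for i
    using component_le_norm_cart[of "x - a" i] by (simp add: dist_norm norm_minus_commute)
  then show "x \<in> hbox (a - (\<chi> i. r)) (2 * r)"
    unfolding hbox_def by (auto simp: abs_less_iff algebra_simps) (smt (verit))+
qed

lemma hbox_dist_less:
  fixes x y :: "real^'n"
  assumes "x \<in> hbox a s" "y \<in> hbox a s"
  shows "dist x y < real CARD('n) * s"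
proof -
  have "dist x y \<le> (\<Sum>i\<in>UNIV. \<bar>(x - y) $ i\<bar>)"
    unfolding dist_norm by (rule norm_le_l1_cart)
  also have "\<dots> < (\<Sum>i\<in>(UNIV::'n set). s)"
  proof (rule sum_strict_mono)
    fix i
    have "a $ i \<le> x $ i" "x $ i < a $ i + s" "a $ i \<le> y $ i" "y $ i < a $ i + s"
      using assms by (auto simp: hbox_def)
    then show "\<bar>(x - y) $ i\<bar> < s" by (simp add: abs_less_iff)
  qed auto
  finally show ?thesis by simp
qed

text \<open>The cubic maximal function for \<open>ennreal\<close>-valued v, so that indicators and
  densities can be inserted without coercions.\<close>

definition mx :: "(real^'n \<Rightarrow> ennreal) \<Rightarrow> real^'n \<Rightarrow> ennreal" where
  "mx v x = (SUP Q\<in>{Q. cube Q \<and> x \<in> Q}. cube_avg Q v)"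

lemma hl_maximal_eq_mx: "hl_maximal f = mx (\<lambda>y. ennreal (norm (f y)))"
  by (simp add: hl_maximal_def mx_def fun_eq_iff)

lemma hl_maximal_indicator: "hl_maximal (indicator U :: real^'n \<Rightarrow> real) = mx (indicator U)"
  unfolding hl_maximal_eq_mx by (rule arg_cong[where f = mx]) (auto split: split_indicator)

lemma less_divide_ennreal_iff:
  assumes "b \<noteq> 0" "b < (top::ennreal)" shows "c < a / b \<longleftrightarrow> c * b < a"
proof -
  have *: "a / b * b = a" using assms by (simp add: ennreal_divide_times)
  show ?thesis
  proof
    assume "c < a / b"
    then have "c * b < a / b * b" 
      using assms by (intro ennreal_mult_strict_right_mono) (auto simp: zero_less_iff_neq_zero)
    then show "c * b < a" by (simp only: *)
  next
    assume "c * b < a"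
    then show "c < a / b"
      using mult_right_mono[of "a / b" c b] by (metis * not_le zero_le)
  qed
qed

lemma less_mx_iff:
  "c < mx v x \<longleftrightarrow> (\<exists>a s. 0 < s \<and> x \<in> hbox a s \<and> c * ennreal (s ^ CARD('n)) < (\<integral>\<^sup>+y\<in>hbox a s. v y \<partial>lebesgue))"
  for v :: "real^'n \<Rightarrow> ennreal"
proof -
  have *: "c < I / ennreal (s ^ CARD('n)) \<longleftrightarrow> c * ennreal (s ^ CARD('n)) < I" if "0 < s" for s I
  proof -
    have "0 < s ^ CARD('n)" using that by simp
    then show ?thesis
      using that by (intro less_divide_ennreal_iff) (simp_all add: not_le)
  qed
  show ?thesis
    unfolding mx_def less_SUP_iff cube_avg_def
    by (auto simp: cube_iff emeasure_hbox *) (metis emeasure_hbox less_imp_le *)+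
qed


text \<open>A strict inequality survives enlarging the cube by \<delta> on every side, and the
  enlarged cube contains a ball about x even if x lies on a face of the original half-open cube.
  Measurability of \<open>mx v\<close> follows for arbitrary v.\<close>

lemma open_mx_greater: "open {x. c < mx v x}" for v :: "real^'n \<Rightarrow> ennreal"
proof (rule openI)
  fix x assume "x \<in> {x. c < mx v x}"
  then have cx: "c < mx v x" by simp
  then obtain a s where s: "0 < s" "x \<in> hbox a s"
    and I: "c * ennreal (s ^ CARD('n)) < (\<integral>\<^sup>+y\<in>hbox a s. v y \<partial>lebesgue)"
    by (auto simp: less_mx_iff)
  have "((\<lambda>\<delta>. (s + 2 * \<delta>) ^ CARD('n)) \<longlongrightarrow> (s + 2 * 0) ^ CARD('n)) (at_right 0)"
    by (intro tendsto_intros)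
  \<comment> \<open>The number c lies below \<open>mx v x\<close>, hence is finite; this makes
    multiplication by c continuous.\<close>
  then have "((\<lambda>\<delta>. c * ennreal ((s + 2 * \<delta>) ^ CARD('n))) \<longlongrightarrow> c * ennreal ((s + 2 * 0) ^ CARD('n))) (at_right 0)"
    using less_le_trans[OF cx top_greatest] by (intro ennreal_tendsto_cmult tendsto_ennrealI) simp_all
  then have "\<forall>\<^sub>F \<delta> in at_right 0. c * ennreal ((s + 2 * \<delta>) ^ CARD('n)) < (\<integral>\<^sup>+y\<in>hbox a s. v y \<partial>lebesgue)"
    using I by (intro order_tendstoD) auto
  then obtain \<delta> where \<delta>: "0 < \<delta>"
    "c * ennreal ((s + 2 * \<delta>) ^ CARD('n)) < (\<integral>\<^sup>+y\<in>hbox a s. v y \<partial>lebesgue)"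
    unfolding eventually_at_right_field using dense by blast
  show "\<exists>\<epsilon>>0. ball x \<epsilon> \<subseteq> {x. c < mx v x}"
  proof (rule exI[of _ \<delta>], rule conjI)
    show "ball x \<delta> \<subseteq> {x. c < mx v x}"
    proof
      fix z assume "z \<in> ball x \<delta>"
      then have z: "\<bar>z $ i - x $ i\<bar> < \<delta>" for i
        using component_le_norm_cart[of "z - x" i] by (simp add: dist_norm norm_minus_commute)
      have zz: "z \<in> hbox (a - (\<chi> i. \<delta>)) (s + 2 * \<delta>)"
        unfolding hbox_def mem_Collect_eq
      proof (rule allI)
        fix i show "(a - (\<chi> i. \<delta>)) $ i \<le> z $ i \<and> z $ i < (a - (\<chi> i. \<delta>)) $ i + (s + 2 * \<delta>)"
          using z[of i] s(2) by (auto simp: hbox_def abs_less_iff dest!: spec[of _ i])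
      qed
      have sub: "hbox a s \<subseteq> hbox (a - (\<chi> i. \<delta>)) (s + 2 * \<delta>)"
        using \<delta>(1) unfolding hbox_def by (auto simp: algebra_simps) (smt (verit))+
      have "(\<integral>\<^sup>+y\<in>hbox a s. v y \<partial>lebesgue) \<le> (\<integral>\<^sup>+y\<in>hbox (a - (\<chi> i. \<delta>)) (s + 2 * \<delta>). v y \<partial>lebesgue)"
        using sub by (intro nn_integral_mono) (auto split: split_indicator)
      with \<delta>(2) have "c * ennreal ((s + 2 * \<delta>) ^ CARD('n)) < (\<integral>\<^sup>+y\<in>hbox (a - (\<chi> i. \<delta>)) (s + 2 * \<delta>). v y \<partial>lebesgue)"
        by (rule less_le_trans)
      with zz have "c < mx v z"
        unfolding less_mx_iff using s(1) \<delta>(1)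
        by (intro exI[of _ "a - (\<chi> i. \<delta>)"] exI[of _ "s + 2 * \<delta>"]) auto
      then show "z \<in> {x. c < mx v x}" by simp
    qed
  qed (rule \<delta>)
qed

lemma mx_measurable [measurable]: "mx v \<in> borel_measurable lebesgue"
proof (rule borel_measurableI_greater)
  fix c show "{x \<in> space lebesgue. c < mx v x} \<in> sets lebesgue"
    using open_mx_greater[of c v] by simp
qed

lemma mx_mono: "(\<And>y. v y \<le> u y) \<Longrightarrow> mx v x \<le> mx u x"
  unfolding mx_def cube_avg_def
  by (intro SUP_mono) (auto intro!: nn_integral_mono mult_right_mono divide_right_mono_ennreal)

lemma mx_indicator_mono: "A \<subseteq> B \<Longrightarrow> mx (indicator A) x \<le> mx (indicator B) x"
  by (rule mx_mono) (auto split: split_indicator)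

lemma mx_indicator_le_1: "mx (indicator A) x \<le> 1" for x :: "real^'n"
proof (rule ccontr)
  assume "\<not> mx (indicator A) x \<le> 1"
  then obtain a s where s: "0 < s" "ennreal (s ^ CARD('n)) < (\<integral>\<^sup>+y\<in>hbox a s. indicator A y \<partial>lebesgue)"
    by (auto simp: not_le less_mx_iff)
  have "(\<integral>\<^sup>+y\<in>hbox a s. indicator A y \<partial>lebesgue) \<le> (\<integral>\<^sup>+y. indicator (hbox a s) y \<partial>lebesgue)"
    by (intro nn_integral_mono) (auto split: split_indicator)
  also have "\<dots> = ennreal (s ^ CARD('n))" using s(1) by (simp add: emeasure_hbox)
  finally show False using s(2) by simp
qed

text \<open>Balls and cubes of comparable measure contain each other. One constant b serves both
  directions, so that a passage from cubes to balls and back costs a fixed power of b.\<close>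

lemma mx_lev_equiv:
  obtains b :: real where "0 < b"
    "\<And>(v :: real^'n \<Rightarrow> ennreal) t x. 0 \<le> t \<Longrightarrow> x \<in> lev v t \<Longrightarrow> ennreal (b * t) < mx v x"
    "\<And>(v :: real^'n \<Rightarrow> ennreal) t x. 0 \<le> t \<Longrightarrow> ennreal t < mx v x \<Longrightarrow> x \<in> lev v (b * t)"
proof -
  let ?n = "CARD('n)"
  define m where "m = measure lebesgue (ball (0::real^'n) 1)"
  have m: "0 < m" unfolding m_def by simp
  have "emeasure lebesgue (ball (0::real^'n) 1) = ennreal m"
    unfolding m_def using emeasure_lborel_ball_finite[of "0::real^'n" 1] 
    by (subst emeasure_eq_ennreal_measure) (auto simp: emeasure_completion)
  then have em: "emeasure lebesgue (ball a r) = ennreal (r ^ ?n * m)" if "0 \<le> r" for a :: "real^'n" and r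
    using emeasure_ball_scale[of r 1 a 0] that m by (simp add: ennreal_mult)
  \<comment> \<open>The first entry compares a ball of radius r with the cube of side 2 r around it,
    the second a cube of side s with the ball of radius (n + 1) s about any of its points.\<close>
  define b where "b = min (m / 2 ^ ?n) (1 / (m * (?n + 1) ^ ?n))"
  have b: "0 < b" "b \<le> m / 2 ^ ?n" "b \<le> 1 / (m * (?n + 1) ^ ?n)"
    using m by (auto simp: b_def)
  show thesis
  proof (rule that[OF b(1)])
    fix v :: "real^'n \<Rightarrow> ennreal" and t x
    assume t: "0 \<le> t" and "x \<in> lev v t"
    then obtain a r where r: "0 < r" "x \<in> ball a r"
      "ennreal t * emeasure lebesgue (ball a r) < (\<integral>\<^sup>+x\<in>ball a r. v x \<partial>lebesgue)" by (auto elim: levE)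
    have "b * t * (2 * r) ^ ?n \<le> m / 2 ^ ?n * t * (2 * r) ^ ?n"
      using b(2) t r(1) by (intro mult_right_mono) auto
    also have "\<dots> = t * (r ^ ?n * m)" by (simp add: power_mult_distrib)
    finally have "ennreal (b * t) * ennreal ((2 * r) ^ ?n) \<le> ennreal t * emeasure lebesgue (ball a r)"
      using t r(1) b(1) m by (simp add: em ennreal_leI flip: ennreal_mult)
    also note r(3)
    also have "(\<integral>\<^sup>+x\<in>ball a r. v x \<partial>lebesgue) \<le> (\<integral>\<^sup>+x\<in>hbox (a - (\<chi> i. r)) (2 * r). v x \<partial>lebesgue)"
      using ball_subset_hbox[of a r] by (intro nn_integral_mono) (auto split: split_indicator)
    finally show "ennreal (b * t) < mx v x"
      unfolding less_mx_iff using r(1,2) ball_subset_hbox[of a r] 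
      by (intro exI[of _ "a - (\<chi> i. r)"] exI[of _ "2 * r"]) auto
  next
    fix v :: "real^'n \<Rightarrow> ennreal" and t x
    assume t: "0 \<le> t" and "ennreal t < mx v x"
    then obtain a s where s: "0 < s" "x \<in> hbox a s"
      "ennreal t * ennreal (s ^ ?n) < (\<integral>\<^sup>+y\<in>hbox a s. v y \<partial>lebesgue)" by (auto simp: less_mx_iff)
    have sub: "hbox a s \<subseteq> ball x ((?n + 1) * s)"
    proof
      fix y assume "y \<in> hbox a s"
      then have "dist x y < ?n * s" using s(2) by (intro hbox_dist_less)
      also have "\<dots> \<le> (?n + 1) * s" using s(1) by (simp add: algebra_simps)
      finally show "y \<in> ball x ((?n + 1) * s)" by simp
    qed
    have "b * t * (((?n + 1) * s) ^ ?n * m) \<le> 1 / (m * (?n + 1) ^ ?n) * t * (((?n + 1) * s) ^ ?n * m)"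
      using b(3) t s(1) m by (intro mult_right_mono) auto
    also have "\<dots> = t * s ^ ?n" using m by (simp add: power_mult_distrib)
    finally have "ennreal (b * t) * emeasure lebesgue (ball x ((?n + 1) * s)) \<le> ennreal t * ennreal (s ^ ?n)"
      using t s(1) b(1) m by (simp add: em ennreal_leI flip: ennreal_mult)
    also note s(3)
    also have "(\<integral>\<^sup>+y\<in>hbox a s. v y \<partial>lebesgue) \<le> (\<integral>\<^sup>+y\<in>ball x ((?n + 1) * s). v y \<partial>lebesgue)"
      using sub by (intro nn_integral_mono) (auto split: split_indicator)
    finally show "x \<in> lev v (b * t)"
      using s(1) by (intro levI[of x x "(?n + 1) * s"]) auto
  qed
qed

lemma mx_indicator_eq_1:
  assumes "open U" "x \<in> U" shows "mx (indicator U) x = 1"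
proof (rule antisym)
  show "mx (indicator U) x \<le> 1" by (rule mx_indicator_le_1)
  obtain r where r: "0 < r" "ball x r \<subseteq> U" using assms open_contains_ball by blast
  define s where "s = r / CARD('a)"
  have s: "0 < s" using r by (simp add: s_def)
  have x: "x \<in> hbox x s" using s by (simp add: hbox_def)
  have sub: "hbox x s \<subseteq> U"
    using hbox_dist_less[OF x] r(2) by (force simp: s_def)
  have "emeasure lebesgue (hbox x s) = (\<integral>\<^sup>+y. indicator (hbox x s) y \<partial>lebesgue)" by simp
  also have "\<dots> \<le> (\<integral>\<^sup>+y\<in>hbox x s. indicator U y \<partial>lebesgue)"
    using sub by (intro nn_integral_mono) (auto split: split_indicator)
  finally have "1 \<le> cube_avg (hbox x s) (indicator U)"
  proof -
    assume le: "emeasure lebesgue (hbox x s) \<le> (\<integral>\<^sup>+y\<in>hbox x s. indicator U y \<partial>lebesgue)"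
    have "1 = emeasure lebesgue (hbox x s) / emeasure lebesgue (hbox x s)"
      using s by (intro ennreal_divide_self[symmetric]) (auto simp: emeasure_hbox not_le)
    also have "\<dots> \<le> cube_avg (hbox x s) (indicator U)"
      unfolding cube_avg_def by (rule divide_right_mono_ennreal[OF le])
    finally show ?thesis .
  qed
  also have "\<dots> \<le> mx (indicator U) x"
    unfolding mx_def using x s by (intro SUP_upper) (auto simp: cube_iff)
  finally show "1 \<le> mx (indicator U) x" .
qed

section \<open>Riesz transforms of random sums\<close>

lemma sum_Pow_insert:
  assumes "finite S" "x \<notin> S"
  shows "(\<Sum>A\<in>Pow (insert x S). h A) = (\<Sum>A\<in>Pow S. h A + h (insert x A))"
proof -
  have "inj_on (insert x) (Pow S)" using assms(2) by (auto simp: inj_on_def)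
  moreover have "Pow S \<inter> insert x ` Pow S = {}" using assms(2) by auto
  ultimately show ?thesis
    using assms by (simp add: Pow_insert sum.union_disjoint sum.reindex sum.distrib o_def)
qed

text \<open>A choice of signs is encoded by the set A of indices with sign +1, so averaging over
  independent random signs is a sum over \<open>Pow S\<close>.\<close>

definition signed_sum :: "'a set \<Rightarrow> ('a \<Rightarrow> real) \<Rightarrow> 'a set \<Rightarrow> real" where
  "signed_sum S a A = (\<Sum>P\<in>S. if P \<in> A then a P else - a P)"

lemma signed_sum_insert:
  assumes "finite S" "x \<notin> S" "A \<subseteq> S"
  shows "signed_sum (insert x S) a A = signed_sum S a A - a x"
    "signed_sum (insert x S) a (insert x A) = signed_sum S a A + a x"
proof -
  have "x \<notin> A" using assms by auto
  moreover have "(\<Sum>P\<in>S. if P \<in> insert x A then a P else - a P) = (\<Sum>P\<in>S. if P \<in> A then a P else - a P)"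
    using assms(2) by (intro sum.cong) auto
  ultimately show "signed_sum (insert x S) a A = signed_sum S a A - a x"
    "signed_sum (insert x S) a (insert x A) = signed_sum S a A + a x"
    using assms by (simp_all add: signed_sum_def)
qed

text \<open>Induction on S: the two signs of a new term contribute
  \<open>(X - a) ^ k + (X + a) ^ k\<close>, in which the odd powers of X cancel.\<close>

lemma signed_sum_moments:
  assumes "finite S"
  shows "(\<Sum>A\<in>Pow S. (signed_sum S a A)\<^sup>2) = 2 ^ card S * (\<Sum>P\<in>S. (a P)\<^sup>2)"
    and "(\<Sum>A\<in>Pow S. (signed_sum S a A) ^ 4) \<le> 3 * 2 ^ card S * (\<Sum>P\<in>S. (a P)\<^sup>2)\<^sup>2"
proof -
  have "(\<Sum>A\<in>Pow S. (signed_sum S a A)\<^sup>2) = 2 ^ card S * (\<Sum>P\<in>S. (a P)\<^sup>2) \<and>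
    (\<Sum>A\<in>Pow S. (signed_sum S a A) ^ 4) \<le> 3 * 2 ^ card S * (\<Sum>P\<in>S. (a P)\<^sup>2)\<^sup>2"
    using assms
  proof induction
    case empty then show ?case by (simp add: signed_sum_def)
  next
    case (insert x S)
    let ?X = "signed_sum S a" and ?s = "\<Sum>P\<in>S. (a P)\<^sup>2"
    have "(\<Sum>A\<in>Pow (insert x S). (signed_sum (insert x S) a A)\<^sup>2)
        = (\<Sum>A\<in>Pow S. (?X A - a x)\<^sup>2 + (?X A + a x)\<^sup>2)"
      using insert by (subst sum_Pow_insert) (auto intro!: sum.cong simp: signed_sum_insert)
    also have "\<dots> = (\<Sum>A\<in>Pow S. 2 * (?X A)\<^sup>2 + 2 * (a x)\<^sup>2)"
      by (intro sum.cong refl) (simp add: power2_eq_square algebra_simps)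
    also have "\<dots> = 2 * (2 ^ card S * ?s) + 2 ^ card S * (2 * (a x)\<^sup>2)"
      using insert by (simp add: sum.distrib card_Pow flip: sum_distrib_left)
    finally have 2: "(\<Sum>A\<in>Pow (insert x S). (signed_sum (insert x S) a A)\<^sup>2)
        = 2 ^ card (insert x S) * (\<Sum>P\<in>insert x S. (a P)\<^sup>2)"
      using insert by (simp add: algebra_simps)
    have "(\<Sum>A\<in>Pow (insert x S). (signed_sum (insert x S) a A) ^ 4)
        = (\<Sum>A\<in>Pow S. (?X A - a x) ^ 4 + (?X A + a x) ^ 4)"
      using insert by (subst sum_Pow_insert) (auto intro!: sum.cong simp: signed_sum_insert)
    also have "\<dots> = (\<Sum>A\<in>Pow S. 2 * (?X A) ^ 4 + 12 * (a x)\<^sup>2 * (?X A)\<^sup>2 + 2 * (a x) ^ 4)"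
      by (intro sum.cong refl) (simp add: power2_eq_square power4_eq_xxxx algebra_simps)
    also have "\<dots> = 2 * (\<Sum>A\<in>Pow S. (?X A) ^ 4) + 12 * (a x)\<^sup>2 * (2 ^ card S * ?s) + 2 ^ card S * (2 * (a x) ^ 4)"
      using insert by (simp add: sum.distrib card_Pow flip: sum_distrib_left)
    \<comment> \<open>The coefficient of \<open>(a x) ^ 4\<close> is raised from 2 to 6 in order to
      complete the square.\<close>
    also have "\<dots> \<le> 2 * (3 * 2 ^ card S * ?s\<^sup>2) + 12 * (a x)\<^sup>2 * (2 ^ card S * ?s) + 2 ^ card S * (6 * (a x) ^ 4)"
      using insert by (intro add_mono mult_left_mono) auto
    also have "\<dots> = 3 * 2 ^ card (insert x S) * (\<Sum>P\<in>insert x S. (a P)\<^sup>2)\<^sup>2"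
      using insert by (simp add: power2_eq_square power4_eq_xxxx algebra_simps)
    finally show ?case using 2 by simp
  qed
  then show "(\<Sum>A\<in>Pow S. (signed_sum S a A)\<^sup>2) = 2 ^ card S * (\<Sum>P\<in>S. (a P)\<^sup>2)"
    "(\<Sum>A\<in>Pow S. (signed_sum S a A) ^ 4) \<le> 3 * 2 ^ card S * (\<Sum>P\<in>S. (a P)\<^sup>2)\<^sup>2"
    by auto
qed

text \<open>The first moment is bounded below through the second and the fourth by summing one
  polynomial inequality over all signs, with no Hoelder inequality for three exponents.\<close>

lemma khinchine_lower:
  assumes "finite S"
  shows "2 ^ card S * sqrt (\<Sum>P\<in>S. (a P)\<^sup>2) \<le> 2 * (\<Sum>A\<in>Pow S. \<bar>signed_sum S a A\<bar>)"
proof -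
  define s where "s = sqrt (\<Sum>P\<in>S. (a P)\<^sup>2)"
  have s2: "(\<Sum>P\<in>S. (a P)\<^sup>2) = s\<^sup>2" and s0: "0 \<le> s"
    unfolding s_def by (simp_all add: sum_nonneg)
  show ?thesis
  proof (cases "s = 0")
    case True then show ?thesis by (simp add: s_def[symmetric] sum_nonneg)
  next
    case False
    with s0 have s: "0 < s" by simp
    \<comment> \<open>With \<open>q\<^sup>2 = 3 * s\<^sup>2\<close> this is the non-negativity of a
      cubic in |x| with a double root at q. For this q the fourth moment consumes only a third of
      the main term: 9 - 3 = 6.\<close>
    have pt: "3 * s\<^sup>2 * x\<^sup>2 * 3 - x ^ 4 \<le> 2 * (sqrt 3 * s) ^ 3 * \<bar>x\<bar>" for x
    proof -
      define q where "q = sqrt 3 * s"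
      have q: "0 < q" "q\<^sup>2 = 3 * s\<^sup>2" using s by (simp_all add: q_def power_mult_distrib)
      have "0 \<le> (\<bar>x\<bar> - q)\<^sup>2 * (\<bar>x\<bar> + 2 * q) * \<bar>x\<bar>" using q by simp
      also have "\<dots> = x ^ 4 - 3 * q\<^sup>2 * x\<^sup>2 + 2 * q ^ 3 * \<bar>x\<bar>"
        by (cases "0 \<le> x") (simp_all add: power2_eq_square power3_eq_cube power4_eq_xxxx algebra_simps)
      finally show ?thesis using q(2) unfolding q_def[symmetric] by simp
    qed
    have "9 * s\<^sup>2 * (2 ^ card S * s\<^sup>2) - 3 * 2 ^ card S * (s\<^sup>2)\<^sup>2
      \<le> 9 * s\<^sup>2 * (\<Sum>A\<in>Pow S. (signed_sum S a A)\<^sup>2) - (\<Sum>A\<in>Pow S. (signed_sum S a A) ^ 4)"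
      using signed_sum_moments[OF assms, of a] by (simp add: s2)
    also have "\<dots> = (\<Sum>A\<in>Pow S. 3 * s\<^sup>2 * (signed_sum S a A)\<^sup>2 * 3 - (signed_sum S a A) ^ 4)"
      by (simp add: sum_subtractf sum_distrib_left mult_ac)
    also have "\<dots> \<le> (\<Sum>A\<in>Pow S. 2 * (sqrt 3 * s) ^ 3 * \<bar>signed_sum S a A\<bar>)"
      by (intro sum_mono pt)
    also have "\<dots> = 2 * (sqrt 3) ^ 3 * s ^ 3 * (\<Sum>A\<in>Pow S. \<bar>signed_sum S a A\<bar>)"
      by (simp add: power_mult_distrib sum_distrib_left mult_ac)
    finally have "s ^ 3 * (2 ^ card S * s * 6) \<le> s ^ 3 * (2 * (sqrt 3) ^ 3 * (\<Sum>A\<in>Pow S. \<bar>signed_sum S a A\<bar>))"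
      by (simp add: power2_eq_square power3_eq_cube algebra_simps)
    then have 1: "2 ^ card S * s * 6 \<le> 2 * (sqrt 3) ^ 3 * (\<Sum>A\<in>Pow S. \<bar>signed_sum S a A\<bar>)"
      using s by simp
    have "sqrt 3 \<le> 2" by (rule real_le_lsqrt) auto
    moreover have "(sqrt 3) ^ 3 = 3 * sqrt (3::real)" by (simp add: power3_eq_cube)
    ultimately have "2 * (sqrt 3) ^ 3 * (\<Sum>A\<in>Pow S. \<bar>signed_sum S a A\<bar>) \<le> 12 * (\<Sum>A\<in>Pow S. \<bar>signed_sum S a A\<bar>)"
      by (intro mult_right_mono sum_nonneg) auto
    with 1 have "2 ^ card S * s * 6 \<le> 12 * (\<Sum>A\<in>Pow S. \<bar>signed_sum S a A\<bar>)" by (rule order_trans)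
    then have "2 ^ card S * s \<le> 2 * (\<Sum>A\<in>Pow S. \<bar>signed_sum S a A\<bar>)" by linarith
    then show ?thesis unfolding s_def .
  qed
qed

text \<open>Layer cake over the levels \<open>2 ^ k\<close>: values up to 1 cost
  \<open>weight_of w F\<close>, and the layers above 1 contribute
  \<open>2 * 2 powr (k * (1 - p))\<close> times J, a convergent geometric series because p >
  1.\<close>

lemma nn_integral_weak_type_le:
  assumes w: "weight w" and F: "F \<in> sets lebesgue" and g: "g \<in> borel_measurable lebesgue"
    and p: "1 < p"
    and wk: "\<And>k::nat. ennreal ((2 ^ k) powr p) * weight_of w (F \<inter> {x. g x > 2 ^ k}) \<le> J"
  shows "(\<integral>\<^sup>+x\<in>F. ennreal (g x) * ennreal (w x) \<partial>lebesgue)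
    \<le> weight_of w F + ennreal (2 / (1 - 2 powr (1 - p))) * J"
proof -
  have wm: "w \<in> borel_measurable lebesgue" by (rule weight_measurable[OF w])
  let ?B = "\<lambda>k::nat. F \<inter> {x. g x > 2 ^ k}"
  have B: "?B k \<in> sets lebesgue" for k
  proof -
    have "{x \<in> space lebesgue. g x > 2 ^ k} \<in> sets lebesgue" using g by measurable
    then show ?thesis using F by auto
  qed
  have pt: "ennreal (g x) \<le> 1 + (\<Sum>k. ennreal (2 ^ Suc k) * indicator {x. g x > 2 ^ k} x)" for x
  proof (cases "g x \<le> 1")
    case True then show ?thesis by (simp add: add_increasing2 ennreal_le_1)
  next
    case False
    define k where "k = (LEAST k::nat. g x \<le> 2 ^ Suc k)"
    have ex: "\<exists>k::nat. g x \<le> 2 ^ Suc k"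
    proof -
      obtain k where "g x < 2 ^ k" using real_arch_pow[of 2 "g x"] by auto
      moreover have "(2::real) ^ k \<le> 2 ^ Suc k" by simp
      ultimately have "g x \<le> 2 ^ Suc k" by linarith
      then show ?thesis by blast
    qed
    have k1: "g x \<le> 2 ^ Suc k" unfolding k_def by (rule LeastI_ex[OF ex])
    have k2: "2 ^ k < g x"
    proof (cases k)
      case 0 then show ?thesis using False by simp
    next
      case (Suc m)
      then have "\<not> g x \<le> 2 ^ Suc m" using not_less_Least[of m "\<lambda>k. g x \<le> 2 ^ Suc k"] by (simp add: k_def)
      then show ?thesis using Suc by simp
    qed
    have "ennreal (g x) \<le> ennreal (2 ^ Suc k) * indicator {x. g x > 2 ^ k} x"
      using k1 k2 by (simp add: ennreal_leI del: power_Suc)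
    also have "\<dots> \<le> (\<Sum>k. ennreal (2 ^ Suc k) * indicator {x. g x > 2 ^ k} x)"
    proof -
      have "h k \<le> suminf h" for h :: "nat \<Rightarrow> ennreal"
        using sum_le_suminf[of h "{k}"] by simp
      then show ?thesis .
    qed
    finally show ?thesis by (simp add: add_increasing)
  qed
  have "(\<integral>\<^sup>+x\<in>F. ennreal (g x) * ennreal (w x) \<partial>lebesgue)
    \<le> (\<integral>\<^sup>+x. ennreal (w x) * indicator F x + (\<Sum>k. ennreal (2 ^ Suc k) * (ennreal (w x) * indicator (?B k) x)) \<partial>lebesgue)"
  proof (rule nn_integral_mono)
    fix x
    have "ennreal (g x) * ennreal (w x) * indicator F x
      \<le> (1 + (\<Sum>k. ennreal (2 ^ Suc k) * indicator {x. g x > 2 ^ k} x)) * (ennreal (w x) * indicator F x)"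
      unfolding mult.assoc by (rule mult_right_mono[OF pt]) simp
    also have "\<dots> = ennreal (w x) * indicator F x +
       (\<Sum>k. ennreal (2 ^ Suc k) * indicator {x. g x > 2 ^ k} x * (ennreal (w x) * indicator F x))"
      by (simp add: distrib_right)
    also have "(\<lambda>k. ennreal (2 ^ Suc k) * indicator {x. g x > 2 ^ k} x * (ennreal (w x) * indicator F x))
      = (\<lambda>k. ennreal (2 ^ Suc k) * (ennreal (w x) * indicator (?B k) x))"
      by (auto simp: fun_eq_iff split: split_indicator)
    finally show "ennreal (g x) * ennreal (w x) * indicator F x
      \<le> ennreal (w x) * indicator F x + (\<Sum>k. ennreal (2 ^ Suc k) * (ennreal (w x) * indicator (?B k) x))" .
  qed
  also have "\<dots> = weight_of w F + (\<Sum>k. ennreal (2 ^ Suc k) * weight_of w (?B k))"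
    unfolding weight_of_def using wm B F
    by (subst nn_integral_add, simp, simp, subst nn_integral_suminf) (auto simp: nn_integral_cmult)
  also have "(\<Sum>k. ennreal (2 ^ Suc k) * weight_of w (?B k)) \<le> (\<Sum>k. ennreal (2 * (2 powr (1 - p)) ^ k) * J)"
  proof (intro suminf_le allI)
    fix k :: nat
    have *: "2 ^ Suc k = (2 * (2 powr (1 - p)) ^ k) * (2 ^ k) powr p"
      by (simp add: powr_diff power_divide powr_powr powr_realpow[symmetric] mult_ac)
    have "ennreal (2 ^ Suc k) * weight_of w (?B k)
       = ennreal (2 * (2 powr (1 - p)) ^ k) * (ennreal ((2 ^ k) powr p) * weight_of w (?B k))"
      by (subst ennreal_mult_left_assoc) (simp_all add: * del: power_Suc)
    also have "\<dots> \<le> ennreal (2 * (2 powr (1 - p)) ^ k) * J"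
      by (intro mult_left_mono wk) simp
    finally show "ennreal (2 ^ Suc k) * weight_of w (?B k) \<le> ennreal (2 * (2 powr (1 - p)) ^ k) * J" .
  qed auto
  also have "(\<Sum>k. ennreal (2 * (2 powr (1 - p)) ^ k) * J) = ennreal (2 / (1 - 2 powr (1 - p))) * J"
  proof -
    have "2 powr (1 - p) < 2 powr 0" using p by (intro powr_less_mono) auto
    then have "(\<lambda>k. 2 * (2 powr (1 - p)) ^ k) sums (2 * (1 / (1 - 2 powr (1 - p))))"
      by (intro sums_mult geometric_sums) auto
    then have "(\<Sum>k. ennreal (2 * (2 powr (1 - p)) ^ k)) = ennreal (2 / (1 - 2 powr (1 - p)))"
      by (intro suminf_ennreal_eq) auto
    then show ?thesis by simp
  qed
  finally show ?thesis by (simp add: add_left_mono)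
qed

section \<open>Riesz transforms off the support\<close>

definition rker :: "'n::finite \<Rightarrow> real^'n \<Rightarrow> real" where
  "rker j z = riesz_const CARD('n) * (z $ j / norm z ^ (CARD('n) + 1))"

lemma riesz_const_pos: "0 < riesz_const n"
  unfolding riesz_const_def by (intro divide_pos_pos Gamma_real_pos) (auto intro: add_nonneg_pos)

lemma rker_measurable [measurable]: "rker j \<in> borel_measurable borel"
  unfolding rker_def by measurable

lemma rker_minus: "rker j (- z) = - rker j z"
  by (simp add: rker_def)

lemma abs_rker_le:
  fixes z :: "real^'n"
  assumes "0 < d" "d \<le> norm z"
  shows "\<bar>rker j z\<bar> \<le> riesz_const CARD('n) / d ^ CARD('n)"
proof -
  have "\<bar>z $ j\<bar> / norm z ^ (CARD('n) + 1) \<le> norm z / norm z ^ (CARD('n) + 1)"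
    using component_le_norm_cart[of z j] by (intro divide_right_mono) auto
  also have "\<dots> = 1 / norm z ^ CARD('n)" using assms by simp
  also have "\<dots> \<le> 1 / d ^ CARD('n)" using assms by (intro frac_le power_mono) auto
  finally have "riesz_const CARD('n) * (\<bar>z $ j\<bar> / norm z ^ (CARD('n) + 1)) \<le> riesz_const CARD('n) * (1 / d ^ CARD('n))"
    using riesz_const_pos[of "CARD('n)"] by (intro mult_left_mono) auto
  then show ?thesis
    using riesz_const_pos[of "CARD('n)"] by (simp add: rker_def abs_mult)
qed

lemma rker_ge:
  fixes z :: "real^'n"
  assumes "0 < c" "c \<le> z $ j" "norm z \<le> b"
  shows "riesz_const CARD('n) * (c / b ^ (CARD('n) + 1)) \<le> rker j z"
proof -
  have "0 < norm z" using assms(1,2) component_le_norm_cart[of z j] by linarith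
  then have "c / b ^ (CARD('n) + 1) \<le> z $ j / norm z ^ (CARD('n) + 1)"
    using assms by (intro frac_le power_mono) auto
  then show ?thesis
    unfolding rker_def using riesz_const_pos[of "CARD('n)"] by (intro mult_left_mono) auto
qed

lemma lborel_integral_reflect:
  fixes g :: "'a::euclidean_space \<Rightarrow> 'b::{banach, second_countable_topology}"
  assumes "g \<in> borel_measurable borel"
  shows "(\<integral>y. g (x - y) \<partial>lborel) = (\<integral>y. g y \<partial>lborel)"
proof -
  have "(lborel :: 'a measure) = distr lborel borel (\<lambda>y. x - y)"
    using lborel_affine[of "-1" x] by (simp add: density_1)
  then have "(\<integral>y. g y \<partial>lborel) = (\<integral>y. g y \<partial>distr lborel borel (\<lambda>y. x - y))" by simp
  also have "\<dots> = (\<integral>y. g (x - y) \<partial>lborel)"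
    using assms by (intro integral_distr) auto
  finally show ?thesis by simp
qed

text \<open>For \<epsilon> < d the truncation removes nothing from the support, so the expression
  under the limit is eventually constant.\<close>

lemma riesz_away_from_support:
  fixes f :: "real^'n \<Rightarrow> complex"
  assumes f: "f \<in> borel_measurable borel" and d: "0 < d" "\<And>y. y \<in> ball x d \<Longrightarrow> f y = 0"
  shows "riesz j f x = (\<integral>y. of_real (rker j (x - y)) * f y \<partial>lborel)"
proof -
  let ?I = "\<integral>y. of_real (rker j (x - y)) * f y \<partial>lborel"
  have "of_real (riesz_const CARD('n)) * (LINT y:{y. norm y > \<epsilon>}|lebesgue.
          f (x - y) * of_real (y $ j / norm y ^ (CARD('n) + 1))) = ?I" if "0 < \<epsilon>" "\<epsilon> < d" for \<epsilon>
  proof -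
    have *: "indicator {y. norm y > \<epsilon>} y *\<^sub>R (f (x - y) * of_real (y $ j / norm y ^ (CARD('n) + 1)))
      = f (x - y) * of_real (y $ j / norm y ^ (CARD('n) + 1))" for y
      using d(2)[of "x - y"] that by (auto simp: dist_norm split: split_indicator)
    have "of_real (riesz_const CARD('n)) * (LINT y:{y. norm y > \<epsilon>}|lebesgue.
          f (x - y) * of_real (y $ j / norm y ^ (CARD('n) + 1)))
      = of_real (riesz_const CARD('n)) * (\<integral>y. f (x - y) * of_real (y $ j / norm y ^ (CARD('n) + 1)) \<partial>lborel)"
      unfolding set_lebesgue_integral_def * using f by (subst integral_completion) auto
    also have "\<dots> = (\<integral>y. of_real (riesz_const CARD('n)) * (f (x - y) * of_real (y $ j / norm y ^ (CARD('n) + 1))) \<partial>lborel)"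
      by (rule integral_mult_right_zero[symmetric])
    also have "\<dots> = (\<integral>y. of_real (rker j (x - (x - y))) * f (x - y) \<partial>lborel)"
      by (intro Bochner_Integration.integral_cong refl) (simp add: rker_def)
    also have "\<dots> = ?I"
      using f by (intro lborel_integral_reflect[where g = "\<lambda>y. of_real (rker j (x - y)) * f y"]) measurable
    finally show ?thesis .
  qed
  then have "\<forall>\<^sub>F \<epsilon> in at_right 0. of_real (riesz_const CARD('n)) * (LINT y:{y. norm y > \<epsilon>}|lebesgue.
          f (x - y) * of_real (y $ j / norm y ^ (CARD('n) + 1))) = ?I"
    unfolding eventually_at_right_field using d(1) by blast
  then show ?thesis
    unfolding riesz_def by (intro tendsto_Lim tendsto_eventually) auto
qed

lemma riesz_le_maximal_truncation:
  fixes f :: "real^'n \<Rightarrow> complex"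
  assumes f: "f \<in> borel_measurable borel" and d: "0 < d" "\<And>y. y \<in> ball x d \<Longrightarrow> f y = 0"
  shows "ennreal (norm (\<integral>y. of_real (rker j (x - y)) * f y \<partial>lborel)) \<le> maximal_truncation (riesz j) f x"
proof -
  have "(\<lambda>y. f y * indicator {y. norm (y - x) > d / 2} y) = f"
    using d by (auto simp: fun_eq_iff dist_norm norm_minus_commute split: split_indicator)
  then show ?thesis
    unfolding maximal_truncation_def
    using d(1) riesz_away_from_support[OF assms, where j = j] by (intro SUP_upper2[of "d / 2"]) simp_all
qed

lemma complex_of_real_measurable: "complex_of_real \<in> borel_measurable borel"
  by (intro borel_measurable_continuous_onI continuous_intros)

lemma signed_sum_indicator_measurable:
  assumes "\<And>P. P \<in> S \<Longrightarrow> Y P \<in> sets M"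
  shows "(\<lambda>y. signed_sum S (\<lambda>P. indicator (Y P) y) A) \<in> borel_measurable M"
  unfolding signed_sum_def
proof (rule borel_measurable_sum)
  fix P assume "P \<in> S"
  then have "(\<lambda>y. indicator (Y P) y :: real) \<in> borel_measurable M"
    using assms by (intro borel_measurable_indicator)
  then show "(\<lambda>y. if P \<in> A then indicator (Y P) y else - indicator (Y P) y :: real) \<in> borel_measurable M"
    by (cases "P \<in> A") auto
qed

text \<open>The sets \<open>Y P\<close> stay at distance d from x, where the kernel is bounded. So
  the integral of the random sum splits into the signed sum of the individual integrals, and
  truncation at d/2 changes nothing.\<close>

lemma riesz_signed_sum_le:
  fixes Y :: "'i \<Rightarrow> (real^'n) set"
  assumes S: "finite S" and Y: "\<And>P. P \<in> S \<Longrightarrow> Y P \<in> sets borel" "\<And>P. P \<in> S \<Longrightarrow> emeasure lborel (Y P) < \<infinity>"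
    and d: "0 < d" "\<And>P. P \<in> S \<Longrightarrow> Y P \<inter> ball x d = {}"
  shows "ennreal \<bar>signed_sum S (\<lambda>P. \<integral>y. indicator (Y P) y * rker j (x - y) \<partial>lborel) A\<bar>
    \<le> maximal_truncation (riesz j) (\<lambda>y. of_real (signed_sum S (\<lambda>P. indicator (Y P) y) A)) x"
proof -
  have int: "integrable lborel (\<lambda>y. indicator (Y P) y * rker j (x - y))" if P: "P \<in> S" for P
  proof (rule Bochner_Integration.integrable_bound)
    show "integrable lborel (\<lambda>y. riesz_const CARD('n) / d ^ CARD('n) * indicator (Y P) y :: real)"
      using Y[OF P] by (intro integrable_mult_right integrable_real_indicator) auto
    show "(\<lambda>y. indicator (Y P) y * rker j (x - y)) \<in> borel_measurable lborel"
      using Y[OF P] by (intro borel_measurable_times borel_measurable_indicator) (auto, measurable)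
    have "norm (rker j (x - y)) \<le> norm (riesz_const CARD('n) / d ^ CARD('n))" if "y \<in> Y P" for y
    proof -
      have "d \<le> norm (x - y)" using d(2)[OF P] that by (auto simp: dist_norm not_less)
      from abs_rker_le[OF d(1) this, of j] show ?thesis
        using riesz_const_pos[of "CARD('n)"] d(1) by (simp add: abs_of_pos)
    qed
    then show "AE y in lborel. norm (indicator (Y P) y * rker j (x - y)) \<le> norm (riesz_const CARD('n) / d ^ CARD('n) * indicator (Y P) y)"
      by (auto split: split_indicator)
  qed
  let ?f = "\<lambda>y. of_real (signed_sum S (\<lambda>P. indicator (Y P) y) A) :: complex"
  have f: "?f \<in> borel_measurable borel"
    using signed_sum_indicator_measurable[of S Y borel A] Y(1)
    by (intro measurable_compose[OF _ complex_of_real_measurable]) auto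
  have f0: "?f y = 0" if "y \<in> ball x d" for y
  proof -
    have "y \<notin> Y P" if "P \<in> S" for P using d(2)[OF that] \<open>y \<in> ball x d\<close> by blast
    then show ?thesis unfolding signed_sum_def by (auto intro!: sum.neutral)
  qed
  have "(\<integral>y. of_real (rker j (x - y)) * ?f y \<partial>lborel)
    = (\<integral>y. of_real (\<Sum>P\<in>S. (if P \<in> A then 1 else -1) * (indicator (Y P) y * rker j (x - y))) \<partial>lborel)"
    unfolding signed_sum_def
    by (intro Bochner_Integration.integral_cong refl)
       (auto simp: sum_distrib_left mult_ac simp flip: of_real_mult intro!: sum.cong)
  also have "\<dots> = of_real (\<integral>y. (\<Sum>P\<in>S. (if P \<in> A then 1 else -1) * (indicator (Y P) y * rker j (x - y))) \<partial>lborel)"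
    by (rule integral_complex_of_real)
  also have "(\<integral>y. (\<Sum>P\<in>S. (if P \<in> A then 1 else -1) * (indicator (Y P) y * rker j (x - y))) \<partial>lborel)
    = (\<Sum>P\<in>S. (\<integral>y. (if P \<in> A then 1 else -1) * (indicator (Y P) y * rker j (x - y)) \<partial>lborel))"
    using int by (intro Bochner_Integration.integral_sum integrable_mult_right) auto
  also have "\<dots> = signed_sum S (\<lambda>P. \<integral>y. indicator (Y P) y * rker j (x - y) \<partial>lborel) A"
    unfolding signed_sum_def by (intro sum.cong) auto
  finally have "ennreal \<bar>signed_sum S (\<lambda>P. \<integral>y. indicator (Y P) y * rker j (x - y) \<partial>lborel) A\<bar>
    = ennreal (norm (\<integral>y. of_real (rker j (x - y)) * ?f y \<partial>lborel))" by simp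
  also have "\<dots> \<le> maximal_truncation (riesz j) ?f x"
    by (rule riesz_le_maximal_truncation[OF f d(1) f0])
  finally show ?thesis .
qed

lemma abs_signed_sum_indicator_le:
  assumes "finite S" "disjoint_family_on Y S"
  shows "\<bar>signed_sum S (\<lambda>P. indicator (Y P) y) A\<bar> \<le> indicator (\<Union>P\<in>S. Y P) y"
proof (cases "\<exists>P\<in>S. y \<in> Y P")
  case True
  then obtain P where P: "P \<in> S" "y \<in> Y P" by blast
  have "y \<notin> Y Q" if "Q \<in> S" "Q \<noteq> P" for Q
    using assms(2) P that unfolding disjoint_family_on_def by blast
  then have "signed_sum S (\<lambda>P. indicator (Y P) y) A = (\<Sum>Q\<in>{P}. if Q \<in> A then indicator (Y Q) y else - indicator (Y Q) y)"
    unfolding signed_sum_def using assms(1) P by (intro sum.mono_neutral_right) auto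
  then show ?thesis using P by (auto split: split_indicator)
next
  case False
  then have "signed_sum S (\<lambda>P. indicator (Y P) y) A = 0"
    unfolding signed_sum_def by (intro sum.neutral) auto
  then show ?thesis by (simp add: indicator_def)
qed

lemma mult_measure_le_integral_indicator:
  fixes g :: "'a::euclidean_space \<Rightarrow> real"
  assumes "Y \<in> sets borel" "emeasure lborel Y < \<infinity>" "\<And>y. y \<in> Y \<Longrightarrow> c \<le> g y"
    "integrable lborel (\<lambda>y. indicator Y y * g y)"
  shows "c * measure lborel Y \<le> (\<integral>y. indicator Y y * g y \<partial>lborel)"
proof -
  have "c * measure lborel Y = (\<integral>y. c * indicator Y y \<partial>lborel)"
    using assms(1) by simp
  also have "\<dots> \<le> (\<integral>y. indicator Y y * g y \<partial>lborel)"
    using assms by (intro integral_mono integrable_mult_right integrable_real_indicator) (auto split: split_indicator)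
  finally show ?thesis .
qed

text \<open>The small ball lies on the side of a that is opposite to x in the j-th coordinate. Hence
  \<open>x $ j - y $ j\<close> has the sign of -s and modulus at least
  \<open>\<rho> / 2 - \<rho> / 16\<close>, while \<open>norm (x - y)\<close> is below 5 \<rho> +
  \<rho>/2 + \<rho>/16.\<close>

lemma rker_ball_average_ge:
  fixes x a :: "real^'n" and j :: 'n
  assumes \<rho>: "0 < \<rho>" and s: "s = 1 \<or> s = -1" and x: "dist a x < 5 * \<rho>" "s * (x $ j - a $ j) \<le> 0"
    and y: "y \<in> ball (a + (s * \<rho> / 2) *\<^sub>R axis j 1) (\<rho> / 16)"
  shows "riesz_const CARD('n) * ((\<rho> / 4) / (6 * \<rho>) ^ (CARD('n) + 1)) \<le> - s * rker j (x - y)"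
proof -
  let ?c = "a + (s * \<rho> / 2) *\<^sub>R axis j 1"
  have "\<bar>(?c - y) $ j\<bar> \<le> norm (?c - y)" by (rule component_le_norm_cart)
  then have "\<bar>a $ j + s * \<rho> / 2 - y $ j\<bar> < \<rho> / 16" using y by (simp add: dist_norm axis_def)
  then have 1: "a $ j + s * \<rho> / 2 - y $ j < \<rho> / 16" "- (\<rho> / 16) < a $ j + s * \<rho> / 2 - y $ j"
    unfolding abs_less_iff by linarith+
  have "norm (x - y) \<le> dist x a + dist a ?c + dist ?c y"
    using dist_triangle[of x y a] dist_triangle[of a y ?c] by (simp add: dist_norm)
  also have "dist a ?c = \<rho> / 2" using \<rho> s by (auto simp: dist_norm)
  finally have n: "norm (x - y) \<le> 6 * \<rho>" using x y \<rho> by (simp add: dist_commute)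
  from s show ?thesis
  proof
    assume "s = -1"
    then have "riesz_const CARD('n) * ((\<rho> / 4) / (6 * \<rho>) ^ (CARD('n) + 1)) \<le> rker j (x - y)"
      using 1 x(2) n \<rho> by (intro rker_ge) auto
    then show ?thesis using \<open>s = -1\<close> by simp
  next
    assume "s = 1"
    then have "riesz_const CARD('n) * ((\<rho> / 4) / (6 * \<rho>) ^ (CARD('n) + 1)) \<le> rker j (- (x - y))"
      using 1 x(2) n \<rho> by (intro rker_ge) (auto simp: norm_minus_commute)
    then show ?thesis unfolding rker_minus using \<open>s = 1\<close> by simp
  qed
qed

section \<open>Sparse chains of open sets\<close>

text \<open>The kernel bound of \<open>rker_ball_average_ge\<close> times half the measure of a ball
  of radius \<rho>/16; the powers of \<rho> cancel, so the constant is the same at every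
  scale.\<close>

definition chain_const :: "'n::finite itself \<Rightarrow> real" where
  "chain_const _ = riesz_const CARD('n) / (4 * 6 ^ (CARD('n) + 1)) * (measure lborel (ball (0::real^'n) 1) / (2 * 16 ^ CARD('n)))"

lemma chain_const_pos: "0 < chain_const TYPE('n::finite)"
proof -
  have "0 < measure lborel (ball (0::real^'n) 1)" by simp
  then show ?thesis
    unfolding chain_const_def using riesz_const_pos[of "CARD('n)"] by (intro mult_pos_pos divide_pos_pos) auto
qed

text \<open>Let \<open>\<rho>\<close> be the distance of \<open>x\<close> to the complement of \<open>G\<close>. The sets \<open>Y\<close> are the balls of radius
  \<open>\<rho>/16\<close> about \<open>x \<plusminus> (\<rho>/2) e\<^sub>j\<close>, without \<open>H\<close>, for finitely many \<open>x\<close> selected by Vitali's lemma. For a point in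
  the dilated ball about \<open>x\<close>, the kernel has a fixed sign on at least one of the two.\<close>

lemma sparse_generation:
  fixes F G H :: "(real^'n) set" and j :: 'n
  assumes F: "compact F" "F \<subseteq> H" "F \<subseteq> G" and o: "open G" "open H" and fin: "emeasure lebesgue G < \<infinity>"
    and sparse: "\<And>z a r. z \<notin> G \<Longrightarrow> z \<in> ball a r \<Longrightarrow>
      emeasure lebesgue (H \<inter> ball a r) \<le> ennreal (1 / (2 * 32 ^ CARD('n))) * emeasure lebesgue (ball a r)"
  obtains I :: "((real^'n) \<times> bool) set" and Y where "finite I" "disjoint_family_on Y I"
    "\<And>P. P \<in> I \<Longrightarrow> Y P \<in> sets borel" "\<And>P. P \<in> I \<Longrightarrow> Y P \<subseteq> G - H"
    "\<And>P. P \<in> I \<Longrightarrow> emeasure lborel (Y P) < \<infinity>"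
    "\<And>x. x \<in> F \<Longrightarrow> \<exists>P\<in>I. chain_const TYPE('n) \<le> \<bar>\<integral>y. indicator (Y P) y * rker j (x - y) \<partial>lborel\<bar>"
proof -
  let ?n = "CARD('n)"
  define m where "m = measure lborel (ball (0::real^'n) 1)"
  have mb: "measure lborel (ball a r) = r ^ ?n * m" if "0 \<le> r" for a :: "real^'n" and r
    using content_ball_conv_unit_ball[of r a] that by (simp add: m_def)
  have m: "0 < m" by (simp add: m_def)
  \<comment> \<open>The distance to the complement is meaningful because G has finite measure and so
    is not the whole space.\<close>
  define \<rho> where "\<rho> x = infdist x (- G)" for x
  have ne: "- G \<noteq> {}"
  proof
    assume "- G = {}"
    then have "G = UNIV" by auto
    then show False using fin by (simp add: emeasure_completion emeasure_lborel_UNIV)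
  qed
  have cl: "closed (- G)" using o(1) by (rule closed_Compl)
  have \<rho>: "0 < \<rho> x" if "x \<in> F" for x
    unfolding \<rho>_def using F that by (intro infdist_pos_not_in_closed cl ne) auto
  have sub: "ball x (\<rho> x) \<subseteq> G" for x
  proof
    fix y assume "y \<in> ball x (\<rho> x)"
    then show "y \<in> G" using infdist_le[of y "- G" x] by (auto simp: \<rho>_def)
  qed
  obtain I0 where I0: "I0 \<subseteq> F" "finite I0" "F \<subseteq> (\<Union>x\<in>I0. ball x (\<rho> x))"
    by (rule compactE_image[OF F(1), of F "\<lambda>x. ball x (\<rho> x)"]) (use \<rho> in \<open>auto intro!: centre_in_ball[THEN iffD2]\<close>)
  obtain C where C: "C \<subseteq> I0" "pairwise (\<lambda>i j. disjnt (cball i (\<rho> i)) (cball j (\<rho> j))) C"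
    "\<And>i. i \<in> I0 \<Longrightarrow> \<exists>j. j \<in> C \<and> \<not> disjnt (cball i (\<rho> i)) (cball j (\<rho> j)) \<and> cball i (\<rho> i) \<subseteq> ball j (5 * \<rho> j)"
  proof (rule Vitali_covering_lemma_cballs_balls[of I0 \<rho> "Max (\<rho> ` I0)" "\<lambda>x. x"])
    show "0 < \<rho> i \<and> \<rho> i \<le> Max (\<rho> ` I0)" if "i \<in> I0" for i using \<rho> I0 that by auto
  qed blast
  define sg :: "bool \<Rightarrow> real" where "sg \<sigma> = (if \<sigma> then 1 else -1)" for \<sigma>
  define ce where "ce x \<sigma> = x + (sg \<sigma> * \<rho> x / 2) *\<^sub>R axis j 1" for x \<sigma>
  define Y where "Y = (\<lambda>(x, \<sigma>). ball (ce x \<sigma>) (\<rho> x / 16) - H)"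
  have CF: "C \<subseteq> F" using C I0 by blast
  have ce: "dist x (ce x \<sigma>) = \<rho> x / 2" if "x \<in> C" for x \<sigma>
    using \<rho>[of x] CF that by (auto simp: ce_def dist_norm sg_def)
  have cesub: "ball (ce x \<sigma>) (\<rho> x / 16) \<subseteq> ball x (\<rho> x)" if "x \<in> C" for x \<sigma>
  proof
    fix y assume "y \<in> ball (ce x \<sigma>) (\<rho> x / 16)"
    moreover have "0 < \<rho> x" using \<rho> CF that by blast
    ultimately show "y \<in> ball x (\<rho> x)" using dist_triangle[of x y "ce x \<sigma>"] ce[OF that, of \<sigma>] by simp
  qed
  have Yb: "Y P \<in> sets borel" for P
    unfolding Y_def using o by (cases P) auto
  have Yfin: "emeasure lborel (Y P) < \<infinity>" for P
  proof (cases P)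
    case (Pair x \<sigma>)
    have "emeasure lborel (Y P) \<le> emeasure lborel (ball (ce x \<sigma>) (\<rho> x / 16))"
      by (intro emeasure_mono) (auto simp: Y_def Pair)
    then show ?thesis using emeasure_lborel_ball_finite[of "ce x \<sigma>" "\<rho> x / 16"] by (rule le_less_trans)
  qed
  \<comment> \<open>Since 32 = 2 * 16, the sparseness constant \<open>1 / (2 * 32 ^ n)\<close> makes
    the part of H in the ball of radius 2 \<rho> at most half as large as the ball of radius
    \<rho>/16. The larger ball is used because it contains a point outside G.\<close>
  have Ym: "(\<rho> x / 16) ^ ?n * m / 2 \<le> measure lborel (Y (x, \<sigma>))" if x: "x \<in> C" for x \<sigma>
  proof -
    have r: "0 < \<rho> x" using \<rho> CF x by blast
    obtain z where "z \<in> - G" "infdist x (- G) = dist x z"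
      using infdist_attains_inf[OF cl ne] by blast
    then have z: "z \<notin> G" "z \<in> ball x (2 * \<rho> x)" using r by (auto simp: \<rho>_def)
    have "emeasure lborel (H \<inter> ball x (2 * \<rho> x)) \<le> ennreal (1 / (2 * 32 ^ ?n)) * emeasure lborel (ball x (2 * \<rho> x))"
      using sparse[OF z] o by (simp add: emeasure_lebesgue_eq_lborel)
    also have "emeasure lborel (ball x (2 * \<rho> x)) = ennreal ((2 * \<rho> x) ^ ?n * m)"
      using emeasure_lborel_ball_finite[of x "2 * \<rho> x"] r by (simp add: emeasure_eq_ennreal_measure mb)
    also have "ennreal (1 / (2 * 32 ^ ?n)) * \<dots> = ennreal ((\<rho> x / 16) ^ ?n * m / 2)"
    proof -
      have "(32::real) ^ ?n = 2 ^ ?n * 16 ^ ?n" by (simp flip: power_mult_distrib)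
      then show ?thesis using r m by (simp add: power_mult_distrib power_divide flip: ennreal_mult)
    qed
    finally have 1: "emeasure lborel (H \<inter> ball x (2 * \<rho> x)) \<le> ennreal ((\<rho> x / 16) ^ ?n * m / 2)" .
    have "ball (ce x \<sigma>) (\<rho> x / 16) \<subseteq> Y (x, \<sigma>) \<union> (H \<inter> ball x (2 * \<rho> x))"
    proof -
      have "ball x (\<rho> x) \<subseteq> ball x (2 * \<rho> x)" using r by (intro subset_ball) simp
      then show ?thesis using cesub[OF x, of \<sigma>] by (auto simp: Y_def simp del: mem_ball)
    qed
    then have "emeasure lborel (ball (ce x \<sigma>) (\<rho> x / 16)) \<le> emeasure lborel (Y (x, \<sigma>) \<union> (H \<inter> ball x (2 * \<rho> x)))"
      using o Yb by (intro emeasure_mono) auto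
    also have "\<dots> \<le> emeasure lborel (Y (x, \<sigma>)) + emeasure lborel (H \<inter> ball x (2 * \<rho> x))"
      using o Yb by (intro emeasure_subadditive) auto
    also have "\<dots> \<le> ennreal (measure lborel (Y (x, \<sigma>))) + ennreal ((\<rho> x / 16) ^ ?n * m / 2)"
      using Yfin[of "(x, \<sigma>)"] 1 by (intro add_mono) (auto simp: emeasure_eq_ennreal_measure)
    also have "emeasure lborel (ball (ce x \<sigma>) (\<rho> x / 16)) = ennreal ((\<rho> x / 16) ^ ?n * m)"
      using emeasure_lborel_ball_finite[of "ce x \<sigma>" "\<rho> x / 16"] r by (simp add: emeasure_eq_ennreal_measure mb)
    finally have "(\<rho> x / 16) ^ ?n * m \<le> measure lborel (Y (x, \<sigma>)) + (\<rho> x / 16) ^ ?n * m / 2"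
      using r m by (simp flip: ennreal_plus add: ennreal_le_iff)
    then show ?thesis by simp
  qed
  show thesis
  proof (rule that[of "C \<times> UNIV" Y])
    show "finite (C \<times> (UNIV :: bool set))"
      by (intro finite_cartesian_product finite_subset[OF C(1) I0(2)] finite)
    show "Y P \<in> sets borel" "emeasure lborel (Y P) < \<infinity>" for P by (fact Yb Yfin)+
    show "Y P \<subseteq> G - H" if "P \<in> C \<times> UNIV" for P
      using that cesub sub by (cases P) (fastforce simp: Y_def)
    show "disjoint_family_on Y (C \<times> UNIV)"
      unfolding disjoint_family_on_def
    proof (intro ballI impI)
      fix P Q assume PQ: "P \<in> C \<times> UNIV" "Q \<in> C \<times> (UNIV :: bool set)" "P \<noteq> Q"
      obtain x \<sigma> y \<tau> where e: "P = (x, \<sigma>)" "Q = (y, \<tau>)" by (cases P, cases Q) auto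
      show "Y P \<inter> Y Q = {}"
      proof (cases "x = y")
        case False
        then have "disjnt (cball x (\<rho> x)) (cball y (\<rho> y))" using C(2) PQ e by (auto simp: pairwise_def)
        then have "ball x (\<rho> x) \<inter> ball y (\<rho> y) = {}"
          unfolding disjnt_def using ball_subset_cball by blast
        moreover have "Y P \<subseteq> ball x (\<rho> x)" "Y Q \<subseteq> ball y (\<rho> y)"
          using cesub PQ e by (auto simp: Y_def simp del: mem_ball)
        ultimately show ?thesis by blast
      next
        case True
        then have st: "\<sigma> \<noteq> \<tau>" using PQ e by auto
        have r: "0 < \<rho> x" using \<rho> CF PQ e by auto
        have d: "dist (ce x \<sigma>) (ce x \<tau>) = \<rho> x"
        proof -
          have "ce x \<sigma> - ce x \<tau> = (sg \<sigma> * \<rho> x / 2 - sg \<tau> * \<rho> x / 2) *\<^sub>R axis j 1"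
            unfolding scaleR_left_diff_distrib by (simp add: ce_def)
          moreover have "\<bar>sg \<sigma> * \<rho> x / 2 - sg \<tau> * \<rho> x / 2\<bar> = \<rho> x"
            using st r by (cases \<sigma>; cases \<tau>) (auto simp: sg_def)
          ultimately show ?thesis by (simp add: dist_norm)
        qed
        have "z \<notin> ball (ce x \<tau>) (\<rho> x / 16)" if "z \<in> ball (ce x \<sigma>) (\<rho> x / 16)" for z
          using dist_triangle[of "ce x \<sigma>" "ce x \<tau>" z] d that r by (auto simp: dist_commute)
        then show ?thesis using True e by (auto simp: Y_def simp del: mem_ball)
      qed
    qed
    fix x assume x: "x \<in> F"
    then obtain i where i: "i \<in> I0" "x \<in> ball i (\<rho> i)" using I0(3) by blast
    with C(3)[OF i(1)] obtain a where a: "a \<in> C" "x \<in> ball a (5 * \<rho> a)"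
      using ball_subset_cball[of i "\<rho> i"] by blast
    have r: "0 < \<rho> a" using \<rho> CF a by blast
    define \<sigma> where "\<sigma> \<longleftrightarrow> x $ j < a $ j"
    have s: "sg \<sigma> = 1 \<or> sg \<sigma> = -1" "sg \<sigma> * (x $ j - a $ j) \<le> 0"
      by (auto simp: sg_def \<sigma>_def)
    obtain d where d: "0 < d" "ball x d \<subseteq> H" using x F o(2) open_contains_ball by blast
    let ?Y = "Y (a, \<sigma>)"
    \<comment> \<open>Y avoids H, and H contains a ball about x; so the singularity of the kernel is
      not met.\<close>
    have bd: "\<bar>rker j (x - y)\<bar> \<le> riesz_const ?n / d ^ ?n" if "y \<in> ?Y" for y
    proof -
      have "y \<notin> ball x d" using that d(2) by (auto simp: Y_def)
      then show ?thesis using d by (intro abs_rker_le) (auto simp: dist_norm)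
    qed
    have int: "integrable lborel (\<lambda>y. indicator ?Y y * (- sg \<sigma> * rker j (x - y)))"
    proof (rule Bochner_Integration.integrable_bound)
      show "integrable lborel (\<lambda>y. riesz_const ?n / d ^ ?n * indicator ?Y y :: real)"
        using Yb[of "(a, \<sigma>)"] Yfin[of "(a, \<sigma>)"] by (intro integrable_mult_right integrable_real_indicator) auto
      show "(\<lambda>y. indicator ?Y y * (- sg \<sigma> * rker j (x - y))) \<in> borel_measurable lborel"
        using Yb[of "(a, \<sigma>)"] by (intro borel_measurable_times borel_measurable_indicator) (auto, measurable)
      show "AE y in lborel. norm (indicator ?Y y * (- sg \<sigma> * rker j (x - y))) \<le> norm (riesz_const ?n / d ^ ?n * indicator ?Y y)"
        using bd s(1) riesz_const_pos[of ?n] d(1) by (auto simp: abs_mult abs_of_pos split: split_indicator)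
    qed
    have "riesz_const ?n * ((\<rho> a / 4) / (6 * \<rho> a) ^ (?n + 1)) * measure lborel ?Y
      \<le> (\<integral>y. indicator ?Y y * (- sg \<sigma> * rker j (x - y)) \<partial>lborel)"
      using a s r int Yb Yfin
      by (intro mult_measure_le_integral_indicator rker_ball_average_ge[of "\<rho> a" "sg \<sigma>" a]) (auto simp: Y_def ce_def)
    moreover have "chain_const TYPE('n) \<le> riesz_const ?n * ((\<rho> a / 4) / (6 * \<rho> a) ^ (?n + 1)) * measure lborel ?Y"
    proof -
      have "chain_const TYPE('n) = riesz_const ?n * ((\<rho> a / 4) / (6 * \<rho> a) ^ (?n + 1)) * ((\<rho> a / 16) ^ ?n * m / 2)"
        using r by (simp add: chain_const_def m_def power_mult_distrib power_divide field_simps)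
      also have "\<dots> \<le> riesz_const ?n * ((\<rho> a / 4) / (6 * \<rho> a) ^ (?n + 1)) * measure lborel ?Y"
        using Ym[OF a(1), of \<sigma>] r riesz_const_pos[of ?n] by (intro mult_left_mono) auto
      finally show ?thesis .
    qed
    moreover have "(\<integral>y. indicator ?Y y * (- sg \<sigma> * rker j (x - y)) \<partial>lborel)
       = - sg \<sigma> * (\<integral>y. indicator ?Y y * rker j (x - y) \<partial>lborel)"
      by (simp add: mult.left_commute)
    ultimately have "chain_const TYPE('n) \<le> \<bar>\<integral>y. indicator ?Y y * rker j (x - y) \<partial>lborel\<bar>"
      using s(1) by auto
    then show "\<exists>P\<in>C \<times> UNIV. chain_const TYPE('n) \<le> \<bar>\<integral>y. indicator (Y P) y * rker j (x - y) \<partial>lborel\<bar>"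
      using a(1) by blast
  qed
qed

lemma weight_of_le_mx:
  assumes "open U" "F \<subseteq> U"
  shows "weight_of w F \<le> (\<integral>\<^sup>+x. epow (mx (indicator U) x) p * ennreal (w x) \<partial>lebesgue)"
  unfolding weight_of_def
proof (rule nn_integral_mono)
  fix x show "ennreal (w x) * indicator F x \<le> epow (mx (indicator U) x) p * ennreal (w x)"
    using assms mx_indicator_eq_1[of U x] by (cases "x \<in> F") auto
qed

text \<open>For every choice of signs the random sum is dominated by the indicator of U, so the
  hypothesis applies with a bound independent of the signs. Averaging over the signs, Khinchine's
  inequality makes the mean of the Riesz transforms at least c/2 on F.\<close>

lemma random_signs_bound:
  fixes w :: "real^'n \<Rightarrow> real" and Y :: "'i \<Rightarrow> (real^'n) set" and F :: "(real^'n) set"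
  assumes w: "weight w" and p: "1 < p" and C: "0 < C"
    and H: "\<And>f :: real^'n \<Rightarrow> complex. integrable lebesgue f \<Longrightarrow>
       weak_Lp_norm p w (maximal_truncation (riesz j) f) \<le> ennreal C * Lp_norm p w (hl_maximal f)"
    and F: "F \<in> sets lebesgue" "F \<subseteq> U" and U: "open U"
    and S: "finite S" and dj: "disjoint_family_on Y S"
    and Y: "\<And>P. P \<in> S \<Longrightarrow> Y P \<in> sets borel" "\<And>P. P \<in> S \<Longrightarrow> Y P \<subseteq> U"
      "\<And>P. P \<in> S \<Longrightarrow> emeasure lborel (Y P) < \<infinity>"
    and dist: "\<And>x. x \<in> F \<Longrightarrow> \<exists>d>0. \<forall>P\<in>S. Y P \<inter> ball x d = {}"
    and low: "\<And>x. x \<in> F \<Longrightarrow> c\<^sup>2 \<le> (\<Sum>P\<in>S. (\<integral>y. indicator (Y P) y * rker j (x - y) \<partial>lborel)\<^sup>2)"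
    and c: "0 \<le> c"
  shows "ennreal c * weight_of w F \<le> ennreal (2 * (1 + 2 / (1 - 2 powr (1 - p)) * C powr p)) *
     (\<integral>\<^sup>+x. epow (mx (indicator U) x) p * ennreal (w x) \<partial>lebesgue)"
proof -
  let ?I = "\<integral>\<^sup>+x. epow (mx (indicator U) x) p * ennreal (w x) \<partial>lebesgue"
  let ?h = "\<lambda>x P. \<integral>y. indicator (Y P) y * rker j (x - y) \<partial>lborel"
  let ?g = "\<lambda>A x. signed_sum S (?h x) A"
  define C2 where "C2 = 1 + 2 / (1 - 2 powr (1 - p)) * C powr p"
  have "2 powr (1 - p) < 2 powr 0" using p by (intro powr_less_mono) auto
  then have q: "0 < 1 - 2 powr (1 - p)" by simp
  have C2: "0 \<le> C2" unfolding C2_def using q by (intro add_nonneg_nonneg mult_nonneg_nonneg divide_nonneg_nonneg) auto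
  have wm: "w \<in> borel_measurable lebesgue" by (rule weight_measurable[OF w])
  have hm: "(\<lambda>x. ?h x P) \<in> borel_measurable borel" if "P \<in> S" for P
  proof -
    have [measurable]: "Y P \<in> sets borel" by (rule Y(1)[OF that])
    show ?thesis by (rule lborel.borel_measurable_lebesgue_integral) measurable
  qed
  have gm: "?g A \<in> borel_measurable lebesgue" for A
  proof -
    have "?g A \<in> borel_measurable borel"
      unfolding signed_sum_def
    proof (rule borel_measurable_sum)
      fix P assume "P \<in> S"
      from hm[OF this] show "(\<lambda>x. if P \<in> A then ?h x P else - ?h x P) \<in> borel_measurable borel"
        by (cases "P \<in> A") auto
    qed
    then show ?thesis by (intro measurable_completion) simp
  qed
  have key: "(\<integral>\<^sup>+x\<in>F. ennreal \<bar>?g A x\<bar> * ennreal (w x) \<partial>lebesgue) \<le> ennreal C2 * ?I" for A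
  proof -
    let ?f = "\<lambda>y. of_real (signed_sum S (\<lambda>P. indicator (Y P) y) A) :: complex"
    have "integrable lborel (\<lambda>y. signed_sum S (\<lambda>P. indicator (Y P) y) A)"
      unfolding signed_sum_def
    proof (rule Bochner_Integration.integrable_sum)
      fix P assume P: "P \<in> S"
      have "integrable lborel (\<lambda>y. indicator (Y P) y :: real)"
        using Y(1,3)[OF P] by (intro integrable_real_indicator) auto
      then show "integrable lborel (\<lambda>y. if P \<in> A then indicator (Y P) y else - indicator (Y P) y :: real)"
        by (cases "P \<in> A") auto
    qed
    then have int: "integrable lborel ?f" by (rule integrable_of_real)
    then have int': "integrable lebesgue ?f"
      by (subst integrable_completion) auto
    have le: "hl_maximal ?f x \<le> mx (indicator U) x" for x
      unfolding hl_maximal_eq_mx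
    proof (rule mx_mono)
      fix y
      have "\<bar>signed_sum S (\<lambda>P. indicator (Y P) y) A\<bar> \<le> indicator (\<Union>P\<in>S. Y P) y"
        by (rule abs_signed_sum_indicator_le[OF S dj])
      also have "\<dots> \<le> indicator U y" using Y(2) by (auto split: split_indicator)
      finally have "ennreal (norm (?f y)) \<le> ennreal (indicator U y)"
        unfolding norm_of_real by (rule ennreal_leI)
      then show "ennreal (norm (?f y)) \<le> indicator U y" unfolding ennreal_indicator .
    qed
    have "(\<integral>\<^sup>+x. epow (hl_maximal ?f x) p * ennreal (w x) \<partial>lebesgue) \<le> ?I"
      using le p by (intro nn_integral_mono mult_right_mono epow_mono) auto
    then have wk: "ennreal (\<alpha> powr p) * weight_of w {x. maximal_truncation (riesz j) ?f x > ennreal \<alpha>} \<le> ennreal (C powr p) * ?I"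
      if "0 < \<alpha>" for \<alpha>
      using H[OF int'] that C p by (subst (asm) weak_Lp_norm_le_iff) (auto elim!: order_trans intro!: mult_left_mono dest!: spec[of _ \<alpha>])
    have "(\<integral>\<^sup>+x\<in>F. ennreal \<bar>?g A x\<bar> * ennreal (w x) \<partial>lebesgue)
      \<le> weight_of w F + ennreal (2 / (1 - 2 powr (1 - p))) * (ennreal (C powr p) * ?I)"
    proof (rule nn_integral_weak_type_le[OF w F(1) _ p])
      show "(\<lambda>x. \<bar>?g A x\<bar>) \<in> borel_measurable lebesgue" using gm by measurable
      fix k :: nat
      have sub: "F \<inter> {x. \<bar>?g A x\<bar> > 2 ^ k} \<subseteq> {x. maximal_truncation (riesz j) ?f x > ennreal (2 ^ k)}"
      proof safe
        fix x assume x: "x \<in> F" "\<bar>?g A x\<bar> > 2 ^ k"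
        obtain d where "0 < d" "\<forall>P\<in>S. Y P \<inter> ball x d = {}" using dist x by blast
        then have "ennreal \<bar>?g A x\<bar> \<le> maximal_truncation (riesz j) ?f x"
          using Y by (intro riesz_signed_sum_le[OF S]) auto
        moreover have "ennreal (2 ^ k) < ennreal \<bar>?g A x\<bar>" using x by (intro ennreal_lessI) auto
        ultimately show "ennreal (2 ^ k) < maximal_truncation (riesz j) ?f x" by (rule less_le_trans[rotated])
      qed
      have "ennreal ((2 ^ k) powr p) * weight_of w (F \<inter> {x. \<bar>?g A x\<bar> > 2 ^ k})
        \<le> ennreal ((2 ^ k) powr p) * weight_of w {x. maximal_truncation (riesz j) ?f x > ennreal (2 ^ k)}"
        by (intro mult_left_mono weight_of_mono sub) simp
      also have "\<dots> \<le> ennreal (C powr p) * ?I" by (rule wk) simp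
      finally show "ennreal ((2 ^ k) powr p) * weight_of w (F \<inter> {x. \<bar>?g A x\<bar> > 2 ^ k}) \<le> ennreal (C powr p) * ?I" .
    qed
    \<comment> \<open>The term \<open>weight_of w F\<close> is absorbed because the maximal function
      of the indicator equals 1 on the open set U.\<close>
    also have "\<dots> \<le> 1 * ?I + ennreal (2 / (1 - 2 powr (1 - p)) * C powr p) * ?I"
      using weight_of_le_mx[OF U F(2), of w p] q by (intro add_mono) (simp_all add: ennreal_mult_left_assoc)
    also have "\<dots> = ennreal C2 * ?I"
      unfolding C2_def using q by (subst ennreal_plus) (auto simp: distrib_right)
    finally show ?thesis .
  qed
  have pt: "2 ^ card S * c \<le> (\<Sum>A\<in>Pow S. 2 * \<bar>?g A x\<bar>)" if "x \<in> F" for x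
  proof -
    have "c \<le> sqrt (\<Sum>P\<in>S. (?h x P)\<^sup>2)" using low[OF that] c by (intro real_le_rsqrt)
    then have "2 ^ card S * c \<le> 2 ^ card S * sqrt (\<Sum>P\<in>S. (?h x P)\<^sup>2)" by simp
    also have "\<dots> \<le> 2 * (\<Sum>A\<in>Pow S. \<bar>?g A x\<bar>)" by (rule khinchine_lower[OF S])
    finally show ?thesis by (simp add: sum_distrib_left)
  qed
  have "ennreal (2 ^ card S) * (ennreal c * weight_of w F) = (\<integral>\<^sup>+x. ennreal (2 ^ card S * c) * (ennreal (w x) * indicator F x) \<partial>lebesgue)"
    unfolding weight_of_def using wm F c by (subst nn_integral_cmult) (auto simp: ennreal_mult mult.assoc)
  also have "\<dots> \<le> (\<integral>\<^sup>+x. (\<Sum>A\<in>Pow S. 2 * (ennreal \<bar>?g A x\<bar> * ennreal (w x) * indicator F x)) \<partial>lebesgue)"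
  proof (rule nn_integral_mono)
    fix x
    show "ennreal (2 ^ card S * c) * (ennreal (w x) * indicator F x)
      \<le> (\<Sum>A\<in>Pow S. 2 * (ennreal \<bar>?g A x\<bar> * ennreal (w x) * indicator F x))"
    proof (cases "x \<in> F")
      case True
      have "ennreal (2 ^ card S * c) * (ennreal (w x) * indicator F x) \<le> ennreal (\<Sum>A\<in>Pow S. 2 * \<bar>?g A x\<bar>) * (ennreal (w x) * indicator F x)"
        by (intro mult_right_mono ennreal_leI pt True) simp
      also have "ennreal (\<Sum>A\<in>Pow S. 2 * \<bar>?g A x\<bar>) = (\<Sum>A\<in>Pow S. 2 * ennreal \<bar>?g A x\<bar>)"
        by (subst sum_ennreal[symmetric]) (auto simp: ennreal_mult)
      finally show ?thesis by (simp add: sum_distrib_right mult.assoc)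
    qed simp
  qed
  also have "\<dots> = (\<Sum>A\<in>Pow S. 2 * (\<integral>\<^sup>+x\<in>F. ennreal \<bar>?g A x\<bar> * ennreal (w x) \<partial>lebesgue))"
  proof -
    have m: "(\<lambda>x. ennreal \<bar>?g A x\<bar> * ennreal (w x) * indicator F x) \<in> borel_measurable lebesgue" for A
      using gm[of A] wm F(1) by measurable
    show ?thesis using m by (subst nn_integral_sum) (auto simp: nn_integral_cmult)
  qed
  also have "\<dots> \<le> (\<Sum>A\<in>Pow S. 2 * (ennreal C2 * ?I))"
    by (intro sum_mono mult_left_mono key) simp
  also have "\<dots> = ennreal (2 ^ card S) * (ennreal (2 * C2) * ?I)"
    using S C2 by (simp add: card_Pow ennreal_mult mult.assoc flip: ennreal_power)
  finally show ?thesis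
    unfolding C2_def[symmetric] by (subst (asm) ennreal_mult_le_mult_iff) auto
qed

text \<open>Each gap between consecutive members of the chain carries one generation of sets, and
  each generation adds at least the square of \<open>chain_const\<close> to the square sum at every
  point of F. Different gaps are disjoint, so all generations fit into one random sum. Compact F
  come first because a generation is built from a finite cover.\<close>

lemma riesz_chain_bound:
  fixes w :: "real^'n \<Rightarrow> real" and j :: 'n and G :: "nat \<Rightarrow> (real^'n) set"
  assumes w: "weight w" and p: "1 < p" and C: "0 < C"
    and H: "\<And>f :: real^'n \<Rightarrow> complex. integrable lebesgue f \<Longrightarrow>
       weak_Lp_norm p w (maximal_truncation (riesz j) f) \<le> ennreal C * Lp_norm p w (hl_maximal f)"
    and G: "\<And>k. k \<le> L \<Longrightarrow> open (G k)" "\<And>k. k < L \<Longrightarrow> G k \<subseteq> G (Suc k)" "G L \<subseteq> U"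
    and U: "open U" "emeasure lebesgue U < \<infinity>"
    and sparse: "\<And>k z a r. k < L \<Longrightarrow> z \<notin> G (Suc k) \<Longrightarrow> z \<in> ball a r \<Longrightarrow>
      emeasure lebesgue (G k \<inter> ball a r) \<le> ennreal (1 / (2 * 32 ^ CARD('n))) * emeasure lebesgue (ball a r)"
  shows "ennreal (sqrt L * chain_const TYPE('n)) * weight_of w (G 0)
    \<le> ennreal (2 * (1 + 2 / (1 - 2 powr (1 - p)) * C powr p)) *
     (\<integral>\<^sup>+x. epow (mx (indicator U) x) p * ennreal (w x) \<partial>lebesgue)"
proof -
  let ?D = "ennreal (2 * (1 + 2 / (1 - 2 powr (1 - p)) * C powr p)) *
     (\<integral>\<^sup>+x. epow (mx (indicator U) x) p * ennreal (w x) \<partial>lebesgue)"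
  have mono: "G k \<subseteq> G m" if "k \<le> m" "m \<le> L" for k m
    using that by (induction m rule: dec_induct) (use G(2) in \<open>auto simp: Suc_le_eq\<close>)
  have sub: "G k \<subseteq> U" if "k \<le> L" for k using mono[OF that order_refl] G(3) by blast
  have cmp: "ennreal (sqrt L * chain_const TYPE('n)) * weight_of w F \<le> ?D" if F: "compact F" "F \<subseteq> G 0" for F
  proof -
    define Q where "Q k I Y \<longleftrightarrow> finite (I :: ((real^'n) \<times> bool) set) \<and> disjoint_family_on Y I \<and>
      (\<forall>P\<in>I. Y P \<in> sets borel \<and> Y P \<subseteq> G (Suc k) - G k \<and> emeasure lborel (Y P) < \<infinity>) \<and>
      (\<forall>x\<in>F. \<exists>P\<in>I. chain_const TYPE('n) \<le> \<bar>\<integral>y. indicator (Y P) y * rker j (x - y) \<partial>lborel\<bar>)" for k I Y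
    have "\<exists>IY. Q k (fst IY) (snd IY)" if k: "k \<in> {..<L}" for k
    proof -
      have kL: "k < L" "k \<le> L" "Suc k \<le> L" using k by auto
      have FG: "F \<subseteq> G k" "F \<subseteq> G (Suc k)" using F(2) mono[of 0 k] mono[of 0 "Suc k"] kL by auto
      have fin: "emeasure lebesgue (G (Suc k)) < \<infinity>"
        using sub[OF kL(3)] U by (intro le_less_trans[OF emeasure_mono U(2)]) auto
      have sp: "emeasure lebesgue (G k \<inter> ball a r) \<le> ennreal (1 / (2 * 32 ^ CARD('n))) * emeasure lebesgue (ball a r)"
        if "z \<notin> G (Suc k)" "z \<in> ball a r" for z a r
        by (rule sparse[OF kL(1) that])
      show ?thesis
      proof (rule sparse_generation[OF F(1) FG G(1)[OF kL(3)] G(1)[OF kL(2)] fin sp, where j = j])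
        fix I :: "((real^'n) \<times> bool) set" and Y
        assume "finite I" "disjoint_family_on Y I" "\<And>P. P \<in> I \<Longrightarrow> Y P \<in> sets borel"
          "\<And>P. P \<in> I \<Longrightarrow> Y P \<subseteq> G (Suc k) - G k" "\<And>P. P \<in> I \<Longrightarrow> emeasure lborel (Y P) < \<infinity>"
          "\<And>x. x \<in> F \<Longrightarrow> \<exists>P\<in>I. chain_const TYPE('n) \<le> \<bar>\<integral>y. indicator (Y P) y * rker j (x - y) \<partial>lborel\<bar>"
        then have "Q k (fst (I, Y)) (snd (I, Y))" unfolding Q_def by auto
        then show ?thesis by (rule exI)
      qed
    qed
    then have "\<forall>k\<in>{..<L}. \<exists>IY. Q k (fst IY) (snd IY)" by blast
    then obtain IY where IY: "\<forall>k\<in>{..<L}. Q k (fst (IY k)) (snd (IY k))"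
      by (rule bchoice[THEN exE])
    define I where "I k = fst (IY k)" for k
    define Y where "Y k = snd (IY k)" for k
    have IY: "\<And>k. k \<in> {..<L} \<Longrightarrow> finite (I k :: ((real^'n) \<times> bool) set) \<and> disjoint_family_on (Y k) (I k) \<and>
      (\<forall>P\<in>I k. Y k P \<in> sets borel \<and> Y k P \<subseteq> G (Suc k) - G k \<and> emeasure lborel (Y k P) < \<infinity>) \<and>
      (\<forall>x\<in>F. \<exists>P\<in>I k. chain_const TYPE('n) \<le> \<bar>\<integral>y. indicator (Y k P) y * rker j (x - y) \<partial>lborel\<bar>)"
      using IY unfolding I_def Y_def Q_def by blast
    have Ysub: "Y k P \<subseteq> G (Suc k) - G k" and Yset: "Y k P \<in> sets borel" and Yfin: "emeasure lborel (Y k P) < \<infinity>"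
      if "k < L" "P \<in> I k" for k P
      using IY[of k] that by blast+
    define S where "S = (SIGMA k:{..<L}. I k)"
    define Z where "Z = (\<lambda>(k, P). Y k P)"
    have a1: "F \<in> sets lebesgue" using F(1) by (simp add: compact_imp_closed)
    have a2: "F \<subseteq> U" using F(2) sub[of 0] by blast
    have a3: "open U" by fact
    have a4: "finite S" unfolding S_def using IY by (intro finite_SigmaI) auto
    have a5: "disjoint_family_on Z S"
        unfolding disjoint_family_on_def
      proof (intro ballI impI)
        fix a b assume ab: "a \<in> S" "b \<in> S" "a \<noteq> b"
        obtain k P l Q where e: "a = (k, P)" "b = (l, Q)" by (cases a, cases b) auto
        have kl: "k < L" "l < L" "P \<in> I k" "Q \<in> I l" using ab e by (auto simp: S_def)
        have Yk: "Y k P \<subseteq> G (Suc k) - G k" "Y l Q \<subseteq> G (Suc l) - G l" using Ysub kl by auto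
        consider "k = l" | "k < l" | "l < k" by linarith
        then show "Z a \<inter> Z b = {}"
        proof cases
          case 1
          then show ?thesis using IY[of k] kl ab e by (auto simp: Z_def disjoint_family_on_def)
        next
          case 2
          then have "G (Suc k) \<subseteq> G l" using kl by (intro mono) auto
          then show ?thesis using Yk e by (auto simp: Z_def)
        next
          case 3
          then have "G (Suc l) \<subseteq> G k" using kl by (intro mono) auto
          then show ?thesis using Yk e by (auto simp: Z_def)
        qed
      qed
      have ZP: "Z P \<in> sets borel \<and> Z P \<subseteq> U \<and> emeasure lborel (Z P) < \<infinity>" if "P \<in> S" for P
      proof -
        obtain k Q where e: "P = (k, Q)" by (cases P)
        have k: "k < L" "Q \<in> I k" using that e by (auto simp: S_def)
        then have "G (Suc k) \<subseteq> U" by (intro sub) simp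
        then show ?thesis using Ysub[OF k] Yset[OF k] Yfin[OF k] by (auto simp: Z_def e)
      qed
    have a6: "Z P \<in> sets borel" if "P \<in> S" for P by (rule ZP[OF that, THEN conjunct1])
    have a7: "Z P \<subseteq> U" if "P \<in> S" for P by (rule ZP[OF that, THEN conjunct2, THEN conjunct1])
    have a8: "emeasure lborel (Z P) < \<infinity>" if "P \<in> S" for P by (rule ZP[OF that, THEN conjunct2, THEN conjunct2])
    have a9: "\<exists>d>0. \<forall>P\<in>S. Z P \<inter> ball x d = {}" if "x \<in> F" for x
      proof -
        have "x \<in> G 0" using that F(2) by blast
        then obtain d where d: "0 < d" "ball x d \<subseteq> G 0" using openE[OF G(1)[of 0]] by blast
        have "Z P \<inter> ball x d = {}" if "P \<in> S" for P
        proof -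
          obtain k Q where e: "P = (k, Q)" by (cases P)
          have "k < L" "Q \<in> I k" using that e by (auto simp: S_def)
          then have "Y k Q \<subseteq> G (Suc k) - G k" "G 0 \<subseteq> G k" using Ysub mono[of 0 k] by auto
          then show ?thesis using d e by (auto simp: Z_def)
        qed
        then show ?thesis using d by blast
      qed
    have a11: "0 \<le> sqrt L * chain_const TYPE('n)" using chain_const_pos[where 'n = 'n] by simp
    have a10: "(sqrt L * chain_const TYPE('n))\<^sup>2 \<le> (\<Sum>P\<in>S. (\<integral>y. indicator (Z P) y * rker j (x - y) \<partial>lborel)\<^sup>2)"
        if x: "x \<in> F" for x
      proof -
        let ?h = "\<lambda>k P. \<integral>y. indicator (Y k P) y * rker j (x - y) \<partial>lborel"
        have "(sqrt L * chain_const TYPE('n))\<^sup>2 = (\<Sum>k<L. (chain_const TYPE('n))\<^sup>2)"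
          by (simp add: power_mult_distrib)
        also have "\<dots> \<le> (\<Sum>k<L. \<Sum>P\<in>I k. (?h k P)\<^sup>2)"
        proof (rule sum_mono)
          fix k assume k: "k \<in> {..<L}"
          then obtain P where P: "P \<in> I k" "chain_const TYPE('n) \<le> \<bar>?h k P\<bar>" using IY x by blast
          have "(chain_const TYPE('n))\<^sup>2 \<le> (?h k P)\<^sup>2"
            using P(2) chain_const_pos[where 'n = 'n] by (subst abs_le_square_iff[symmetric]) simp
          also have "\<dots> \<le> (\<Sum>P\<in>I k. (?h k P)\<^sup>2)"
            using IY[OF k] P(1) by (intro member_le_sum) auto
          finally show "(chain_const TYPE('n))\<^sup>2 \<le> (\<Sum>P\<in>I k. (?h k P)\<^sup>2)" .
        qed
        also have "\<dots> = (\<Sum>(k, P)\<in>S. (?h k P)\<^sup>2)"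
          unfolding S_def using IY by (intro sum.Sigma) auto
        finally show ?thesis by (simp add: Z_def case_prod_unfold)
      qed
    show ?thesis
      by (rule random_signs_bound[OF w p C H a1 a2 a3 a4 a5 a6 a7 a8 a9 a10 a11])
  qed
  \<comment> \<open>\<open>G 0\<close> is exhausted by compact sets; the bound does not depend on
    them.\<close>
  obtain K where K: "\<And>n. compact (K n)" "\<And>n. K n \<subseteq> G 0" "\<And>n. K n \<subseteq> interior (K (Suc n))" "\<Union>(range K) = G 0"
    using open_Union_compact_subsets[OF G(1)[of 0]] by (metis le0)
  have Ks: "K n \<in> sets lebesgue" for n using K(1) by (simp add: compact_imp_closed)
  have inc: "incseq K" using K(3) interior_subset by (intro incseq_SucI) blast
  have "weight_of w (G 0) = (SUP n. weight_of w (K n))"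
  proof -
    have "range K \<subseteq> sets (density lebesgue (\<lambda>x. ennreal (w x)))" using Ks by auto
    from SUP_emeasure_incseq[OF this inc] show ?thesis
      using Ks K(4) G(1)[of 0] by (simp add: weight_of_eq_emeasure[OF w])
  qed
  then have "ennreal (sqrt L * chain_const TYPE('n)) * weight_of w (G 0) = (SUP n. ennreal (sqrt L * chain_const TYPE('n)) * weight_of w (K n))"
    by (simp add: SUP_mult_left_ennreal)
  also have "\<dots> \<le> ?D" by (intro SUP_least cmp K)
  finally show ?thesis .
qed

section \<open>Decay of the integral of the p-th power of the maximal function of an
  indicator\<close>

lemma set_nn_integral_indicator:
  "A \<in> sets lebesgue \<Longrightarrow> B \<in> sets lebesgue \<Longrightarrow>
    (\<integral>\<^sup>+x\<in>B. indicator A x \<partial>lebesgue) = emeasure lebesgue (A \<inter> B)"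
  by (simp add: indicator_inter_arith[symmetric])

text \<open>About each y in E there is a radius at which the density of E exceeds \<eta> although on
  the five-fold ball it does not. The first property puts the ball into U, the second bounds E in
  the five-fold ball, and Vitali's lemma trades E for \<open>5 ^ n * \<eta>\<close> times U. The
  search stops before radius 2 \<rho>, since a larger ball would contain x, which lies outside
  U.\<close>

lemma emeasure_Int_ball_le_off_superset:
  fixes E U :: "(real^'n) set"
  assumes E: "open E" and U: "open U" and \<eta>: "0 < \<eta>" "\<eta> < 1" and lev: "lev (indicator E) \<eta> \<subseteq> U"
    and x: "x \<notin> U" "x \<in> ball a \<rho>"
  shows "emeasure lebesgue (E \<inter> ball a \<rho>) \<le> ennreal (5 ^ CARD('n) * \<eta>) * emeasure lebesgue (U \<inter> ball a (3 * \<rho>))"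
proof -
  have Es: "E \<in> sets lebesgue" using E by simp
  have \<rho>: "0 < \<rho>" using x(2) by (meson le_less_trans mem_ball zero_le_dist)
  define T where "T y r \<longleftrightarrow> ennreal \<eta> * emeasure lebesgue (ball y r) < emeasure lebesgue (E \<inter> ball y r)" for y r
  define K where "K = {(y, r). y \<in> E \<inter> ball a \<rho> \<and> 0 < r \<and> r \<le> 2 * \<rho> \<and> T y r \<and> \<not> T y (5 * r)}"
  have TU: "ball y r \<subseteq> U" if "T y r" for y r
  proof
    fix z assume "z \<in> ball y r"
    then have "z \<in> lev (indicator E) \<eta>"
      using that unfolding T_def by (intro levI[of z y r]) (simp_all add: set_nn_integral_indicator Es)
    then show "z \<in> U" using lev by blast
  qed
  have Tr: "r < 2 * \<rho>" if "T y r" "y \<in> ball a \<rho>" for y r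
  proof (rule ccontr)
    assume "\<not> r < 2 * \<rho>"
    moreover have "dist y x < 2 * \<rho>" using dist_triangle[of y x a] that(2) x(2) by (simp add: dist_commute)
    ultimately have "x \<in> ball y r" by simp
    then show False using TU[OF that(1)] x(1) by blast
  qed
  have cov: "E \<inter> ball a \<rho> \<subseteq> (\<Union>(y, r)\<in>K. ball y r)"
  proof
    fix y assume y: "y \<in> E \<inter> ball a \<rho>"
    then obtain r0 where r0: "0 < r0" "ball y r0 \<subseteq> E" using openE[OF E] by blast
    have "ennreal \<eta> * emeasure lebesgue (ball y r0) < 1 * emeasure lebesgue (ball y r0)"
      using \<eta> r0(1) by (intro ennreal_mult_strict_right_mono emeasure_ball_pos) (use emeasure_ball_finite(1)[of y r0] in \<open>auto simp: ennreal_less_iff\<close>)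
    moreover have "E \<inter> ball y r0 = ball y r0" using r0 by blast
    ultimately have T0: "T y r0" unfolding T_def by simp
    have "\<exists>k. T y (r0 * 5 ^ k) \<and> \<not> T y (r0 * 5 ^ Suc k)"
    proof (rule ccontr)
      assume a: "\<not> ?thesis"
      have all: "T y (r0 * 5 ^ k)" for k by (induction k) (use a T0 in auto)
      obtain k where "2 * \<rho> / r0 < 5 ^ k" using real_arch_pow[of 5 "2 * \<rho> / r0"] by auto
      then have "2 * \<rho> < r0 * 5 ^ k" using r0(1) by (simp add: field_simps)
      then show False using Tr[OF all[of k]] y by auto
    qed
    then obtain k where k: "T y (r0 * 5 ^ k)" "\<not> T y (r0 * 5 ^ Suc k)" by blast
    have "(y, r0 * 5 ^ k) \<in> K"
      unfolding K_def using k y r0(1) Tr[OF k(1)] by (auto simp: mult_ac intro: less_imp_le)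
    moreover have "y \<in> ball y (r0 * 5 ^ k)" using r0(1) by simp
    ultimately show "y \<in> (\<Union>(y, r)\<in>K. ball y r)" by blast
  qed
  have "emeasure lebesgue (E \<inter> ball a \<rho>) \<le> ennreal (5 ^ CARD('n) * \<eta>) * emeasure lebesgue (\<Union>(y, r)\<in>K. ball y r)"
  proof (rule Vitali_measure_le[OF _ cov])
    show "0 < r \<and> r \<le> 2 * \<rho>" if "(y, r) \<in> K" for y r using that by (simp add: K_def)
    fix y r assume yr: "(y, r) \<in> K"
    have "emeasure lebesgue (E \<inter> ball a \<rho> \<inter> ball y (5 * r)) \<le> emeasure lebesgue (E \<inter> ball y (5 * r))"
      using Es by (intro emeasure_mono) auto
    also have "\<dots> \<le> ennreal \<eta> * emeasure lebesgue (ball y (5 * r))"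
      using yr by (auto simp: K_def T_def not_less)
    also have "\<dots> = ennreal \<eta> * (ennreal (5 ^ CARD('n)) * emeasure lebesgue (ball y r))"
      using yr by (subst emeasure_ball_scale[of _ _ _ y]) (auto simp: K_def)
    also have "\<dots> = ennreal (5 ^ CARD('n) * \<eta>) * emeasure lebesgue (ball y r)"
      using \<eta> by (subst ennreal_mult_left_assoc) (auto simp: mult.commute[of \<eta>])
    finally show "emeasure lebesgue (E \<inter> ball a \<rho> \<inter> ball y (5 * r)) \<le> ennreal (5 ^ CARD('n) * \<eta>) * emeasure lebesgue (ball y r)" .
  qed (use Es in auto)
  also have "\<dots> \<le> ennreal (5 ^ CARD('n) * \<eta>) * emeasure lebesgue (U \<inter> ball a (3 * \<rho>))"
  proof (intro mult_left_mono emeasure_mono)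
    show "(\<Union>(y, r)\<in>K. ball y r) \<subseteq> U \<inter> ball a (3 * \<rho>)"
    proof clarify
      fix z y r assume yr: "(y, r) \<in> K" "z \<in> ball y r"
      have "z \<in> U" using TU[of y r] yr by (auto simp: K_def)
      moreover have "dist a z < 3 * \<rho>" using dist_triangle[of a z y] yr by (auto simp: K_def)
      ultimately show "z \<in> U \<inter> ball a (3 * \<rho>)" by simp
    qed
    show "U \<inter> ball a (3 * \<rho>) \<in> sets lebesgue" using U by auto
  qed simp
  finally show ?thesis .
qed

text \<open>Off U, passing from E to U gains a full factor \<eta>. The preceding estimate is applied
  to balls through x; \<open>15 ^ n\<close> combines its \<open>5 ^ n\<close> with the passage to
  the triple ball, and \<open>b\<^sup>2\<close> pays for going from cubes to balls and back.\<close>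

lemma mx_indicator_le_off_superset:
  obtains c where "0 < c" "\<And>E U \<eta> (x :: real^'n). open E \<Longrightarrow> open U \<Longrightarrow> 0 < \<eta> \<Longrightarrow> \<eta> < 1 \<Longrightarrow>
    lev (indicator E) \<eta> \<subseteq> U \<Longrightarrow> x \<notin> U \<Longrightarrow> mx (indicator E) x \<le> ennreal (c * \<eta>) * mx (indicator U) x"
proof -
  obtain b :: real where b: "0 < b"
    "\<And>(v :: real^'n \<Rightarrow> ennreal) t x. 0 \<le> t \<Longrightarrow> x \<in> lev v t \<Longrightarrow> ennreal (b * t) < mx v x"
    "\<And>(v :: real^'n \<Rightarrow> ennreal) t x. 0 \<le> t \<Longrightarrow> ennreal t < mx v x \<Longrightarrow> x \<in> lev v (b * t)"
    by (rule mx_lev_equiv) blast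
  show thesis
  proof (rule that[of "15 ^ CARD('n) / b\<^sup>2"])
    show "0 < 15 ^ CARD('n) / b\<^sup>2" using b by simp
    fix E U \<eta> and x :: "real^'n"
    assume A: "open E" "open U" "0 < \<eta>" "\<eta> < 1" "lev (indicator E) \<eta> \<subseteq> U" "x \<notin> U"
    show "mx (indicator E) x \<le> ennreal (15 ^ CARD('n) / b\<^sup>2 * \<eta>) * mx (indicator U) x"
    proof (rule dense_le)
      fix tt assume tt: "tt < mx (indicator E) x"
      then have "tt < \<infinity>" using less_le_trans[OF tt mx_indicator_le_1] by (auto simp: less_top[symmetric] elim: less_trans)
      then obtain t where t: "0 \<le> t" "tt = ennreal t" by (cases tt) auto
      have "x \<in> lev (indicator E) (b * t)" using tt t b by auto
      then obtain a r where ar: "0 < r" "x \<in> ball a r" "ennreal (b * t) * emeasure lebesgue (ball a r) < (\<integral>\<^sup>+x\<in>ball a r. indicator E x \<partial>lebesgue)"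
        by (auto elim: levE)
      have Es: "E \<in> sets lebesgue" "U \<in> sets lebesgue" using A by auto
      have "ennreal (b * t) * emeasure lebesgue (ball a r) < emeasure lebesgue (E \<inter> ball a r)"
        using ar(3) Es by (simp add: set_nn_integral_indicator)
      also have "\<dots> \<le> ennreal (5 ^ CARD('n) * \<eta>) * emeasure lebesgue (U \<inter> ball a (3 * r))"
        by (rule emeasure_Int_ball_le_off_superset[OF A ar(2)])
      finally have 1: "ennreal (b * t) * emeasure lebesgue (ball a r) < ennreal (5 ^ CARD('n) * \<eta>) * emeasure lebesgue (U \<inter> ball a (3 * r))" .
      have x3: "x \<in> ball a (3 * r)" using ar by auto
      have 15: "(15::real) ^ CARD('n) = 5 ^ CARD('n) * 3 ^ CARD('n)" by (simp flip: power_mult_distrib)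
      have "x \<in> lev (indicator U) (b * t / (15 ^ CARD('n) * \<eta>))"
      proof (rule ccontr)
        assume "x \<notin> lev (indicator U) (b * t / (15 ^ CARD('n) * \<eta>))"
        from not_levD[OF this x3]
        have "emeasure lebesgue (U \<inter> ball a (3 * r)) \<le> ennreal (b * t / (15 ^ CARD('n) * \<eta>)) * emeasure lebesgue (ball a (3 * r))"
          using Es by (simp add: set_nn_integral_indicator)
        also have "\<dots> = ennreal (b * t / (15 ^ CARD('n) * \<eta>)) * (ennreal (3 ^ CARD('n)) * emeasure lebesgue (ball a r))"
          using ar(1) by (subst emeasure_ball_scale[of _ _ _ a]) auto
        also have "\<dots> = ennreal (b * t / (15 ^ CARD('n) * \<eta>) * 3 ^ CARD('n)) * emeasure lebesgue (ball a r)"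
          using b t A by (intro ennreal_mult_left_assoc) auto
        also have "b * t / (15 ^ CARD('n) * \<eta>) * 3 ^ CARD('n) = b * t / (5 ^ CARD('n) * \<eta>)"
          by (simp add: 15)
        finally have "ennreal (5 ^ CARD('n) * \<eta>) * emeasure lebesgue (U \<inter> ball a (3 * r))
          \<le> ennreal (5 ^ CARD('n) * \<eta>) * (ennreal (b * t / (5 ^ CARD('n) * \<eta>)) * emeasure lebesgue (ball a r))"
          by (rule mult_left_mono) simp
        also have "\<dots> = ennreal (5 ^ CARD('n) * \<eta> * (b * t / (5 ^ CARD('n) * \<eta>))) * emeasure lebesgue (ball a r)"
          using A by (intro ennreal_mult_left_assoc) auto
        also have "5 ^ CARD('n) * \<eta> * (b * t / (5 ^ CARD('n) * \<eta>)) = b * t" using A by simp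
        finally show False using 1 by simp
      qed
      then have 2: "ennreal (b * (b * t / (15 ^ CARD('n) * \<eta>))) < mx (indicator U) x"
        using b t A by (intro b(2)) auto
      have "tt = ennreal (15 ^ CARD('n) / b\<^sup>2 * \<eta> * (b * (b * t / (15 ^ CARD('n) * \<eta>))))"
        using b(1) A by (simp add: t power2_eq_square field_simps)
      also have "\<dots> = ennreal (15 ^ CARD('n) / b\<^sup>2 * \<eta>) * ennreal (b * (b * t / (15 ^ CARD('n) * \<eta>)))"
        using b(1) A t by (intro ennreal_mult) auto
      also have "\<dots> \<le> ennreal (15 ^ CARD('n) / b\<^sup>2 * \<eta>) * mx (indicator U) x"
        using 2 by (intro mult_left_mono) auto
      finally show "tt \<le> ennreal (15 ^ CARD('n) / b\<^sup>2 * \<eta>) * mx (indicator U) x" .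
    qed
  qed
qed

text \<open>Three shares of \<epsilon>/3: points off U, where M of E is small against M of U; points
  of U where M of E is at most e, while M of U is 1; and a level set of M of E, whose weight is
  small because it starts a chain of L level sets that ends in U.\<close>

lemma mx_integral_decay:
  fixes w :: "real^'n \<Rightarrow> real" and j :: 'n
  assumes w: "weight w" and p: "1 < p" and C: "0 < C"
    and H: "\<And>f :: real^'n \<Rightarrow> complex. integrable lebesgue f \<Longrightarrow>
       weak_Lp_norm p w (maximal_truncation (riesz j) f) \<le> ennreal C * Lp_norm p w (hl_maximal f)"
    and \<epsilon>: "0 < \<epsilon>"
  obtains \<eta> where "0 < \<eta>" "\<And>E U. open E \<Longrightarrow> open U \<Longrightarrow> emeasure lebesgue U < \<infinity> \<Longrightarrow> lev (indicator E) \<eta> \<subseteq> U \<Longrightarrow>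
    (\<integral>\<^sup>+x. epow (mx (indicator E) x) p * ennreal (w x) \<partial>lebesgue)
      \<le> ennreal \<epsilon> * (\<integral>\<^sup>+x. epow (mx (indicator U) x) p * ennreal (w x) \<partial>lebesgue)"
proof -
  obtain b :: real where b: "0 < b"
    "\<And>(v :: real^'n \<Rightarrow> ennreal) t x. 0 \<le> t \<Longrightarrow> x \<in> lev v t \<Longrightarrow> ennreal (b * t) < mx v x"
    "\<And>(v :: real^'n \<Rightarrow> ennreal) t x. 0 \<le> t \<Longrightarrow> ennreal t < mx v x \<Longrightarrow> x \<in> lev v (b * t)"
    by (rule mx_lev_equiv) blast
  obtain c1 where c1: "0 < c1" "\<And>E U \<eta> (x :: real^'n). open E \<Longrightarrow> open U \<Longrightarrow> 0 < \<eta> \<Longrightarrow> \<eta> < 1 \<Longrightarrow>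
    lev (indicator E) \<eta> \<subseteq> U \<Longrightarrow> x \<notin> U \<Longrightarrow> mx (indicator E) x \<le> ennreal (c1 * \<eta>) * mx (indicator U) x"
    by (rule mx_indicator_le_off_superset) blast
  let ?n = "CARD('n)"
  define D where "D = 2 * (1 + 2 / (1 - 2 powr (1 - p)) * C powr p)"
  have "2 powr (1 - p) < 2 powr 0" using p by (intro powr_less_mono) auto
  then have D: "0 < D" unfolding D_def by (auto intro!: add_pos_nonneg)
  have cc: "0 < chain_const TYPE('n)" by (rule chain_const_pos)
  \<comment> \<open>The value e is the one whose p-th power is \<epsilon>/3.\<close>
  define e where "e = (\<epsilon> / 3) powr (1 / p)"
  have e: "0 < e" "e powr p = \<epsilon> / 3" using \<epsilon> p by (simp_all add: e_def powr_powr)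
  define t where "t = b * e"
  have t: "0 < t" "t / b = e" using b e by (simp_all add: t_def)
  \<comment> \<open>The gain \<open>sqrt L\<close> of the chain has to outweigh the constant D of
    the chain bound.\<close>
  obtain L :: nat where L: "(D / (chain_const TYPE('n) * (\<epsilon> / 3)))\<^sup>2 < real L"
    using reals_Archimedean2 by blast
  have L0: "0 < sqrt (real L)" using L by (smt (verit) real_sqrt_gt_zero zero_le_power2)
  have "D / (chain_const TYPE('n) * (\<epsilon> / 3)) \<le> sqrt (real L)"
    using L by (intro real_le_rsqrt) auto
  then have L1: "D / (sqrt (real L) * chain_const TYPE('n)) \<le> \<epsilon> / 3"
    using L0 cc \<epsilon> D by (simp add: field_simps)
  \<comment> \<open>The ratio of consecutive levels: \<open>15 ^ n * \<kappa>\<close> is exactly the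
    sparseness that \<open>riesz_chain_bound\<close> asks for.\<close>
  define \<kappa> :: real where "\<kappa> = 1 / (15 ^ ?n * (2 * 32 ^ ?n))"
  have \<kappa>: "0 < \<kappa>" "\<kappa> < 1" "15 ^ ?n * \<kappa> = 1 / (2 * 32 ^ ?n)" "3 ^ ?n * \<kappa> \<le> 1"
  proof -
    show "0 < \<kappa>" by (simp add: \<kappa>_def)
    show 15: "15 ^ ?n * \<kappa> = 1 / (2 * 32 ^ ?n)" by (simp add: \<kappa>_def)
    have "1 \<le> (32::real) ^ ?n" by (rule one_le_power) simp
    then have "1 < 2 * (32::real) ^ ?n" by linarith
    then have "15 ^ ?n * \<kappa> < 1" unfolding 15 by simp
    moreover have "1 * \<kappa> \<le> 15 ^ ?n * \<kappa>" "3 ^ ?n * \<kappa> \<le> 15 ^ ?n * \<kappa>"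
      using \<open>0 < \<kappa>\<close> by (intro mult_right_mono one_le_power power_mono; simp)+
    ultimately show "\<kappa> < 1" "3 ^ ?n * \<kappa> \<le> 1" by linarith+
  qed
  \<comment> \<open>The second entry keeps the last level set of the chain inside U, the third turns
    the gain off U into the factor e, and 1/2 keeps \<eta> below 1.\<close>
  define \<eta> where "\<eta> = min (1/2) (min (t * \<kappa> ^ L) (e / c1))"
  have \<eta>: "0 < \<eta>" "\<eta> < 1" "\<eta> \<le> t * \<kappa> ^ L" "c1 * \<eta> \<le> e"
  proof -
    show "0 < \<eta>" "\<eta> < 1" "\<eta> \<le> t * \<kappa> ^ L" using t \<kappa> e c1 by (auto simp: \<eta>_def)
    have "\<eta> \<le> e / c1" by (simp add: \<eta>_def)
    then show "c1 * \<eta> \<le> e" using c1(1) by (simp add: field_simps)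
  qed
  show thesis
  proof (rule that[OF \<eta>(1)])
    fix E U :: "(real^'n) set"
    assume A: "open E" "open U" "emeasure lebesgue U < \<infinity>" "lev (indicator E) \<eta> \<subseteq> U"
    let ?I = "\<integral>\<^sup>+x. epow (mx (indicator U) x) p * ennreal (w x) \<partial>lebesgue"
    let ?v = "indicator E :: real^'n \<Rightarrow> ennreal"
    have wm: "w \<in> borel_measurable lebesgue" by (rule weight_measurable[OF w])
    have Em: "?v \<in> borel_measurable lebesgue" using A(1) by (intro borel_measurable_indicator) simp
    have "ennreal (sqrt L * chain_const TYPE('n)) * weight_of w (lev ?v (t * \<kappa> ^ 0)) \<le> ennreal D * ?I"
      unfolding D_def
    proof (rule riesz_chain_bound[OF w p C H, where G = "\<lambda>k. lev ?v (t * \<kappa> ^ k)"])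
      show "open (lev ?v (t * \<kappa> ^ k))" for k by (rule open_lev)
      show "lev ?v (t * \<kappa> ^ k) \<subseteq> lev ?v (t * \<kappa> ^ Suc k)" for k
        using \<kappa> t by (intro lev_antimono mult_left_mono power_decreasing) auto
      show "lev ?v (t * \<kappa> ^ L) \<subseteq> U" using lev_antimono[OF \<eta>(3)] A(4) by blast
      show "open U" "emeasure lebesgue U < \<infinity>" by fact+
      fix k z a r assume z: "z \<notin> lev ?v (t * \<kappa> ^ Suc k)" "z \<in> ball a r"
      have "emeasure lebesgue (lev ?v (t * \<kappa> ^ k) \<inter> ball a r)
        \<le> ennreal (15 ^ ?n * (t * \<kappa> ^ Suc k / (t * \<kappa> ^ k))) * emeasure lebesgue (ball a r)"
      proof (rule emeasure_lev_Int_ball_le[OF Em _ _ _ z])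
        have "3 ^ ?n * (t * \<kappa> ^ Suc k) = (3 ^ ?n * \<kappa>) * (t * \<kappa> ^ k)" by simp
        also have "\<dots> \<le> 1 * (t * \<kappa> ^ k)" using \<kappa> t by (intro mult_right_mono) auto
        finally show "3 ^ ?n * (t * \<kappa> ^ Suc k) \<le> t * \<kappa> ^ k" by simp
      qed (use t \<kappa> in auto)
      also have "15 ^ ?n * (t * \<kappa> ^ Suc k / (t * \<kappa> ^ k)) = 1 / (2 * 32 ^ ?n)"
        using t \<kappa>(1) by (simp add: \<kappa>(3))
      finally show "emeasure lebesgue (lev ?v (t * \<kappa> ^ k) \<inter> ball a r) \<le> ennreal (1 / (2 * 32 ^ ?n)) * emeasure lebesgue (ball a r)" .
    qed
    then have ch: "ennreal (sqrt L * chain_const TYPE('n)) * weight_of w (lev ?v t) \<le> ennreal D * ?I" by simp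
    have wl: "weight_of w (lev ?v t) \<le> ennreal (\<epsilon> / 3) * ?I"
    proof -
      let ?q = "sqrt L * chain_const TYPE('n)"
      have q: "0 < ?q" using L0 cc by simp
      have "weight_of w (lev ?v t) = ennreal (1 / ?q) * (ennreal ?q * weight_of w (lev ?v t))"
        using q by (subst ennreal_mult_left_assoc) auto
      also have "\<dots> \<le> ennreal (1 / ?q) * (ennreal D * ?I)" by (rule mult_left_mono[OF ch]) simp
      also have "\<dots> = ennreal (D / ?q) * ?I" using q by (subst ennreal_mult_left_assoc) auto
      also have "\<dots> \<le> ennreal (\<epsilon> / 3) * ?I" using L1 by (intro mult_right_mono ennreal_leI) auto
      finally show ?thesis .
    qed
    have pt: "epow (mx ?v x) p \<le> ennreal (\<epsilon> / 3) * epow (mx (indicator U) x) p +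
      (ennreal (\<epsilon> / 3) * epow (mx (indicator U) x) p + indicator (lev ?v t) x)" for x
    proof (cases "x \<in> U")
      case False
      have "epow (mx ?v x) p \<le> epow (ennreal (c1 * \<eta>) * mx (indicator U) x) p"
        using p by (intro epow_mono c1(2) A \<eta> False) auto
      also have "\<dots> = ennreal ((c1 * \<eta>) powr p) * epow (mx (indicator U) x) p"
        using c1 \<eta> p by (intro epow_mult) auto
      also have "\<dots> \<le> ennreal (e powr p) * epow (mx (indicator U) x) p"
        using c1 \<eta> p by (intro mult_right_mono ennreal_leI powr_mono2) auto
      finally show ?thesis by (simp add: e add_increasing2)
    next
      case True
      then have 1: "mx (indicator U) x = 1" by (rule mx_indicator_eq_1[OF A(2)])
      show ?thesis
      proof (cases "x \<in> lev ?v t")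
        case True
        have "epow (mx ?v x) p \<le> epow 1 p" using p by (intro epow_mono mx_indicator_le_1) auto
        then show ?thesis using True by (simp add: add_increasing)
      next
        case False
        have "mx ?v x \<le> ennreal e"
        proof (rule ccontr)
          assume "\<not> mx ?v x \<le> ennreal e"
          then have "x \<in> lev ?v (b * e)" using e by (intro b(3)) auto
          then show False using False by (simp add: t_def)
        qed
        then have "epow (mx ?v x) p \<le> epow (ennreal e) p" using p by (intro epow_mono) auto
        also have "\<dots> = ennreal (\<epsilon> / 3)" using e(1) unfolding e(2)[symmetric] by (simp add: epow_ennreal)
        finally show ?thesis by (simp add: 1 add_increasing2)
      qed
    qed
    have "(\<integral>\<^sup>+x. epow (mx ?v x) p * ennreal (w x) \<partial>lebesgue)
      \<le> (\<integral>\<^sup>+x. (ennreal (\<epsilon> / 3) * (epow (mx (indicator U) x) p * ennreal (w x)) +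
      (ennreal (\<epsilon> / 3) * (epow (mx (indicator U) x) p * ennreal (w x)) + ennreal (w x) * indicator (lev ?v t) x)) \<partial>lebesgue)"
    proof (rule nn_integral_mono)
      fix x
      have "epow (mx ?v x) p * ennreal (w x) \<le> (ennreal (\<epsilon> / 3) * epow (mx (indicator U) x) p +
      (ennreal (\<epsilon> / 3) * epow (mx (indicator U) x) p + indicator (lev ?v t) x)) * ennreal (w x)"
        by (rule mult_right_mono[OF pt]) simp
      then show "epow (mx ?v x) p * ennreal (w x) \<le> ennreal (\<epsilon> / 3) * (epow (mx (indicator U) x) p * ennreal (w x)) +
      (ennreal (\<epsilon> / 3) * (epow (mx (indicator U) x) p * ennreal (w x)) + ennreal (w x) * indicator (lev ?v t) x)"
        by (simp add: distrib_right mult.assoc mult.commute[of "indicator (lev ?v t) x"])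
    qed
    also have "\<dots> = ennreal (\<epsilon> / 3) * ?I + (ennreal (\<epsilon> / 3) * ?I + weight_of w (lev ?v t))"
    proof -
      have m: "(\<lambda>x. epow (mx (indicator U) x) p * ennreal (w x)) \<in> borel_measurable lebesgue"
        using wm by measurable
      have m2: "(\<lambda>x. ennreal (w x) * indicator (lev ?v t) x) \<in> borel_measurable lebesgue"
        using wm by measurable
      show ?thesis
        unfolding weight_of_def using m m2 by (simp add: nn_integral_add nn_integral_cmult)
    qed
    also have "\<dots> \<le> ennreal (\<epsilon> / 3) * ?I + (ennreal (\<epsilon> / 3) * ?I + ennreal (\<epsilon> / 3) * ?I)"
      by (intro add_left_mono wl)
    also have "\<dots> = ennreal \<epsilon> * ?I"
    proof -
      have "ennreal \<epsilon> = ennreal (\<epsilon> / 3) + (ennreal (\<epsilon> / 3) + ennreal (\<epsilon> / 3))"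
        using \<epsilon> by (simp flip: ennreal_plus)
      then show ?thesis by (simp add: distrib_right)
    qed
    finally show "(\<integral>\<^sup>+x. epow (mx ?v x) p * ennreal (w x) \<partial>lebesgue) \<le> ennreal \<epsilon> * ?I" .
  qed
qed

section \<open>Geometric decay and the class \<open>SC p\<close>\<close>

text \<open>Let s be the maximal function of v at x. If c is not large against s, the trivial bound
  1 is good enough. Otherwise x lies outside the level set at s/b, and the sparseness of the level
  set at c bounds its density in every ball through x by a multiple of s/c.\<close>

lemma mx_indicator_lev_le:
  obtains K where "0 < K" "\<And>(v :: real^'n \<Rightarrow> ennreal) c x. v \<in> borel_measurable lebesgue \<Longrightarrow> 0 < c \<Longrightarrow>
    mx (indicator (lev v c)) x \<le> ennreal (K / c) * mx v x"
proof -
  let ?n = "CARD('n)"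
  obtain b :: real where b: "0 < b"
    "\<And>(v :: real^'n \<Rightarrow> ennreal) t x. 0 \<le> t \<Longrightarrow> x \<in> lev v t \<Longrightarrow> ennreal (b * t) < mx v x"
    "\<And>(v :: real^'n \<Rightarrow> ennreal) t x. 0 \<le> t \<Longrightarrow> ennreal t < mx v x \<Longrightarrow> x \<in> lev v (b * t)"
    by (rule mx_lev_equiv) blast
  define K where "K = 15 ^ ?n / b\<^sup>2 + 3 ^ ?n / b"
  have K: "0 < K" "15 ^ ?n / b\<^sup>2 \<le> K" "3 ^ ?n / b \<le> K" using b(1) by (auto simp: K_def add_pos_pos)
  show thesis
  proof (rule that[OF K(1)])
    fix v :: "real^'n \<Rightarrow> ennreal" and c x
    assume v: "v \<in> borel_measurable lebesgue" and c: "(0::real) < c"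
    let ?E = "lev v c"
    show "mx (indicator ?E) x \<le> ennreal (K / c) * mx v x"
    proof (cases "mx v x")
      case top
      then show ?thesis using K(1) c by (simp add: ennreal_mult_top)
    next
      case (real s)
      have x: "x \<notin> lev v (s / b)"
      proof
        assume "x \<in> lev v (s / b)"
        then have "ennreal (b * (s / b)) < mx v x" using real b(1) by (intro b(2)) auto
        then show False using b(1) real by simp
      qed
      show ?thesis
      proof (cases "3 ^ ?n * (s / b) \<le> c")
        case False
        then have "c \<le> 3 ^ ?n / b * s" by simp
        also have "\<dots> \<le> K * s" using K(3) real(1) by (rule mult_right_mono)
        finally have "c \<le> K * s" .
        then have "1 \<le> K / c * s" using c by (simp add: field_simps)
        then have "1 \<le> ennreal (K / c) * mx v x"
          using real K(1) c by (simp add: ennreal_le_iff flip: ennreal_mult ennreal_1)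
        then show ?thesis using mx_indicator_le_1 order_trans by blast
      next
        case True
        have "x \<notin> lev (indicator ?E) (15 ^ ?n * (s / b / c))"
        proof
          assume "x \<in> lev (indicator ?E) (15 ^ ?n * (s / b / c))"
          then obtain a r where ar: "0 < r" "x \<in> ball a r"
            "ennreal (15 ^ ?n * (s / b / c)) * emeasure lebesgue (ball a r) < (\<integral>\<^sup>+x\<in>ball a r. indicator ?E x \<partial>lebesgue)"
            by (auto elim: levE)
          have "(\<integral>\<^sup>+x\<in>ball a r. indicator ?E x \<partial>lebesgue) \<le> ennreal (15 ^ ?n * (s / b / c)) * emeasure lebesgue (ball a r)"
            using emeasure_lev_Int_ball_le[OF v _ c True x ar(2)] real(1) b(1) by (simp add: set_nn_integral_indicator)
          then show False using ar(3) by simp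
        qed
        then have "\<not> ennreal (15 ^ ?n * (s / b / c) / b) < mx (indicator ?E) x"
          using b(3)[of "15 ^ ?n * (s / b / c) / b" "indicator ?E" x] real(1) b(1) c by auto
        then have "mx (indicator ?E) x \<le> ennreal (15 ^ ?n / b\<^sup>2 / c * s)"
          by (simp add: not_less power2_eq_square mult_ac)
        also have "\<dots> \<le> ennreal (K / c * s)"
          using K(2) c real(1) by (intro ennreal_leI mult_right_mono divide_right_mono) auto
        also have "\<dots> = ennreal (K / c) * mx v x"
          using K(1) c real by (subst ennreal_mult) auto
        finally show ?thesis .
      qed
    qed
  qed
qed

text \<open>A coarse substitute for Lebesgue differentiation: v is at most a constant times its
  maximal function almost everywhere. Averages about points of the exceptional set D are at most t,
  so D fills at most the fraction \<open>1 / (2 * 5 ^ n)\<close> of each ball about such a point.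
  Vitali's lemma inside an open set of measure less than twice that of D would then give D less than
  its own measure.\<close>

lemma null_above_lev:
  fixes v :: "real^'n \<Rightarrow> ennreal"
  assumes v: "v \<in> borel_measurable lebesgue" and t: "0 < t"
  shows "emeasure lebesgue ({x. ennreal (2 * 5 ^ CARD('n) * t) < v x} - lev v t) = 0"
proof -
  let ?n = "CARD('n)"
  define D where "D = {x. ennreal (2 * 5 ^ CARD('n) * t) < v x} - lev v t"
  have D: "D \<in> sets lebesgue"
  proof -
    have "{x \<in> space lebesgue. ennreal (2 * 5 ^ CARD('n) * t) < v x} \<in> sets lebesgue" using v by measurable
    then show ?thesis unfolding D_def by auto
  qed
  have "emeasure lebesgue (D \<inter> ball 0 (real m)) = 0" for m
  proof (rule ccontr)
    let ?D = "D \<inter> ball 0 (real m)"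
    assume ne: "emeasure lebesgue ?D \<noteq> 0"
    have Ds: "?D \<in> sets lebesgue" using D by auto
    have "emeasure lebesgue ?D \<le> emeasure lebesgue (ball (0::real^'n) (real m))"
      by (intro emeasure_mono) auto
    also have "\<dots> < \<infinity>" by (rule emeasure_ball_finite)
    finally obtain d where d: "0 \<le> d" "emeasure lebesgue ?D = ennreal d"
      by (cases "emeasure lebesgue ?D") auto
    with ne have d0: "0 < d" by auto
    \<comment> \<open>Outer regularity with excess smaller than the measure d of the bounded piece
      of D, so that O' has measure below 2 d.\<close>
    obtain O' where O': "open O'" "?D \<subseteq> O'" "O' - ?D \<in> lmeasurable" "emeasure lebesgue (O' - ?D) < ennreal d"
      using sets_lebesgue_outer_open[OF Ds d0] by blast
    have "emeasure lebesgue O' = emeasure lebesgue (?D \<union> (O' - ?D))" using O'(2) by (simp add: Un_absorb1)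
    also have "\<dots> \<le> emeasure lebesgue ?D + emeasure lebesgue (O' - ?D)"
      using Ds O'(1) by (intro emeasure_subadditive) auto
    also have "\<dots> < ennreal d + ennreal d"
      unfolding d(2) using O'(4) by (intro ennreal_add_left_cancel_less[THEN iffD2]) auto
    finally have Olt: "emeasure lebesgue O' < ennreal (2 * d)" using d by (simp flip: ennreal_plus)
    define K where "K = {(y, r). y \<in> ?D \<and> 0 < r \<and> r \<le> 1 \<and> ball y r \<subseteq> O'}"
    have "emeasure lebesgue ?D \<le> ennreal (1/2) * emeasure lebesgue (\<Union>(y, r)\<in>K. ball y r)"
    proof (rule Vitali_measure_le[where B = 1])
      show "?D \<subseteq> (\<Union>(y, r)\<in>K. ball y r)"
      proof
        fix y assume y: "y \<in> ?D"
        then obtain r where r: "0 < r" "ball y r \<subseteq> O'" using O'(2) openE[OF O'(1)] by blast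
        have "ball y (min r 1) \<subseteq> ball y r" by (rule subset_ball) simp
        then have "(y, min r 1) \<in> K" using r y by (auto simp: K_def)
        moreover have "y \<in> ball y (min r 1)" using r by simp
        ultimately show "y \<in> (\<Union>(y, r)\<in>K. ball y r)" by blast
      qed
      fix y r assume yr: "(y, r) \<in> K"
      then have r: "0 < r" and y: "y \<notin> lev v t" by (auto simp: K_def D_def)
      let ?A = "?D \<inter> ball y (5 * r)"
      have "ennreal (2 * 5 ^ ?n * t) * emeasure lebesgue ?A = (\<integral>\<^sup>+x. ennreal (2 * 5 ^ ?n * t) * indicator ?A x \<partial>lebesgue)"
        using Ds by (subst nn_integral_cmult_indicator) auto
      also have "\<dots> \<le> (\<integral>\<^sup>+x\<in>ball y (5 * r). v x \<partial>lebesgue)"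
        by (intro nn_integral_mono) (auto simp: D_def split: split_indicator)
      also have "\<dots> \<le> ennreal t * emeasure lebesgue (ball y (5 * r))"
        using r by (intro not_levD[OF y]) auto
      also have "\<dots> = ennreal t * (ennreal (5 ^ ?n) * emeasure lebesgue (ball y r))"
        using r by (subst emeasure_ball_scale[of _ _ _ y]) auto
      finally have 1: "ennreal (2 * 5 ^ ?n * t) * emeasure lebesgue ?A \<le> ennreal t * (ennreal (5 ^ ?n) * emeasure lebesgue (ball y r))" .
      have "emeasure lebesgue ?A = ennreal (1 / (2 * 5 ^ ?n * t)) * (ennreal (2 * 5 ^ ?n * t) * emeasure lebesgue ?A)"
        using t by (subst ennreal_mult_left_assoc) auto
      also have "\<dots> \<le> ennreal (1 / (2 * 5 ^ ?n * t)) * (ennreal t * (ennreal (5 ^ ?n) * emeasure lebesgue (ball y r)))"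
        using 1 by (rule mult_left_mono) simp
      also have "\<dots> = ennreal (1 / (2 * 5 ^ ?n * t) * (t * 5 ^ ?n)) * emeasure lebesgue (ball y r)"
        using t by (subst ennreal_mult_left_assoc[of t], simp, subst ennreal_mult_left_assoc) auto
      also have "1 / (2 * 5 ^ ?n * t) * (t * 5 ^ ?n) = 1 / 2" using t by simp
      finally show "emeasure lebesgue ?A \<le> ennreal (1/2) * emeasure lebesgue (ball y r)" .
    qed (use Ds in \<open>auto simp: K_def\<close>)
    also have "\<dots> \<le> ennreal (1/2) * emeasure lebesgue O'"
      using O'(1) by (intro mult_left_mono emeasure_mono) (auto simp: K_def)
    also have "\<dots> < ennreal d"
    proof -
      obtain q where q: "0 \<le> q" "emeasure lebesgue O' = ennreal q"
        using Olt by (cases "emeasure lebesgue O'") auto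
      then have "q < 2 * d" using Olt d by (simp add: ennreal_less_iff)
      then have "1/2 * q < d" by simp
      then have "ennreal (1/2 * q) < ennreal d" using d0 by (intro ennreal_lessI)
      moreover have "ennreal (1/2) * ennreal q = ennreal (1/2 * q)" using q(1) by (intro ennreal_mult[symmetric]) auto
      ultimately show ?thesis unfolding q(2) by simp
    qed
    finally show False using d by simp
  qed
  then have N: "(\<Union>m. D \<inter> ball 0 (real m)) \<in> null_sets lebesgue"
    using D by (intro null_sets_UN null_setsI) auto
  have E: "(\<Union>m. D \<inter> ball 0 (real m)) = D"
  proof -
    have "\<exists>m. x \<in> ball 0 (real m)" for x :: "real^'n"
      using reals_Archimedean2[of "norm x"] by auto
    then show ?thesis by blast
  qed
  have "D \<in> null_sets lebesgue" using N unfolding E .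
  then show ?thesis unfolding D_def[symmetric] by (rule null_setsD1)
qed

section \<open>Reverse Hoelder sums over disjoint cubes\<close>

lemma weight_of_bounded_finite:
  fixes w :: "real^'n \<Rightarrow> real"
  assumes "weight w" "bounded S" shows "weight_of w S < \<infinity>"
proof -
  obtain R where "\<forall>y\<in>S. dist 0 y \<le> R" using assms(2) bounded_any_center[of S 0] by blast
  then have R: "S \<subseteq> cball 0 R" by auto
  have "integrable lebesgue (\<lambda>x. indicator (cball 0 R) x *\<^sub>R w x)"
    using assms(1) unfolding weight_def locally_integrable_def set_integrable_def by auto
  then have "(\<integral>\<^sup>+x. ennreal (norm (indicator (cball 0 R) x *\<^sub>R w x)) \<partial>lebesgue) < \<infinity>"
    by (simp add: integrable_iff_bounded)
  also have "(\<integral>\<^sup>+x. ennreal (norm (indicator (cball 0 R) x *\<^sub>R w x)) \<partial>lebesgue) = weight_of w (cball 0 R)"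
    unfolding weight_of_def using assms(1) by (intro nn_integral_cong) (auto simp: weight_def split: split_indicator)
  finally show ?thesis using weight_of_mono[OF R, of w] by (rule le_less_trans[rotated])
qed

lemma bounded_hbox: "bounded (hbox a s)" for a :: "real^'n"
proof (cases "hbox a s = {}")
  case False
  then obtain x where "x \<in> hbox a s" by blast
  then have "hbox a s \<subseteq> ball x (real CARD('n) * s)" using hbox_dist_less by auto
  then show ?thesis by (rule bounded_subset[OF bounded_ball])
qed auto

lemma mx_indicator_ge_1:
  fixes x :: "real^'n"
  assumes "cube Q" "x \<in> Q" "Q \<subseteq> \<Omega>" shows "1 \<le> mx (indicator \<Omega>) x"
proof -
  obtain a s where Q: "0 < s" "Q = hbox a s" using assms(1) by (auto simp: cube_iff)
  have "1 = emeasure lebesgue Q / emeasure lebesgue Q"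
    using Q by (intro ennreal_divide_self[symmetric]) (auto simp: emeasure_hbox not_le)
  also have "\<dots> \<le> cube_avg Q (indicator \<Omega>)"
  proof -
    have "emeasure lebesgue Q = (\<integral>\<^sup>+y. indicator Q y \<partial>lebesgue)" using Q by simp
    also have "\<dots> \<le> (\<integral>\<^sup>+y\<in>Q. indicator \<Omega> y \<partial>lebesgue)"
      using assms(3) by (intro nn_integral_mono) (auto split: split_indicator)
    finally show ?thesis unfolding cube_avg_def by (rule divide_right_mono_ennreal)
  qed
  also have "\<dots> \<le> mx (indicator \<Omega>) x"
    unfolding mx_def using assms by (intro SUP_upper) auto
  finally show ?thesis .
qed

text \<open>A value between consecutive levels of ratio a is charged to the lower level at the price
  of the upper one. The levels are those of \<open>iterated_level_bound\<close>, shifted by the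
  factor M that \<open>null_above_lev\<close> costs.\<close>

lemma powr_le_geometric_suminf:
  fixes u :: real
  assumes "0 \<le> u" "0 < M" "1 < a" "0 < \<delta>"
  shows "ennreal (u powr \<delta>) \<le> ennreal ((M * a) powr \<delta>) +
    (\<Sum>k. ennreal ((M * a ^ (k + 2)) powr \<delta>) * indicator {u. M * a ^ (k + 1) < u} u)"
proof (cases "u \<le> M * a")
  case True
  then have "u powr \<delta> \<le> (M * a) powr \<delta>" using assms by (intro powr_mono2) auto
  then show ?thesis by (simp add: ennreal_leI add_increasing2)
next
  case False
  define k where "k = (LEAST k::nat. u \<le> M * a ^ (k + 2))"
  have ex: "\<exists>k::nat. u \<le> M * a ^ (k + 2)"
  proof -
    obtain k where k: "u / M < a ^ k" using real_arch_pow[of a "u / M"] assms by auto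
    have "a ^ k \<le> a ^ (k + 2)" using assms by (intro power_increasing) auto
    with k have "u / M \<le> a ^ (k + 2)" by linarith
    then have "u \<le> M * a ^ (k + 2)" using assms by (simp add: field_simps)
    then show ?thesis by blast
  qed
  have k1: "u \<le> M * a ^ (k + 2)" unfolding k_def by (rule LeastI_ex[OF ex])
  have k2: "M * a ^ (k + 1) < u"
  proof (cases k)
    case 0 then show ?thesis using False by simp
  next
    case (Suc m)
    then have "\<not> u \<le> M * a ^ (m + 2)" using not_less_Least[of m "\<lambda>k. u \<le> M * a ^ (k + 2)"] by (simp add: k_def)
    then show ?thesis using Suc by simp
  qed
  have "ennreal (u powr \<delta>) \<le> ennreal ((M * a ^ (k + 2)) powr \<delta>)"
    using k1 assms by (intro ennreal_leI powr_mono2) auto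
  also have "\<dots> = ennreal ((M * a ^ (k + 2)) powr \<delta>) * indicator {u. M * a ^ (k + 1) < u} u"
    using k2 by (simp only: indicator_simps mem_Collect_eq mult_1_right)
  also have "\<dots> \<le> (\<Sum>k. ennreal ((M * a ^ (k + 2)) powr \<delta>) * indicator {u. M * a ^ (k + 1) < u} u)"
  proof -
    have "h k \<le> suminf h" for h :: "nat \<Rightarrow> ennreal"
      using sum_le_suminf[of h "{k}"] by simp
    then show ?thesis .
  qed
  finally show ?thesis by (rule order_trans) simp
qed

text \<open>Normalise by the average W and use
  \<open>z powr (1 / (1 + \<delta>)) \<le> 1 + z\<close>. The summand of the \<open>SC\<close>
  condition thereby becomes linear in the integral of \<open>(w / W) powr \<delta> * w\<close>, and
  the cubes can be summed to one integral.\<close>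

lemma powr_average_le:
  fixes w :: "real^'n \<Rightarrow> real"
  assumes w: "weight w" and Q: "cube Q" and \<delta>: "0 < \<delta>"
  defines "W \<equiv> enn2real (cube_avg Q (\<lambda>x. ennreal (w x)))"
  shows "epow (cube_avg Q (\<lambda>x. ennreal (w x powr (1 + \<delta>)))) (1 / (1 + \<delta>)) * emeasure lebesgue Q
    \<le> weight_of w Q + (\<integral>\<^sup>+x\<in>Q. ennreal ((w x / W) powr \<delta>) * ennreal (w x) \<partial>lebesgue)"
proof -
  have wm: "w \<in> borel_measurable lebesgue" by (rule weight_measurable[OF w])
  obtain a s where s: "0 < s" "Q = hbox a s" using Q by (auto simp: cube_iff)
  have Qs: "Q \<in> sets lebesgue" using s by simp
  define m where "m = s ^ CARD('n)"
  have m: "0 < m" "emeasure lebesgue Q = ennreal m" using s by (simp_all add: m_def emeasure_hbox)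
  have "weight_of w Q < \<infinity>" using bounded_hbox s by (intro weight_of_bounded_finite[OF w]) auto
  then obtain A where A: "0 \<le> A" "weight_of w Q = ennreal A" by (cases "weight_of w Q") auto
  have W: "W = A / m" "cube_avg Q (\<lambda>x. ennreal (w x)) = ennreal (A / m)"
    using A m by (simp_all add: W_def cube_avg_def weight_of_def[symmetric] divide_ennreal)
  show ?thesis
  \<comment> \<open>Division by W is meaningless if w has no mass on Q; then w vanishes almost
    everywhere on Q and the left side is 0.\<close>
  proof (cases "A = 0")
    case True
    then have "(\<integral>\<^sup>+x. ennreal (w x) * indicator Q x \<partial>lebesgue) = 0" using A by (simp add: weight_of_def)
    then have "AE x in lebesgue. ennreal (w x) * indicator Q x = 0"
      using wm Qs by (subst (asm) nn_integral_0_iff_AE) auto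
    then have "AE x in lebesgue. ennreal (w x powr (1 + \<delta>)) * indicator Q x = 0"
      by eventually_elim (use weight_nonneg[OF w] in \<open>auto simp: ennreal_eq_0_iff dual_order.antisym split: split_indicator\<close>)
    then have "(\<integral>\<^sup>+x\<in>Q. ennreal (w x powr (1 + \<delta>)) \<partial>lebesgue) = 0"
      using wm Qs by (subst nn_integral_0_iff_AE) auto
    then show ?thesis by (simp add: cube_avg_def)
  next
    case False
    then have W0: "0 < W" using A m W by simp
    define y where "y = (\<integral>\<^sup>+x\<in>Q. ennreal ((w x / W) powr (1 + \<delta>)) \<partial>lebesgue)"
    have eq: "w x powr (1 + \<delta>) = W powr (1 + \<delta>) * (w x / W) powr (1 + \<delta>)" for x
      using W0 weight_nonneg[OF w, of x] by (simp add: powr_divide)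
    have "(\<integral>\<^sup>+x\<in>Q. ennreal (w x powr (1 + \<delta>)) \<partial>lebesgue)
      = (\<integral>\<^sup>+x. ennreal (W powr (1 + \<delta>)) * (ennreal ((w x / W) powr (1 + \<delta>)) * indicator Q x) \<partial>lebesgue)"
      by (intro nn_integral_cong) (simp add: eq[symmetric] ennreal_mult_left_assoc mult.assoc)
    also have "\<dots> = ennreal (W powr (1 + \<delta>)) * y"
      unfolding y_def using wm Qs by (intro nn_integral_cmult) auto
    finally have "cube_avg Q (\<lambda>x. ennreal (w x powr (1 + \<delta>))) = ennreal (W powr (1 + \<delta>)) * (y / emeasure lebesgue Q)"
      by (simp add: cube_avg_def ennreal_times_divide)
    then have "epow (cube_avg Q (\<lambda>x. ennreal (w x powr (1 + \<delta>)))) (1 / (1 + \<delta>))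
       = ennreal W * epow (y / emeasure lebesgue Q) (1 / (1 + \<delta>))"
      using W0 \<delta> by (simp add: epow_mult powr_powr)
    moreover have "epow (y / emeasure lebesgue Q) (1 / (1 + \<delta>)) \<le> 1 + y / emeasure lebesgue Q"
    proof -
      have "epow z (1 / (1 + \<delta>)) \<le> 1 + z" for z
      proof (cases z)
        case (real u)
        have "u powr (1 / (1 + \<delta>)) \<le> 1 + u"
        proof (cases "u \<le> 1")
          case True
          then have "u powr (1 / (1 + \<delta>)) \<le> 1 powr (1 / (1 + \<delta>))" using real \<delta> by (intro powr_mono2) auto
          then show ?thesis using real by simp
        next
          case False
          then have "u powr (1 / (1 + \<delta>)) \<le> u powr 1" using \<delta> by (intro powr_mono) auto
          then show ?thesis using False by simp
        qed
        then have "ennreal (u powr (1 / (1 + \<delta>))) \<le> ennreal (1 + u)" by (rule ennreal_leI)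
        also have "ennreal (1 + u) = 1 + ennreal u" using real by (subst ennreal_plus) auto
        finally show ?thesis using real by (simp add: epow_ennreal)
      qed simp
      then show ?thesis .
    qed
    ultimately have "epow (cube_avg Q (\<lambda>x. ennreal (w x powr (1 + \<delta>)))) (1 / (1 + \<delta>)) * emeasure lebesgue Q
      \<le> ennreal W * (1 + y / emeasure lebesgue Q) * emeasure lebesgue Q"
      by (simp add: mult_right_mono mult_left_mono)
    also have "\<dots> = ennreal W * emeasure lebesgue Q + ennreal W * (y / emeasure lebesgue Q * emeasure lebesgue Q)"
      by (simp add: distrib_left distrib_right mult.assoc)
    also have "y / emeasure lebesgue Q * emeasure lebesgue Q = y"
      using m by (simp add: ennreal_divide_times)
    also have "ennreal W * emeasure lebesgue Q = weight_of w Q"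
      using m A W0 W(1) by (simp flip: ennreal_mult)
    also have "ennreal W * y = (\<integral>\<^sup>+x. ennreal W * (ennreal ((w x / W) powr (1 + \<delta>)) * indicator Q x) \<partial>lebesgue)"
      unfolding y_def using wm Qs by (intro nn_integral_cmult[symmetric]) auto
    also have "\<dots> = (\<integral>\<^sup>+x\<in>Q. ennreal ((w x / W) powr \<delta>) * ennreal (w x) \<partial>lebesgue)"
    proof (rule nn_integral_cong)
      fix x
      have "W * (w x / W) powr (1 + \<delta>) = (w x / W) powr \<delta> * w x"
        using W0 weight_nonneg[OF w, of x] by (cases "w x = 0") (auto simp: powr_add)
      then have "ennreal W * ennreal ((w x / W) powr (1 + \<delta>)) = ennreal ((w x / W) powr \<delta>) * ennreal (w x)"
        using W0 weight_nonneg[OF w, of x] by (simp flip: ennreal_mult)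
      then show "ennreal W * (ennreal ((w x / W) powr (1 + \<delta>)) * indicator Q x) = ennreal ((w x / W) powr \<delta>) * ennreal (w x) * indicator Q x"
        by (simp add: mult.assoc[symmetric])
    qed
    finally show ?thesis .
  qed
qed

text \<open>Suppose all cubes meeting a ball of radius r have side at most r. They lie in the (n +
  2)-fold ball and carry no more v-mass than measure, so the v-average is at most
  \<open>(n + 2) ^ n\<close>. A ball with a larger average therefore meets a cube of side s > r, and
  this cube fills a fixed fraction of the ball of radius (n + 2) s about x.\<close>

lemma lev_normalized_subset:
  obtains c where "0 < c" "\<And>\<Q> v t. finite \<Q> \<Longrightarrow> (\<forall>Q\<in>\<Q>. cube (Q :: (real^'n) set)) \<Longrightarrow> disjoint \<Q> \<Longrightarrow>
    (\<And>Q. Q \<in> \<Q> \<Longrightarrow> (\<integral>\<^sup>+x\<in>Q. v x \<partial>lebesgue) \<le> emeasure lebesgue Q) \<Longrightarrow>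
    v \<in> borel_measurable lebesgue \<Longrightarrow>
    (\<And>x. x \<notin> \<Union>\<Q> \<Longrightarrow> v x = 0) \<Longrightarrow> (real CARD('n) + 2) ^ CARD('n) \<le> t \<Longrightarrow> lev v t \<subseteq> lev (indicator (\<Union>\<Q>)) c"
proof -
  let ?n = "CARD('n)"
  define m where "m = measure lebesgue (ball (0::real^'n) 1)"
  have m: "0 < m" unfolding m_def by simp
  have "emeasure lebesgue (ball (0::real^'n) 1) = ennreal m"
    unfolding m_def using emeasure_lborel_ball_finite[of "0::real^'n" 1] 
    by (subst emeasure_eq_ennreal_measure) (auto simp: emeasure_completion)
  then have em: "emeasure lebesgue (ball a r) = ennreal (r ^ ?n * m)" if "0 \<le> r" for a :: "real^'n" and r
    using emeasure_ball_scale[of r 1 a 0] that m by (simp add: ennreal_mult)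
  \<comment> \<open>The factor 2 leaves the strict inequality required by
    \<open>lev\<close>.\<close>
  define c where "c = 1 / (2 * m * (?n + 2) ^ ?n)"
  have c: "0 < c" using m by (simp add: c_def)
  show thesis
  proof (rule that[OF c], rule subsetI)
    fix \<Q> :: "(real^'n) set set" and v t x
    assume fin: "finite \<Q>" and cub: "\<forall>Q\<in>\<Q>. cube Q" and dj: "disjoint \<Q>"
      and le: "\<And>Q. Q \<in> \<Q> \<Longrightarrow> (\<integral>\<^sup>+x\<in>Q. v x \<partial>lebesgue) \<le> emeasure lebesgue Q"
      and vm: "v \<in> borel_measurable lebesgue"
      and v0: "\<And>x. x \<notin> \<Union>\<Q> \<Longrightarrow> v x = 0" and t: "(real ?n + 2) ^ ?n \<le> t" and x: "x \<in> lev v t"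
    have Qs: "Q \<in> sets lebesgue" if "Q \<in> \<Q>" for Q using cub that by (auto simp: cube_iff)
    have Us: "\<Union>\<Q> \<in> sets lebesgue" using fin Qs by (intro sets.finite_Union) auto
    from x obtain b r where br: "0 < r" "x \<in> ball b r" "ennreal t * emeasure lebesgue (ball b r) < (\<integral>\<^sup>+x\<in>ball b r. v x \<partial>lebesgue)"
      by (auto elim: levE)
    have "\<exists>q s. 0 < s \<and> hbox q s \<in> \<Q> \<and> r < s \<and> hbox q s \<inter> ball b r \<noteq> {}"
    proof (rule ccontr)
      assume "\<not> ?thesis"
      then have small: "s \<le> r" if "0 < s" "hbox q s \<in> \<Q>" "hbox q s \<inter> ball b r \<noteq> {}" for q s
        using that not_le by blast
      define P where "P = {Q \<in> \<Q>. Q \<inter> ball b r \<noteq> {}}"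
      have P: "finite P" "P \<subseteq> \<Q>" using fin by (auto simp: P_def)
      have PB: "Q \<subseteq> ball b ((?n + 2) * r)" if QP: "Q \<in> P" for Q
      proof
        fix z assume z: "z \<in> Q"
        have "cube Q" using that P(2) cub by blast
        then obtain q s where qs: "0 < s" "Q = hbox q s" by (auto simp: cube_iff)
        have "Q \<inter> ball b r \<noteq> {}" using QP by (simp add: P_def)
        then obtain y where y: "y \<in> Q" "y \<in> ball b r" by blast
        have sr: "s \<le> r" using small[of s q] qs that by (auto simp: P_def)
        have "dist b z \<le> dist b y + dist y z" by (rule dist_triangle)
        also have "\<dots> < r + ?n * s" using y z qs hbox_dist_less[of y q s z] by auto
        also have "\<dots> \<le> r + ?n * r" using sr by (intro add_left_mono mult_left_mono) auto
        also have "\<dots> \<le> (?n + 2) * r" using br(1) by (simp add: algebra_simps)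
        finally show "z \<in> ball b ((?n + 2) * r)" by simp
      qed
      have "(\<integral>\<^sup>+x\<in>ball b r. v x \<partial>lebesgue) \<le> (\<integral>\<^sup>+x. (\<Sum>Q\<in>P. v x * indicator Q x) \<partial>lebesgue)"
      proof (rule nn_integral_mono)
        fix x show "v x * indicator (ball b r) x \<le> (\<Sum>Q\<in>P. v x * indicator Q x)"
        proof (cases "x \<in> ball b r \<and> v x \<noteq> 0")
          case True
          then obtain Q where Q: "Q \<in> \<Q>" "x \<in> Q" using v0[of x] by blast
          then have "Q \<in> P" using True by (auto simp: P_def)
          have "v x * indicator (ball b r) x = v x * indicator Q x" using True Q by simp
          also have "\<dots> \<le> (\<Sum>Q\<in>P. v x * indicator Q x)"
            using P(1) \<open>Q \<in> P\<close> by (intro member_le_sum) auto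
          finally show ?thesis .
        qed auto
      qed
      also have "\<dots> = (\<Sum>Q\<in>P. \<integral>\<^sup>+x\<in>Q. v x \<partial>lebesgue)"
      proof (rule nn_integral_sum)
        fix Q assume "Q \<in> P"
        then show "(\<lambda>x. v x * indicator Q x) \<in> borel_measurable lebesgue"
          using vm Qs P(2) by (intro borel_measurable_times_ennreal borel_measurable_indicator) auto
      qed
      also have "\<dots> \<le> (\<Sum>Q\<in>P. emeasure lebesgue Q)" using le P(2) by (intro sum_mono) auto
      also have "\<dots> = emeasure lebesgue (\<Union>P)"
      proof -
        have "disjoint_family_on (\<lambda>Q. Q) P" using dj P(2) unfolding disjoint_family_on_def disjoint_def by blast
        then show ?thesis using P Qs by (subst sum_emeasure[of "\<lambda>Q. Q"]) auto
      qed
      also have "\<dots> \<le> emeasure lebesgue (ball b ((?n + 2) * r))"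
        using PB by (intro emeasure_mono) auto
      also have "\<dots> = ennreal ((real ?n + 2) ^ ?n) * emeasure lebesgue (ball b r)"
        using br(1) emeasure_ball_scale[of "real ?n + 2" r b b] by (simp add: add.commute)
      also have "\<dots> \<le> ennreal t * emeasure lebesgue (ball b r)"
        using t by (intro mult_right_mono ennreal_leI) auto
      finally show False using br(3) by simp
    qed
    then obtain q s where qs: "0 < s" "hbox q s \<in> \<Q>" "r < s" "hbox q s \<inter> ball b r \<noteq> {}" by blast
    then obtain y where y: "y \<in> hbox q s" "y \<in> ball b r" by blast
    have sub: "hbox q s \<subseteq> ball x ((?n + 2) * s)"
    proof
      fix z assume z: "z \<in> hbox q s"
      have "dist x z \<le> dist x b + dist b y + dist y z"
        using dist_triangle[of x z b] dist_triangle[of b z y] by simp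
      also have "\<dots> < r + r + ?n * s" using y z br(2) hbox_dist_less[OF y(1) z] by (simp add: dist_commute)
      also have "\<dots> \<le> (?n + 2) * s" using qs(3) by (simp add: algebra_simps)
      finally show "z \<in> ball x ((?n + 2) * s)" by simp
    qed
    show "x \<in> lev (indicator (\<Union>\<Q>)) c"
    proof (rule levI[of x x "(?n + 2) * s"])
      show "x \<in> ball x ((?n + 2) * s)" using qs(1) by simp
      have "c * (((?n + 2) * s) ^ ?n * m) = s ^ ?n / 2"
        using m by (simp add: c_def power_mult_distrib)
      also have "\<dots> < s ^ ?n" using qs(1) by simp
      finally have "ennreal (c * (((?n + 2) * s) ^ ?n * m)) < ennreal (s ^ ?n)"
        using qs(1) by (intro ennreal_lessI) auto
      then have "ennreal c * emeasure lebesgue (ball x ((?n + 2) * s)) < emeasure lebesgue (hbox q s)"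
        using qs(1) c m by (simp add: em emeasure_hbox ennreal_mult)
      also have "\<dots> \<le> emeasure lebesgue (\<Union>\<Q> \<inter> ball x ((?n + 2) * s))"
        using sub qs(2) Us by (intro emeasure_mono) auto
      also have "\<dots> = (\<integral>\<^sup>+z\<in>ball x ((?n + 2) * s). indicator (\<Union>\<Q>) z \<partial>lebesgue)"
        using Us by (simp add: set_nn_integral_indicator)
      finally show "ennreal c * emeasure lebesgue (ball x ((?n + 2) * s)) < (\<integral>\<^sup>+z\<in>ball x ((?n + 2) * s). indicator (\<Union>\<Q>) z \<partial>lebesgue)" .
    qed
  qed
qed

text \<open>Off the level set at \<open>a ^ (k + 1)\<close>, the one at \<open>a ^ (k + 2)\<close>
  has density at most \<open>15 ^ n / a \<le> \<eta>\<close> in every ball. So consecutive level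
  sets satisfy the inclusion in \<open>dec\<close>, and each step halves the integral.\<close>

lemma iterated_level_bound:
  fixes w :: "real^'n \<Rightarrow> real" and v :: "real^'n \<Rightarrow> ennreal"
  assumes v: "v \<in> borel_measurable lebesgue" "(\<integral>\<^sup>+x. v x \<partial>lebesgue) < \<infinity>"
    and a: "1 < a" "3 ^ CARD('n) \<le> a" "15 ^ CARD('n) \<le> \<eta> * a"
    and dec: "\<And>E U. open E \<Longrightarrow> open U \<Longrightarrow> emeasure lebesgue U < \<infinity> \<Longrightarrow> lev (indicator E) \<eta> \<subseteq> U \<Longrightarrow>
    (\<integral>\<^sup>+x. epow (mx (indicator E) x) p * ennreal (w x) \<partial>lebesgue)
      \<le> ennreal (1/2) * (\<integral>\<^sup>+x. epow (mx (indicator U) x) p * ennreal (w x) \<partial>lebesgue)"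
  shows "(\<integral>\<^sup>+x. epow (mx (indicator (lev v (a ^ (k + 1)))) x) p * ennreal (w x) \<partial>lebesgue)
    \<le> ennreal ((1/2) ^ k) * (\<integral>\<^sup>+x. epow (mx (indicator (lev v a)) x) p * ennreal (w x) \<partial>lebesgue)"
proof (induction k)
  case 0
  then show ?case by simp
next
  case (Suc k)
  let ?I = "\<lambda>k. \<integral>\<^sup>+x. epow (mx (indicator (lev v (a ^ k))) x) p * ennreal (w x) \<partial>lebesgue"
  have sub: "lev (indicator (lev v (a ^ (k + 2)))) \<eta> \<subseteq> lev v (a ^ (k + 1))"
  proof (rule subsetI, rule ccontr)
    fix x assume x: "x \<in> lev (indicator (lev v (a ^ (k + 2)))) \<eta>" "x \<notin> lev v (a ^ (k + 1))"
    from x(1) obtain b r where br: "0 < r" "x \<in> ball b r"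
      "ennreal \<eta> * emeasure lebesgue (ball b r) < (\<integral>\<^sup>+x\<in>ball b r. indicator (lev v (a ^ (k + 2))) x \<partial>lebesgue)"
      by (auto elim: levE)
    have a': "a ^ (k + 2) = a * a ^ (k + 1)" by simp
    have "(\<integral>\<^sup>+x\<in>ball b r. indicator (lev v (a ^ (k + 2))) x \<partial>lebesgue) = emeasure lebesgue (lev v (a ^ (k + 2)) \<inter> ball b r)"
      by (rule set_nn_integral_indicator) auto
    also have "\<dots> \<le> ennreal (15 ^ CARD('n) * (a ^ (k + 1) / a ^ (k + 2))) * emeasure lebesgue (ball b r)"
    proof (rule emeasure_lev_Int_ball_le[OF v(1) _ _ _ x(2) br(2)])
      show "3 ^ CARD('n) * a ^ (k + 1) \<le> a ^ (k + 2)" unfolding a' using a by (intro mult_right_mono) auto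
    qed (use a in auto)
    also have "15 ^ CARD('n) * (a ^ (k + 1) / a ^ (k + 2)) = 15 ^ CARD('n) / a" unfolding a' using a by simp
    also have "ennreal (15 ^ CARD('n) / a) * emeasure lebesgue (ball b r) \<le> ennreal \<eta> * emeasure lebesgue (ball b r)"
      using a by (intro mult_right_mono ennreal_leI) (auto simp: field_simps)
    finally show False using br(3) by simp
  qed
  have fin: "emeasure lebesgue (lev v (a ^ (k + 1))) < \<infinity>"
    using emeasure_lev_le[OF v(1), of "a ^ (k + 1)"] v(2) a
    by (auto simp: ennreal_mult_less_top intro: le_less_trans)
  have "?I (k + 2) \<le> ennreal (1/2) * ?I (k + 1)"
    by (rule dec[OF open_lev open_lev fin sub])
  also have "\<dots> \<le> ennreal (1/2) * (ennreal ((1/2) ^ k) * ?I 1)"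
    using Suc by (intro mult_left_mono) auto
  also have "\<dots> = ennreal ((1/2) ^ Suc k) * ?I 1"
    by (subst ennreal_mult_left_assoc) auto
  finally show ?case by simp
qed

lemma riesz_weak_type_imp_SC:
  fixes w :: "real^'n \<Rightarrow> real" and j :: 'n
  assumes w: "weight w" and p: "1 < p" and C: "0 < C"
    and H: "\<And>f :: real^'n \<Rightarrow> complex. integrable lebesgue f \<Longrightarrow>
       weak_Lp_norm p w (maximal_truncation (riesz j) f) \<le> ennreal C * Lp_norm p w (hl_maximal f)"
  shows "w \<in> SC p"
proof -
  let ?n = "CARD('n)"
  let ?J = "\<lambda>U. \<integral>\<^sup>+x. epow (mx (indicator U) x) p * ennreal (w x) \<partial>lebesgue"
  have wm: "w \<in> borel_measurable lebesgue" by (rule weight_measurable[OF w])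
  obtain \<eta> where \<eta>: "0 < \<eta>" "\<And>E U. open E \<Longrightarrow> open U \<Longrightarrow> emeasure lebesgue U < \<infinity> \<Longrightarrow> lev (indicator E) \<eta> \<subseteq> U \<Longrightarrow>
    ?J E \<le> ennreal (1/2) * ?J U"
    by (rule mx_integral_decay[OF w p C H, of "1/2"]) auto
  obtain K where K: "0 < K" "\<And>(v :: real^'n \<Rightarrow> ennreal) c x. v \<in> borel_measurable lebesgue \<Longrightarrow> 0 < c \<Longrightarrow>
    mx (indicator (lev v c)) x \<le> ennreal (K / c) * mx v x"
    by (rule mx_indicator_lev_le) blast
  obtain c where c: "0 < c" "\<And>\<Q> v t. finite \<Q> \<Longrightarrow> (\<forall>Q\<in>\<Q>. cube (Q :: (real^'n) set)) \<Longrightarrow> disjoint \<Q> \<Longrightarrow>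
    (\<And>Q. Q \<in> \<Q> \<Longrightarrow> (\<integral>\<^sup>+x\<in>Q. v x \<partial>lebesgue) \<le> emeasure lebesgue Q) \<Longrightarrow>
    v \<in> borel_measurable lebesgue \<Longrightarrow>
    (\<And>x. x \<notin> \<Union>\<Q> \<Longrightarrow> v x = 0) \<Longrightarrow> (real ?n + 2) ^ ?n \<le> t \<Longrightarrow> lev v t \<subseteq> lev (indicator (\<Union>\<Q>)) c"
    by (rule lev_normalized_subset) blast
  \<comment> \<open>The summands ensure in turn a > 1, the two conditions of
    \<open>iterated_level_bound\<close>, and the threshold of
    \<open>lev_normalized_subset\<close>.\<close>
  define a where "a = 2 + 3 ^ ?n + 15 ^ ?n / \<eta> + (real ?n + 2) ^ ?n"
  have a: "1 < a" "3 ^ ?n \<le> a" "15 ^ ?n \<le> \<eta> * a" "(real ?n + 2) ^ ?n \<le> a"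
  proof -
    have pos: "0 \<le> (3::real) ^ ?n" "0 \<le> 15 ^ ?n / \<eta>" "0 \<le> (real ?n + 2) ^ ?n" using \<eta>(1) by auto
    show "1 < a" "3 ^ ?n \<le> a" "(real ?n + 2) ^ ?n \<le> a" unfolding a_def using pos by linarith+
    have "15 ^ ?n / \<eta> \<le> a" unfolding a_def using pos by linarith
    then show "15 ^ ?n \<le> \<eta> * a" using \<eta>(1) by (simp add: field_simps)
  qed
  \<comment> \<open>The loss in \<open>null_above_lev\<close>.\<close>
  define M :: real where "M = 2 * 5 ^ ?n"
  have M: "0 < M" by (simp add: M_def)
  \<comment> \<open>With this exponent the powers of the levels grow by 5/4 per step, while the
    weights decay by 1/2; the product 5/8 is summable.\<close>
  define \<delta> where "\<delta> = ln (5/4) / ln a"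
  have \<delta>: "0 < \<delta>" "a powr \<delta> = 5/4" using a(1) by (simp_all add: \<delta>_def powr_def)
  \<comment> \<open>Here 25/16 is (5/4) squared, from the exponent k + 2, and 8/3 is the sum of the
    powers of 5/8.\<close>
  define S where "S = M powr \<delta> * (25/16) * (8/3)"
  define Cf where "Cf = 1 + (M * a) powr \<delta> + S * (K / c) powr p"
  have S0: "0 \<le> S" by (simp add: S_def)
  have Cf: "0 < Cf" unfolding Cf_def using S0 by (intro add_pos_nonneg) auto
  \<comment> \<open>Finite families first: their union is bounded, so v is integrable and its level
    sets have finite measure, as \<open>mx_integral_decay\<close> demands.\<close>
  have main: "(\<Sum>Q\<in>\<Q>. epow (cube_avg Q (\<lambda>x. ennreal (w x powr (1 + \<delta>)))) (1 / (1 + \<delta>)) * emeasure lebesgue Q)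
      \<le> ennreal Cf * ?J (\<Union>\<Q>)"
    if fin: "finite \<Q>" and cub: "\<forall>Q\<in>\<Q>. cube (Q :: (real^'n) set)" and dj: "disjoint \<Q>" for \<Q>
  proof -
    let ?\<Omega> = "\<Union>\<Q>"
    define W where "W Q = enn2real (cube_avg Q (\<lambda>x. ennreal (w x)))" for Q
    \<comment> \<open>On a cube with \<open>W Q = 0\<close> the quotient is 0 by convention, so v
      vanishes there and its average stays at most 1.\<close>
    define v where "v x = (\<Sum>Q\<in>\<Q>. indicator Q x * (w x / W Q))" for x
    have W0: "0 \<le> W Q" for Q by (simp add: W_def)
    have Qs: "Q \<in> sets lebesgue" if "Q \<in> \<Q>" for Q using cub that by (auto simp: cube_iff)
    have Us: "?\<Omega> \<in> sets lebesgue" using fin Qs by (intro sets.finite_Union) auto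
    have vQ: "v x = w x / W Q" if "Q \<in> \<Q>" "x \<in> Q" for x Q
    proof -
      have "v x = (\<Sum>Q'\<in>{Q}. indicator Q' x * (w x / W Q'))"
        unfolding v_def using fin that dj by (intro sum.mono_neutral_right) (auto simp: disjoint_def split: split_indicator)
      then show ?thesis using that by simp
    qed
    have v0: "v x = 0" if "x \<notin> ?\<Omega>" for x
      unfolding v_def using that by (intro sum.neutral) auto
    have vnn: "0 \<le> v x" for x
      unfolding v_def using weight_nonneg[OF w] W0 by (intro sum_nonneg mult_nonneg_nonneg divide_nonneg_nonneg) auto
    have vm: "v \<in> borel_measurable lebesgue"
      unfolding v_def
    proof (rule borel_measurable_sum)
      fix Q assume "Q \<in> \<Q>"
      then show "(\<lambda>x. indicator Q x * (w x / W Q)) \<in> borel_measurable lebesgue"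
        using Qs wm by (intro borel_measurable_times borel_measurable_indicator borel_measurable_divide) auto
    qed
    let ?v = "\<lambda>x. ennreal (v x)"
    have evm: "?v \<in> borel_measurable lebesgue" using vm by measurable
    have vint: "(\<integral>\<^sup>+x\<in>Q. ?v x \<partial>lebesgue) \<le> emeasure lebesgue Q" if Q: "Q \<in> \<Q>" for Q
    proof (cases "W Q = 0")
      case True
      then have "(\<integral>\<^sup>+x\<in>Q. ?v x \<partial>lebesgue) = (\<integral>\<^sup>+x. 0 \<partial>(lebesgue :: (real^'n) measure))"
        using vQ[OF Q] by (intro nn_integral_cong) (auto split: split_indicator)
      then show ?thesis by simp
    next
      case False
      then have Wp: "0 < W Q" using W0[of Q] by simp
      have "cube Q" using cub Q by blast
      then obtain q s where s: "0 < s" "Q = hbox q s" by (auto simp: cube_iff)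
      have "cube_avg Q (\<lambda>x. ennreal (w x)) < \<infinity>"
        using Wp unfolding W_def by (metis enn2real_top infinity_ennreal_def less_irrefl less_top)
      then have Wc: "ennreal (W Q) = cube_avg Q (\<lambda>x. ennreal (w x))" by (simp add: W_def)
      have "(\<integral>\<^sup>+x\<in>Q. ?v x \<partial>lebesgue) = (\<integral>\<^sup>+x. ennreal (1 / W Q) * (ennreal (w x) * indicator Q x) \<partial>lebesgue)"
        using vQ[OF Q] Wp weight_nonneg[OF w]
        by (intro nn_integral_cong) (auto simp flip: ennreal_mult split: split_indicator)
      also have "\<dots> = ennreal (1 / W Q) * (\<integral>\<^sup>+x\<in>Q. ennreal (w x) \<partial>lebesgue)"
        using wm Qs[OF Q] by (intro nn_integral_cmult) auto
      also have "(\<integral>\<^sup>+x\<in>Q. ennreal (w x) \<partial>lebesgue) = ennreal (W Q) * emeasure lebesgue Q"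
        unfolding Wc cube_avg_def using s by (simp add: ennreal_divide_times emeasure_hbox)
      also have "ennreal (1 / W Q) * (ennreal (W Q) * emeasure lebesgue Q) = emeasure lebesgue Q"
        using Wp by (subst ennreal_mult_left_assoc) auto
      finally show ?thesis by simp
    qed
    have sumQ: "(\<Sum>Q\<in>\<Q>. \<integral>\<^sup>+x\<in>Q. g x \<partial>lebesgue) = (\<integral>\<^sup>+x\<in>?\<Omega>. g x \<partial>lebesgue)"
      if g: "g \<in> borel_measurable lebesgue" for g
    proof -
      have "disjoint_family_on (\<lambda>Q. Q) \<Q>" using dj unfolding disjoint_family_on_def disjoint_def by blast
      then have "(\<Sum>Q\<in>\<Q>. emeasure (density lebesgue g) Q) = emeasure (density lebesgue g) (\<Union>Q\<in>\<Q>. Q)"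
        using Qs fin by (intro sum_emeasure) auto
      then show ?thesis using g Qs Us by (simp add: emeasure_density)
    qed
    have wle: "weight_of w ?\<Omega> \<le> ?J ?\<Omega>"
      unfolding weight_of_def
    proof (rule nn_integral_mono)
      fix x show "ennreal (w x) * indicator ?\<Omega> x \<le> epow (mx (indicator ?\<Omega>) x) p * ennreal (w x)"
      proof (cases "x \<in> ?\<Omega>")
        case True
        then obtain Q where Q: "Q \<in> \<Q>" "x \<in> Q" by blast
        have "1 \<le> mx (indicator ?\<Omega>) x" using Q cub by (intro mx_indicator_ge_1[of Q]) auto
        then have "epow 1 p \<le> epow (mx (indicator ?\<Omega>) x) p" using p by (intro epow_mono) auto
        then have "1 * ennreal (w x) \<le> epow (mx (indicator ?\<Omega>) x) p * ennreal (w x)" by (intro mult_right_mono) auto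
        then show ?thesis using True by simp
      qed simp
    qed
    have Ofin: "emeasure lebesgue ?\<Omega> < \<infinity>"
    proof -
      have "bounded Q" if "Q \<in> \<Q>" for Q
      proof -
        have "cube Q" using cub that by blast
        then show ?thesis using bounded_hbox unfolding cube_iff by auto
      qed
      then have "bounded ?\<Omega>" using fin by (intro bounded_Union) auto
      then obtain R where "\<forall>y\<in>?\<Omega>. dist 0 y \<le> R" using bounded_any_center[of ?\<Omega> 0] by blast
      then have "?\<Omega> \<subseteq> ball 0 (R + 1)" by force
      then have "emeasure lebesgue ?\<Omega> \<le> emeasure lebesgue (ball (0::real^'n) (R + 1))" by (intro emeasure_mono) auto
      also have "\<dots> < \<infinity>" by (rule emeasure_ball_finite)
      finally show ?thesis .
    qed
    have vfin: "(\<integral>\<^sup>+x. ?v x \<partial>lebesgue) < \<infinity>"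
    proof -
      have "(\<integral>\<^sup>+x. ?v x \<partial>lebesgue) = (\<integral>\<^sup>+x\<in>?\<Omega>. ?v x \<partial>lebesgue)"
        using v0 by (intro nn_integral_cong) (auto split: split_indicator)
      also have "\<dots> = (\<Sum>Q\<in>\<Q>. \<integral>\<^sup>+x\<in>Q. ?v x \<partial>lebesgue)" by (rule sumQ[OF evm, symmetric])
      also have "\<dots> \<le> (\<Sum>Q\<in>\<Q>. \<integral>\<^sup>+x\<in>Q. 1 \<partial>lebesgue)"
        using vint Qs by (intro sum_mono) (simp add: nn_integral_indicator)
      also have "\<dots> = emeasure lebesgue ?\<Omega>" using Us by (subst sumQ) auto
      finally show ?thesis using Ofin by (rule le_less_trans)
    qed
    let ?L = "\<lambda>k. lev ?v (a ^ (k + 1))"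
    have L0: "?J (lev ?v a) \<le> ennreal ((K / c) powr p) * ?J ?\<Omega>"
    proof -
      have sub: "lev ?v a \<subseteq> lev (indicator ?\<Omega>) c"
        by (rule c(2)[OF fin cub dj vint evm _ a(4)]) (simp_all add: v0)
      have "?J (lev ?v a) \<le> (\<integral>\<^sup>+x. ennreal ((K / c) powr p) * (epow (mx (indicator ?\<Omega>) x) p * ennreal (w x)) \<partial>lebesgue)"
      proof (rule nn_integral_mono)
        fix x
        have "mx (indicator (lev ?v a)) x \<le> mx (indicator (lev (indicator ?\<Omega>) c)) x"
          by (rule mx_indicator_mono[OF sub])
        also have "\<dots> \<le> ennreal (K / c) * mx (indicator ?\<Omega>) x"
          using Us c(1) by (intro K(2) borel_measurable_indicator) auto
        finally have "epow (mx (indicator (lev ?v a)) x) p \<le> epow (ennreal (K / c) * mx (indicator ?\<Omega>) x) p"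
          using p by (intro epow_mono) auto
        also have "\<dots> = ennreal ((K / c) powr p) * epow (mx (indicator ?\<Omega>) x) p"
          using K(1) c(1) p by (intro epow_mult) auto
        finally have "epow (mx (indicator (lev ?v a)) x) p * ennreal (w x) \<le> ennreal ((K / c) powr p) * epow (mx (indicator ?\<Omega>) x) p * ennreal (w x)"
          by (rule mult_right_mono) simp
        then show "epow (mx (indicator (lev ?v a)) x) p * ennreal (w x) \<le> ennreal ((K / c) powr p) * (epow (mx (indicator ?\<Omega>) x) p * ennreal (w x))"
          by (simp add: mult.assoc)
      qed
      also have "\<dots> = ennreal ((K / c) powr p) * ?J ?\<Omega>"
        using wm by (intro nn_integral_cmult) measurable
      finally show ?thesis .
    qed
    have wL: "weight_of w {x. M * a ^ (k + 1) < v x} \<le> ennreal ((1/2) ^ k) * (ennreal ((K / c) powr p) * ?J ?\<Omega>)" for k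
    proof -
      let ?A = "{x. M * a ^ (k + 1) < v x}"
      have As: "?A \<in> sets lebesgue"
      proof -
        have "{x \<in> space lebesgue. M * a ^ (k + 1) < v x} \<in> sets lebesgue" using vm by measurable
        then show ?thesis by simp
      qed
      have ap: "0 < a ^ (k + 1)" using a by simp
      have "{x. ennreal (2 * 5 ^ ?n * a ^ (k + 1)) < ?v x} = ?A"
        unfolding M_def using vnn ap by (auto simp: ennreal_less_iff simp del: power_Suc)
      then have "emeasure lebesgue (?A - ?L k) = 0" using null_above_lev[OF evm ap] by simp
      then have "?A - ?L k \<in> null_sets lebesgue" using As by (intro null_setsI) auto
      then have "AE x in lebesgue. x \<notin> ?A - ?L k" by (rule AE_not_in)
      then have "weight_of w ?A \<le> weight_of w (?L k)"
        unfolding weight_of_def by (intro nn_integral_mono_AE) (auto elim!: eventually_mono split: split_indicator)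
      also have "\<dots> \<le> ?J (?L k)" by (intro weight_of_le_mx open_lev) auto
      also have "\<dots> \<le> ennreal ((1/2) ^ k) * ?J (lev ?v a)"
        by (rule iterated_level_bound[OF evm vfin a(1-3) \<eta>(2)])
      also have "\<dots> \<le> ennreal ((1/2) ^ k) * (ennreal ((K / c) powr p) * ?J ?\<Omega>)"
        by (intro mult_left_mono L0) simp
      finally show ?thesis .
    qed
    have geo: "(\<Sum>k. ennreal ((M * a ^ (k + 2)) powr \<delta>) * ennreal ((1/2) ^ k)) = ennreal S"
    proof -
      have "(M * a ^ (k + 2)) powr \<delta> = M powr \<delta> * (25/16) * (5/4) ^ k" for k
      proof -
        have "(a ^ (k + 2)) powr \<delta> = (a powr \<delta>) ^ (k + 2)"
        proof -
          have "(a ^ m) powr \<delta> = (a powr \<delta>) ^ m" for m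
            using a(1) by (induction m) (auto simp: powr_mult)
          then show ?thesis .
        qed
        also have "\<dots> = (25/16) * (5/4) ^ k" unfolding \<delta>(2) by (simp add: power_add power2_eq_square)
        finally have "(a ^ (k + 2)) powr \<delta> = (25/16) * (5/4) ^ k" .
        then show ?thesis using M a(1) by (simp add: powr_mult)
      qed
      then have "(\<Sum>k. ennreal ((M * a ^ (k + 2)) powr \<delta>) * ennreal ((1/2) ^ k)) = (\<Sum>k. ennreal (M powr \<delta> * (25/16) * (5/8) ^ k))"
        by (intro suminf_cong) (simp add: power_divide power_mult_distrib[symmetric] flip: ennreal_mult)
      also have "\<dots> = ennreal S"
      proof (rule suminf_ennreal_eq)
        have "(\<lambda>k. (5/8) ^ k) sums (1 / (1 - 5/8 :: real))" by (rule geometric_sums) simp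
        then have "(\<lambda>k. M powr \<delta> * (25/16) * (5/8) ^ k) sums (M powr \<delta> * (25/16) * (1 / (1 - 5/8)))"
          by (rule sums_mult)
        then show "(\<lambda>k. M powr \<delta> * (25/16) * (5/8) ^ k) sums S" by (simp add: S_def)
      qed simp
      finally show ?thesis .
    qed
    have key: "(\<integral>\<^sup>+x\<in>?\<Omega>. ennreal (v x powr \<delta>) * ennreal (w x) \<partial>lebesgue)
      \<le> ennreal ((M * a) powr \<delta>) * ?J ?\<Omega> + ennreal S * (ennreal ((K / c) powr p) * ?J ?\<Omega>)"
    proof -
      let ?c = "\<lambda>k. ennreal ((M * a ^ (k + 2)) powr \<delta>)"
      let ?A = "\<lambda>k. {x. M * a ^ (k + 1) < v x}"
      have As: "?A k \<in> sets lebesgue" for k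
      proof -
        have "{x \<in> space lebesgue. M * a ^ (k + 1) < v x} \<in> sets lebesgue" using vm by measurable
        then show ?thesis by simp
      qed
      have "(\<integral>\<^sup>+x\<in>?\<Omega>. ennreal (v x powr \<delta>) * ennreal (w x) \<partial>lebesgue)
        \<le> (\<integral>\<^sup>+x. ennreal ((M * a) powr \<delta>) * (ennreal (w x) * indicator ?\<Omega> x) + (\<Sum>k. ?c k * (ennreal (w x) * indicator (?A k) x)) \<partial>lebesgue)"
      proof (rule nn_integral_mono)
        fix x
        have "ennreal (v x powr \<delta>) * (ennreal (w x) * indicator ?\<Omega> x)
          \<le> (ennreal ((M * a) powr \<delta>) + (\<Sum>k. ?c k * indicator {u. M * a ^ (k + 1) < u} (v x))) * (ennreal (w x) * indicator ?\<Omega> x)"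
          by (intro mult_right_mono powr_le_geometric_suminf vnn M a \<delta>) simp
        also have "\<dots> = ennreal ((M * a) powr \<delta>) * (ennreal (w x) * indicator ?\<Omega> x) +
          (\<Sum>k. ?c k * indicator {u. M * a ^ (k + 1) < u} (v x) * (ennreal (w x) * indicator ?\<Omega> x))"
          by (simp add: distrib_right)
        also have "(\<Sum>k. ?c k * indicator {u. M * a ^ (k + 1) < u} (v x) * (ennreal (w x) * indicator ?\<Omega> x))
          \<le> (\<Sum>k. ?c k * (ennreal (w x) * indicator (?A k) x))"
          by (intro suminf_le) (auto split: split_indicator)
        finally show "ennreal (v x powr \<delta>) * ennreal (w x) * indicator ?\<Omega> x
          \<le> ennreal ((M * a) powr \<delta>) * (ennreal (w x) * indicator ?\<Omega> x) + (\<Sum>k. ?c k * (ennreal (w x) * indicator (?A k) x))"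
          by (simp add: mult.assoc add_left_mono)
      qed
      also have "\<dots> = ennreal ((M * a) powr \<delta>) * weight_of w ?\<Omega> + (\<Sum>k. ?c k * weight_of w (?A k))"
      proof -
        have m1: "(\<lambda>x. ennreal (w x) * indicator ?\<Omega> x) \<in> borel_measurable lebesgue"
          using wm Us by (intro borel_measurable_times_ennreal borel_measurable_indicator) auto
        have m2: "(\<lambda>x. ennreal (w x) * indicator (?A k) x) \<in> borel_measurable lebesgue" for k
          using wm As[of k] by (intro borel_measurable_times_ennreal borel_measurable_indicator) auto
        show ?thesis
          unfolding weight_of_def using m1 m2
          by (subst nn_integral_add, simp, simp, subst nn_integral_suminf) (simp_all add: nn_integral_cmult)
      qed
      also have "(\<Sum>k. ?c k * weight_of w (?A k)) \<le> (\<Sum>k. ?c k * (ennreal ((1/2) ^ k) * (ennreal ((K / c) powr p) * ?J ?\<Omega>)))"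
        by (intro suminf_le mult_left_mono wL) auto
      also have "\<dots> = ennreal S * (ennreal ((K / c) powr p) * ?J ?\<Omega>)"
        unfolding geo[symmetric] ennreal_suminf_multc[symmetric] by (simp only: mult.assoc)
      finally show ?thesis
        using wle by (meson add_mono mult_left_mono order_refl order_trans zero_le)
    qed
    have "(\<Sum>Q\<in>\<Q>. epow (cube_avg Q (\<lambda>x. ennreal (w x powr (1 + \<delta>)))) (1 / (1 + \<delta>)) * emeasure lebesgue Q)
      \<le> (\<Sum>Q\<in>\<Q>. weight_of w Q + (\<integral>\<^sup>+x\<in>Q. ennreal (v x powr \<delta>) * ennreal (w x) \<partial>lebesgue))"
    proof (rule sum_mono)
      fix Q assume Q: "Q \<in> \<Q>"
      then have "cube Q" using cub by blast
      from powr_average_le[OF w this \<delta>(1)]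
      have "epow (cube_avg Q (\<lambda>x. ennreal (w x powr (1 + \<delta>)))) (1 / (1 + \<delta>)) * emeasure lebesgue Q
        \<le> weight_of w Q + (\<integral>\<^sup>+x\<in>Q. ennreal ((w x / W Q) powr \<delta>) * ennreal (w x) \<partial>lebesgue)"
        by (simp add: W_def)
      also have "(\<integral>\<^sup>+x\<in>Q. ennreal ((w x / W Q) powr \<delta>) * ennreal (w x) \<partial>lebesgue)
        = (\<integral>\<^sup>+x\<in>Q. ennreal (v x powr \<delta>) * ennreal (w x) \<partial>lebesgue)"
        using vQ[OF Q] by (intro nn_integral_cong) (auto split: split_indicator)
      finally show "epow (cube_avg Q (\<lambda>x. ennreal (w x powr (1 + \<delta>)))) (1 / (1 + \<delta>)) * emeasure lebesgue Q
        \<le> weight_of w Q + (\<integral>\<^sup>+x\<in>Q. ennreal (v x powr \<delta>) * ennreal (w x) \<partial>lebesgue)" .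
    qed
    also have "\<dots> = weight_of w ?\<Omega> + (\<integral>\<^sup>+x\<in>?\<Omega>. ennreal (v x powr \<delta>) * ennreal (w x) \<partial>lebesgue)"
    proof -
      have "(\<lambda>x. ennreal (v x powr \<delta>) * ennreal (w x)) \<in> borel_measurable lebesgue" using vm wm by measurable
      moreover have "(\<lambda>x. ennreal (w x)) \<in> borel_measurable lebesgue" using wm by measurable
      ultimately show ?thesis unfolding sum.distrib weight_of_def by (simp only: sumQ)
    qed
    also have "\<dots> \<le> ?J ?\<Omega> + (ennreal ((M * a) powr \<delta>) * ?J ?\<Omega> + ennreal S * (ennreal ((K / c) powr p) * ?J ?\<Omega>))"
      by (intro add_mono wle key)
    also have "\<dots> = ennreal Cf * ?J ?\<Omega>"
    proof -
      have "ennreal Cf = 1 + (ennreal ((M * a) powr \<delta>) + ennreal (S * (K / c) powr p))"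
        unfolding Cf_def using S0 by (simp add: add.assoc flip: ennreal_plus ennreal_1)
      then show ?thesis using S0 by (simp add: distrib_right ennreal_mult_left_assoc)
    qed
    finally show ?thesis .
  qed
  have "(\<Sum>\<^sub>\<infinity>Q\<in>\<Q>. epow (cube_avg Q (\<lambda>x. ennreal (w x powr (1 + \<delta>)))) (1 / (1 + \<delta>)) * emeasure lebesgue Q)
      \<le> ennreal Cf * ?J (\<Union>\<Q>)"
    if cub: "\<forall>Q\<in>\<Q>. cube (Q :: (real^'n) set)" and dj: "disjoint \<Q>" for \<Q>
  \<comment> \<open>An infinite sum is the supremum of its finite partial sums, and the right side
    only grows when the subfamily is replaced by the whole family.\<close>
  proof (subst nonneg_infsum_complete, simp, rule SUP_least)
    fix F assume "F \<in> {F. finite F \<and> F \<subseteq> \<Q>}"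
    then have F: "finite F" "F \<subseteq> \<Q>" by auto
    have "(\<Sum>Q\<in>F. epow (cube_avg Q (\<lambda>x. ennreal (w x powr (1 + \<delta>)))) (1 / (1 + \<delta>)) * emeasure lebesgue Q) \<le> ennreal Cf * ?J (\<Union>F)"
      using F cub pairwise_subset[OF dj F(2)] by (intro main) auto
    also have "\<dots> \<le> ennreal Cf * ?J (\<Union>\<Q>)"
      using F(2) p by (intro mult_left_mono nn_integral_mono mult_right_mono epow_mono mx_indicator_mono) auto
    finally show "(\<Sum>Q\<in>F. epow (cube_avg Q (\<lambda>x. ennreal (w x powr (1 + \<delta>)))) (1 / (1 + \<delta>)) * emeasure lebesgue Q) \<le> ennreal Cf * ?J (\<Union>\<Q>)" .
  qed
  then show ?thesis
    unfolding SC_def hl_maximal_indicator using w Cf \<delta>(1)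
    by (intro CollectI conjI exI[of _ Cf] exI[of _ "1 + \<delta>"]) auto
qed

section \<open>Kernels and operators with a Dini modulus\<close>

text \<open>Fubini's theorem on a product of Borel measures asks for Borel functions. The value
  \<infinity> on a Borel null set makes the replacement a majorant everywhere and not only almost
  everywhere.\<close>

lemma borel_majorant:
  fixes g :: "'a::euclidean_space \<Rightarrow> ennreal"
  assumes "g \<in> borel_measurable lebesgue"
  obtains h where "h \<in> borel_measurable borel" "\<And>x. g x \<le> h x" "AE x in lborel. g x = h x"
proof -
  obtain g' where g': "g' \<in> borel_measurable lborel" "AE x in lborel. g x = g' x"
    using completion_ex_borel_measurable[OF assms] by blast
  obtain N where N: "\<And>x. x \<notin> N \<Longrightarrow> g x = g' x" "N \<in> null_sets lborel"
    using AE_E3[OF g'(2)] by auto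
  show thesis
  proof (rule that[of "\<lambda>x. if x \<in> N then \<infinity> else g' x"])
    show "(\<lambda>x. if x \<in> N then \<infinity> else g' x) \<in> borel_measurable borel"
      using g'(1) N(2) by (intro measurable_If_set) (auto simp: null_sets_def)
    show "AE x in lborel. g x = (if x \<in> N then \<infinity> else g' x)"
      using AE_not_in[OF N(2)] by eventually_elim (use N in auto)
  qed (use N in auto)
qed

text \<open>F plays the part of \<open>\<omega> t / t\<close>, and its integral over a window of t
  comparable to the ratio of the distances replaces the value of the modulus at that ratio. The
  separation by the factor 8 leaves room to move the intermediate point of comparison.\<close>

definition kernel_modulus :: "(real^'n \<Rightarrow> real^'n \<Rightarrow> complex) \<Rightarrow> (real \<Rightarrow> ennreal) \<Rightarrow> real \<Rightarrow> bool" where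
  "kernel_modulus K F C \<longleftrightarrow> 0 < C \<and> F \<in> borel_measurable borel \<and> (\<integral>\<^sup>+t. F t \<partial>lborel) < \<infinity> \<and>
    (\<forall>x x' y. x \<noteq> y \<longrightarrow> 8 * dist x x' \<le> dist x y \<longrightarrow>
      ennreal (norm (K x y - K x' y)) \<le> ennreal (C / dist x y ^ CARD('n)) *
        (\<integral>\<^sup>+t\<in>{dist x x' / (2 * dist x y)<..<4 * dist x x' / dist x y}. F t \<partial>lborel))"

text \<open>The modulus \<open>\<omega>\<close> need not be monotone. Comparing \<open>K x y\<close> and \<open>K x' y\<close> with \<open>K x'' y\<close>
  for all points \<open>x''\<close> on the line through \<open>x\<close> and \<open>x'\<close> at distance between \<open>2d\<close> and \<open>3d\<close> from \<open>x\<close>, where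
  \<open>d\<close> is the distance of \<open>x\<close> and \<open>x'\<close>, and averaging over \<open>x''\<close> replaces \<open>\<omega>\<close> by its averages.\<close>

lemma dini_smooth_kernel_modulus:
  fixes K :: "real^'n \<Rightarrow> real^'n \<Rightarrow> complex"
  assumes "dini_smooth_kernel K"
  obtains F C where "kernel_modulus K F C"
proof -
  let ?n = "CARD('n)"
  obtain \<omega> where \<omega>: "dini \<omega>" and sm: "\<And>x x' y. norm (x - x') < norm (x - y) / 2 \<Longrightarrow>
           norm (K x y - K x' y) \<le> \<omega> (norm (x - x') / norm (x - y)) * (1 / norm (x - y) ^ ?n)"
    using assms unfolding dini_smooth_kernel_def by blast
  have nn: "0 \<le> \<omega> t" for t using \<omega> by (simp add: dini_def)
  have int: "integrable lebesgue (\<lambda>t. indicator {0<..<1} t *\<^sub>R (\<omega> t / t))"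
    using \<omega> by (simp add: dini_def set_integrable_def)
  define g where "g t = ennreal (indicator {0<..<1} t *\<^sub>R (\<omega> t / t))" for t
  have gm: "g \<in> borel_measurable lebesgue"
    unfolding g_def using borel_measurable_integrable[OF int] by measurable
  obtain F where F: "F \<in> borel_measurable borel" "\<And>x. g x \<le> F x" "AE x in lborel. g x = F x"
    by (rule borel_majorant[OF gm]) blast
  have "(\<integral>\<^sup>+t. F t \<partial>lborel) = (\<integral>\<^sup>+t. g t \<partial>lborel)"
    using F(3) by (intro nn_integral_cong_AE) auto
  also have "\<dots> = (\<integral>\<^sup>+t. g t \<partial>lebesgue)" by (simp add: nn_integral_completion)
  also have "\<dots> = (\<integral>\<^sup>+t. ennreal (norm (indicator {0<..<1} t *\<^sub>R (\<omega> t / t))) \<partial>lebesgue)"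
    unfolding g_def using nn by (intro nn_integral_cong) (auto split: split_indicator)
  also have "\<dots> < \<infinity>" using int by (simp add: integrable_iff_bounded)
  finally have Ffin: "(\<integral>\<^sup>+t. F t \<partial>lborel) < \<infinity>" .
  have \<omega>F: "ennreal (\<omega> t) \<le> ennreal t * F t" if "0 < t" "t < 1" for t
  proof -
    have "ennreal (\<omega> t) = ennreal t * ennreal (\<omega> t / t)" using that nn by (simp flip: ennreal_mult)
    also have "ennreal (\<omega> t / t) \<le> F t" using F(2)[of t] that by (simp add: g_def)
    finally show ?thesis by (simp add: mult_left_mono)
  qed
  \<comment> \<open>3 s bounds \<tau> and 2 s bounds \<tau> - s below; \<open>(8/7) ^ n\<close>
    bounds the n-th power of r/r'.\<close>
  define C :: real where "C = 3 + 2 * (8/7) ^ ?n"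
  have "kernel_modulus K F C"
    unfolding kernel_modulus_def
  proof (intro conjI allI impI)
    show "0 < C" by (simp add: C_def add_pos_pos)
    fix x x' y :: "real^'n"
    assume xy: "x \<noteq> y" and d8: "8 * dist x x' \<le> dist x y"
    define d r r' where "d = dist x x'" and "r = dist x y" and "r' = dist x' y"
    define \<Delta> where "\<Delta> = norm (K x y - K x' y) * r ^ ?n"
    have r: "0 < r" using xy by (simp add: r_def)
    have rn: "norm (x - y) = r" "norm (x' - y) = r'" by (simp_all add: r_def r'_def dist_norm)
    show "ennreal (norm (K x y - K x' y)) \<le> ennreal (C / dist x y ^ ?n) *
        (\<integral>\<^sup>+t\<in>{dist x x' / (2 * dist x y)<..<4 * dist x x' / dist x y}. F t \<partial>lborel)"
    proof (cases "x = x'")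
      case False
      then have d: "0 < d" by (simp add: d_def)
      have d8': "8 * d \<le> r" using d8 by (simp add: d_def r_def)
      define s where "s = d / r"
      have s: "0 < s" "s \<le> 1/8" using d r d8' by (simp_all add: s_def field_simps)
      define u where "u = (1 / d) *\<^sub>R (x' - x)"
      have u: "norm u = 1" "x' = x + d *\<^sub>R u"
        using d by (simp_all add: u_def d_def dist_norm norm_minus_commute)
      have r'1: "r \<le> r' + d" "r' \<le> r + d"
        using dist_triangle[of x y x'] dist_triangle[of x' y x] by (auto simp: r_def r'_def d_def dist_commute)
      have r': "7/8 * r \<le> r'" "r' \<le> 9/8 * r" "0 < r'" using r'1 d8' r by linarith+
      \<comment> \<open>The second comparison takes place at distance r' from y; \<rho> converts its
        ratio to the scale r.\<close>
      define \<rho> where "\<rho> = r / r'"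
      have \<rho>: "8/9 \<le> \<rho>" "\<rho> \<le> 8/7" "0 < \<rho>" using r r' by (simp_all add: \<rho>_def field_simps)
      have pt: "ennreal \<Delta> \<le> ennreal (3 * s) * F \<tau> + ennreal ((8/7) ^ ?n * (2 * s * \<rho>)) * F ((\<tau> - s) * \<rho>)"
        if \<tau>: "2 * s < \<tau>" "\<tau> < 3 * s" for \<tau>
      proof -
        define x'' where "x'' = x + (\<tau> * r) *\<^sub>R u"
        have n1: "norm (x - x'') = \<tau> * r" using \<tau> s r u by (simp add: x''_def abs_mult)
        have "x' - x'' = (d - \<tau> * r) *\<^sub>R u" unfolding x''_def u(2) by (simp add: algebra_simps)
        moreover have "d = s * r" using r by (simp add: s_def)
        ultimately have "x' - x'' = - (((\<tau> - s) * r) *\<^sub>R u)" by (simp add: algebra_simps)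
        then have n2: "norm (x' - x'') = (\<tau> - s) * r" using \<tau> s r u by (simp add: abs_mult)
        have lt1: "\<tau> * r < r / 2" using \<tau> s r by (simp add: field_simps)
        have "(\<tau> - s) * r \<le> (1/4) * r" using \<tau> s r by (intro mult_right_mono) auto
        then have lt2: "(\<tau> - s) * r < r' / 2" using r' r by linarith
        have e1: "norm (K x y - K x'' y) \<le> \<omega> \<tau> * (1 / r ^ ?n)"
          using sm[of x x'' y] lt1 r unfolding n1 rn by simp
        have e2: "norm (K x' y - K x'' y) \<le> \<omega> ((\<tau> - s) * \<rho>) * (1 / r' ^ ?n)"
          using sm[of x' x'' y] lt2 unfolding n2 rn by (simp add: \<rho>_def)
        have "norm (K x y - K x' y) \<le> norm (K x y - K x'' y) + norm (K x' y - K x'' y)"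
          using norm_triangle_ineq4[of "K x y - K x'' y" "K x' y - K x'' y"] by simp
        also have "\<dots> \<le> \<omega> \<tau> * (1 / r ^ ?n) + \<omega> ((\<tau> - s) * \<rho>) * (1 / r' ^ ?n)" by (intro add_mono e1 e2)
        finally have "\<Delta> \<le> (\<omega> \<tau> * (1 / r ^ ?n) + \<omega> ((\<tau> - s) * \<rho>) * (1 / r' ^ ?n)) * r ^ ?n"
          unfolding \<Delta>_def using r by (intro mult_right_mono) auto
        also have "\<dots> = \<omega> \<tau> + \<omega> ((\<tau> - s) * \<rho>) * \<rho> ^ ?n"
          using r r' by (simp add: \<rho>_def field_simps)
        also have "\<dots> \<le> \<omega> \<tau> + \<omega> ((\<tau> - s) * \<rho>) * (8/7) ^ ?n"
          using \<rho> nn by (intro add_left_mono mult_left_mono power_mono) auto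
        finally have "ennreal \<Delta> \<le> ennreal (\<omega> \<tau> + \<omega> ((\<tau> - s) * \<rho>) * (8/7) ^ ?n)" by (rule ennreal_leI)
        also have "\<dots> = ennreal (\<omega> \<tau>) + ennreal ((8/7) ^ ?n) * ennreal (\<omega> ((\<tau> - s) * \<rho>))"
          using nn by (subst ennreal_plus) (simp_all add: ennreal_mult mult.commute)
        also have "\<dots> \<le> ennreal (3 * s) * F \<tau> + ennreal ((8/7) ^ ?n) * (ennreal (2 * s * \<rho>) * F ((\<tau> - s) * \<rho>))"
        proof (intro add_mono mult_left_mono)
          have "ennreal (\<omega> \<tau>) \<le> ennreal \<tau> * F \<tau>" using \<tau> s by (intro \<omega>F) auto
          also have "\<dots> \<le> ennreal (3 * s) * F \<tau>" using \<tau> by (intro mult_right_mono ennreal_leI) auto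
          finally show "ennreal (\<omega> \<tau>) \<le> ennreal (3 * s) * F \<tau>" .
          have "(\<tau> - s) * \<rho> \<le> (1/4) * (8/7)" using \<tau> s \<rho> by (intro mult_mono) auto
          then have "ennreal (\<omega> ((\<tau> - s) * \<rho>)) \<le> ennreal ((\<tau> - s) * \<rho>) * F ((\<tau> - s) * \<rho>)"
            using \<tau> s \<rho> by (intro \<omega>F) auto
          also have "\<dots> \<le> ennreal (2 * s * \<rho>) * F ((\<tau> - s) * \<rho>)"
            using \<tau> \<rho> by (intro mult_right_mono ennreal_leI) auto
          finally show "ennreal (\<omega> ((\<tau> - s) * \<rho>)) \<le> ennreal (2 * s * \<rho>) * F ((\<tau> - s) * \<rho>)" .
        qed auto
        finally show ?thesis by (simp add: ennreal_mult_left_assoc)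
      qed
      define I where "I = (\<integral>\<^sup>+t\<in>{s / 2<..<4 * s}. F t \<partial>lborel)"
      have I1: "(\<integral>\<^sup>+\<tau>\<in>{2 * s<..<3 * s}. F \<tau> \<partial>lborel) \<le> I"
        unfolding I_def using s by (intro nn_integral_mono) (auto split: split_indicator)
      \<comment> \<open>The substitution \<open>t = (\<tau> - s) * \<rho>\<close> maps the interval
        from 2 s to 3 s to one inside the window from s/2 to 4 s, because \<rho> lies between 1/2
        and 2.\<close>
      have I2: "ennreal \<rho> * (\<integral>\<^sup>+\<tau>. F ((\<tau> - s) * \<rho>) * indicator {2 * s<..<3 * s} \<tau> \<partial>lborel) \<le> I"
      proof -
        have Fm: "(\<lambda>t. F t * indicator {s * \<rho><..<2 * s * \<rho>} t) \<in> borel_measurable borel" using F(1) by measurable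
        have "(\<integral>\<^sup>+t. F t * indicator {s * \<rho><..<2 * s * \<rho>} t \<partial>lborel)
          = ennreal \<bar>\<rho>\<bar> * (\<integral>\<^sup>+\<tau>. F (- s * \<rho> + \<rho> * \<tau>) * indicator {s * \<rho><..<2 * s * \<rho>} (- s * \<rho> + \<rho> * \<tau>) \<partial>lborel)"
          using \<rho> by (intro nn_integral_real_affine[OF Fm]) auto
        also have "(\<integral>\<^sup>+\<tau>. F (- s * \<rho> + \<rho> * \<tau>) * indicator {s * \<rho><..<2 * s * \<rho>} (- s * \<rho> + \<rho> * \<tau>) \<partial>lborel)
          = (\<integral>\<^sup>+\<tau>. F ((\<tau> - s) * \<rho>) * indicator {2 * s<..<3 * s} \<tau> \<partial>lborel)"
        proof (rule nn_integral_cong)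
          fix \<tau>
          have e: "- s * \<rho> + \<rho> * \<tau> = (\<tau> - s) * \<rho>" by (simp add: algebra_simps)
          have "(\<tau> - s) * \<rho> \<in> {s * \<rho><..<2 * s * \<rho>} \<longleftrightarrow> \<tau> \<in> {2 * s<..<3 * s}"
            using \<rho>(3) by (auto simp: mult_less_cancel_right)
          then show "F (- s * \<rho> + \<rho> * \<tau>) * indicator {s * \<rho><..<2 * s * \<rho>} (- s * \<rho> + \<rho> * \<tau>) = F ((\<tau> - s) * \<rho>) * indicator {2 * s<..<3 * s} \<tau>"
            unfolding e by (simp add: indicator_def)
        qed
        finally have eqI: "(\<integral>\<^sup>+t. F t * indicator {s * \<rho><..<2 * s * \<rho>} t \<partial>lborel)
          = ennreal \<bar>\<rho>\<bar> * (\<integral>\<^sup>+\<tau>. F ((\<tau> - s) * \<rho>) * indicator {2 * s<..<3 * s} \<tau> \<partial>lborel)" .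
        have "(\<integral>\<^sup>+t. F t * indicator {s * \<rho><..<2 * s * \<rho>} t \<partial>lborel) \<le> I"
        proof -
          have "s * (1/2) \<le> s * \<rho>" "2 * s * \<rho> \<le> 2 * s * 2" using s \<rho> by (intro mult_left_mono; simp)+
          then have "{s * \<rho><..<2 * s * \<rho>} \<subseteq> {s / 2<..<4 * s}" unfolding greaterThanLessThan_subseteq_greaterThanLessThan by linarith
          then show ?thesis unfolding I_def by (intro nn_integral_mono mult_left_mono) (auto split: split_indicator simp del: greaterThanLessThan_iff)
        qed
        then show ?thesis unfolding eqI using \<rho>(3) by simp
      qed
      \<comment> \<open>Integration of \<open>pt\<close> over \<tau>, an interval of length s; this
        s is cancelled at the end against the factors s on the right.\<close>
      have "ennreal \<Delta> * ennreal s = (\<integral>\<^sup>+\<tau>. ennreal \<Delta> * indicator {2 * s<..<3 * s} \<tau> \<partial>lborel)"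
        using s by (subst nn_integral_cmult_indicator) auto
      also have "\<dots> \<le> (\<integral>\<^sup>+\<tau>. ennreal (3 * s) * (F \<tau> * indicator {2 * s<..<3 * s} \<tau>) +
         ennreal ((8/7) ^ ?n * (2 * s * \<rho>)) * (F ((\<tau> - s) * \<rho>) * indicator {2 * s<..<3 * s} \<tau>) \<partial>lborel)"
        using pt by (intro nn_integral_mono) (auto split: split_indicator)
      also have "\<dots> = ennreal (3 * s) * (\<integral>\<^sup>+\<tau>\<in>{2 * s<..<3 * s}. F \<tau> \<partial>lborel) +
         ennreal ((8/7) ^ ?n * (2 * s * \<rho>)) * (\<integral>\<^sup>+\<tau>. F ((\<tau> - s) * \<rho>) * indicator {2 * s<..<3 * s} \<tau> \<partial>lborel)"
      proof -
        have m1: "(\<lambda>\<tau>. F \<tau> * indicator {2 * s<..<3 * s} \<tau>) \<in> borel_measurable lborel"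
          "(\<lambda>\<tau>. F ((\<tau> - s) * \<rho>) * indicator {2 * s<..<3 * s} \<tau>) \<in> borel_measurable lborel"
          using F(1) by measurable
        then show ?thesis by (subst nn_integral_add) (auto simp: nn_integral_cmult)
      qed
      also have "\<dots> \<le> ennreal (3 * s) * I + ennreal ((8/7) ^ ?n * (2 * s)) * I"
      proof (intro add_mono mult_left_mono I1)
        have "ennreal ((8/7) ^ ?n * (2 * s * \<rho>)) * (\<integral>\<^sup>+\<tau>. F ((\<tau> - s) * \<rho>) * indicator {2 * s<..<3 * s} \<tau> \<partial>lborel)
          = ennreal ((8/7) ^ ?n * (2 * s)) * (ennreal \<rho> * (\<integral>\<^sup>+\<tau>. F ((\<tau> - s) * \<rho>) * indicator {2 * s<..<3 * s} \<tau> \<partial>lborel))"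
          using s by (subst ennreal_mult_left_assoc) (auto simp: mult_ac)
        also have "\<dots> \<le> ennreal ((8/7) ^ ?n * (2 * s)) * I" by (intro mult_left_mono I2) simp
        finally show "ennreal ((8/7) ^ ?n * (2 * s * \<rho>)) * (\<integral>\<^sup>+\<tau>. F ((\<tau> - s) * \<rho>) * indicator {2 * s<..<3 * s} \<tau> \<partial>lborel) \<le> ennreal ((8/7) ^ ?n * (2 * s)) * I" .
      qed simp
      also have "\<dots> = ennreal s * (ennreal C * I)"
      proof -
        have "ennreal (3 * s) + ennreal ((8/7) ^ ?n * (2 * s)) = ennreal (s * C)"
          using s by (subst ennreal_plus[symmetric]) (auto simp: C_def algebra_simps)
        then show ?thesis using s by (simp add: distrib_right[symmetric] ennreal_mult_left_assoc)
      qed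
      finally have "ennreal s * ennreal \<Delta> \<le> ennreal s * (ennreal C * I)" by (simp add: mult.commute)
      then have \<Delta>I: "ennreal \<Delta> \<le> ennreal C * I"
        using s by (subst (asm) ennreal_mult_le_mult_iff) auto
      have "ennreal (norm (K x y - K x' y)) = ennreal (1 / r ^ ?n) * ennreal \<Delta>"
        unfolding \<Delta>_def using r by (simp flip: ennreal_mult)
      also have "\<dots> \<le> ennreal (1 / r ^ ?n) * (ennreal C * I)" by (intro mult_left_mono \<Delta>I) simp
      also have "\<dots> = ennreal (C / r ^ ?n) * I" using r by (subst ennreal_mult_left_assoc) auto
      also have "I = (\<integral>\<^sup>+t\<in>{d / (2 * r)<..<4 * d / r}. F t \<partial>lborel)"
        unfolding I_def s_def by (simp add: mult.commute)
      finally show ?thesis unfolding d_def r_def .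
    qed simp
  qed (use F Ffin in auto)
  then show thesis by (rule that)
qed

lemma kernel_modulus_pointwise:
  fixes K :: "real^'n \<Rightarrow> real^'n \<Rightarrow> complex"
  assumes "kernel_modulus K F C" "x \<noteq> y" "8 * dist x x' \<le> dist x y"
  shows "norm (K x y - K x' y) \<le> C * enn2real (\<integral>\<^sup>+t. F t \<partial>lborel) / dist x y ^ CARD('n)"
proof -
  let ?I = "\<integral>\<^sup>+t. F t \<partial>lborel"
  have C: "0 < C" "?I < \<infinity>" using assms(1) by (auto simp: kernel_modulus_def)
  have "ennreal (norm (K x y - K x' y)) \<le> ennreal (C / dist x y ^ CARD('n)) *
        (\<integral>\<^sup>+t\<in>{dist x x' / (2 * dist x y)<..<4 * dist x x' / dist x y}. F t \<partial>lborel)"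
    using assms unfolding kernel_modulus_def by blast
  also have "\<dots> \<le> ennreal (C / dist x y ^ CARD('n)) * ?I"
    by (intro mult_left_mono nn_integral_mono) (auto split: split_indicator)
  also have "\<dots> = ennreal (C * enn2real ?I / dist x y ^ CARD('n))"
  proof -
    define i where "i = enn2real ?I"
    have "?I = ennreal i" "0 \<le> i" using C by (simp_all add: i_def)
    then show ?thesis unfolding i_def[symmetric] using C by (simp flip: ennreal_mult)
  qed
  finally show ?thesis
    using C by (subst (asm) ennreal_le_iff) auto
qed

text \<open>Fubini in y and t takes the place of a sum over dyadic annuli. For fixed t the window
  puts y at distance between d/(2 t) and 4 d/t from x. If that reaches beyond R, the ball of radius
  4 d/t contains z, so the average of g over it is at most a. The powers of t cancel:
  \<open>(2 * t / d) ^ n * (4 * d / t) ^ n = 8 ^ n\<close>.\<close>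

lemma kernel_difference_integral:
  fixes K :: "real^'n \<Rightarrow> real^'n \<Rightarrow> complex"
  assumes K: "kernel_modulus K F C" and g: "g \<in> borel_measurable lebesgue"
    and R: "0 < R" "8 * dist x x' \<le> R" and z: "z \<in> ball x R" "z \<notin> lev g a" and a: "0 \<le> a"
  shows "(\<integral>\<^sup>+y\<in>{y. R \<le> dist x y}. ennreal (norm (K x y - K x' y)) * g y \<partial>lebesgue)
    \<le> ennreal (C * 8 ^ CARD('n) * measure lborel (ball (0::real^'n) 1) * enn2real (\<integral>\<^sup>+t. F t \<partial>lborel) * a)"
proof (cases "x = x'")
  case True
  then show ?thesis by simp
next
  case False
  let ?n = "CARD('n)" and ?I = "\<integral>\<^sup>+t. F t \<partial>lborel"
  define m where "m = measure lborel (ball (0::real^'n) 1)"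
  have m: "0 < m" by (simp add: m_def)
  have em: "emeasure lebesgue (ball b r) = ennreal (r ^ ?n * m)" if "0 \<le> r" for b :: "real^'n" and r
    using content_ball_conv_unit_ball[of r b] emeasure_lborel_ball_finite[of b r] that
    by (simp add: m_def emeasure_lebesgue_eq_lborel emeasure_eq_ennreal_measure)
  have C: "0 < C" "?I < \<infinity>" and Fm[measurable]: "F \<in> borel_measurable borel"
    using K by (auto simp: kernel_modulus_def)
  define d where "d = dist x x'"
  have d: "0 < d" using False by (simp add: d_def)
  obtain h where h[measurable]: "h \<in> borel_measurable borel" and gh: "\<And>x. g x \<le> h x" "AE x in lborel. g x = h x"
    by (rule borel_majorant[OF g]) blast
  \<comment> \<open>The window is written with one indicator for each of its bounds, so that f is
    visibly jointly measurable.\<close>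
  define f where "f y t = ennreal (C / dist x y ^ ?n) * F t * h y *
     (indicator {t. d / (2 * dist x y) < t} t * indicator {t. t < 4 * d / dist x y} t * indicator {y. R \<le> dist x y} y)" for y t
  have pt: "ennreal (norm (K x y - K x' y)) * g y * indicator {y. R \<le> dist x y} y \<le> (\<integral>\<^sup>+t. f y t \<partial>lborel)" for y
  proof (cases "R \<le> dist x y")
    case True
    then have "ennreal (norm (K x y - K x' y)) \<le> ennreal (C / dist x y ^ ?n) * (\<integral>\<^sup>+t\<in>{d / (2 * dist x y)<..<4 * d / dist x y}. F t \<partial>lborel)"
    proof -
      have "x \<noteq> y" "8 * dist x x' \<le> dist x y" using True R by auto
      then show ?thesis using K unfolding kernel_modulus_def d_def by blast
    qed
    also have "\<dots> = (\<integral>\<^sup>+t. ennreal (C / dist x y ^ ?n) * (F t * indicator {d / (2 * dist x y)<..<4 * d / dist x y} t) \<partial>lborel)"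
      by (intro nn_integral_cmult[symmetric]) measurable
    finally have "ennreal (norm (K x y - K x' y)) * g y \<le> (\<integral>\<^sup>+t. ennreal (C / dist x y ^ ?n) * (F t * indicator {d / (2 * dist x y)<..<4 * d / dist x y} t) \<partial>lborel) * h y"
      using gh(1) by (intro mult_mono) auto
    also have "\<dots> = (\<integral>\<^sup>+t. ennreal (C / dist x y ^ ?n) * (F t * indicator {d / (2 * dist x y)<..<4 * d / dist x y} t) * h y \<partial>lborel)"
      by (intro nn_integral_multc[symmetric]) measurable
    also have "\<dots> = (\<integral>\<^sup>+t. f y t \<partial>lborel)"
      unfolding f_def using True by (intro nn_integral_cong) (auto simp: mult_ac split: split_indicator)
    finally show ?thesis using True by simp
  qed simp
  have inner: "(\<integral>\<^sup>+y. f y t \<partial>lborel) \<le> ennreal (C * 8 ^ ?n * m * a) * F t" for t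
  proof (cases "0 < t \<and> R < 4 * d / t")
    case False
    have "f y t = 0" for y
    proof (rule ccontr)
      assume "f y t \<noteq> 0"
      then have *: "d / (2 * dist x y) < t" "t < 4 * d / dist x y" "R \<le> dist x y"
        by (auto simp: f_def split: split_indicator_asm)
      then have p: "0 < dist x y" using R by linarith
      have "0 < d / (2 * dist x y)" using d p by simp
      then have "0 < t" using *(1) by linarith
      moreover have "dist x y < 4 * d / t" using *(2) p \<open>0 < t\<close> by (simp add: field_simps)
      ultimately show False using False *(3) by simp
    qed
    then show ?thesis by simp
  next
    case True
    let ?B = "ball x (4 * d / t)"
    have le: "f y t \<le> ennreal (C * (2 * t / d) ^ ?n) * F t * (h y * indicator ?B y)" for y
    proof (cases "d / (2 * dist x y) < t \<and> t < 4 * d / dist x y \<and> R \<le> dist x y")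
      case yes: True
      then have p: "0 < dist x y" using R by linarith
      have "y \<in> ?B" using yes p True by (simp add: field_simps)
      have "1 / dist x y \<le> 2 * t / d" using yes p d by (simp add: field_simps)
      then have "(1 / dist x y) ^ ?n \<le> (2 * t / d) ^ ?n" using p by (intro power_mono) auto
      then have "C / dist x y ^ ?n \<le> C * (2 * t / d) ^ ?n"
        using C(1) by (simp add: power_one_over divide_inverse mult_left_mono power_inverse)
      then have "ennreal (C / dist x y ^ ?n) * F t * h y \<le> ennreal (C * (2 * t / d) ^ ?n) * F t * h y"
        by (intro mult_right_mono ennreal_leI) auto
      then show ?thesis using yes \<open>y \<in> ?B\<close> by (simp add: f_def)
    next
      case False
      then have "f y t = 0" by (auto simp: f_def split: split_indicator)
      then show ?thesis by simp
    qed
    have "(\<integral>\<^sup>+y. f y t \<partial>lborel) \<le> (\<integral>\<^sup>+y. ennreal (C * (2 * t / d) ^ ?n) * F t * (h y * indicator ?B y) \<partial>lborel)"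
      by (intro nn_integral_mono le)
    also have "\<dots> = ennreal (C * (2 * t / d) ^ ?n) * F t * (\<integral>\<^sup>+y\<in>?B. h y \<partial>lborel)"
      using h by (intro nn_integral_cmult borel_measurable_times_ennreal borel_measurable_indicator) auto
    also have "(\<integral>\<^sup>+y\<in>?B. h y \<partial>lborel) = (\<integral>\<^sup>+y\<in>?B. g y \<partial>lborel)"
      using gh(2) by (intro nn_integral_cong_AE) (auto elim!: eventually_mono)
    also have "\<dots> = (\<integral>\<^sup>+y\<in>?B. g y \<partial>lebesgue)" by (simp add: nn_integral_completion)
    also have "\<dots> \<le> ennreal a * emeasure lebesgue ?B"
      using True z by (intro not_levD[of z]) auto
    also have "emeasure lebesgue ?B = ennreal ((4 * d / t) ^ ?n * m)" using True d by (intro em) auto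
    also have "ennreal (C * (2 * t / d) ^ ?n) * F t * (ennreal a * ennreal ((4 * d / t) ^ ?n * m))
       = ennreal (C * (2 * t / d) ^ ?n * (a * ((4 * d / t) ^ ?n * m))) * F t"
      using True d C(1) m a by (simp add: ennreal_mult mult_ac)
    also have "C * (2 * t / d) ^ ?n * (a * ((4 * d / t) ^ ?n * m)) = C * 8 ^ ?n * m * a"
    proof -
      have "(2 * t / d) ^ ?n * (4 * d / t) ^ ?n = 8 ^ ?n"
        unfolding power_mult_distrib[symmetric] using True d by simp
      then show ?thesis by (simp add: mult_ac)
    qed
    finally show ?thesis by (simp add: mult_left_mono)
  qed
  have fm: "(\<lambda>(y, t). f y t) \<in> borel_measurable (lborel \<Otimes>\<^sub>M lborel)"
    unfolding f_def by measurable
  have "(\<integral>\<^sup>+y\<in>{y. R \<le> dist x y}. ennreal (norm (K x y - K x' y)) * g y \<partial>lebesgue)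
    \<le> (\<integral>\<^sup>+y. (\<integral>\<^sup>+t. f y t \<partial>lborel) \<partial>lebesgue)"
    by (intro nn_integral_mono pt)
  also have "\<dots> = (\<integral>\<^sup>+y. (\<integral>\<^sup>+t. f y t \<partial>lborel) \<partial>lborel)" by (simp add: nn_integral_completion)
  also have "\<dots> = (\<integral>\<^sup>+t. (\<integral>\<^sup>+y. f y t \<partial>lborel) \<partial>lborel)"
    by (rule lborel_pair.Fubini'[OF fm, symmetric])
  also have "\<dots> \<le> (\<integral>\<^sup>+t. ennreal (C * 8 ^ ?n * m * a) * F t \<partial>lborel)"
    by (intro nn_integral_mono inner)
  also have "\<dots> = ennreal (C * 8 ^ ?n * m * a) * ?I" by (intro nn_integral_cmult) measurable
  also have "\<dots> = ennreal (C * 8 ^ ?n * m * enn2real ?I * a)"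
  proof -
    define i where "i = enn2real ?I"
    have "?I = ennreal i" "0 \<le> i" using C by (simp_all add: i_def)
    then show ?thesis unfolding i_def[symmetric] using C m a by (simp add: mult_ac flip: ennreal_mult)
  qed
  finally show ?thesis by (simp add: m_def)
qed

section \<open>Pointwise estimates for operators with a Dini kernel\<close>

definition L1_norm :: "(real^'n \<Rightarrow> complex) \<Rightarrow> real" where
  "L1_norm f = (LINT x|lebesgue. norm (f x))"

lemma L1_norm_nonneg [simp]: "0 \<le> L1_norm f"
  by (simp add: L1_norm_def)

lemma ennreal_L1_norm:
  "integrable lebesgue f \<Longrightarrow> ennreal (L1_norm f) = (\<integral>\<^sup>+x. ennreal (norm (f x)) \<partial>lebesgue)"
  unfolding L1_norm_def by (intro nn_integral_eq_integral[symmetric] integrable_norm) auto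

lemma integrable_mult_indicator_set:
  fixes f :: "real^'n \<Rightarrow> complex"
  assumes "integrable lebesgue f" "A \<in> sets lebesgue"
  shows "integrable lebesgue (\<lambda>y. f y * indicator A y)"
proof -
  have "integrable lebesgue (\<lambda>y. indicator A y *\<^sub>R f y)"
    using assms(2,1) by (rule integrable_mult_indicator)
  moreover have "(\<lambda>y. indicator A y *\<^sub>R f y) = (\<lambda>y. f y * indicator A y)"
    by (auto simp: fun_eq_iff split: split_indicator)
  ultimately show ?thesis by simp
qed

text \<open>The weak norm is unfolded to level sets, and the smoothness of the kernel enters only in
  its integrated form.\<close>

locale dini_CZ =
  fixes T :: "(real^'n \<Rightarrow> complex) \<Rightarrow> real^'n \<Rightarrow> complex"
    and K :: "real^'n \<Rightarrow> real^'n \<Rightarrow> complex" and F :: "real \<Rightarrow> ennreal" and C C0 :: real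
  assumes lin: "linear_on_L1 T"
    and meas: "\<And>f. integrable lebesgue f \<Longrightarrow> T f \<in> borel_measurable lebesgue"
    and C0: "0 < C0"
    and weak: "\<And>f \<mu>. integrable lebesgue f \<Longrightarrow> 0 < \<mu> \<Longrightarrow>
      ennreal \<mu> * emeasure lebesgue {x. \<mu> < norm (T f x)} \<le> ennreal (C0 * L1_norm f)"
    and ker: "has_kernel T K" and mod: "kernel_modulus K F C"

lemma dini_CZ_operatorE:
  assumes "dini_CZ_operator T"
  obtains K F C C0 where "dini_CZ T K F C C0"
proof -
  from assms obtain K where K: "dini_smooth_kernel K" "has_kernel T K"
    and T: "linear_on_L1 T" "weak_type_1_1 T" by (auto simp: dini_CZ_operator_def)
  obtain F C where FC: "kernel_modulus K F C" using dini_smooth_kernel_modulus[OF K(1)] by blast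
  from T(2) obtain C0 where C0: "0 < C0" and m: "\<And>f. integrable lebesgue f \<Longrightarrow> T f \<in> borel_measurable lebesgue"
    and wk: "\<And>f. integrable lebesgue f \<Longrightarrow>
        weak_Lp_norm 1 (\<lambda>_. 1) (\<lambda>x. ennreal (norm (T f x))) \<le> ennreal C0 * Lp_norm 1 (\<lambda>_. 1) (\<lambda>x. ennreal (norm (f x)))"
    unfolding weak_type_1_1_def by blast
  have "dini_CZ T K F C C0"
  proof
    fix f :: "real^'a \<Rightarrow> complex" and \<mu> :: real
    assume f: "integrable lebesgue f" and \<mu>: "0 < \<mu>"
    have s: "{x. \<mu> < norm (T f x)} \<in> sets lebesgue"
    proof -
      have "{x \<in> space lebesgue. \<mu> < norm (T f x)} \<in> sets lebesgue" using m[OF f] by measurable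
      then show ?thesis by simp
    qed
    have "ennreal (\<mu> powr 1) * weight_of (\<lambda>_. 1) {x. ennreal \<mu> < ennreal (norm (T f x))}
      \<le> ennreal (C0 powr 1) * (\<integral>\<^sup>+x. epow (ennreal (norm (f x))) 1 * ennreal 1 \<partial>lebesgue)"
      using wk[OF f] C0 \<mu> by (subst (asm) weak_Lp_norm_le_iff) auto
    moreover have "weight_of (\<lambda>_. 1) {x. ennreal \<mu> < ennreal (norm (T f x))} = emeasure lebesgue {x. \<mu> < norm (T f x)}"
      unfolding weight_of_def using \<mu> s by (simp add: ennreal_less_iff)
    ultimately show "ennreal \<mu> * emeasure lebesgue {x. \<mu> < norm (T f x)} \<le> ennreal (C0 * L1_norm f)"
      using \<mu> C0 f by (simp add: epow_ennreal ennreal_mult L1_norm_nonneg ennreal_L1_norm)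
  qed (use T C0 m K FC in auto)
  then show thesis by (rule that)
qed

lemma L1_norm_le_ball:
  assumes f: "integrable lebesgue f" and g: "\<And>y. ennreal (norm (f y)) \<le> g y * indicator (ball c r) y"
    and z: "z \<in> ball c r" "z \<notin> lev g a" and a: "0 \<le> a"
  shows "L1_norm f \<le> a * measure lebesgue (ball c r)"
proof -
  have "ennreal (L1_norm f) \<le> (\<integral>\<^sup>+y\<in>ball c r. g y \<partial>lebesgue)"
    unfolding ennreal_L1_norm[OF f] using g by (intro nn_integral_mono) auto
  also have "\<dots> \<le> ennreal a * emeasure lebesgue (ball c r)" by (rule not_levD[OF z(2,1)])
  also have "\<dots> = ennreal (a * measure lebesgue (ball c r))"
    using a emeasure_ball_finite[of c r] by (simp add: emeasure_eq_ennreal_measure ennreal_mult)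
  finally show ?thesis using a by (subst (asm) ennreal_le_iff) auto
qed

lemma measure_ball_scale:
  fixes a b :: "real^'n"
  assumes "0 \<le> c" "0 \<le> r"
  shows "measure lebesgue (ball a (c * r)) = c ^ CARD('n) * measure lebesgue (ball b r)"
  unfolding measure_def emeasure_ball_scale[OF assms, of a b] using assms by (simp add: enn2real_mult)

context dini_CZ
begin

text \<open>\<open>A1\<close> and \<open>A\<close> bound differences of \<open>T f\<close>, against
  the \<open>L\<^sup>1\<close> norm and against ball averages. \<open>A2\<close> bounds
  \<open>T f\<close> away from the support; its second summand comes from the weak type on a ball of
  radius \<epsilon>/8.\<close>

definition "m1 = measure lebesgue (ball (0::real^'n) 1)"
definition "A1 = C * enn2real (\<integral>\<^sup>+t. F t \<partial>lborel)"
definition "A = C * 8 ^ CARD('n) * m1 * enn2real (\<integral>\<^sup>+t. F t \<partial>lborel)"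
definition "A2 = A1 + 8 ^ CARD('n) * (2 * C0) / m1"

lemma m1_pos: "0 < m1" by (simp add: m1_def)

lemma measure_ball: "0 \<le> r \<Longrightarrow> measure lebesgue (ball (x::real^'n) r) = r ^ CARD('n) * m1"
  using measure_ball_scale[of r 1 x 0] by (simp add: m1_def)

lemma emeasure_ball_eq: "0 \<le> r \<Longrightarrow> emeasure lebesgue (ball (x::real^'n) r) = ennreal (r ^ CARD('n) * m1)"
proof -
  assume "0 \<le> r"
  have "emeasure lebesgue (ball x r) = ennreal (measure lebesgue (ball x r))"
    by (rule emeasure_eq_ennreal_measure) (use emeasure_ball_finite(2)[of x r] in simp)
  then show ?thesis unfolding measure_ball[OF \<open>0 \<le> r\<close>] .
qed

lemma C_pos: "0 < C" using mod by (simp add: kernel_modulus_def)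
lemma A1_nonneg: "0 \<le> A1" using C_pos by (simp add: A1_def)
lemma A_nonneg: "0 \<le> A" using C_pos m1_pos by (simp add: A_def)
lemma A2_pos: "0 < A2" unfolding A2_def using A1_nonneg C0 m1_pos by (intro add_nonneg_pos) auto

text \<open>Vanishing on a ball about x is the form in which "off the support" is used from here on:
  there \<open>T f x\<close> is a definite value and not merely determined up to null sets.\<close>

lemma kernel_rep:
  assumes "integrable lebesgue f" "0 < \<epsilon>" "\<And>y. y \<in> ball x \<epsilon> \<Longrightarrow> f y = 0"
  shows "has_bochner_integral lebesgue (\<lambda>y. K x y * f y) (T f x)"
proof -
  have "{y. f y \<noteq> 0} \<subseteq> - ball x \<epsilon>" using assms(3) by blast
  then have "closure {y. f y \<noteq> 0} \<subseteq> - ball x \<epsilon>" by (intro closure_minimal) auto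
  then have "x \<notin> closure {y. f y \<noteq> 0}" using assms(2) by auto
  then show ?thesis using ker assms(1) by (simp add: has_kernel_def)
qed

text \<open>\<open>linear_on_L1\<close> gives additivity only almost everywhere; the truncations
  need it at one prescribed point, where the kernel formula provides it.\<close>

lemma T_add:
  assumes "integrable lebesgue f" "integrable lebesgue g" "0 < \<epsilon>"
    "\<And>y. y \<in> ball x \<epsilon> \<Longrightarrow> f y = 0" "\<And>y. y \<in> ball x \<epsilon> \<Longrightarrow> g y = 0"
  shows "T (\<lambda>y. f y + g y) x = T f x + T g x"
proof -
  have "has_bochner_integral lebesgue (\<lambda>y. K x y * f y + K x y * g y) (T f x + T g x)"
    using assms by (intro has_bochner_integral_add kernel_rep) auto
  moreover have "has_bochner_integral lebesgue (\<lambda>y. K x y * (f y + g y)) (T (\<lambda>y. f y + g y) x)"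
    using assms by (intro kernel_rep[of _ \<epsilon>]) auto
  ultimately show ?thesis by (simp add: distrib_left has_bochner_integral_eq)
qed

lemma T_eq_0:
  assumes "integrable lebesgue f" "0 < \<epsilon>" "\<And>y. y \<in> ball x \<epsilon> \<Longrightarrow> f y = 0" "L1_norm f = 0"
  shows "T f x = 0"
proof -
  have k: "has_bochner_integral lebesgue (\<lambda>y. K x y * f y) (T f x)"
    by (rule kernel_rep[of f \<epsilon>]) (use assms in auto)
  have "AE y in lebesgue. f y = 0"
    using assms(1,4) integral_nonneg_eq_0_iff_AE[of lebesgue "\<lambda>y. norm (f y)"] by (simp add: L1_norm_def)
  then have "(\<integral>y. K x y * f y \<partial>lebesgue) = (\<integral>y. 0 \<partial>(lebesgue :: (real^'n) measure))"
    using k by (intro integral_cong_AE) (auto simp: has_bochner_integral_iff intro: borel_measurable_integrable)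
  then show ?thesis using k by (simp add: has_bochner_integral_iff)
qed

lemma T_diff_integral:
  assumes f: "integrable lebesgue f" and R: "0 < R" "8 * dist x x' \<le> R" and f0: "\<And>y. y \<in> ball x R \<Longrightarrow> f y = 0"
  shows "has_bochner_integral lebesgue (\<lambda>y. (K x y - K x' y) * f y) (T f x - T f x')"
proof -
  have "f y = 0" if "y \<in> ball x' (R / 2)" for y
  proof (rule f0)
    show "y \<in> ball x R" using that R dist_triangle[of x y x'] by simp
  qed
  then have "has_bochner_integral lebesgue (\<lambda>y. K x y * f y - K x' y * f y) (T f x - T f x')"
    using f R f0 by (intro has_bochner_integral_diff kernel_rep[of f R] kernel_rep[of f "R / 2"]) auto
  then show ?thesis by (simp add: left_diff_distrib)
qed

lemma T_diff_nn_integral: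
  assumes "integrable lebesgue f" "0 < R" "8 * dist x x' \<le> R" "\<And>y. y \<in> ball x R \<Longrightarrow> f y = 0"
  shows "ennreal (norm (T f x - T f x')) \<le> (\<integral>\<^sup>+y. ennreal (norm (K x y - K x' y)) * ennreal (norm (f y)) \<partial>lebesgue)"
proof -
  have "ennreal (norm (T f x - T f x')) \<le> (\<integral>\<^sup>+y. ennreal (norm ((K x y - K x' y) * f y)) \<partial>lebesgue)"
    using T_diff_integral[OF assms] integral_norm_bound_ennreal[of lebesgue "\<lambda>y. (K x y - K x' y) * f y"]
    by (simp add: has_bochner_integral_iff)
  then show ?thesis by (simp add: norm_mult ennreal_mult)
qed

lemma T_diff_crude:
  assumes f: "integrable lebesgue f" and R: "0 < R" "8 * dist x x' \<le> R" and f0: "\<And>y. y \<in> ball x R \<Longrightarrow> f y = 0"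
  shows "norm (T f x - T f x') \<le> A1 / R ^ CARD('n) * L1_norm f"
proof -
  have "ennreal (norm (T f x - T f x')) \<le> (\<integral>\<^sup>+y. ennreal (norm (K x y - K x' y)) * ennreal (norm (f y)) \<partial>lebesgue)"
    by (rule T_diff_nn_integral[OF assms])
  also have "\<dots> \<le> (\<integral>\<^sup>+y. ennreal (A1 / R ^ CARD('n)) * ennreal (norm (f y)) \<partial>lebesgue)"
  proof (rule nn_integral_mono)
    fix y
    show "ennreal (norm (K x y - K x' y)) * ennreal (norm (f y)) \<le> ennreal (A1 / R ^ CARD('n)) * ennreal (norm (f y))"
    proof (cases "y \<in> ball x R")
      case False
      then have r: "R \<le> dist x y" by simp
      then have "norm (K x y - K x' y) \<le> A1 / dist x y ^ CARD('n)"
        unfolding A1_def using R by (intro kernel_modulus_pointwise[OF mod]) auto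
      also have "\<dots> \<le> A1 / R ^ CARD('n)"
        using r R A1_nonneg by (intro frac_le power_mono) auto
      finally show ?thesis by (intro mult_right_mono ennreal_leI) auto
    qed (simp add: f0)
  qed
  also have "\<dots> = ennreal (A1 / R ^ CARD('n)) * ennreal (L1_norm f)"
    unfolding ennreal_L1_norm[OF f] using borel_measurable_integrable[OF f] by (intro nn_integral_cmult) measurable
  also have "\<dots> = ennreal (A1 / R ^ CARD('n) * L1_norm f)"
    using A1_nonneg R L1_norm_nonneg by (intro ennreal_mult[symmetric]) auto
  finally show ?thesis using A1_nonneg R L1_norm_nonneg by (subst (asm) ennreal_le_iff) auto
qed

lemma T_diff_le:
  assumes f: "integrable lebesgue f" and R: "0 < R" "8 * dist x x' \<le> R" and f0: "\<And>y. y \<in> ball x R \<Longrightarrow> f y = 0"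
    and g: "g \<in> borel_measurable lebesgue" "\<And>y. ennreal (norm (f y)) \<le> g y"
    and z: "z \<in> ball x R" "z \<notin> lev g a" and a: "0 \<le> a"
  shows "norm (T f x - T f x') \<le> A * a"
proof -
  have "ennreal (norm (T f x - T f x')) \<le> (\<integral>\<^sup>+y. ennreal (norm (K x y - K x' y)) * ennreal (norm (f y)) \<partial>lebesgue)"
    by (rule T_diff_nn_integral[OF f R f0])
  also have "\<dots> \<le> (\<integral>\<^sup>+y\<in>{y. R \<le> dist x y}. ennreal (norm (K x y - K x' y)) * g y \<partial>lebesgue)"
  proof (rule nn_integral_mono)
    fix y
    show "ennreal (norm (K x y - K x' y)) * ennreal (norm (f y)) \<le> ennreal (norm (K x y - K x' y)) * g y * indicator {y. R \<le> dist x y} y"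
      using f0[of y] g(2)[of y] by (cases "R \<le> dist x y") (auto intro!: mult_left_mono)
  qed
  also have "\<dots> \<le> ennreal (A * a)"
    unfolding A_def m1_def using kernel_difference_integral[OF mod g(1) R z a] by simp
  finally show ?thesis using A_nonneg a by (subst (asm) ennreal_le_iff) auto
qed

text \<open>The size estimate is recovered from smoothness and weak type: a larger value at x would
  persist above \<mu> on the whole ball of radius \<epsilon>/8, by \<open>T_diff_crude\<close>, and
  contradict the weak type.\<close>

lemma T_size:
  assumes f: "integrable lebesgue f" and \<epsilon>: "0 < \<epsilon>" and f0: "\<And>y. y \<in> ball x \<epsilon> \<Longrightarrow> f y = 0"
  shows "norm (T f x) \<le> A2 / \<epsilon> ^ CARD('n) * L1_norm f"
proof (cases "L1_norm f = 0")
  case True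
  then show ?thesis using T_eq_0[OF f \<epsilon> f0] by simp
next
  case False
  let ?n = "CARD('n)"
  have N: "0 < L1_norm f" using False by (simp add: less_le)
  \<comment> \<open>Twice the level that the weak type permits on a ball of radius
    \<epsilon>/8.\<close>
  define \<mu> where "\<mu> = 8 ^ ?n * (2 * C0) / m1 / \<epsilon> ^ ?n * L1_norm f"
  have \<mu>: "0 < \<mu>" unfolding \<mu>_def using N C0 m1_pos \<epsilon> by simp
  show ?thesis
  proof (rule ccontr)
    assume "\<not> ?thesis"
    then have big: "A1 / \<epsilon> ^ ?n * L1_norm f + \<mu> < norm (T f x)"
      by (simp add: A2_def \<mu>_def add_divide_distrib distrib_right)
    have sub: "ball x (1/8 * \<epsilon>) \<subseteq> {x. \<mu> < norm (T f x)}"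
    proof
      fix x' assume "x' \<in> ball x (1/8 * \<epsilon>)"
      then have "norm (T f x - T f x') \<le> A1 / \<epsilon> ^ ?n * L1_norm f"
        using \<epsilon> by (intro T_diff_crude f f0) auto
      then show "x' \<in> {x. \<mu> < norm (T f x)}"
        using big norm_triangle_ineq2[of "T f x" "T f x'"] by simp
    qed
    have s: "{x. \<mu> < norm (T f x)} \<in> sets lebesgue"
    proof -
      have "{x \<in> space lebesgue. \<mu> < norm (T f x)} \<in> sets lebesgue" using meas[OF f] by measurable
      then show ?thesis by simp
    qed
    have "ennreal \<mu> * emeasure lebesgue (ball x (1/8 * \<epsilon>)) \<le> ennreal \<mu> * emeasure lebesgue {x. \<mu> < norm (T f x)}"
      using sub s by (intro mult_left_mono emeasure_mono) auto
    also have "\<dots> \<le> ennreal (C0 * L1_norm f)" by (rule weak[OF f \<mu>])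
    finally have "ennreal (\<mu> * ((1/8 * \<epsilon>) ^ ?n * m1)) \<le> ennreal (C0 * L1_norm f)"
      using \<epsilon> \<mu> m1_pos by (simp add: emeasure_ball_eq ennreal_mult)
    then have "\<mu> * ((1/8 * \<epsilon>) ^ ?n * m1) \<le> C0 * L1_norm f"
      using N C0 by (subst (asm) ennreal_le_iff) auto
    also have "\<mu> * ((1/8 * \<epsilon>) ^ ?n * m1) = 2 * C0 * L1_norm f"
      unfolding \<mu>_def using m1_pos \<epsilon> by (simp add: power_mult_distrib power_divide)
    finally show False using N C0 by simp
  qed
qed

end

section \<open>Maximal truncations\<close>

lemma nn_integral_decseq_tendsto_0:
  fixes g :: "'a \<Rightarrow> ennreal"
  assumes g: "g \<in> borel_measurable M" "(\<integral>\<^sup>+x. g x \<partial>M) < \<infinity>"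
    and S: "\<And>k. S k \<in> sets M" "decseq S" "(\<Inter>k. S k) = {}"
  shows "(\<lambda>k::nat. \<integral>\<^sup>+x\<in>S k. g x \<partial>M) \<longlonglongrightarrow> 0"
proof -
  have e: "emeasure (density M g) (S k) = (\<integral>\<^sup>+x\<in>S k. g x \<partial>M)" for k
    using g(1) S(1) by (rule emeasure_density)
  have "(\<integral>\<^sup>+x\<in>S k. g x \<partial>M) \<le> (\<integral>\<^sup>+x. g x \<partial>M)" for k
    by (intro nn_integral_mono) (auto split: split_indicator)
  then have "emeasure (density M g) (S k) < \<infinity>" for k
    unfolding e using g(2) by (rule le_less_trans)
  then have "emeasure (density M g) (S k) \<noteq> \<infinity>" for k by (metis less_irrefl)
  then have "(\<lambda>k. emeasure (density M g) (S k)) \<longlonglongrightarrow> emeasure (density M g) (\<Inter>k. S k)"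
    using S(1,2) by (intro Lim_emeasure_decseq) auto
  then show ?thesis unfolding e S(3) by simp
qed

definition trunc :: "(real^'n \<Rightarrow> complex) \<Rightarrow> real \<Rightarrow> real^'n \<Rightarrow> real^'n \<Rightarrow> complex" where
  "trunc f \<epsilon> x = (\<lambda>y. f y * indicator {y. norm (y - x) > \<epsilon>} y)"

lemma trunc_eq: "trunc f \<epsilon> x y = (if \<epsilon> < dist x y then f y else 0)"
  by (simp add: trunc_def dist_norm norm_minus_commute)

lemma trunc_integrable:
  assumes "integrable lebesgue f" shows "integrable lebesgue (trunc f \<epsilon> x)"
proof -
  have "{y. norm (y - x) > \<epsilon>} = - cball x \<epsilon>" by (auto simp: dist_norm norm_minus_commute)
  then have "{y. norm (y - x) > \<epsilon>} \<in> sets lebesgue" by simp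
  then show ?thesis unfolding trunc_def by (rule integrable_mult_indicator_set[OF assms])
qed

lemma maximal_truncation_eq: "maximal_truncation T f x = (SUP \<epsilon>\<in>{0::real<..}. ennreal (norm (T (trunc f \<epsilon> x) x)))"
  by (simp add: maximal_truncation_def trunc_def)

lemma less_maximal_truncation_iff:
  "0 \<le> c \<Longrightarrow> ennreal c < maximal_truncation T f x \<longleftrightarrow> (\<exists>\<epsilon>>0. c < norm (T (trunc f \<epsilon> x) x))"
  unfolding maximal_truncation_eq less_SUP_iff by (auto simp: ennreal_less_iff)

lemma L1_norm_mono:
  assumes "integrable lebesgue f" "integrable lebesgue g" "\<And>y. norm (f y) \<le> norm (g y)"
  shows "L1_norm f \<le> L1_norm g"
  unfolding L1_norm_def using assms by (intro integral_mono integrable_norm) auto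

context dini_CZ
begin

lemma norm_T_add_le:
  assumes "integrable lebesgue f" "integrable lebesgue g" "0 < \<epsilon>"
    "\<And>y. y \<in> ball x \<epsilon> \<Longrightarrow> f y = 0" "\<And>y. y \<in> ball x \<epsilon> \<Longrightarrow> g y = 0" "\<And>y. h y = f y + g y"
  shows "norm (T h x) \<le> norm (T f x) + norm (T g x)"
proof -
  have "h = (\<lambda>y. f y + g y)" using assms(6) by auto
  then show ?thesis using T_add[OF assms(1-5)] norm_triangle_ineq by metis
qed

text \<open>This holds at every x because each truncation vanishes near x, where T is additive
  pointwise.\<close>

lemma maximal_truncation_add_le:
  assumes f: "integrable lebesgue f" "integrable lebesgue g" and h: "\<And>y. h y = f y + g y"
  shows "maximal_truncation T h x \<le> maximal_truncation T f x + maximal_truncation T g x"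
  unfolding maximal_truncation_eq[of T h]
proof (rule SUP_least)
  fix \<epsilon> :: real assume "\<epsilon> \<in> {0<..}"
  then have \<epsilon>: "0 < \<epsilon>" by simp
  have "norm (T (trunc h \<epsilon> x) x) \<le> norm (T (trunc f \<epsilon> x) x) + norm (T (trunc g \<epsilon> x) x)"
    by (rule norm_T_add_le[OF trunc_integrable[OF f(1)] trunc_integrable[OF f(2)] \<epsilon>]) (auto simp: trunc_eq h)
  then have "ennreal (norm (T (trunc h \<epsilon> x) x)) \<le> ennreal (norm (T (trunc f \<epsilon> x) x)) + ennreal (norm (T (trunc g \<epsilon> x) x))"
    by (simp flip: ennreal_plus add: ennreal_leI)
  also have "\<dots> \<le> maximal_truncation T f x + maximal_truncation T g x"
    unfolding maximal_truncation_eq using \<epsilon> by (intro add_mono SUP_upper) auto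
  finally show "ennreal (norm (T (trunc h \<epsilon> x) x)) \<le> maximal_truncation T f x + maximal_truncation T g x" .
qed

text \<open>As x' tends to x, the window of the modulus shrinks towards 0, where F has little mass.
  Hence the kernel differences are uniformly small off the ball about x.\<close>

lemma T_continuous_at:
  assumes h: "integrable lebesgue h" and \<epsilon>: "0 < \<epsilon>" and h0: "\<And>y. y \<in> ball x \<epsilon> \<Longrightarrow> h y = 0" and e: "0 < e"
  obtains s where "0 < s" "\<And>x'. dist x x' \<le> s \<Longrightarrow> norm (T h x - T h x') < e"
proof -
  let ?n = "CARD('n)"
  have Fm: "F \<in> borel_measurable borel" "(\<integral>\<^sup>+t. F t \<partial>lborel) < \<infinity>" using mod by (auto simp: kernel_modulus_def)
  \<comment> \<open>Chosen so that the final bound is e times a quotient below 1; the summand 1 also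
    covers h of norm 0.\<close>
  define e2 where "e2 = e * \<epsilon> ^ ?n / (C * (L1_norm h + 1))"
  have N: "0 < L1_norm h + 1" by (simp add: add_nonneg_pos)
  have e2: "0 < e2" unfolding e2_def using e \<epsilon> C_pos N by simp
  have "(\<lambda>k::nat. \<integral>\<^sup>+t\<in>{0<..<1 / real (Suc k)}. F t \<partial>lborel) \<longlonglongrightarrow> 0"
  proof (rule nn_integral_decseq_tendsto_0)
    show "decseq (\<lambda>k::nat. {0<..<1 / real (Suc k)})"
    proof (intro decseq_SucI)
      fix k :: nat
      have "1 / real (Suc (Suc k)) \<le> 1 / real (Suc k)" by (intro frac_le) auto
      then show "{0<..<1 / real (Suc (Suc k))} \<subseteq> {0<..<1 / real (Suc k)}"
        unfolding greaterThanLessThan_subseteq_greaterThanLessThan by simp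
    qed
    show "(\<Inter>k::nat. {0<..<1 / real (Suc k)}) = {}"
    proof -
      have False if t: "t \<in> (\<Inter>k::nat. {0<..<1 / real (Suc k)})" for t
      proof -
        have t': "0 < t" "t < 1 / real (Suc k)" for k using t by auto
        obtain k where "inverse (real (Suc k)) < t" using reals_Archimedean[OF t'(1)] by blast
        then show False using t'(2)[of k] by (simp add: inverse_eq_divide)
      qed
      then show ?thesis by blast
    qed
  qed (use Fm in auto)
  then have "\<forall>\<^sub>F k in sequentially. (\<integral>\<^sup>+t\<in>{0<..<1 / real (Suc k)}. F t \<partial>lborel) < ennreal e2"
    using e2 by (intro order_tendstoD) auto
  then obtain k where k: "(\<integral>\<^sup>+t\<in>{0<..<1 / real (Suc k)}. F t \<partial>lborel) < ennreal e2"
    by (auto simp: eventually_sequentially)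
  define s where "s = \<epsilon> / (8 * real (Suc k))"
  have s: "0 < s" "8 * s \<le> \<epsilon>" "4 * s / \<epsilon> < 1 / real (Suc k)"
  proof -
    define q where "q = real (Suc k)"
    have q: "1 \<le> q" by (simp add: q_def)
    have sq: "s = \<epsilon> / (8 * q)" by (simp add: s_def q_def)
    show "0 < s" using q \<epsilon> by (simp add: sq)
    show "8 * s \<le> \<epsilon>" using q \<epsilon> by (simp add: sq divide_le_eq)
    have "4 * s / \<epsilon> = 1 / (2 * q)" using q \<epsilon> by (simp add: sq)
    also have "\<dots> < 1 / q" using q by (intro frac_less2) auto
    finally show "4 * s / \<epsilon> < 1 / real (Suc k)" by (simp only: q_def)
  qed
  show thesis
  proof (rule that[OF s(1)])
    fix x' assume d: "dist x x' \<le> s"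
    have pt: "norm (K x y - K x' y) \<le> C / \<epsilon> ^ ?n * e2" if y: "y \<notin> ball x \<epsilon>" for y
    proof -
      have r: "\<epsilon> \<le> dist x y" using y by simp
      have "4 * dist x x' / dist x y \<le> 4 * s / \<epsilon>" using d r \<epsilon> s(1) by (intro frac_le) auto
      then have sub: "{dist x x' / (2 * dist x y)<..<4 * dist x x' / dist x y} \<subseteq> {0<..<1 / real (Suc k)}"
      proof (intro subsetI)
        fix t assume "t \<in> {dist x x' / (2 * dist x y)<..<4 * dist x x' / dist x y}"
        moreover have "0 \<le> dist x x' / (2 * dist x y)" by simp
        ultimately show "t \<in> {0<..<1 / real (Suc k)}"
          using s(3) \<open>4 * dist x x' / dist x y \<le> 4 * s / \<epsilon>\<close> unfolding greaterThanLessThan_iff by linarith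
      qed
      have "ennreal (norm (K x y - K x' y)) \<le> ennreal (C / dist x y ^ ?n) * (\<integral>\<^sup>+t\<in>{dist x x' / (2 * dist x y)<..<4 * dist x x' / dist x y}. F t \<partial>lborel)"
      proof -
        have "x \<noteq> y" "8 * dist x x' \<le> dist x y" using r \<epsilon> d s by auto
        then show ?thesis using mod unfolding kernel_modulus_def by blast
      qed
      also have "\<dots> \<le> ennreal (C / \<epsilon> ^ ?n) * (\<integral>\<^sup>+t\<in>{0<..<1 / real (Suc k)}. F t \<partial>lborel)"
        using r \<epsilon> C_pos sub
        by (intro mult_mono ennreal_leI frac_le power_mono nn_integral_mono) (auto split: split_indicator)
      also have "\<dots> \<le> ennreal (C / \<epsilon> ^ ?n) * ennreal e2" using k by (intro mult_left_mono) auto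
      also have "\<dots> = ennreal (C / \<epsilon> ^ ?n * e2)" using C_pos \<epsilon> e2 by (intro ennreal_mult[symmetric]) auto
      finally show ?thesis using C_pos \<epsilon> e2 by (subst (asm) ennreal_le_iff) auto
    qed
    have "ennreal (norm (T h x - T h x')) \<le> (\<integral>\<^sup>+y. ennreal (norm (K x y - K x' y)) * ennreal (norm (h y)) \<partial>lebesgue)"
      using d s by (intro T_diff_nn_integral[OF h \<epsilon> _ h0]) auto
    also have "\<dots> \<le> (\<integral>\<^sup>+y. ennreal (C / \<epsilon> ^ ?n * e2) * ennreal (norm (h y)) \<partial>lebesgue)"
    proof (rule nn_integral_mono)
      fix y show "ennreal (norm (K x y - K x' y)) * ennreal (norm (h y)) \<le> ennreal (C / \<epsilon> ^ ?n * e2) * ennreal (norm (h y))"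
        using pt[of y] h0[of y] by (cases "y \<in> ball x \<epsilon>") (auto intro!: mult_right_mono ennreal_leI)
    qed
    also have "\<dots> = ennreal (C / \<epsilon> ^ ?n * e2) * ennreal (L1_norm h)"
      unfolding ennreal_L1_norm[OF h] using borel_measurable_integrable[OF h] by (intro nn_integral_cmult) measurable
    also have "\<dots> = ennreal (C / \<epsilon> ^ ?n * e2 * L1_norm h)" using C_pos \<epsilon> e2 by (intro ennreal_mult[symmetric]) auto
    finally have "norm (T h x - T h x') \<le> C / \<epsilon> ^ ?n * e2 * L1_norm h"
      using C_pos \<epsilon> e2 by (subst (asm) ennreal_le_iff) auto
    also have "\<dots> = e * (L1_norm h / (L1_norm h + 1))" unfolding e2_def using C_pos \<epsilon> N by simp
    also have "\<dots> < e * 1" using e N by (intro mult_strict_left_mono) (auto simp: divide_less_eq)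
    finally show "norm (T h x - T h x') < e" by simp
  qed
qed

text \<open>Lower semicontinuity, hence measurability. A truncation about x with value above c is
  compared with the one about x' at a slightly larger radius. Their difference lives in a thin shell
  about x and has small \<open>L\<^sup>1\<close> norm, so \<open>T_size\<close> controls it at
  x'.\<close>

lemma open_maximal_truncation_greater:
  assumes f: "integrable lebesgue f" and c: "0 \<le> c"
  shows "open {x. ennreal c < maximal_truncation T f x}"
proof (rule openI)
  let ?n = "CARD('n)"
  fix x assume "x \<in> {x. ennreal c < maximal_truncation T f x}"
  then obtain \<epsilon> where \<epsilon>: "0 < \<epsilon>" "c < norm (T (trunc f \<epsilon> x) x)" using c by (auto simp: less_maximal_truncation_iff)
  define h where "h = trunc f \<epsilon> x"
  have h: "integrable lebesgue h" unfolding h_def by (rule trunc_integrable[OF f])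
  define e where "e = (norm (T h x) - c) / 2"
  have e: "0 < e" using \<epsilon> by (simp add: e_def h_def)
  obtain s where s: "0 < s" "\<And>x'. dist x x' \<le> s \<Longrightarrow> norm (T h x - T h x') < e"
    by (rule T_continuous_at[OF h \<epsilon>(1) _ e, of x]) (auto simp: h_def trunc_eq)
  \<comment> \<open>The \<open>L\<^sup>1\<close> norm that \<open>T_size\<close> at distance
    \<epsilon>/2 converts into e.\<close>
  define e3 where "e3 = e / (A2 / (\<epsilon> / 2) ^ ?n)"
  have e3: "0 < e3" unfolding e3_def using e A2_pos \<epsilon> by simp
  define S where "S k = cball x (\<epsilon> + 1 / real (Suc k)) - cball x \<epsilon>" for k :: nat
  have "(\<lambda>k::nat. \<integral>\<^sup>+y\<in>S k. ennreal (norm (f y)) \<partial>lebesgue) \<longlonglongrightarrow> 0"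
  proof (rule nn_integral_decseq_tendsto_0)
    show "decseq S"
    proof (intro decseq_SucI)
      fix k
      have "cball x (\<epsilon> + 1 / real (Suc (Suc k))) \<subseteq> cball x (\<epsilon> + 1 / real (Suc k))"
        by (intro subset_cball) (simp add: field_simps)
      then show "S (Suc k) \<subseteq> S k" unfolding S_def by blast
    qed
    show "(\<Inter>k. S k) = {}"
    proof -
      have False if y: "y \<in> (\<Inter>k. S k)" for y
      proof -
        have y': "0 < dist x y - \<epsilon>" "dist x y \<le> \<epsilon> + 1 / real (Suc k)" for k using y by (auto simp: S_def)
        obtain k where "inverse (real (Suc k)) < dist x y - \<epsilon>" using reals_Archimedean[OF y'(1)] by blast
        then show False using y'(2)[of k] by (simp add: inverse_eq_divide)
      qed
      then show ?thesis by blast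
    qed
    show "(\<lambda>y. ennreal (norm (f y))) \<in> borel_measurable lebesgue"
      using borel_measurable_integrable[OF f] by measurable
    show "(\<integral>\<^sup>+y. ennreal (norm (f y)) \<partial>lebesgue) < \<infinity>" using f by (simp add: integrable_iff_bounded)
  qed (auto simp: S_def)
  then have "\<forall>\<^sub>F k in sequentially. (\<integral>\<^sup>+y\<in>S k. ennreal (norm (f y)) \<partial>lebesgue) < ennreal e3"
    using e3 by (intro order_tendstoD) auto
  then obtain k where k: "(\<integral>\<^sup>+y\<in>S k. ennreal (norm (f y)) \<partial>lebesgue) < ennreal e3"
    by (auto simp: eventually_sequentially)
  define \<delta> where "\<delta> = min s (min (\<epsilon> / 2) (1 / (2 * real (Suc k))))"
  have \<delta>: "0 < \<delta>" "\<delta> \<le> s" "\<delta> \<le> \<epsilon> / 2" "2 * \<delta> \<le> 1 / real (Suc k)"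
  proof -
    show "0 < \<delta>" "\<delta> \<le> s" "\<delta> \<le> \<epsilon> / 2" using s \<epsilon> by (auto simp: \<delta>_def)
    have "\<delta> \<le> 1 / (2 * real (Suc k))" by (simp add: \<delta>_def)
    then show "2 * \<delta> \<le> 1 / real (Suc k)" by (simp add: field_simps)
  qed
  show "\<exists>d>0. ball x d \<subseteq> {x. ennreal c < maximal_truncation T f x}"
  proof (intro exI[of _ \<delta>] conjI subsetI)
    fix x' assume x': "x' \<in> ball x \<delta>"
    \<comment> \<open>The radius is enlarged by \<delta> so that the complement of the new ball lies
      in that of the old one; what is lost lies within 2 \<delta> of the old sphere.\<close>
    define g where "g = trunc f (\<epsilon> + \<delta>) x'"
    have g: "integrable lebesgue g" unfolding g_def by (rule trunc_integrable[OF f])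
    have tri: "dist x y \<le> dist x' y + \<delta>" "dist x' y \<le> dist x y + \<delta>" for y
      using dist_triangle[of x y x'] dist_triangle[of x' y x] x' by (auto simp: dist_commute)
    define r where "r y = h y - g y" for y
    have r: "integrable lebesgue r" unfolding r_def using h g by (intro Bochner_Integration.integrable_diff)
    have rb: "ennreal (norm (r y)) \<le> ennreal (norm (f y)) * indicator (S k) y" for y
      using tri[of y] \<delta>(1,4) by (auto simp: r_def h_def g_def trunc_eq S_def split: split_indicator)
    have "ennreal (L1_norm r) \<le> (\<integral>\<^sup>+y\<in>S k. ennreal (norm (f y)) \<partial>lebesgue)"
      unfolding ennreal_L1_norm[OF r] by (intro nn_integral_mono rb)
    also note k
    finally have Nr: "L1_norm r < e3" by (simp add: ennreal_less_iff)
    have z: "h y = 0" "g y = 0" "r y = 0" if "y \<in> ball x' (\<epsilon> / 2)" for y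
      using that tri(1)[of y] \<delta> by (auto simp: r_def h_def g_def trunc_eq)
    have "norm (T r x') \<le> A2 / (\<epsilon> / 2) ^ ?n * L1_norm r"
      using \<epsilon> z(3) by (intro T_size r) auto
    also have "\<dots> < A2 / (\<epsilon> / 2) ^ ?n * e3" using Nr A2_pos \<epsilon> by (intro mult_strict_left_mono) auto
    also have "\<dots> = e" unfolding e3_def using A2_pos \<epsilon> by simp
    finally have 1: "norm (T r x') < e" .
    have "norm (T h x') \<le> norm (T g x') + norm (T r x')"
      by (rule norm_T_add_le[OF g r half_gt_zero[OF \<epsilon>(1)] z(2,3)]) (simp_all add: r_def)
    moreover have "norm (T h x - T h x') < e" using x' \<delta> by (intro s(2)) auto
    moreover have "norm (T h x) \<le> norm (T h x') + norm (T h x - T h x')"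
      using norm_triangle_ineq[of "T h x'" "T h x - T h x'"] by simp
    ultimately have "c < norm (T g x')" using 1 unfolding e_def by (simp add: field_simps)
    then show "x' \<in> {x. ennreal c < maximal_truncation T f x}"
      using c \<epsilon> \<delta> unfolding g_def by (auto simp: less_maximal_truncation_iff intro!: exI[of _ "\<epsilon> + \<delta>"])
  qed (rule \<delta>)
qed


section \<open>Weak type and localisation of the maximal truncation\<close>

abbreviation mt :: "(real^'n \<Rightarrow> complex) \<Rightarrow> real^'n \<Rightarrow> ennreal" where "mt \<equiv> maximal_truncation T"
abbreviation mag :: "(real^'n \<Rightarrow> complex) \<Rightarrow> real^'n \<Rightarrow> ennreal" where "mag f \<equiv> \<lambda>y. ennreal (norm (f y))"

lemma mag_measurable: "integrable lebesgue f \<Longrightarrow> mag f \<in> borel_measurable lebesgue"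
  using borel_measurable_integrable[of lebesgue f] by measurable

text \<open>\<open>\<gamma>0\<close> makes the far part vary by at most c/4 on the comparison ball
  and lets the near part exceed c/2 on at most half of that ball. \<open>A3\<close> is the weak type
  constant of the maximal truncation, and \<open>A4\<close> is the cost of moving a far truncation
  to a neighbouring centre.\<close>

definition "\<gamma>0 = min (1 / (4 * (A + 1))) (1 / (4 * C0 * 16 ^ CARD('n)))"
definition "A3 = 5 ^ CARD('n) / \<gamma>0 + 16 * 5 ^ CARD('n) * C0"
definition "A4 = A + A2 * 6 ^ CARD('n) * m1"

lemma \<gamma>0: "0 < \<gamma>0" "A * \<gamma>0 \<le> 1/4" "2 * C0 * \<gamma>0 * 16 ^ CARD('n) \<le> 1/2"
proof -
  show "0 < \<gamma>0" unfolding \<gamma>0_def using A_nonneg C0 by (auto intro: add_nonneg_pos)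
  have A: "0 < A + 1" using A_nonneg by simp
  have "A * \<gamma>0 \<le> A * (1 / (4 * (A + 1)))"
    using A_nonneg by (intro mult_left_mono) (auto simp: \<gamma>0_def)
  also have "\<dots> = (A / (A + 1)) / 4" by simp
  also have "\<dots> \<le> 1 / 4" using A A_nonneg by (intro divide_right_mono) (auto simp: divide_le_eq)
  finally show "A * \<gamma>0 \<le> 1/4" .
  have "2 * C0 * 16 ^ CARD('n) * \<gamma>0 \<le> 2 * C0 * 16 ^ CARD('n) * (1 / (4 * C0 * 16 ^ CARD('n)))"
    using C0 by (intro mult_left_mono) (auto simp: \<gamma>0_def)
  also have "\<dots> = 1/2" using C0 by simp
  finally show "2 * C0 * \<gamma>0 * 16 ^ CARD('n) \<le> 1/2" by (simp add: mult_ac)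
qed

lemma A3_pos: "0 < A3" unfolding A3_def using \<gamma>0(1) C0 by (intro add_pos_pos) auto
lemma A4_pos: "0 < A4" unfolding A4_def using A_nonneg A2_pos m1_pos by (intro add_nonneg_pos) auto

lemma T_split_AE:
  assumes "integrable lebesgue f" "integrable lebesgue g"
  shows "AE x in lebesgue. T (\<lambda>y. f y + g y) x = T f x + T g x"
  using lin assms unfolding linear_on_L1_def
  by (elim allE[of _ f] allE[of _ g] allE[of _ 1]) auto

lemma sets_T_greater: "integrable lebesgue f \<Longrightarrow> {x. c < norm (T f x)} \<in> sets lebesgue"
proof -
  assume "integrable lebesgue f"
  then have "{x \<in> space lebesgue. c < norm (T f x)} \<in> sets lebesgue" using meas by measurable
  then show ?thesis by simp
qed

lemma emeasure_T_greater_le: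
  assumes "integrable lebesgue f" "0 < c"
  shows "emeasure lebesgue {x. c < norm (T f x)} \<le> ennreal (C0 * L1_norm f / c)"
proof -
  have "emeasure lebesgue {x. c < norm (T f x)} = ennreal (1 / c) * (ennreal c * emeasure lebesgue {x. c < norm (T f x)})"
    using assms(2) by (subst ennreal_mult_left_assoc) auto
  also have "\<dots> \<le> ennreal (1 / c) * ennreal (C0 * L1_norm f)"
    by (intro mult_left_mono weak assms) simp
  also have "\<dots> = ennreal (C0 * L1_norm f / c)" using assms(2) C0 by (simp flip: ennreal_mult)
  finally show ?thesis .
qed

text \<open>Where \<open>T\<^sup>*\<close> is large at \<open>x\<close> while the averages of \<open>f\<close> are small, \<open>T f\<close> itself is large on half of
  a ball around \<open>x\<close>; this gives the weak type of \<open>T\<^sup>*\<close> without Cotlar's inequality.\<close>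

lemma maximal_truncation_greater_subset:
  assumes f: "integrable lebesgue f" and c: "0 < c"
  shows "{x. ennreal c < mt f x} \<subseteq> lev (mag f) (\<gamma>0 * c) \<union> lev (indicator {x. c / 4 < norm (T f x)}) (1/4)"
proof (rule subsetI, rule ccontr)
  let ?n = "CARD('n)" and ?S = "{x. c / 4 < norm (T f x)}"
  fix x assume "x \<in> {x. ennreal c < mt f x}"
  then obtain \<epsilon> where \<epsilon>: "0 < \<epsilon>" "c < norm (T (trunc f \<epsilon> x) x)" using c by (auto simp: less_maximal_truncation_iff)
  assume "x \<notin> lev (mag f) (\<gamma>0 * c) \<union> lev (indicator ?S) (1/4)"
  then have nl: "x \<notin> lev (mag f) (\<gamma>0 * c)" "x \<notin> lev (indicator ?S) (1/4)" by auto
  define f2 where "f2 = trunc f \<epsilon> x"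
  define f1 where "f1 y = f y - f2 y" for y
  have f2: "integrable lebesgue f2" unfolding f2_def by (rule trunc_integrable[OF f])
  have f1: "integrable lebesgue f1" unfolding f1_def using f f2 by (intro Bochner_Integration.integrable_diff)
  \<comment> \<open>The radius \<epsilon>/8 is the largest for which \<open>T_diff_le\<close>
    compares x with the points of the ball.\<close>
  define B where "B = ball x (1/8 * \<epsilon>)"
  have ga: "0 \<le> \<gamma>0 * c" using \<gamma>0 c by simp
  have N1: "L1_norm f1 \<le> \<gamma>0 * c * measure lebesgue (ball x (16 * (1/8 * \<epsilon>)))"
  proof (rule L1_norm_le_ball[OF f1 _ _ nl(1) ga])
    show "ennreal (norm (f1 y)) \<le> mag f y * indicator (ball x (16 * (1/8 * \<epsilon>))) y" for y
      using \<epsilon> by (auto simp: f1_def f2_def trunc_eq split: split_indicator)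
    show "x \<in> ball x (16 * (1/8 * \<epsilon>))" using \<epsilon> by simp
  qed
  have Bm: "emeasure lebesgue B = ennreal (measure lebesgue B)" "0 < measure lebesgue B"
    unfolding B_def using \<epsilon> m1_pos by (simp_all only: emeasure_ball_eq measure_ball) auto
  have N1': "L1_norm f1 \<le> \<gamma>0 * c * 16 ^ ?n * measure lebesgue B"
    using N1 \<epsilon> measure_ball_scale[of 16 "1/8 * \<epsilon>" x x] unfolding B_def by (simp add: mult.assoc)
  have "C0 * L1_norm f1 / (c / 2) \<le> C0 * (\<gamma>0 * c * 16 ^ ?n * measure lebesgue B) / (c / 2)"
    using N1' C0 c by (intro divide_right_mono mult_left_mono) auto
  also have "\<dots> = (2 * C0 * \<gamma>0 * 16 ^ ?n) * measure lebesgue B" using c by simp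
  also have "\<dots> \<le> 1/2 * measure lebesgue B" using \<gamma>0(3) Bm(2) by (intro mult_right_mono) auto
  finally have "emeasure lebesgue {x. c / 2 < norm (T f1 x)} \<le> ennreal (1/2 * measure lebesgue B)"
    using emeasure_T_greater_le[OF f1, of "c / 2"] c by (simp add: order_trans[OF _ ennreal_leI])
  have AEs: "AE z in lebesgue. T f z = T f1 z + T f2 z"
  proof -
    have "f = (\<lambda>y. f1 y + f2 y)" by (simp add: f1_def)
    then show ?thesis using T_split_AE[OF f1 f2] by simp
  qed
  have pt: "z \<in> ?S" if z: "z \<in> B" "T f z = T f1 z + T f2 z" "\<not> c / 2 < norm (T f1 z)" for z
  proof -
    have "norm (T f2 x - T f2 z) \<le> A * (\<gamma>0 * c)"
    proof (rule T_diff_le[OF f2 \<epsilon>(1) _ _ mag_measurable[OF f] _ _ nl(1) ga])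
      show "8 * dist x z \<le> \<epsilon>" using z by (simp add: B_def)
      show "f2 y = 0" if "y \<in> ball x \<epsilon>" for y using that by (simp add: f2_def trunc_eq)
      show "mag f2 y \<le> mag f y" for y by (simp add: f2_def trunc_eq)
      show "x \<in> ball x \<epsilon>" using \<epsilon> by simp
    qed
    also have "\<dots> = (A * \<gamma>0) * c" by simp
    also have "\<dots> \<le> 1/4 * c" using \<gamma>0(2) c by (intro mult_right_mono) auto
    finally have "c - c / 4 < norm (T f2 z)"
      using \<epsilon>(2) norm_triangle_ineq2[of "T f2 x" "T f2 z"] by (simp add: f2_def)
    moreover have "norm (T f2 z) \<le> norm (T f z) + norm (T f1 z)"
      using norm_triangle_ineq4[of "T f z" "T f1 z"] z(2) by simp
    ultimately show ?thesis using z(3) by simp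
  qed
  have Ss: "?S \<in> sets lebesgue" by (rule sets_T_greater[OF f])
  have Hs: "{x. c / 2 < norm (T f1 x)} \<in> sets lebesgue" by (rule sets_T_greater[OF f1])
  have Bs: "B \<in> sets lebesgue" by (simp add: B_def)
  \<comment> \<open>The two sets covering B up to a null set have at most 1/4 and 1/2 of its
    measure.\<close>
  have "emeasure lebesgue B \<le> emeasure lebesgue ((?S \<inter> B) \<union> {x. c / 2 < norm (T f1 x)})"
    using AEs pt Ss Hs Bs by (intro emeasure_mono_AE) (auto elim!: eventually_mono)
  also have "\<dots> \<le> emeasure lebesgue (?S \<inter> B) + emeasure lebesgue {x. c / 2 < norm (T f1 x)}"
    using Ss Hs Bs by (intro emeasure_subadditive) auto
  also have "emeasure lebesgue (?S \<inter> B) \<le> ennreal (1/4) * emeasure lebesgue B"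
    using not_levD[OF nl(2), of x "1/8 * \<epsilon>"] \<epsilon> Ss by (simp add: B_def set_nn_integral_indicator)
  finally have "emeasure lebesgue B \<le> ennreal (1/4) * emeasure lebesgue B + ennreal (1/2 * measure lebesgue B)"
    using \<open>emeasure lebesgue {x. c / 2 < norm (T f1 x)} \<le> ennreal (1/2 * measure lebesgue B)\<close>
    by (meson add_mono order_refl order_trans)
  also have "\<dots> = ennreal (3/4 * measure lebesgue B)"
    unfolding Bm(1) using Bm(2) by (simp flip: ennreal_mult ennreal_plus)
  finally have "measure lebesgue B \<le> 3/4 * measure lebesgue B"
    unfolding Bm(1) using Bm(2) by (subst (asm) ennreal_le_iff) auto
  then show False using Bm(2) by simp
qed

lemma maximal_truncation_weak_type:
  assumes f: "integrable lebesgue f" and c: "0 < c"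
  shows "emeasure lebesgue {x. ennreal c < mt f x} \<le> ennreal (A3 / c * L1_norm f)"
proof -
  let ?n = "CARD('n)" and ?S = "{x. c / 4 < norm (T f x)}"
  have Ss: "?S \<in> sets lebesgue" by (rule sets_T_greater[OF f])
  have "emeasure lebesgue {x. ennreal c < mt f x}
    \<le> emeasure lebesgue (lev (mag f) (\<gamma>0 * c) \<union> lev (indicator ?S) (1/4))"
    by (intro emeasure_mono maximal_truncation_greater_subset f c) auto
  also have "\<dots> \<le> emeasure lebesgue (lev (mag f) (\<gamma>0 * c)) + emeasure lebesgue (lev (indicator ?S) (1/4))"
    by (intro emeasure_subadditive) auto
  also have "\<dots> \<le> ennreal (5 ^ ?n / (\<gamma>0 * c)) * (\<integral>\<^sup>+x. mag f x \<partial>lebesgue) + ennreal (5 ^ ?n / (1/4)) * (\<integral>\<^sup>+x. indicator ?S x \<partial>lebesgue)"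
    using \<gamma>0(1) c Ss by (intro add_mono emeasure_lev_le mag_measurable f borel_measurable_indicator) auto
  also have "\<dots> \<le> ennreal (5 ^ ?n / (\<gamma>0 * c)) * ennreal (L1_norm f) + ennreal (5 ^ ?n / (1/4)) * ennreal (C0 * L1_norm f / (c / 4))"
    using emeasure_T_greater_le[OF f, of "c / 4"] c Ss
    by (intro add_mono mult_left_mono) (simp_all add: ennreal_L1_norm[OF f])
  also have "\<dots> = ennreal (5 ^ ?n / (\<gamma>0 * c) * L1_norm f + 5 ^ ?n / (1/4) * (C0 * L1_norm f / (c / 4)))"
    using \<gamma>0(1) c C0 by (simp flip: ennreal_mult ennreal_plus)
  also have "5 ^ ?n / (\<gamma>0 * c) * L1_norm f + 5 ^ ?n / (1/4) * (C0 * L1_norm f / (c / 4)) = A3 / c * L1_norm f"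
    unfolding A3_def using \<gamma>0(1) c by (simp add: field_simps)
  finally show ?thesis .
qed

text \<open>The far part truncated about x is compared with f truncated about xb at the larger of
  the two radii. The difference vanishes near x and is carried by a ball of comparable radius, so
  \<open>T_size\<close> bounds it by an average of f; \<open>T_diff_le\<close> then moves the
  evaluation from xb to x.\<close>

lemma maximal_truncation_far_le:
  assumes f: "integrable lebesgue f" and \<rho>: "dist x xb \<le> \<rho>" "0 < \<rho>" "8 * \<rho> \<le> R"
    and z: "z \<in> ball xb R" "z \<notin> lev (mag f) a" and a: "0 \<le> a"
  shows "mt (trunc f R xb) x \<le> mt f xb + ennreal (A4 * a)"
  unfolding maximal_truncation_eq[of T "trunc f R xb"]
proof (rule SUP_least)
  let ?n = "CARD('n)"
  fix \<epsilon> :: real assume "\<epsilon> \<in> {0<..}"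
  then have \<epsilon>: "0 < \<epsilon>" by simp
  define \<epsilon>' where "\<epsilon>' = max \<epsilon> R"
  have \<epsilon>': "0 < \<epsilon>'" "8 * \<rho> \<le> \<epsilon>'" "R \<le> \<epsilon>'" "\<epsilon> \<le> \<epsilon>'" "\<epsilon>' = \<epsilon> \<or> \<epsilon>' = R" using \<epsilon> \<rho> by (auto simp: \<epsilon>'_def)
  define g1 where "g1 = trunc (trunc f R xb) \<epsilon> x"
  define g2 where "g2 = trunc f \<epsilon>' xb"
  define g3 where "g3 y = g1 y - g2 y" for y
  have g1: "integrable lebesgue g1" and g2: "integrable lebesgue g2"
    unfolding g1_def g2_def by (intro trunc_integrable f)+
  have g3: "integrable lebesgue g3" unfolding g3_def using g1 g2 by (intro Bochner_Integration.integrable_diff)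
  have tri: "dist x y \<le> dist xb y + \<rho>" "dist xb y \<le> dist x y + \<rho>" for y
    using dist_triangle[of x y xb] dist_triangle[of xb y x] \<rho>(1) by (auto simp: dist_commute)
  have z0: "g2 y = 0 \<and> g3 y = 0" if "y \<in> ball x (\<epsilon>' / 2)" for y
  proof -
    have y: "dist x y < \<epsilon>' / 2" using that by simp
    then have "dist xb y \<le> \<epsilon>'" using tri(2)[of y] \<epsilon>'(2) \<rho>(2) by linarith
    then have 2: "g2 y = 0" by (simp add: g2_def trunc_eq)
    have "dist x y \<le> \<epsilon> \<or> dist xb y \<le> R"
    proof (cases "\<epsilon>' = \<epsilon>")
      case True then show ?thesis using y \<epsilon> by linarith
    next
      case False
      then have "\<epsilon>' = R" using \<epsilon>'(5) by blast
      then show ?thesis using y tri(2)[of y] \<rho> by linarith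
    qed
    then have "g1 y = 0" by (auto simp: g1_def trunc_eq)
    with 2 show ?thesis by (simp add: g3_def)
  qed
  have g3b: "ennreal (norm (g3 y)) \<le> mag f y * indicator (ball x (6 * (\<epsilon>' / 2))) y" for y
  proof (cases "y \<in> ball x (6 * (\<epsilon>' / 2))")
    case True
    have "norm (g3 y) \<le> norm (f y)" by (auto simp: g3_def g1_def g2_def trunc_eq)
    then show ?thesis using True by (simp add: ennreal_leI)
  next
    case False
    then have "3 * \<epsilon>' \<le> dist x y" by simp
    then have "\<epsilon> < dist x y" "R < dist xb y" "\<epsilon>' < dist xb y" using tri(1)[of y] \<epsilon>' \<rho> by linarith+
    then show ?thesis by (simp add: g3_def g1_def g2_def trunc_eq)
  qed
  have zx: "z \<in> ball x (6 * (\<epsilon>' / 2))" using z(1) tri(1)[of z] \<epsilon>' \<rho> by simp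
  have "L1_norm g3 \<le> a * measure lebesgue (ball x (6 * (\<epsilon>' / 2)))"
    by (rule L1_norm_le_ball[OF g3 g3b zx z(2) a])
  also have "measure lebesgue (ball x (6 * (\<epsilon>' / 2))) = 6 ^ ?n * ((\<epsilon>' / 2) ^ ?n * m1)"
    using \<epsilon>' measure_ball_scale[of 6 "\<epsilon>' / 2" x x] by (simp only: measure_ball)
  finally have N3: "L1_norm g3 \<le> a * (6 ^ ?n * ((\<epsilon>' / 2) ^ ?n * m1))" .
  have "norm (T g3 x) \<le> A2 / (\<epsilon>' / 2) ^ ?n * L1_norm g3"
    using \<epsilon>' z0 by (intro T_size g3) auto
  also have "\<dots> \<le> A2 / (\<epsilon>' / 2) ^ ?n * (a * (6 ^ ?n * ((\<epsilon>' / 2) ^ ?n * m1)))"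
    using N3 A2_pos \<epsilon>' by (intro mult_left_mono) auto
  also have "\<dots> = A2 * 6 ^ ?n * m1 * a" using \<epsilon>' by simp
  finally have 3: "norm (T g3 x) \<le> A2 * 6 ^ ?n * m1 * a" .
  have 2: "norm (T g2 xb - T g2 x) \<le> A * a"
  proof (rule T_diff_le[OF g2 \<epsilon>'(1) _ _ mag_measurable[OF f] _ _ z(2) a])
    show "8 * dist xb x \<le> \<epsilon>'" using \<rho>(1) \<epsilon>'(2) by (simp add: dist_commute)
    show "g2 y = 0" if "y \<in> ball xb \<epsilon>'" for y using that by (simp add: g2_def trunc_eq)
    show "mag g2 y \<le> mag f y" for y by (simp add: g2_def trunc_eq)
    show "z \<in> ball xb \<epsilon>'" using z(1) \<epsilon>' by auto
  qed
  have e2: "0 < \<epsilon>' / 2" using \<epsilon>' by simp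
  have "norm (T g1 x) \<le> norm (T g2 x) + norm (T g3 x)"
    by (rule norm_T_add_le[OF g2 g3 e2]) (use z0 in \<open>auto simp: g3_def\<close>)
  also have "\<dots> \<le> norm (T g2 xb) + A * a + A2 * 6 ^ ?n * m1 * a"
    using 2 3 norm_triangle_ineq2[of "T g2 x" "T g2 xb"] by (simp add: norm_minus_commute)
  finally have "norm (T g1 x) \<le> norm (T g2 xb) + A4 * a" by (simp add: A4_def distrib_right)
  then have "ennreal (norm (T g1 x)) \<le> ennreal (norm (T g2 xb)) + ennreal (A4 * a)"
    using A4_pos a by (simp flip: ennreal_plus add: ennreal_leI)
  also have "\<dots> \<le> mt f xb + ennreal (A4 * a)"
    unfolding g2_def maximal_truncation_eq using \<epsilon>'(1) by (intro add_right_mono SUP_upper) auto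
  finally show "ennreal (norm (T (trunc (trunc f R xb) \<epsilon> x) x)) \<le> mt f xb + ennreal (A4 * a)"
    by (simp add: g1_def)
qed

text \<open>f is split at distance 8 \<rho> from xb. The far part contributes at most \<mu> + \<nu>
  on the ball, so the excess c must come from the near part, whose norm is controlled by its average
  at z. Two points appear because smallness of the maximal truncation is known at xb and smallness
  of the averages at z, and these need not coincide.\<close>

lemma maximal_truncation_local:
  assumes f: "integrable lebesgue f" and c: "0 < c" and \<rho>: "0 < \<rho>"
    and \<mu>: "0 \<le> \<mu>" "mt f xb \<le> ennreal \<mu>"
    and z: "z \<in> ball xb (8 * \<rho>)" "z \<notin> lev (mag f) a" and a: "0 \<le> a" "A4 * a \<le> \<nu>"
  obtains H where "H \<in> sets lebesgue" "emeasure lebesgue H \<le> ennreal (A3 / c * a * 16 ^ CARD('n)) * emeasure lebesgue (ball xb \<rho>)"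
    "{x \<in> cball xb \<rho>. ennreal (\<mu> + \<nu> + c) < mt f x} \<subseteq> H"
proof -
  let ?n = "CARD('n)"
  define f2 where "f2 = trunc f (8 * \<rho>) xb"
  define f1 where "f1 y = f y - f2 y" for y
  have f2: "integrable lebesgue f2" unfolding f2_def by (rule trunc_integrable[OF f])
  have f1: "integrable lebesgue f1" unfolding f1_def using f f2 by (intro Bochner_Integration.integrable_diff)
  define H where "H = {x. ennreal c < mt f1 x}"
  have "open H" unfolding H_def using c by (intro open_maximal_truncation_greater f1) auto
  then have H: "H \<in> sets lebesgue" by simp
  have "L1_norm f1 \<le> a * measure lebesgue (ball xb (16 * \<rho>))"
  proof (rule L1_norm_le_ball[OF f1 _ _ z(2) a(1)])
    show "ennreal (norm (f1 y)) \<le> mag f y * indicator (ball xb (16 * \<rho>)) y" for y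
      using \<rho> by (auto simp: f1_def f2_def trunc_eq split: split_indicator)
    show "z \<in> ball xb (16 * \<rho>)" using z(1) \<rho> by simp
  qed
  also have "measure lebesgue (ball xb (16 * \<rho>)) = 16 ^ ?n * measure lebesgue (ball xb \<rho>)"
    using \<rho> by (intro measure_ball_scale) auto
  finally have N1: "L1_norm f1 \<le> a * (16 ^ ?n * measure lebesgue (ball xb \<rho>))" .
  have "emeasure lebesgue H \<le> ennreal (A3 / c * L1_norm f1)"
    unfolding H_def by (rule maximal_truncation_weak_type[OF f1 c])
  also have "\<dots> \<le> ennreal (A3 / c * (a * (16 ^ ?n * measure lebesgue (ball xb \<rho>))))"
    using N1 A3_pos c by (intro ennreal_leI mult_left_mono) auto
  also have "\<dots> = ennreal (A3 / c * a * 16 ^ ?n) * emeasure lebesgue (ball xb \<rho>)"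
    using \<rho> A3_pos c a(1) m1_pos by (simp only: emeasure_ball_eq measure_ball less_imp_le) (simp add: mult_ac flip: ennreal_mult)
  finally have Hm: "emeasure lebesgue H \<le> ennreal (A3 / c * a * 16 ^ ?n) * emeasure lebesgue (ball xb \<rho>)" .
  have "{x \<in> cball xb \<rho>. ennreal (\<mu> + \<nu> + c) < mt f x} \<subseteq> H"
  proof
    fix x assume x: "x \<in> {x \<in> cball xb \<rho>. ennreal (\<mu> + \<nu> + c) < mt f x}"
    have \<nu>: "0 \<le> \<nu>" using a A4_pos by (meson mult_nonneg_nonneg less_imp_le order_trans)
    have "mt f2 x \<le> mt f xb + ennreal (A4 * a)"
      unfolding f2_def using x \<rho> by (intro maximal_truncation_far_le[OF f _ \<rho> _ z a(1)]) (auto simp: dist_commute)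
    also have "\<dots> \<le> ennreal \<mu> + ennreal \<nu>" using \<mu> a by (intro add_mono ennreal_leI) auto
    finally have 2: "mt f2 x \<le> ennreal (\<mu> + \<nu>)" using \<mu> \<nu> by simp
    have "mt f x \<le> mt f1 x + mt f2 x"
      by (intro maximal_truncation_add_le f1 f2) (simp add: f1_def)
    also have "\<dots> \<le> mt f1 x + ennreal (\<mu> + \<nu>)" using 2 by (intro add_left_mono)
    finally have "ennreal (\<mu> + \<nu> + c) < mt f1 x + ennreal (\<mu> + \<nu>)" using x by auto
    moreover have "ennreal (\<mu> + \<nu> + c) = ennreal c + ennreal (\<mu> + \<nu>)" using \<mu> \<nu> c by (simp flip: ennreal_plus add: add_ac)
    ultimately have "ennreal c + ennreal (\<mu> + \<nu>) < mt f1 x + ennreal (\<mu> + \<nu>)" by simp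
    then have "ennreal c < mt f1 x" using add_right_mono[of "mt f1 x" "ennreal c" "ennreal (\<mu> + \<nu>)"] not_less by blast
    then show "x \<in> H" by (simp add: H_def)
  qed
  with H Hm show thesis by (rule that)
qed

end

section \<open>Maximal dyadic cubes\<close>

text \<open>Equality of floors makes the cubes of one generation the classes of an equivalence
  relation; nesting is then halving of the floors.\<close>

definition dyadic :: "int \<Rightarrow> real^'n \<Rightarrow> (real^'n) set" where
  "dyadic k x = {y. \<forall>i. \<lfloor>y $ i / 2 powi k\<rfloor> = \<lfloor>x $ i / 2 powi k\<rfloor>}"

lemma dyadic_self: "x \<in> dyadic k x"
  by (simp add: dyadic_def)

lemma dyadic_eq: "y \<in> dyadic k x \<Longrightarrow> dyadic k y = dyadic k x"
  by (simp add: dyadic_def)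

lemma dyadic_eq_hbox: "dyadic k x = hbox (\<chi> i. of_int \<lfloor>x $ i / 2 powi k\<rfloor> * 2 powi k) (2 powi k)"
proof -
  have h: "0 < (2::real) powi k" by simp
  have "\<lfloor>a / h\<rfloor> = m \<longleftrightarrow> of_int m * h \<le> a \<and> a < of_int m * h + h" if "0 < h" for a h :: real and m
    using that by (auto simp: floor_eq_iff field_simps)
  from this[OF h] show ?thesis unfolding dyadic_def hbox_def by auto
qed

lemma dyadic_subset_Suc: "dyadic k x \<subseteq> dyadic (k + 1) x"
proof
  fix y assume y: "y \<in> dyadic k x"
  have *: "\<lfloor>a / 2 powi (k + 1)\<rfloor> = \<lfloor>a / 2 powi k\<rfloor> div 2" for a :: real
    using floor_divide_real_eq_div[of 2 "a / 2 powi k"] by (simp add: power_int_add_1)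
  show "y \<in> dyadic (k + 1) x" using y by (simp add: dyadic_def *)
qed

lemma dyadic_mono: "k \<le> l \<Longrightarrow> dyadic k x \<subseteq> dyadic l x"
proof (induction l rule: int_ge_induct)
  case (step i)
  then show ?case using dyadic_subset_Suc[of i x] by blast
qed simp

lemma cube_dyadic: "cube (dyadic k x)"
  unfolding cube_iff dyadic_eq_hbox by (intro exI conjI) auto

lemma emeasure_dyadic: "emeasure lebesgue (dyadic k x) = ennreal ((2 powi k) ^ CARD('n))" for x :: "real^'n"
  unfolding dyadic_eq_hbox by (simp add: emeasure_hbox)

lemma dyadic_dist_less: "y \<in> dyadic k x \<Longrightarrow> z \<in> dyadic k x \<Longrightarrow> dist y z < CARD('n) * 2 powi k" for x :: "real^'n"
  unfolding dyadic_eq_hbox by (rule hbox_dist_less)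

text \<open>The cubes are those inside \<Omega> whose parent is not. A point xb of the parent
  outside \<Omega> is at distance at most 2 n s from all of the cube. Maximal cubes exist because
  \<Omega> has finite measure and cannot contain arbitrarily large cubes.\<close>

lemma maximal_dyadic_cubes:
  fixes \<Omega> :: "(real^'n) set"
  assumes o: "open \<Omega>" and fin: "emeasure lebesgue \<Omega> < \<infinity>"
  obtains \<Q> where "countable \<Q>" "\<forall>Q\<in>\<Q>. cube Q" "disjoint \<Q>" "\<Union>\<Q> = \<Omega>"
    "\<And>Q. Q \<in> \<Q> \<Longrightarrow> \<exists>(s::real) xb. 0 < s \<and> emeasure lebesgue Q = ennreal (s ^ CARD('n)) \<and> xb \<notin> \<Omega> \<and> Q \<subseteq> cball xb (2 * CARD('n) * s)"
proof -
  let ?n = "CARD('n)"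
  define \<Q> where "\<Q> = {dyadic k x | k x. dyadic k x \<subseteq> \<Omega> \<and> \<not> dyadic (k + 1) x \<subseteq> \<Omega>}"
  show thesis
  proof (rule that)
    show "\<forall>Q\<in>\<Q>. cube Q" using cube_dyadic by (auto simp: \<Q>_def)
    show "countable \<Q>"
    proof (rule countable_subset)
      show "\<Q> \<subseteq> range (\<lambda>(k, g). {y. \<forall>i::'n. \<lfloor>y $ i / 2 powi k\<rfloor> = g i})"
      proof
        fix Q assume "Q \<in> \<Q>"
        then obtain k x where "Q = dyadic k x" by (auto simp: \<Q>_def)
        then have "Q = (\<lambda>(k, g). {y. \<forall>i::'n. \<lfloor>y $ i / 2 powi k\<rfloor> = g i}) (k, \<lambda>i. \<lfloor>x $ i / 2 powi k\<rfloor>)"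
          by (simp add: dyadic_def)
        then show "Q \<in> range (\<lambda>(k, g). {y. \<forall>i::'n. \<lfloor>y $ i / 2 powi k\<rfloor> = g i})" by (rule range_eqI)
      qed
    qed simp
    show "disjoint \<Q>"
      unfolding disjoint_def
    proof (intro ballI impI)
      fix P Q assume PQ: "P \<in> \<Q>" "Q \<in> \<Q>" "P \<noteq> Q"
      obtain k x where P: "P = dyadic k x" "P \<subseteq> \<Omega>" "\<not> dyadic (k + 1) x \<subseteq> \<Omega>" using PQ by (auto simp: \<Q>_def)
      obtain l y where Q: "Q = dyadic l y" "Q \<subseteq> \<Omega>" "\<not> dyadic (l + 1) y \<subseteq> \<Omega>" using PQ by (auto simp: \<Q>_def)
      show "P \<inter> Q = {}"
      proof (rule ccontr)
        assume "P \<inter> Q \<noteq> {}"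
        then obtain z where z: "z \<in> P" "z \<in> Q" by blast
        have eP: "P = dyadic k z" "dyadic (k + 1) x = dyadic (k + 1) z"
          using z P dyadic_subset_Suc[of k x] dyadic_eq by blast+
        have eQ: "Q = dyadic l z" "dyadic (l + 1) y = dyadic (l + 1) z"
          using z Q dyadic_subset_Suc[of l y] dyadic_eq by blast+
        have nP: "\<not> dyadic (k + 1) z \<subseteq> \<Omega>" and nQ: "\<not> dyadic (l + 1) z \<subseteq> \<Omega>"
          and sP: "dyadic k z \<subseteq> \<Omega>" and sQ: "dyadic l z \<subseteq> \<Omega>" using eP eQ P Q by simp_all
        have "\<not> k < l"
        proof
          assume "k < l"
          then have "dyadic (k + 1) z \<subseteq> dyadic l z" by (intro dyadic_mono) simp
          then show False using nP sQ by (meson order_trans)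
        qed
        moreover have "\<not> l < k"
        proof
          assume "l < k"
          then have "dyadic (l + 1) z \<subseteq> dyadic k z" by (intro dyadic_mono) simp
          then show False using nQ sP by (meson order_trans)
        qed
        ultimately have "k = l" by simp
        then show False using eP eQ PQ by simp
      qed
    qed
    show "\<exists>(s::real) xb. 0 < s \<and> emeasure lebesgue Q = ennreal (s ^ ?n) \<and> xb \<notin> \<Omega> \<and> Q \<subseteq> cball xb (2 * ?n * s)" if Q: "Q \<in> \<Q>" for Q
    proof -
      obtain k x where P: "Q = dyadic k x" "\<not> dyadic (k + 1) x \<subseteq> \<Omega>" using Q by (auto simp: \<Q>_def)
      obtain xb where xb: "xb \<in> dyadic (k + 1) x" "xb \<notin> \<Omega>" using P by blast
      have "Q \<subseteq> cball xb (2 * ?n * 2 powi k)"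
      proof
        fix y assume "y \<in> Q"
        then have "y \<in> dyadic (k + 1) x" using P dyadic_subset_Suc[of k x] by blast
        then have "dist xb y < ?n * 2 powi (k + 1)" by (rule dyadic_dist_less[OF xb(1)])
        then show "y \<in> cball xb (2 * ?n * 2 powi k)" by (simp add: power_int_add_1)
      qed
      then show ?thesis using P xb by (intro exI[of _ "2 powi k"] exI[of _ xb]) (simp add: emeasure_dyadic)
    qed
    show "\<Union>\<Q> = \<Omega>"
    proof
      show "\<Union>\<Q> \<subseteq> \<Omega>" by (auto simp: \<Q>_def)
      show "\<Omega> \<subseteq> \<Union>\<Q>"
      proof
        fix x assume x: "x \<in> \<Omega>"
        obtain r where r: "0 < r" "ball x r \<subseteq> \<Omega>" using openE[OF o x] by blast
        obtain m :: nat where m: "real ?n / r < 2 ^ m" using real_arch_pow[of 2 "real ?n / r"] by auto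
        define k0 where "k0 = - int m"
        have k0: "dyadic k0 x \<subseteq> \<Omega>"
        proof
          fix y assume "y \<in> dyadic k0 x"
          then have "dist x y < ?n * 2 powi k0" by (rule dyadic_dist_less[OF dyadic_self])
          also have "\<dots> = ?n / 2 ^ m" by (simp add: k0_def power_int_minus divide_inverse)
          also have "\<dots> \<le> r" using m r by (simp add: field_simps)
          finally show "y \<in> \<Omega>" using r by auto
        qed
        have "\<exists>j::nat. \<not> dyadic (k0 + int j) x \<subseteq> \<Omega>"
        proof (rule ccontr)
          assume "\<not> ?thesis"
          then have all: "dyadic (k0 + int j) x \<subseteq> \<Omega>" for j by blast
          obtain M where M: "0 \<le> M" "emeasure lebesgue \<Omega> = ennreal M" using fin by (cases "emeasure lebesgue \<Omega>") auto
          obtain j where j: "M < 2 ^ j" using real_arch_pow[of 2 M] by auto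
          have "emeasure lebesgue (dyadic (k0 + int (m + j)) x) \<le> emeasure lebesgue \<Omega>"
            using o by (intro emeasure_mono all) auto
          moreover have e: "k0 + int (m + j) = int j" by (simp add: k0_def)
          ultimately have "ennreal ((2 ^ j) ^ ?n) \<le> ennreal M"
            unfolding e emeasure_dyadic M(2) by simp
          then have "(2 ^ j) ^ ?n \<le> M" using M by (subst (asm) ennreal_le_iff) auto
          moreover have "(2::real) ^ j \<le> (2 ^ j) ^ ?n" by (intro self_le_power) auto
          ultimately show False using j by linarith
        qed
        then have J: "\<not> dyadic (k0 + int (LEAST j. \<not> dyadic (k0 + int j) x \<subseteq> \<Omega>)) x \<subseteq> \<Omega>" by (rule LeastI_ex)
        define j where "j = (LEAST j. \<not> dyadic (k0 + int j) x \<subseteq> \<Omega>)"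
        have "j \<noteq> 0" using J k0 unfolding j_def[symmetric] by (intro notI) simp
        then obtain i where i: "j = Suc i" by (cases j) auto
        have "dyadic (k0 + int i) x \<subseteq> \<Omega>" using not_less_Least[of i "\<lambda>j. \<not> dyadic (k0 + int j) x \<subseteq> \<Omega>"] i by (simp add: j_def)
        moreover have "\<not> dyadic (k0 + int i + 1) x \<subseteq> \<Omega>" using J unfolding j_def[symmetric] i by (simp add: add.commute add.left_commute)
        ultimately have "dyadic (k0 + int i) x \<in> \<Q>" unfolding \<Q>_def by blast
        then show "x \<in> \<Union>\<Q>" using dyadic_self by blast
      qed
    qed
  qed
qed

text \<open>Hoelder's inequality on \<open>E\<close>, in the elementary form \<open>w \<le> \<tau> + \<tau>\<^bsup>1-r\<^esup> w\<^sup>r\<close> with an optimal \<open>\<tau>\<close>.\<close>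

lemma weight_of_small_subset_le:
  fixes w :: "real^'n \<Rightarrow> real"
  assumes w: "weight w" and r: "1 < r" and Q: "cube Q" and E: "E \<in> sets lebesgue" "E \<subseteq> Q"
    and \<eta>: "0 < \<eta>" "emeasure lebesgue E \<le> ennreal \<eta> * emeasure lebesgue Q"
  shows "weight_of w E \<le> ennreal (2 * \<eta> powr (1 - 1 / r)) *
    (epow (cube_avg Q (\<lambda>x. ennreal (w x powr r))) (1 / r) * emeasure lebesgue Q)"
proof -
  have wm: "w \<in> borel_measurable lebesgue" by (rule weight_measurable[OF w])
  obtain a s where s: "0 < s" "Q = hbox a s" using Q by (auto simp: cube_iff)
  have Qs: "Q \<in> sets lebesgue" using s by simp
  define q where "q = s ^ CARD('n)"
  have q: "0 < q" "emeasure lebesgue Q = ennreal q" using s by (simp_all add: q_def emeasure_hbox)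
  have c: "0 < 2 * \<eta> powr (1 - 1 / r)" using \<eta> by simp
  show ?thesis
  proof (cases "cube_avg Q (\<lambda>x. ennreal (w x powr r))")
    case top
    then show ?thesis using c q by (simp add: ennreal_mult_top ennreal_top_mult)
  next
    case (real \<beta>)
    have I: "(\<integral>\<^sup>+x\<in>Q. ennreal (w x powr r) \<partial>lebesgue) = ennreal (\<beta> * q)"
    proof -
      have "(\<integral>\<^sup>+x\<in>Q. ennreal (w x powr r) \<partial>lebesgue) = cube_avg Q (\<lambda>x. ennreal (w x powr r)) * ennreal q"
        unfolding cube_avg_def q(2) using q(1) by (simp add: ennreal_divide_times)
      then show ?thesis using real q by (simp add: ennreal_mult)
    qed
    show ?thesis
    proof (cases "\<beta> = 0")
      case True
      then have "(\<integral>\<^sup>+x. ennreal (w x powr r) * indicator Q x \<partial>lebesgue) = 0" using I by simp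
      then have "AE x in lebesgue. ennreal (w x powr r) * indicator Q x = 0"
        using wm Qs by (subst (asm) nn_integral_0_iff_AE) auto
      then have "AE x in lebesgue. ennreal (w x) * indicator E x = 0"
      proof eventually_elim
        case (elim x)
        then show ?case using E(2) weight_nonneg[OF w, of x] by (auto split: split_indicator_asm split_indicator simp: ennreal_eq_0_iff)
      qed
      then have "weight_of w E = 0"
        unfolding weight_of_def using wm E by (subst nn_integral_0_iff_AE) auto
      then show ?thesis by simp
    next
      case False
      then have \<beta>: "0 < \<beta>" using real by simp
      define b where "b = \<beta> powr (1 / r)"
      have b: "0 < b" "b powr r = \<beta>" using \<beta> r by (simp_all add: b_def powr_powr)
      \<comment> \<open>This \<tau> makes the two summands equal, each
        \<open>b * \<eta> powr (1 - 1 / r)\<close> per unit of measure of Q.\<close>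
      define \<tau> where "\<tau> = b * \<eta> powr (- (1 / r))"
      have \<tau>: "0 < \<tau>" using b \<eta> by (simp add: \<tau>_def)
      have t1: "\<tau> * \<eta> = b * \<eta> powr (1 - 1 / r)"
        unfolding \<tau>_def using \<eta> by (simp add: powr_diff powr_minus field_simps)
      have t2: "\<tau> powr (1 - r) * \<beta> = b * \<eta> powr (1 - 1 / r)"
      proof -
        have "\<tau> powr (1 - r) = b powr (1 - r) * \<eta> powr (1 - 1 / r)"
        proof -
          have "- (1 / r) * (1 - r) = 1 - 1 / r" using r by (simp add: field_simps)
          then show ?thesis unfolding \<tau>_def using b \<eta> by (simp only: powr_mult powr_powr)
        qed
        moreover have "b powr (1 - r) * b powr r = b" using b(1) by (simp flip: powr_add)
        ultimately show ?thesis using b(2) by (metis mult.assoc mult.commute)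
      qed
      have pt: "w x \<le> \<tau> + \<tau> powr (1 - r) * w x powr r" for x
      proof (cases "w x \<le> \<tau>")
        case True
        then show ?thesis by (simp add: add_increasing2)
      next
        case False
        then have "0 < w x" using \<tau> by linarith
        have "w x = w x powr (1 - r) * w x powr r" using \<open>0 < w x\<close> by (simp flip: powr_add)
        also have "\<dots> \<le> \<tau> powr (1 - r) * w x powr r"
          using False \<tau> r by (intro mult_right_mono powr_mono2') auto
        finally show ?thesis using \<tau> by linarith
      qed
      have "weight_of w E \<le> (\<integral>\<^sup>+x. ennreal \<tau> * indicator E x + ennreal (\<tau> powr (1 - r)) * (ennreal (w x powr r) * indicator Q x) \<partial>lebesgue)"
        unfolding weight_of_def
      proof (rule nn_integral_mono)
        fix x
        have "ennreal (w x) \<le> ennreal \<tau> + ennreal (\<tau> powr (1 - r)) * ennreal (w x powr r)"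
          using pt[of x] \<tau> by (simp add: ennreal_leI flip: ennreal_mult ennreal_plus)
        then show "ennreal (w x) * indicator E x \<le> ennreal \<tau> * indicator E x + ennreal (\<tau> powr (1 - r)) * (ennreal (w x powr r) * indicator Q x)"
          using E(2) by (auto split: split_indicator)
      qed
      also have "\<dots> = ennreal \<tau> * emeasure lebesgue E + ennreal (\<tau> powr (1 - r)) * (\<integral>\<^sup>+x\<in>Q. ennreal (w x powr r) \<partial>lebesgue)"
      proof -
        have m: "(\<lambda>x. ennreal (w x powr r) * indicator Q x) \<in> borel_measurable lebesgue"
          using wm Qs by (intro borel_measurable_times_ennreal borel_measurable_indicator) auto
        show ?thesis using m E(1) by (subst nn_integral_add) (auto simp: nn_integral_cmult)
      qed
      also have "\<dots> \<le> ennreal \<tau> * (ennreal \<eta> * ennreal q) + ennreal (\<tau> powr (1 - r)) * ennreal (\<beta> * q)"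
        using \<eta>(2) unfolding I q(2) by (intro add_right_mono mult_left_mono) auto
      also have "\<dots> = ennreal (\<tau> * \<eta> * q + \<tau> powr (1 - r) * \<beta> * q)"
        using \<tau> \<eta> q \<beta> by (simp add: mult.assoc flip: ennreal_mult ennreal_plus)
      also have "\<tau> * \<eta> * q + \<tau> powr (1 - r) * \<beta> * q = 2 * \<eta> powr (1 - 1 / r) * (b * q)"
        unfolding t1 t2 by simp
      also have "ennreal \<dots> = ennreal (2 * \<eta> powr (1 - 1 / r)) * (epow (ennreal \<beta>) (1 / r) * ennreal q)"
        using b q \<beta> by (simp add: epow_ennreal b_def ennreal_mult)
      finally show ?thesis using real q by simp
    qed
  qed
qed

section \<open>The good-lambda inequality\<close>

context dini_CZ
begin

text \<open>Where the maximal truncation is at most c/4, localisation with x as both centre and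
  reference point shows that its level set at c has density \<open>O(Mf / c)\<close> in every ball
  about x. If Mf is not small against c at x, the bound 1 suffices.\<close>

lemma mx_maximal_truncation_level_le:
  obtains C6 where "0 < C6" "\<And>f c x. integrable lebesgue f \<Longrightarrow> 0 < c \<Longrightarrow> mt f x \<le> ennreal (c / 4) \<Longrightarrow>
    mx (indicator {y. ennreal c < mt f y}) x \<le> ennreal (C6 / c) * mx (mag f) x"
proof -
  let ?n = "CARD('n)"
  obtain b :: real where b: "0 < b"
    "\<And>(v :: real^'n \<Rightarrow> ennreal) t x. 0 \<le> t \<Longrightarrow> x \<in> lev v t \<Longrightarrow> ennreal (b * t) < mx v x"
    "\<And>(v :: real^'n \<Rightarrow> ennreal) t x. 0 \<le> t \<Longrightarrow> ennreal t < mx v x \<Longrightarrow> x \<in> lev v (b * t)"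
    by (rule mx_lev_equiv) blast
  define C6 where "C6 = 2 * 32 ^ ?n * A3 / b\<^sup>2 + 4 * A4 / b"
  have p: "0 < 2 * 32 ^ ?n * A3 / b\<^sup>2" "0 < 4 * A4 / b" using b A3_pos A4_pos by auto
  then have C6: "0 < C6" "2 * 32 ^ ?n * A3 / b\<^sup>2 \<le> C6" "4 * A4 / b \<le> C6" by (auto simp: C6_def)
  show thesis
  proof (rule that[OF C6(1)])
    fix f c x
    assume f: "integrable lebesgue f" and c: "0 < c" and x: "mt f x \<le> ennreal (c / 4)"
    let ?O = "{y. ennreal c < mt f y}"
    have Oo: "open ?O" using c by (intro open_maximal_truncation_greater f) auto
    then have Os: "?O \<in> sets lebesgue" by simp
    show "mx (indicator ?O) x \<le> ennreal (C6 / c) * mx (mag f) x"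
    proof (cases "mx (mag f) x")
      case top
      then show ?thesis using C6(1) c by (simp add: ennreal_mult_top)
    next
      case (real s)
      define a where "a = s / b"
      have a: "0 \<le> a" using real b by (simp add: a_def)
      have xl: "x \<notin> lev (mag f) a"
      proof
        assume "x \<in> lev (mag f) a"
        then have "ennreal (b * a) < mx (mag f) x" using a by (intro b(2)) auto
        then show False using real b by (simp add: a_def)
      qed
      show ?thesis
      proof (cases "A4 * a \<le> c / 4")
        case False
        then have "c / 4 < A4 * (s / b)" by (simp add: a_def)
        then have "c \<le> 4 * A4 / b * s" by (simp add: algebra_simps)
        also have "\<dots> \<le> C6 * s" using C6(3) real by (intro mult_right_mono) auto
        finally have "1 \<le> C6 / c * s" using c by (simp add: field_simps)
        then have "1 \<le> ennreal (C6 / c) * mx (mag f) x"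
          using real C6(1) c by (simp add: ennreal_le_iff flip: ennreal_mult ennreal_1)
        then show ?thesis using mx_indicator_le_1 order_trans by blast
      next
        case True
        have loc: "emeasure lebesgue (?O \<inter> ball x \<rho>) \<le> ennreal (2 * A3 / c * a * 16 ^ ?n) * emeasure lebesgue (ball x \<rho>)"
          if \<rho>: "0 < \<rho>" for \<rho>
        proof -
          \<comment> \<open>The level c is distributed as c/4 for the value at x, c/4 for moving the
            centre and c/2 for the near part.\<close>
          have c2: "0 < c / 2" "0 \<le> c / 4" using c by auto
          have zb: "x \<in> ball x (8 * \<rho>)" using \<rho> by simp
          obtain H where H: "H \<in> sets lebesgue"
            "emeasure lebesgue H \<le> ennreal (A3 / (c / 2) * a * 16 ^ ?n) * emeasure lebesgue (ball x \<rho>)"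
            "{y \<in> cball x \<rho>. ennreal (c / 4 + c / 4 + c / 2) < mt f y} \<subseteq> H"
            by (rule maximal_truncation_local[OF f c2(1) \<rho> c2(2) x zb xl a True])
          have "?O \<inter> ball x \<rho> \<subseteq> H" using H(3) by auto
          then have "emeasure lebesgue (?O \<inter> ball x \<rho>) \<le> emeasure lebesgue H" using H(1) by (rule emeasure_mono)
          also have "\<dots> \<le> ennreal (A3 / (c / 2) * a * 16 ^ ?n) * emeasure lebesgue (ball x \<rho>)" by (rule H(2))
          also have "A3 / (c / 2) * a * 16 ^ ?n = 2 * A3 / c * a * 16 ^ ?n" by simp
          finally show ?thesis .
        qed
        have nl: "x \<notin> lev (indicator ?O) (2 * A3 / c * a * 16 ^ ?n * 2 ^ ?n)"
        proof
          assume "x \<in> lev (indicator ?O) (2 * A3 / c * a * 16 ^ ?n * 2 ^ ?n)"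
          then obtain z \<rho> where \<rho>: "0 < \<rho>" "x \<in> ball z \<rho>"
            "ennreal (2 * A3 / c * a * 16 ^ ?n * 2 ^ ?n) * emeasure lebesgue (ball z \<rho>) < (\<integral>\<^sup>+y\<in>ball z \<rho>. indicator ?O y \<partial>lebesgue)"
            by (auto elim: levE)
          have sub: "ball z \<rho> \<subseteq> ball x (2 * \<rho>)"
          proof
            fix y assume "y \<in> ball z \<rho>"
            then show "y \<in> ball x (2 * \<rho>)" using \<rho>(2) dist_triangle[of x y z] by (simp add: dist_commute)
          qed
          have "(\<integral>\<^sup>+y\<in>ball z \<rho>. indicator ?O y \<partial>lebesgue) = emeasure lebesgue (?O \<inter> ball z \<rho>)"
            using Os by (intro set_nn_integral_indicator) auto
          also have "\<dots> \<le> emeasure lebesgue (?O \<inter> ball x (2 * \<rho>))"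
            using sub Os by (intro emeasure_mono) auto
          also have "\<dots> \<le> ennreal (2 * A3 / c * a * 16 ^ ?n) * emeasure lebesgue (ball x (2 * \<rho>))"
            using \<rho> by (intro loc) auto
          also have "\<dots> = ennreal (2 * A3 / c * a * 16 ^ ?n) * (ennreal (2 ^ ?n) * emeasure lebesgue (ball z \<rho>))"
            using \<rho> by (subst emeasure_ball_scale[of _ _ _ z]) auto
          also have "\<dots> = ennreal (2 * A3 / c * a * 16 ^ ?n * 2 ^ ?n) * emeasure lebesgue (ball z \<rho>)"
            using A3_pos c a by (intro ennreal_mult_left_assoc) auto
          finally show False using \<rho>(3) by simp
        qed
        define t where "t = 2 * A3 / c * a * 16 ^ ?n * 2 ^ ?n / b"
        have t: "0 \<le> t" "b * t = 2 * A3 / c * a * 16 ^ ?n * 2 ^ ?n" using A3_pos c a b by (simp_all add: t_def)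
        have "\<not> ennreal t < mx (indicator ?O) x"
        proof
          assume "ennreal t < mx (indicator ?O) x"
          then have "x \<in> lev (indicator ?O) (b * t)" by (rule b(3)[OF t(1)])
          then show False using nl unfolding t(2) by contradiction
        qed
        then have "mx (indicator ?O) x \<le> ennreal t" by simp
        also have "t = 2 * 32 ^ ?n * A3 / b\<^sup>2 / c * s"
        proof -
          have "(32::real) ^ ?n = 16 ^ ?n * 2 ^ ?n" by (simp flip: power_mult_distrib)
          then show ?thesis by (simp add: t_def a_def power2_eq_square field_simps)
        qed
        also have "ennreal (2 * 32 ^ ?n * A3 / b\<^sup>2 / c * s) \<le> ennreal (C6 / c * s)"
          using C6(2) c real by (intro ennreal_leI mult_right_mono divide_right_mono) auto
        also have "\<dots> = ennreal (C6 / c) * mx (mag f) x"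
          using C6(1) c real by (subst ennreal_mult) auto
        finally show ?thesis .
      qed
    qed
  qed
qed

end

lemma countable_weight_UN_le:
  fixes w :: "real^'n \<Rightarrow> real"
  assumes w: "weight w" and cnt: "countable \<Q>" and E: "\<And>Q. Q \<in> \<Q> \<Longrightarrow> E Q \<in> sets lebesgue"
    and le: "\<And>Q. Q \<in> \<Q> \<Longrightarrow> weight_of w (E Q) \<le> g Q"
  shows "weight_of w (\<Union>Q\<in>\<Q>. E Q) \<le> (\<Sum>\<^sub>\<infinity>Q\<in>\<Q>. g Q)"
proof (cases "\<Q> = {}")
  case True
  then show ?thesis by (simp add: weight_of_def)
next
  case False
  let ?M = "density lebesgue (\<lambda>x. ennreal (w x))"
  define q where "q = from_nat_into \<Q>"
  have q: "range q = \<Q>" unfolding q_def by (rule range_from_nat_into[OF False cnt])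
  define S where "S k = (\<Union>Q\<in>q ` {..<k}. E Q)" for k :: nat
  have qQ: "q i \<in> \<Q>" for i using q by blast
  have Ss: "S k \<in> sets ?M" for k unfolding S_def using E qQ by (intro sets.finite_UN) auto
  have inc: "incseq S" unfolding S_def by (intro incseq_SucI) (auto simp: lessThan_Suc)
  have un: "(\<Union>k. S k) = (\<Union>Q\<in>\<Q>. E Q)"
  proof
    show "(\<Union>k. S k) \<subseteq> (\<Union>Q\<in>\<Q>. E Q)" unfolding S_def using qQ by auto
    show "(\<Union>Q\<in>\<Q>. E Q) \<subseteq> (\<Union>k. S k)"
    proof
      fix x assume "x \<in> (\<Union>Q\<in>\<Q>. E Q)"
      then obtain Q where Q: "Q \<in> \<Q>" "x \<in> E Q" by blast
      then obtain i where "Q = q i" using q by blast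
      then have "x \<in> S (Suc i)" using Q unfolding S_def by auto
      then show "x \<in> (\<Union>k. S k)" by blast
    qed
  qed
  have us: "(\<Union>Q\<in>\<Q>. E Q) \<in> sets lebesgue" using E cnt by (intro sets.countable_UN'') auto
  have "weight_of w (\<Union>Q\<in>\<Q>. E Q) = emeasure ?M (\<Union>k. S k)"
    unfolding un by (rule weight_of_eq_emeasure[OF w us])
  also have "\<dots> = (SUP k. emeasure ?M (S k))"
    using Ss inc by (intro SUP_emeasure_incseq[symmetric]) auto
  also have "\<dots> \<le> (\<Sum>\<^sub>\<infinity>Q\<in>\<Q>. g Q)"
  proof (rule SUP_least)
    fix k
    have "emeasure ?M (S k) \<le> (\<Sum>Q\<in>q ` {..<k}. emeasure ?M (E Q))"
      unfolding S_def using E qQ by (intro emeasure_subadditive_finite) auto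
    also have "\<dots> \<le> (\<Sum>Q\<in>q ` {..<k}. g Q)"
    proof (rule sum_mono)
      fix Q assume "Q \<in> q ` {..<k}"
      then have "Q \<in> \<Q>" using qQ by auto
      then show "emeasure ?M (E Q) \<le> g Q" using le E weight_of_eq_emeasure[OF w] by metis
    qed
    also have "\<dots> \<le> (\<Sum>\<^sub>\<infinity>Q\<in>\<Q>. g Q)"
      using qQ by (subst nonneg_infsum_complete) (auto intro!: SUP_upper)
    finally show "emeasure ?M (S k) \<le> (\<Sum>\<^sub>\<infinity>Q\<in>\<Q>. g Q)" .
  qed
  finally show ?thesis .
qed

lemma ennreal_infsum_cmult_le:
  fixes g :: "'a \<Rightarrow> ennreal"
  shows "(\<Sum>\<^sub>\<infinity>Q\<in>\<Q>. c * g Q) \<le> c * (\<Sum>\<^sub>\<infinity>Q\<in>\<Q>. g Q)"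
proof (subst (1) nonneg_infsum_complete, simp, rule SUP_least)
  fix S assume "S \<in> {S. finite S \<and> S \<subseteq> \<Q>}"
  then have "(\<Sum>Q\<in>S. g Q) \<le> (\<Sum>\<^sub>\<infinity>Q\<in>\<Q>. g Q)"
    by (subst nonneg_infsum_complete) (auto intro!: SUP_upper)
  then show "(\<Sum>Q\<in>S. c * g Q) \<le> c * (\<Sum>\<^sub>\<infinity>Q\<in>\<Q>. g Q)"
    by (simp add: mult_left_mono flip: sum_distrib_left)
qed

context dini_CZ
begin

text \<open>The exponent \<theta> is the gain of Hoelder's inequality with the exponent r of the
  \<open>SC\<close> condition. The constants do not depend on \<gamma>, which is chosen later to
  make the second term small.\<close>

lemma good_lambda:
  assumes w: "weight w" and SC: "w \<in> SC p"
  obtains D \<theta> where "0 < D" "0 < \<theta>" "\<And>f c \<gamma>. integrable lebesgue f \<Longrightarrow> 0 < c \<Longrightarrow> 0 < \<gamma> \<Longrightarrow> A4 * \<gamma> \<le> 1/2 \<Longrightarrow>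
    weight_of w {x. ennreal (2 * c) < mt f x} \<le> weight_of w (lev (mag f) (\<gamma> * c)) +
      ennreal (D * \<gamma> powr \<theta>) * (\<integral>\<^sup>+x. epow (mx (indicator {y. ennreal c < mt f y}) x) p * ennreal (w x) \<partial>lebesgue)"
proof -
  let ?n = "CARD('n)"
  obtain Cs r where Cs: "0 < Cs" "1 < r" and sc: "\<And>\<Q>. (\<forall>Q\<in>\<Q>. cube Q) \<Longrightarrow> disjoint \<Q> \<Longrightarrow>
        (\<Sum>\<^sub>\<infinity>Q\<in>\<Q>. epow (cube_avg Q (\<lambda>x. ennreal (w x powr r))) (1 / r) * emeasure lebesgue Q)
          \<le> ennreal Cs * (\<integral>\<^sup>+x. epow (mx (indicator (\<Union>\<Q>)) x) p * ennreal (w x) \<partial>lebesgue)"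
    using SC unfolding SC_def hl_maximal_indicator by blast
  \<comment> \<open>The bound of \<open>maximal_truncation_local\<close> with near level c/2 and
    averages \<gamma> c on a ball of radius 2 n s, relative to a cube of side s.\<close>
  define D0 where "D0 = 2 * A3 * 16 ^ ?n * (2 * ?n) ^ ?n * m1"
  have D0: "0 < D0" unfolding D0_def using A3_pos m1_pos by simp
  define \<theta> where "\<theta> = 1 - 1 / r"
  have \<theta>: "0 < \<theta>" using Cs(2) by (simp add: \<theta>_def)
  define D where "D = 2 * D0 powr \<theta> * Cs"
  have D: "0 < D" unfolding D_def using D0 Cs by simp
  show thesis
  proof (rule that[OF D \<theta>])
    fix f :: "real^'n \<Rightarrow> complex" and c \<gamma> :: real
    assume f: "integrable lebesgue f" and c: "0 < c" and \<gamma>: "0 < \<gamma>" "A4 * \<gamma> \<le> 1/2"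
    let ?O = "{y. ennreal c < mt f y}" and ?L = "lev (mag f) (\<gamma> * c)"
    have Oo: "open ?O" using c by (intro open_maximal_truncation_greater f) auto
    have "emeasure lebesgue ?O \<le> ennreal (A3 / c * L1_norm f)" by (rule maximal_truncation_weak_type[OF f c])
    also have "\<dots> < \<infinity>" by simp
    finally have fin: "emeasure lebesgue ?O < \<infinity>" .
    obtain \<Q> where \<Q>: "countable \<Q>" "\<forall>Q\<in>\<Q>. cube Q" "disjoint \<Q>" "\<Union>\<Q> = ?O"
      "\<And>Q. Q \<in> \<Q> \<Longrightarrow> \<exists>(s::real) xb. 0 < s \<and> emeasure lebesgue Q = ennreal (s ^ ?n) \<and> xb \<notin> ?O \<and> Q \<subseteq> cball xb (2 * ?n * s)"
      using maximal_dyadic_cubes[OF Oo fin] by (metis (no_types, lifting))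
    define g where "g Q = epow (cube_avg Q (\<lambda>x. ennreal (w x powr r))) (1 / r) * emeasure lebesgue Q" for Q
    have Qs: "Q \<in> sets lebesgue" if "Q \<in> \<Q>" for Q
    proof -
      have "cube Q" using \<Q>(2) that by blast
      then show ?thesis by (auto simp: cube_iff)
    qed
    have "\<exists>E. E \<in> sets lebesgue \<and> E \<subseteq> Q \<and> {x \<in> Q. ennreal (2 * c) < mt f x} \<subseteq> ?L \<union> E \<and>
        emeasure lebesgue E \<le> ennreal (D0 * \<gamma>) * emeasure lebesgue Q" if Q: "Q \<in> \<Q>" for Q
    proof (cases "Q \<subseteq> ?L")
      \<comment> \<open>Such a cube is paid for by the weight of \<open>?L\<close>. Any other cube
        contains a point z at which the averages of f are at most \<gamma> c.\<close>
      case True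
      then show ?thesis by (intro exI[of _ "{}"]) auto
    next
      case False
      then obtain z where z: "z \<in> Q" "z \<notin> ?L" by blast
      obtain s :: real and xb where s: "0 < s" "emeasure lebesgue Q = ennreal (s ^ ?n)" "xb \<notin> ?O" "Q \<subseteq> cball xb (2 * ?n * s)"
        using \<Q>(5)[OF Q] by blast
      define \<rho> where "\<rho> = 2 * ?n * s"
      have \<rho>: "0 < \<rho>" using s by (simp add: \<rho>_def)
      have c2: "0 < c / 2" "0 \<le> c" "mt f xb \<le> ennreal c" "0 \<le> \<gamma> * c" using c \<gamma> s(3) by auto
      have "z \<in> cball xb \<rho>" using z(1) s(4) unfolding \<rho>_def by blast
      then have zb: "z \<in> ball xb (8 * \<rho>)" using \<rho> by simp
      have "A4 * (\<gamma> * c) = (A4 * \<gamma>) * c" by simp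
      also have "\<dots> \<le> 1/2 * c" using \<gamma>(2) c by (intro mult_right_mono) auto
      finally have ac: "A4 * (\<gamma> * c) \<le> c / 2" by simp
      obtain H where H: "H \<in> sets lebesgue"
        "emeasure lebesgue H \<le> ennreal (A3 / (c / 2) * (\<gamma> * c) * 16 ^ ?n) * emeasure lebesgue (ball xb \<rho>)"
        "{x \<in> cball xb \<rho>. ennreal (c + c / 2 + c / 2) < mt f x} \<subseteq> H"
        by (rule maximal_truncation_local[OF f c2(1) \<rho> c2(2,3) zb z(2) c2(4) ac])
      have e: "c + c / 2 + c / 2 = 2 * c" by simp
      have sub: "{x \<in> Q. ennreal (2 * c) < mt f x} \<subseteq> H \<inter> Q"
        using H(3) s(4) unfolding \<rho>_def[symmetric] e by blast
      have "emeasure lebesgue (H \<inter> Q) \<le> emeasure lebesgue H" using H(1) by (intro emeasure_mono) auto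
      also note H(2)
      also have "emeasure lebesgue (ball xb \<rho>) = ennreal (\<rho> ^ ?n * m1)" using \<rho> by (intro emeasure_ball_eq) simp
      also have "ennreal (A3 / (c / 2) * (\<gamma> * c) * 16 ^ ?n) * ennreal (\<rho> ^ ?n * m1) = ennreal (D0 * \<gamma> * s ^ ?n)"
      proof -
        have e2: "A3 / (c / 2) * (\<gamma> * c) * 16 ^ ?n * (\<rho> ^ ?n * m1) = D0 * \<gamma> * s ^ ?n"
          using c by (simp add: D0_def \<rho>_def power_mult_distrib mult_ac)
        have "ennreal (A3 / (c / 2) * (\<gamma> * c) * 16 ^ ?n) * ennreal (\<rho> ^ ?n * m1) =
            ennreal (A3 / (c / 2) * (\<gamma> * c) * 16 ^ ?n * (\<rho> ^ ?n * m1))"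
          using A3_pos c \<gamma> \<rho> m1_pos by (intro ennreal_mult[symmetric]) auto
        then show ?thesis unfolding e2 .
      qed
      also have "\<dots> = ennreal (D0 * \<gamma>) * emeasure lebesgue Q" unfolding s(2) using D0 \<gamma> s(1) by (intro ennreal_mult) auto
      finally show ?thesis using H(1) sub Qs[OF Q] by (intro exI[of _ "H \<inter> Q"]) auto
    qed
    then have "\<forall>Q\<in>\<Q>. \<exists>E. E \<in> sets lebesgue \<and> E \<subseteq> Q \<and> {x \<in> Q. ennreal (2 * c) < mt f x} \<subseteq> ?L \<union> E \<and>
        emeasure lebesgue E \<le> ennreal (D0 * \<gamma>) * emeasure lebesgue Q" by blast
    from bchoice[OF this] obtain E where E: "\<And>Q. Q \<in> \<Q> \<Longrightarrow> E Q \<in> sets lebesgue" "\<And>Q. Q \<in> \<Q> \<Longrightarrow> E Q \<subseteq> Q"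
      "\<And>Q. Q \<in> \<Q> \<Longrightarrow> {x \<in> Q. ennreal (2 * c) < mt f x} \<subseteq> ?L \<union> E Q"
      "\<And>Q. Q \<in> \<Q> \<Longrightarrow> emeasure lebesgue (E Q) \<le> ennreal (D0 * \<gamma>) * emeasure lebesgue Q" by blast
    have Es: "(\<Union>Q\<in>\<Q>. E Q) \<in> sets lebesgue" using E(1) \<Q>(1) by (intro sets.countable_UN'') auto
    have cover: "{x. ennreal (2 * c) < mt f x} \<subseteq> ?L \<union> (\<Union>Q\<in>\<Q>. E Q)"
    proof
      fix x assume x: "x \<in> {x. ennreal (2 * c) < mt f x}"
      have "ennreal c \<le> ennreal (2 * c)" using c by (intro ennreal_leI) auto
      then have "x \<in> ?O" using x by (auto intro: le_less_trans)
      then have "x \<in> \<Union>\<Q>" using \<Q>(4) by simp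
      then obtain Q where "Q \<in> \<Q>" "x \<in> Q" by blast
      then show "x \<in> ?L \<union> (\<Union>Q\<in>\<Q>. E Q)" using E(3) x by blast
    qed
    have "weight_of w {x. ennreal (2 * c) < mt f x} \<le> weight_of w (?L \<union> (\<Union>Q\<in>\<Q>. E Q))"
      by (rule weight_of_mono[OF cover])
    also have "\<dots> \<le> weight_of w ?L + weight_of w (\<Union>Q\<in>\<Q>. E Q)"
      using Es by (simp add: weight_of_eq_emeasure[OF w] emeasure_subadditive)
    also have "weight_of w (\<Union>Q\<in>\<Q>. E Q) \<le> (\<Sum>\<^sub>\<infinity>Q\<in>\<Q>. ennreal (2 * (D0 * \<gamma>) powr \<theta>) * g Q)"
    proof (rule countable_weight_UN_le[OF w \<Q>(1) E(1)])
      fix Q assume Q: "Q \<in> \<Q>"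
      then have "cube Q" using \<Q>(2) by blast
      then show "weight_of w (E Q) \<le> ennreal (2 * (D0 * \<gamma>) powr \<theta>) * g Q"
        unfolding \<theta>_def g_def using D0 \<gamma> Q by (intro weight_of_small_subset_le[OF w Cs(2)] E) auto
    qed
    also have "\<dots> \<le> ennreal (2 * (D0 * \<gamma>) powr \<theta>) * (\<Sum>\<^sub>\<infinity>Q\<in>\<Q>. g Q)" by (rule ennreal_infsum_cmult_le)
    \<comment> \<open>The \<open>SC\<close> condition is applied to the maximal dyadic cubes, whose
      union is the level set at c.\<close>
    also have "\<dots> \<le> ennreal (2 * (D0 * \<gamma>) powr \<theta>) * (ennreal Cs * (\<integral>\<^sup>+x. epow (mx (indicator ?O) x) p * ennreal (w x) \<partial>lebesgue))"
      unfolding g_def using sc[OF \<Q>(2,3)] unfolding \<Q>(4) by (intro mult_left_mono) auto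
    also have "\<dots> = ennreal (D * \<gamma> powr \<theta>) * (\<integral>\<^sup>+x. epow (mx (indicator ?O) x) p * ennreal (w x) \<partial>lebesgue)"
      using D0 \<gamma> by (subst ennreal_mult_left_assoc) (simp_all add: D_def powr_mult mult_ac)
    finally show "weight_of w {x. ennreal (2 * c) < mt f x} \<le> weight_of w ?L +
      ennreal (D * \<gamma> powr \<theta>) * (\<integral>\<^sup>+x. epow (mx (indicator ?O) x) p * ennreal (w x) \<partial>lebesgue)"
      by (simp add: add_left_mono)
  qed
qed

end

lemma weight_of_greater_le:
  assumes w: "weight w" and h: "h \<in> borel_measurable lebesgue" and p: "0 < p" and c: "0 \<le> c"
  shows "ennreal (c powr p) * weight_of w {x. ennreal c < h x} \<le> (\<integral>\<^sup>+x. epow (h x) p * ennreal (w x) \<partial>lebesgue)"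
proof -
  let ?S = "{x. ennreal c < h x}"
  have "{x \<in> space lebesgue. ennreal c < h x} \<in> sets lebesgue" using h by measurable
  then have S: "?S \<in> sets lebesgue" by simp
  have "(\<lambda>x. ennreal (w x) * indicator ?S x) \<in> borel_measurable lebesgue"
    using weight_measurable[OF w] S by measurable
  then have "ennreal (c powr p) * weight_of w ?S = (\<integral>\<^sup>+x. ennreal (c powr p) * (ennreal (w x) * indicator ?S x) \<partial>lebesgue)"
    unfolding weight_of_def by (rule nn_integral_cmult[symmetric])
  also have "\<dots> \<le> (\<integral>\<^sup>+x. epow (h x) p * ennreal (w x) \<partial>lebesgue)"
  proof (rule nn_integral_mono)
    fix x
    show "ennreal (c powr p) * (ennreal (w x) * indicator ?S x) \<le> epow (h x) p * ennreal (w x)"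
    proof (cases "x \<in> ?S")
      case True
      then have "epow (ennreal c) p \<le> epow (h x) p" using p by (intro epow_mono) auto
      then show ?thesis using True c by (simp add: epow_ennreal mult_right_mono)
    qed simp
  qed
  finally show ?thesis .
qed

context dini_CZ
begin

text \<open>The good-lambda inequality is used at level 4 c: it bounds the level 8 c, and the
  indicator integral splits at the set where the maximal truncation exceeds c. Off that set it is at
  most (4 c)/4, as \<open>mx_maximal_truncation_level_le\<close> requires.\<close>

lemma good_lambda_step:
  assumes w: "weight w" and SC: "w \<in> SC p" and p: "0 < p"
  obtains E :: real where "0 < E" "\<And>f c. integrable lebesgue f \<Longrightarrow> 0 < c \<Longrightarrow>
    ennreal ((8 * c) powr p) * weight_of w {x. ennreal (8 * c) < mt f x} \<le>
      ennreal E * (\<integral>\<^sup>+x. epow (mx (mag f) x) p * ennreal (w x) \<partial>lebesgue) +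
      ennreal (1/2) * (ennreal (c powr p) * weight_of w {x. ennreal c < mt f x})"
proof -
  obtain D \<theta> where D: "0 < D" "0 < \<theta>" and gl: "\<And>f c \<gamma>. integrable lebesgue f \<Longrightarrow> 0 < c \<Longrightarrow> 0 < \<gamma> \<Longrightarrow> A4 * \<gamma> \<le> 1/2 \<Longrightarrow>
    weight_of w {x. ennreal (2 * c) < mt f x} \<le> weight_of w (lev (mag f) (\<gamma> * c)) +
      ennreal (D * \<gamma> powr \<theta>) * (\<integral>\<^sup>+x. epow (mx (indicator {y. ennreal c < mt f y}) x) p * ennreal (w x) \<partial>lebesgue)"
    using good_lambda[OF w SC] by blast
  obtain b :: real where b: "0 < b"
    "\<And>(v :: real^'n \<Rightarrow> ennreal) t x. 0 \<le> t \<Longrightarrow> x \<in> lev v t \<Longrightarrow> ennreal (b * t) < mx v x"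
    using mx_lev_equiv by (metis (no_types, lifting))
  obtain C6 where C6: "0 < C6" "\<And>f c x. integrable lebesgue f \<Longrightarrow> 0 < c \<Longrightarrow> mt f x \<le> ennreal (c / 4) \<Longrightarrow>
    mx (indicator {y. ennreal c < mt f y}) x \<le> ennreal (C6 / c) * mx (mag f) x"
    using mx_maximal_truncation_level_le by blast
  \<comment> \<open>The first entry is the side condition of \<open>good_lambda\<close>; the second
    makes the coefficient of the recurring weight at most 1/2 after multiplication by
    \<open>8 powr p\<close>.\<close>
  define \<gamma> where "\<gamma> = min (1 / (2 * A4)) ((1 / (2 * 8 powr p * D)) powr (1 / \<theta>))"
  have \<gamma>: "0 < \<gamma>" unfolding \<gamma>_def using A4_pos D by simp
  have "A4 * \<gamma> \<le> A4 * (1 / (2 * A4))" unfolding \<gamma>_def using A4_pos by (intro mult_left_mono) auto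
  then have A\<gamma>: "A4 * \<gamma> \<le> 1/2" using A4_pos by simp
  have "\<gamma> powr \<theta> \<le> ((1 / (2 * 8 powr p * D)) powr (1 / \<theta>)) powr \<theta>"
    using \<gamma> D by (intro powr_mono2) (auto simp: \<gamma>_def)
  also have "\<dots> = 1 / (2 * 8 powr p * D)" using D by (simp add: powr_powr)
  finally have \<gamma>\<theta>: "8 powr p * (D * \<gamma> powr \<theta>) \<le> 1/2" using D by (simp add: field_simps)
  define d where "d = D * \<gamma> powr \<theta>"
  have d: "0 < d" using D \<gamma> by (simp add: d_def)
  define E where "E = (2 / (\<gamma> * b)) powr p + d * (2 * C6) powr p"
  have E: "0 < E" unfolding E_def using \<gamma> b C6 d by (intro add_pos_pos) auto
  show thesis
  proof (rule that[OF E])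
    fix f :: "real^'n \<Rightarrow> complex" and c :: real
    assume f: "integrable lebesgue f" and c: "0 < c"
    define N where "N = (\<integral>\<^sup>+x. epow (mx (mag f) x) p * ennreal (w x) \<partial>lebesgue)"
    define W where "W = weight_of w {x. ennreal c < mt f x}"
    define L where "L = weight_of w (lev (mag f) (\<gamma> * (4 * c)))"
    define I where "I = (\<integral>\<^sup>+x. epow (mx (indicator {y. ennreal (4 * c) < mt f y}) x) p * ennreal (w x) \<partial>lebesgue)"
    let ?O = "{x. ennreal c < mt f x}"
    have Os: "?O \<in> sets lebesgue" using open_maximal_truncation_greater[OF f, of c] c by simp
    have wm [measurable]: "w \<in> borel_measurable lebesgue" by (rule weight_measurable[OF w])
    have Nm: "(\<lambda>x. epow (mx (mag f) x) p * ennreal (w x)) \<in> borel_measurable lebesgue" by measurable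
    have Wm: "(\<lambda>x. ennreal (w x) * indicator ?O x) \<in> borel_measurable lebesgue" using Os by measurable
    have gl1: "weight_of w {x. ennreal (8 * c) < mt f x} \<le> L + ennreal d * I"
      using gl[OF f _ \<gamma> A\<gamma>, of "4 * c"] c unfolding L_def I_def d_def by simp
    have I_le: "I \<le> W + ennreal ((C6 / (4 * c)) powr p) * N"
    proof -
      have "I \<le> (\<integral>\<^sup>+x. ennreal (w x) * indicator ?O x + ennreal ((C6 / (4 * c)) powr p) * (epow (mx (mag f) x) p * ennreal (w x)) \<partial>lebesgue)"
        unfolding I_def
      proof (rule nn_integral_mono)
        fix x :: "real^'n"
        let ?m = "mx (indicator {y. ennreal (4 * c) < mt f y}) x"
        show "epow ?m p * ennreal (w x) \<le> ennreal (w x) * indicator ?O x +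
            ennreal ((C6 / (4 * c)) powr p) * (epow (mx (mag f) x) p * ennreal (w x))"
        proof (cases "x \<in> ?O")
          case True
          have "epow ?m p \<le> epow 1 p" using p by (intro epow_mono mx_indicator_le_1) simp
          then have "epow ?m p * ennreal (w x) \<le> 1 * ennreal (w x)" by (intro mult_right_mono) auto
          also have "\<dots> = ennreal (w x) * indicator ?O x" using True by simp
          also have "\<dots> \<le> ennreal (w x) * indicator ?O x + ennreal ((C6 / (4 * c)) powr p) * (epow (mx (mag f) x) p * ennreal (w x))"
            by simp
          finally show ?thesis .
        next
          case False
          then have "?m \<le> ennreal (C6 / (4 * c)) * mx (mag f) x" using c by (intro C6(2)[OF f]) auto
          then have "epow ?m p \<le> epow (ennreal (C6 / (4 * c)) * mx (mag f) x) p" using p by (intro epow_mono) auto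
          also have "\<dots> = ennreal ((C6 / (4 * c)) powr p) * epow (mx (mag f) x) p" using c C6(1) p by (intro epow_mult) auto
          finally have "epow ?m p * ennreal (w x) \<le> ennreal ((C6 / (4 * c)) powr p) * epow (mx (mag f) x) p * ennreal (w x)"
            by (rule mult_right_mono) simp
          then show ?thesis using False by (simp add: mult.assoc)
        qed
      qed
      also have "\<dots> = (\<integral>\<^sup>+x. ennreal (w x) * indicator ?O x \<partial>lebesgue) +
          (\<integral>\<^sup>+x. ennreal ((C6 / (4 * c)) powr p) * (epow (mx (mag f) x) p * ennreal (w x)) \<partial>lebesgue)"
        by (rule nn_integral_add[OF Wm borel_measurable_times_ennreal[OF measurable_const Nm]]) simp
      also have "(\<integral>\<^sup>+x. ennreal ((C6 / (4 * c)) powr p) * (epow (mx (mag f) x) p * ennreal (w x)) \<partial>lebesgue)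
          = ennreal ((C6 / (4 * c)) powr p) * N"
        unfolding N_def by (rule nn_integral_cmult[OF Nm])
      finally show ?thesis unfolding W_def weight_of_def .
    qed
    have L_le: "ennreal ((b * (\<gamma> * (4 * c))) powr p) * L \<le> N"
    proof -
      have "L \<le> weight_of w {x. ennreal (b * (\<gamma> * (4 * c))) < mx (mag f) x}"
        unfolding L_def using b(2)[of "\<gamma> * (4 * c)"] \<gamma> c by (intro weight_of_mono) auto
      then have "ennreal ((b * (\<gamma> * (4 * c))) powr p) * L \<le>
          ennreal ((b * (\<gamma> * (4 * c))) powr p) * weight_of w {x. ennreal (b * (\<gamma> * (4 * c))) < mx (mag f) x}"
        by (intro mult_left_mono) auto
      also have "\<dots> \<le> N" unfolding N_def using b(1) \<gamma> c by (intro weight_of_greater_le[OF w _ p]) auto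
      finally show ?thesis .
    qed
    have e1: "(8 * c) powr p = (2 / (\<gamma> * b)) powr p * (b * (\<gamma> * (4 * c))) powr p"
      using b(1) \<gamma> c by (simp flip: powr_mult)
    have e2: "(8 * c) powr p * d * (C6 / (4 * c)) powr p = d * (2 * C6) powr p"
    proof -
      have "(8 * c) powr p * (C6 / (4 * c)) powr p = (2 * C6) powr p"
        using c C6(1) by (simp flip: powr_mult)
      then show ?thesis by (simp add: mult_ac)
    qed
    have "(8 * c) powr p * d = 8 powr p * d * c powr p" using c by (simp add: powr_mult)
    also have "\<dots> \<le> 1/2 * c powr p" using \<gamma>\<theta> by (intro mult_right_mono) (auto simp: d_def)
    finally have e3: "(8 * c) powr p * d \<le> 1/2 * c powr p" .
    have "ennreal ((8 * c) powr p) * weight_of w {x. ennreal (8 * c) < mt f x}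
      \<le> ennreal ((8 * c) powr p) * (L + ennreal d * (W + ennreal ((C6 / (4 * c)) powr p) * N))"
      using gl1 I_le by (meson add_left_mono dual_order.trans mult_left_mono zero_le)
    also have "\<dots> = ennreal ((8 * c) powr p) * L + (ennreal ((8 * c) powr p * d) * W
        + ennreal ((8 * c) powr p * d * (C6 / (4 * c)) powr p) * N)"
      using d by (simp add: distrib_left ennreal_mult mult.assoc)
    also have "\<dots> \<le> ennreal ((2 / (\<gamma> * b)) powr p) * N + (ennreal (1/2 * c powr p) * W + ennreal (d * (2 * C6) powr p) * N)"
    proof (intro add_mono)
      have "ennreal ((8 * c) powr p) * L = ennreal ((2 / (\<gamma> * b)) powr p) * (ennreal ((b * (\<gamma> * (4 * c))) powr p) * L)"
        unfolding e1 by (subst ennreal_mult_left_assoc) auto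
      also have "\<dots> \<le> ennreal ((2 / (\<gamma> * b)) powr p) * N" using L_le by (intro mult_left_mono) auto
      finally show "ennreal ((8 * c) powr p) * L \<le> ennreal ((2 / (\<gamma> * b)) powr p) * N" .
      show "ennreal ((8 * c) powr p * d) * W \<le> ennreal (1/2 * c powr p) * W"
        using e3 by (intro mult_right_mono ennreal_leI) auto
      show "ennreal ((8 * c) powr p * d * (C6 / (4 * c)) powr p) * N \<le> ennreal (d * (2 * C6) powr p) * N" unfolding e2 ..
    qed
    also have "\<dots> = (ennreal ((2 / (\<gamma> * b)) powr p) + ennreal (d * (2 * C6) powr p)) * N + ennreal (1/2 * c powr p) * W"
      by (simp add: distrib_right add_ac)
    also have "ennreal ((2 / (\<gamma> * b)) powr p) + ennreal (d * (2 * C6) powr p) = ennreal E"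
      unfolding E_def using d by (intro ennreal_plus[symmetric]) auto
    also have "ennreal (1/2 * c powr p) * W = ennreal (1/2) * (ennreal (c powr p) * W)"
      by (subst ennreal_mult_left_assoc) auto
    finally show "ennreal ((8 * c) powr p) * weight_of w {x. ennreal (8 * c) < mt f x} \<le>
      ennreal E * (\<integral>\<^sup>+x. epow (mx (mag f) x) p * ennreal (w x) \<partial>lebesgue) +
      ennreal (1/2) * (ennreal (c powr p) * weight_of w {x. ennreal c < mt f x})"
      unfolding N_def W_def .
  qed
qed

section \<open>Small levels and the passage to general f\<close>

text \<open>At distance at least 2 R from the origin, the maximal truncation is at most, and Mf at
  least, a constant times the \<open>L\<^sup>1\<close> norm divided by the n-th power of the
  distance. Closer to the origin Mf has a positive lower bound, which small levels c respect
  automatically; only c0 depends on f.\<close>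

lemma maximal_truncation_small_level:
  obtains C7 :: real where "0 < C7" "\<And>f R. integrable lebesgue f \<Longrightarrow> 0 < R \<Longrightarrow> (\<And>y. y \<notin> ball 0 R \<Longrightarrow> f y = 0) \<Longrightarrow>
    \<exists>c0>0. \<forall>c x. 0 < c \<longrightarrow> c \<le> c0 \<longrightarrow> ennreal c < mt f x \<longrightarrow> ennreal (c / C7) < mx (mag f) x"
proof -
  let ?n = "CARD('n)"
  obtain b :: real where b: "0 < b"
    "\<And>(v :: real^'n \<Rightarrow> ennreal) t x. 0 \<le> t \<Longrightarrow> x \<in> lev v t \<Longrightarrow> ennreal (b * t) < mx v x"
    using mx_lev_equiv by (metis (no_types, lifting))
  \<comment> \<open>\<open>A2 * 2 ^ n\<close> comes from \<open>T_size\<close> at distance |x|/2,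
    and the rest from the lower bound of Mf on the ball of radius 2 |x|.\<close>
  define C7 where "C7 = A2 * 2 ^ ?n * (2 * m1 * 2 ^ ?n) / b"
  have C7: "0 < C7" unfolding C7_def using A2_pos m1_pos b by simp
  show thesis
  proof (rule that[OF C7])
    fix f :: "real^'n \<Rightarrow> complex" and R :: real
    assume f: "integrable lebesgue f" and R: "0 < R" and f0: "\<And>y. y \<notin> ball 0 R \<Longrightarrow> f y = 0"
    let ?L = "L1_norm f"
    have tr: "L1_norm (trunc f \<epsilon> x) \<le> ?L" for \<epsilon> x
      by (rule L1_norm_mono[OF trunc_integrable[OF f] f]) (simp add: trunc_eq)
    show "\<exists>c0>0. \<forall>c x. 0 < c \<longrightarrow> c \<le> c0 \<longrightarrow> ennreal c < mt f x \<longrightarrow> ennreal (c / C7) < mx (mag f) x"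
    proof (cases "?L = 0")
      case True
      have False if cx: "0 < c" "ennreal c < mt f x" for c :: real and x
      proof -
        obtain \<epsilon> where \<epsilon>: "0 < \<epsilon>" "c < norm (T (trunc f \<epsilon> x) x)"
          using cx less_maximal_truncation_iff[of c T f x] less_imp_le[OF cx(1)] by blast
        have "L1_norm (trunc f \<epsilon> x) = 0" using tr[of \<epsilon> x] L1_norm_nonneg[of "trunc f \<epsilon> x"] unfolding True by linarith
        then have "T (trunc f \<epsilon> x) x = 0" by (intro T_eq_0[OF trunc_integrable[OF f] \<epsilon>(1)]) (auto simp: trunc_eq)
        then show False using \<epsilon>(2) cx(1) by simp
      qed
      then show ?thesis by (intro exI[of _ 1]) auto
    next
      case False
      then have L: "0 < ?L" using L1_norm_nonneg[of f] by linarith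
      have low: "ennreal (b * (?L / (2 * m1 * \<rho> ^ ?n))) < mx (mag f) x" if "0 < \<rho>" "norm x + R \<le> \<rho>" for x \<rho>
      proof (rule b(2))
        show "0 \<le> ?L / (2 * m1 * \<rho> ^ ?n)" using L m1_pos that by simp
        have sub: "ball 0 R \<subseteq> ball x \<rho>"
        proof
          fix y :: "real^'n" assume "y \<in> ball 0 R"
          then have "norm y < R" by simp
          moreover have "norm (x - y) \<le> norm x + norm y" by (rule norm_triangle_ineq4)
          ultimately show "y \<in> ball x \<rho>" using that by (simp add: dist_norm)
        qed
        have "(\<integral>\<^sup>+y\<in>ball x \<rho>. mag f y \<partial>lebesgue) = (\<integral>\<^sup>+y. mag f y \<partial>lebesgue)"
        proof (rule nn_integral_cong)
          fix y show "mag f y * indicator (ball x \<rho>) y = mag f y"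
            using f0[of y] sub by (cases "y \<in> ball 0 R") auto
        qed
        also have "\<dots> = ennreal ?L" using ennreal_L1_norm[OF f] by simp
        finally have I: "(\<integral>\<^sup>+y\<in>ball x \<rho>. mag f y \<partial>lebesgue) = ennreal ?L" .
        have "ennreal (?L / (2 * m1 * \<rho> ^ ?n)) * emeasure lebesgue (ball x \<rho>) = ennreal (?L / 2)"
          using that m1_pos L by (simp add: emeasure_ball_eq flip: ennreal_mult)
        also have "\<dots> < ennreal ?L" using L by (simp add: ennreal_less_iff)
        finally show "x \<in> lev (mag f) (?L / (2 * m1 * \<rho> ^ ?n))"
          using that unfolding I[symmetric] by (intro levI[of x x \<rho>]) auto
      qed
      define c0 where "c0 = C7 * (b * (?L / (2 * m1 * (3 * R) ^ ?n)))"
      have c0: "0 < c0" unfolding c0_def using C7 b L m1_pos R by simp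
      have "ennreal (c / C7) < mx (mag f) x" if c: "0 < c" "c \<le> c0" "ennreal c < mt f x" for c :: real and x
      proof (cases "norm x < 2 * R")
        case True
        have "c / C7 \<le> b * (?L / (2 * m1 * (3 * R) ^ ?n))" using c(2) C7 by (simp add: c0_def pos_divide_le_eq mult_ac)
        then have "ennreal (c / C7) \<le> ennreal (b * (?L / (2 * m1 * (3 * R) ^ ?n)))" by (rule ennreal_leI)
        also have "\<dots> < mx (mag f) x" using True R by (intro low) auto
        finally show ?thesis .
      next
        case False
        then have x: "0 < norm x" "R \<le> norm x / 2" using R by linarith+
        obtain \<epsilon> where \<epsilon>: "0 < \<epsilon>" "c < norm (T (trunc f \<epsilon> x) x)"
          using c less_maximal_truncation_iff[of c T f x] less_imp_le[OF c(1)] by blast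
        have z: "trunc f \<epsilon> x y = 0" if "y \<in> ball x (norm x / 2)" for y
        proof -
          have "norm (x - y) < norm x / 2" using that by (simp add: dist_norm)
          moreover have "norm x \<le> norm (x - y) + norm y" using norm_triangle_ineq[of "x - y" y] by simp
          ultimately have "f y = 0" using x(2) by (intro f0) auto
          then show ?thesis by (simp add: trunc_eq)
        qed
        note \<epsilon>(2)
        also have "norm (T (trunc f \<epsilon> x) x) \<le> A2 / (norm x / 2) ^ ?n * L1_norm (trunc f \<epsilon> x)"
          by (rule T_size[OF trunc_integrable[OF f]]) (use x(1) z in auto)
        also have "\<dots> \<le> A2 / (norm x / 2) ^ ?n * ?L" using tr A2_pos by (intro mult_left_mono) auto
        also have "\<dots> = C7 * (b * (?L / (2 * m1 * (2 * norm x) ^ ?n)))"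
          using b(1) x(1) m1_pos by (simp add: C7_def power_mult_distrib power_divide field_simps)
        finally have "c / C7 \<le> b * (?L / (2 * m1 * (2 * norm x) ^ ?n))" using C7 by (simp add: pos_divide_le_eq mult_ac)
        then have "ennreal (c / C7) \<le> ennreal (b * (?L / (2 * m1 * (2 * norm x) ^ ?n)))" by (rule ennreal_leI)
        also have "\<dots> < mx (mag f) x" using x by (intro low) linarith+
        finally show ?thesis .
      qed
      then show ?thesis using c0 by blast
    qed
  qed
qed

text \<open>A single truncation witnesses the value above c. For that radius \<open>T_size\<close>
  bounds the contribution of f outside a large ball, which is smaller than the excess once the ball
  is large enough.\<close>

lemma maximal_truncation_restrict_eventually:
  assumes f: "integrable lebesgue f" and c: "0 \<le> c" and x: "ennreal c < mt f x"
  shows "\<exists>k. \<forall>m\<ge>k. ennreal c < mt (\<lambda>y. f y * indicator (ball 0 (real m + 1)) y) x"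
proof -
  let ?n = "CARD('n)"
  define fm where "fm m = (\<lambda>y. f y * indicator (ball 0 (real m + 1)) y)" for m :: nat
  define gm where "gm m = (\<lambda>y. f y * indicator (- ball 0 (real m + 1)) y)" for m :: nat
  have fi: "integrable lebesgue (fm m)" and gi: "integrable lebesgue (gm m)" for m
    unfolding fm_def gm_def by (auto intro!: integrable_mult_indicator_set[OF f])
  obtain \<epsilon> where \<epsilon>: "0 < \<epsilon>" "c < norm (T (trunc f \<epsilon> x) x)"
    using less_maximal_truncation_iff[OF c] x by blast
  define e where "e = (norm (T (trunc f \<epsilon> x) x) - c) * \<epsilon> ^ ?n / A2"
  have e: "0 < e" unfolding e_def using \<epsilon> A2_pos by simp
  have "(\<lambda>m::nat. \<integral>\<^sup>+y\<in>- ball 0 (real m + 1). mag f y \<partial>lebesgue) \<longlonglongrightarrow> 0"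
  proof (rule nn_integral_decseq_tendsto_0)
    show "mag f \<in> borel_measurable lebesgue" by (rule mag_measurable[OF f])
    show "(\<integral>\<^sup>+y. mag f y \<partial>lebesgue) < \<infinity>" using ennreal_L1_norm[OF f] by (metis ennreal_less_top infinity_ennreal_def)
    show "decseq (\<lambda>m::nat. - ball (0::real^'n) (real m + 1))" unfolding decseq_def by auto
    show "(\<Inter>m::nat. - ball (0::real^'n) (real m + 1)) = {}"
    proof -
      have "\<exists>m::nat. y \<in> ball 0 (real m + 1)" for y :: "real^'n"
      proof -
        obtain m :: nat where "norm y \<le> real m" using real_arch_simple by blast
        then show ?thesis by (intro exI[of _ m]) simp
      qed
      then show ?thesis by blast
    qed
  qed auto
  then have "\<forall>\<^sub>F m in sequentially. (\<integral>\<^sup>+y\<in>- ball 0 (real m + 1). mag f y \<partial>lebesgue) < ennreal e"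
    using e by (intro order_tendstoD(2)) auto
  then obtain k where k: "\<And>m. k \<le> m \<Longrightarrow> (\<integral>\<^sup>+y\<in>- ball 0 (real m + 1). mag f y \<partial>lebesgue) < ennreal e"
    unfolding eventually_sequentially by blast
  have "ennreal c < mt (fm m) x" if m: "k \<le> m" for m
  proof -
    have "ennreal (L1_norm (gm m)) = (\<integral>\<^sup>+y. mag (gm m) y \<partial>lebesgue)" by (rule ennreal_L1_norm[OF gi])
    also have "\<dots> = (\<integral>\<^sup>+y\<in>- ball 0 (real m + 1). mag f y \<partial>lebesgue)"
      unfolding gm_def by (intro nn_integral_cong) (auto simp: indicator_def)
    finally have "ennreal (L1_norm (gm m)) < ennreal e" using k[OF m] by simp
    then have Lg: "L1_norm (gm m) < e" using ennreal_less_iff[of "L1_norm (gm m)" e] by simp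
    have add: "norm (T (trunc f \<epsilon> x) x) \<le> norm (T (trunc (fm m) \<epsilon> x) x) + norm (T (trunc (gm m) \<epsilon> x) x)"
      by (rule norm_T_add_le[OF trunc_integrable[OF fi] trunc_integrable[OF gi] \<epsilon>(1)])
        (auto simp: trunc_eq fm_def gm_def indicator_def)
    have "norm (T (trunc (gm m) \<epsilon> x) x) \<le> A2 / \<epsilon> ^ ?n * L1_norm (trunc (gm m) \<epsilon> x)"
      by (rule T_size[OF trunc_integrable[OF gi] \<epsilon>(1)]) (simp add: trunc_eq)
    also have "\<dots> \<le> A2 / \<epsilon> ^ ?n * L1_norm (gm m)"
      using A2_pos \<epsilon>(1) by (intro mult_left_mono L1_norm_mono[OF trunc_integrable[OF gi] gi]) (auto simp: trunc_eq)
    also have "\<dots> < A2 / \<epsilon> ^ ?n * e"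
      using Lg A2_pos \<epsilon>(1) by (intro mult_strict_left_mono) auto
    also have "\<dots> = norm (T (trunc f \<epsilon> x) x) - c" unfolding e_def using A2_pos \<epsilon>(1) by simp
    finally have "c < norm (T (trunc (fm m) \<epsilon> x) x)" using add by linarith
    then show ?thesis using less_maximal_truncation_iff[OF c] \<epsilon>(1) by blast
  qed
  then show ?thesis unfolding fm_def by blast
qed

lemma maximal_truncation_weighted_weak_type:
  assumes w: "weight w" and SC: "w \<in> SC p" and p: "0 < p"
  shows "\<exists>C>0. \<forall>f. integrable lebesgue f \<longrightarrow> weak_Lp_norm p w (mt f) \<le> ennreal C * Lp_norm p w (hl_maximal f)"
proof -
  obtain E :: real where E: "0 < E" and step: "\<And>f c. integrable lebesgue f \<Longrightarrow> 0 < c \<Longrightarrow>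
    ennreal ((8 * c) powr p) * weight_of w {x. ennreal (8 * c) < mt f x} \<le>
      ennreal E * (\<integral>\<^sup>+x. epow (mx (mag f) x) p * ennreal (w x) \<partial>lebesgue) +
      ennreal (1/2) * (ennreal (c powr p) * weight_of w {x. ennreal c < mt f x})"
    using good_lambda_step[OF w SC p] by blast
  obtain C7 :: real where C7: "0 < C7" and small: "\<And>f R. integrable lebesgue f \<Longrightarrow> 0 < R \<Longrightarrow> (\<And>y. y \<notin> ball 0 R \<Longrightarrow> f y = 0) \<Longrightarrow>
    \<exists>c0>0. \<forall>c x. 0 < c \<longrightarrow> c \<le> c0 \<longrightarrow> ennreal c < mt f x \<longrightarrow> ennreal (c / C7) < mx (mag f) x"
    using maximal_truncation_small_level by blast
  \<comment> \<open>\<open>C7 powr p\<close> serves the start of the induction, and 2 E makes M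
    reproduce itself: \<open>E + M / 2 \<le> M\<close>.\<close>
  define M where "M = C7 powr p + 2 * E"
  have M: "0 < M" unfolding M_def using C7 E by (intro add_pos_pos) auto
  define N where "N f = (\<integral>\<^sup>+x. epow (mx (mag f) x) p * ennreal (w x) \<partial>lebesgue)" for f :: "real^'n \<Rightarrow> complex"
  have bdd: "ennreal (c powr p) * weight_of w {x. ennreal c < mt f x} \<le> ennreal M * N f"
    if f: "integrable lebesgue f" and R: "0 < R" and f0: "\<And>y. y \<notin> ball 0 R \<Longrightarrow> f y = 0" and c: "0 < c" for f R c
  proof -
    obtain c0 where c0: "0 < c0" "\<And>c x. 0 < c \<Longrightarrow> c \<le> c0 \<Longrightarrow> ennreal c < mt f x \<Longrightarrow> ennreal (c / C7) < mx (mag f) x"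
      using small[OF f R f0] by blast
    \<comment> \<open>Climbing from c0 in steps of the factor 8 reaches every level and never
      requires finiteness of the weight of a level set.\<close>
    have "\<forall>c. 0 < c \<longrightarrow> c \<le> c0 * 8 ^ k \<longrightarrow> ennreal (c powr p) * weight_of w {x. ennreal c < mt f x} \<le> ennreal M * N f" for k
    proof (induction k)
      case 0
      show ?case
      proof (intro allI impI)
        fix c :: real assume c: "0 < c" "c \<le> c0 * 8 ^ 0"
        have "weight_of w {x. ennreal c < mt f x} \<le> weight_of w {x. ennreal (c / C7) < mx (mag f) x}"
          using c0(2)[OF c(1)] c(2) by (intro weight_of_mono) auto
        then have "ennreal (c powr p) * weight_of w {x. ennreal c < mt f x} \<le>
            ennreal (c powr p) * weight_of w {x. ennreal (c / C7) < mx (mag f) x}" by (intro mult_left_mono) auto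
        also have "\<dots> = ennreal (C7 powr p * (c / C7) powr p) * weight_of w {x. ennreal (c / C7) < mx (mag f) x}"
          using C7 c(1) by (simp flip: powr_mult)
        also have "\<dots> = ennreal (C7 powr p) * (ennreal ((c / C7) powr p) * weight_of w {x. ennreal (c / C7) < mx (mag f) x})"
          by (subst ennreal_mult_left_assoc) auto
        also have "\<dots> \<le> ennreal (C7 powr p) * N f"
          unfolding N_def using c(1) C7 by (intro mult_left_mono weight_of_greater_le[OF w _ p]) auto
        also have "\<dots> \<le> ennreal M * N f" unfolding M_def using E by (intro mult_right_mono ennreal_leI) auto
        finally show "ennreal (c powr p) * weight_of w {x. ennreal c < mt f x} \<le> ennreal M * N f" .
      qed
    next
      case (Suc k)
      show ?case
      proof (intro allI impI)
        fix c :: real assume c: "0 < c" "c \<le> c0 * 8 ^ Suc k"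
        define c' where "c' = c / 8"
        have c': "0 < c'" "c' \<le> c0 * 8 ^ k" "c = 8 * c'" using c by (auto simp: c'_def)
        have IH: "ennreal (c' powr p) * weight_of w {x. ennreal c' < mt f x} \<le> ennreal M * N f" using Suc.IH c' by blast
        have "ennreal (c powr p) * weight_of w {x. ennreal c < mt f x} \<le>
            ennreal E * N f + ennreal (1/2) * (ennreal (c' powr p) * weight_of w {x. ennreal c' < mt f x})"
          using step[OF f c'(1)] unfolding c'(3) N_def .
        also have "\<dots> \<le> ennreal E * N f + ennreal (1/2) * (ennreal M * N f)"
          using IH by (intro add_left_mono mult_left_mono) auto
        also have "ennreal (1/2) * (ennreal M * N f) = ennreal (1/2 * M) * N f" by (rule ennreal_mult_left_assoc) simp
        also have "ennreal E * N f + ennreal (1/2 * M) * N f = ennreal (E + 1/2 * M) * N f"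
          using E M by (simp add: distrib_right)
        also have "\<dots> \<le> ennreal M * N f" by (intro mult_right_mono ennreal_leI) (auto simp: M_def)
        finally show "ennreal (c powr p) * weight_of w {x. ennreal c < mt f x} \<le> ennreal M * N f" .
      qed
    qed
    moreover obtain k where "c / c0 < 8 ^ k" using real_arch_pow[of 8 "c / c0"] by auto
    then have "c \<le> c0 * 8 ^ k" using c0(1) by (simp add: pos_divide_less_eq mult.commute)
    ultimately show ?thesis using c by blast
  qed
  have gen: "ennreal (c powr p) * weight_of w {x. ennreal c < mt f x} \<le> ennreal M * N f"
    if f: "integrable lebesgue f" and c: "0 < c" for f c
  proof -
    define fm where "fm m = (\<lambda>y. f y * indicator (ball 0 (real m + 1)) y)" for m :: nat
    have fi: "integrable lebesgue (fm m)" for m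
      unfolding fm_def by (auto intro!: integrable_mult_indicator_set[OF f])
    have Nm: "N (fm m) \<le> N f" for m
      unfolding N_def using p by (intro nn_integral_mono mult_right_mono epow_mono mx_mono)
        (auto simp: fm_def indicator_def)
    \<comment> \<open>Lower limits of the level sets of the restricted functions: they increase with
      k, and their union contains the level set of f. So the uniform bound passes to the limit by
      continuity of the measure.\<close>
    define B where "B k = (\<Inter>m\<in>{k..}. {x. ennreal c < mt (fm m) x})" for k :: nat
    let ?\<nu> = "density lebesgue (\<lambda>x. ennreal (w x))"
    have Os: "{x. ennreal c < mt (fm m) x} \<in> sets lebesgue" for m
      using open_maximal_truncation_greater[OF fi, of c] c by simp
    have Bs: "B k \<in> sets lebesgue" for k unfolding B_def using Os by (intro sets.countable_INT'') auto
    have inc: "incseq B" unfolding incseq_def B_def by (auto intro: order_trans)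
    have "{x. ennreal c < mt f x} \<subseteq> (\<Union>k. B k)"
    proof
      fix x assume "x \<in> {x. ennreal c < mt f x}"
      then have "\<exists>k. \<forall>m\<ge>k. ennreal c < mt (fm m) x"
        unfolding fm_def using c by (intro maximal_truncation_restrict_eventually[OF f]) auto
      then show "x \<in> (\<Union>k. B k)" unfolding B_def by auto
    qed
    then have "weight_of w {x. ennreal c < mt f x} \<le> weight_of w (\<Union>k. B k)" by (rule weight_of_mono)
    also have "\<dots> = emeasure ?\<nu> (\<Union>k. B k)" using Bs by (intro weight_of_eq_emeasure[OF w]) auto
    also have "\<dots> = (SUP k. emeasure ?\<nu> (B k))" using Bs inc by (intro SUP_emeasure_incseq[symmetric]) auto
    also have "\<dots> = (SUP k. weight_of w (B k))" using weight_of_eq_emeasure[OF w Bs] by simp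
    finally have "ennreal (c powr p) * weight_of w {x. ennreal c < mt f x} \<le> ennreal (c powr p) * (SUP k. weight_of w (B k))"
      by (intro mult_left_mono) auto
    also have "\<dots> = (SUP k. ennreal (c powr p) * weight_of w (B k))" by (rule SUP_mult_left_ennreal)
    also have "\<dots> \<le> ennreal M * N f"
    proof (rule SUP_least)
      fix k :: nat
      have "weight_of w (B k) \<le> weight_of w {x. ennreal c < mt (fm k) x}" unfolding B_def by (intro weight_of_mono) auto
      then have "ennreal (c powr p) * weight_of w (B k) \<le> ennreal (c powr p) * weight_of w {x. ennreal c < mt (fm k) x}"
        by (intro mult_left_mono) auto
      also have "\<dots> \<le> ennreal M * N (fm k)"
        by (rule bdd[OF fi, of "real k + 1"]) (use c in \<open>auto simp: fm_def indicator_def\<close>)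
      also have "\<dots> \<le> ennreal M * N f" using Nm by (intro mult_left_mono) auto
      finally show "ennreal (c powr p) * weight_of w (B k) \<le> ennreal M * N f" .
    qed
    finally show ?thesis .
  qed
  define C' where "C' = M powr (1 / p)"
  have C': "0 < C'" "C' powr p = M" unfolding C'_def using M p by (simp_all add: powr_powr)
  show ?thesis
  proof (intro exI[of _ C'] conjI allI impI)
    fix f :: "real^'n \<Rightarrow> complex" assume f: "integrable lebesgue f"
    show "weak_Lp_norm p w (mt f) \<le> ennreal C' * Lp_norm p w (hl_maximal f)"
      unfolding weak_Lp_norm_le_iff[OF C'(1) p] C'(2) hl_maximal_eq_mx using gen[OF f] unfolding N_def by blast
  qed (rule C'(1))
qed

end

theorem theorem1p2:
  fixes w :: "real^'n \<Rightarrow> real" and p :: real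
  assumes "weight w"
  shows
    "(p > 0 \<and> w \<in> SC p \<longrightarrow>
       (\<forall>T :: (real^'n \<Rightarrow> complex) \<Rightarrow> real^'n \<Rightarrow> complex. dini_CZ_operator T \<longrightarrow>
          (\<exists>C>0. \<forall>f :: real^'n \<Rightarrow> complex. integrable lebesgue f \<longrightarrow>
             weak_Lp_norm p w (maximal_truncation T f)
               \<le> ennreal C * Lp_norm p w (hl_maximal f))))
     \<and>
     (p > 1 \<and>
       (\<forall>j :: 'n. \<exists>C>0. \<forall>f :: real^'n \<Rightarrow> complex. integrable lebesgue f \<longrightarrow>
          weak_Lp_norm p w (maximal_truncation (riesz j) f)
            \<le> ennreal C * Lp_norm p w (hl_maximal f))
       \<longrightarrow> w \<in> SC p)"
proof (intro conjI impI allI)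
  fix T :: "(real^'n \<Rightarrow> complex) \<Rightarrow> real^'n \<Rightarrow> complex"
  assume SC: "p > 0 \<and> w \<in> SC p" and "dini_CZ_operator T"
  then obtain K F C C0 where "dini_CZ T K F C C0" using dini_CZ_operatorE by blast
  then show "\<exists>C>0. \<forall>f :: real^'n \<Rightarrow> complex. integrable lebesgue f \<longrightarrow>
      weak_Lp_norm p w (maximal_truncation T f) \<le> ennreal C * Lp_norm p w (hl_maximal f)"
    using dini_CZ.maximal_truncation_weighted_weak_type[OF _ assms] SC by blast
next
  assume p: "p > 1 \<and>
       (\<forall>j :: 'n. \<exists>C>0. \<forall>f :: real^'n \<Rightarrow> complex. integrable lebesgue f \<longrightarrow>
          weak_Lp_norm p w (maximal_truncation (riesz j) f)
            \<le> ennreal C * Lp_norm p w (hl_maximal f))"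
  \<comment> \<open>A single coordinate suffices; \<open>undefined\<close> is an arbitrary
    index.\<close>
  then obtain C where C: "C > 0" and H: "\<And>f :: real^'n \<Rightarrow> complex. integrable lebesgue f \<Longrightarrow>
      weak_Lp_norm p w (maximal_truncation (riesz (undefined :: 'n)) f)
        \<le> ennreal C * Lp_norm p w (hl_maximal f)" by blast
  show "w \<in> SC p" by (rule riesz_weak_type_imp_SC[OF assms _ C H]) (use p in auto)
qed

end
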